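(* Let $T\ge1$. Then for any $\sigma\in(0,1)$, $$\big(\langle|\psi-\nabla\chi_T|^2\rangle\big)^{1/2}\le C_\sigma\int_{T/2}^\infty\frac{\Theta_\sigma(r)}{r}\,dr,$$ where $C_\sigma$ depends only on $\sigma$ and $A$.
   Context: $A(y)=(a_{ij}^{\alpha\beta}(y))$ is real, satisfies $\mu|\xi|^2\le a_{ij}^{\alpha\beta}(y)\xi_i^\alpha\xi_j^\beta\le\mu^{-1}|\xi|^2$ ($\mu>0$), and is uniformly almost-periodic. $B^2(\mathbb{R}^d)$ = closure of real trigonometric polynomials in $L^2_{loc}$ under $\|f\|_{B^2}=\limsup_{R\to\infty}(|B(0,R)|^{-1}\int_{B(0,R)}|f|^2)^{1/2}$; $\langle f\rangle=\lim_{L\to\infty}|B(0,L)|^{-1}\int_{B(0,L)}f$. $V^2_{pot}$ = $B^2$-closure of gradients $(\partial_ig^\alpha)$ of trigonometric polynomials $g:\mathbb{R}^d\to\mathbb{R}^m$. $\psi=(\psi_{ij}^{\alpha\beta})$ where $\psi_j^\beta=(\psi_{ij}^{\alpha\beta})_{i,\alpha}\in V^2_{pot}$ is the unique element with $\langle a_{ik}^{\alpha\gamma}\psi_{kj}^{\gamma\beta}\phi_i^\alpha\rangle=-\langle a_{ij}^{\alpha\beta}\phi_i^\alpha\rangle$ for all $\phi\in V^2_{pot}$. Approximate correctors: $P_j^\beta(y)=y_je^\beta$; $\chi_{T,j}^\beta$ is the unique $u\in H^1_{loc}(\mathbb{R}^d;\mathbb{R}^m)$ with $\sup_x\int_{B(x,1)}(|\nabla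 u|^2+|u|^2)<\infty$ and $-\mathrm{div}(A\nabla u)+T^{-2}u=\mathrm{div}(A\nabla P_j^\beta)$; $\nabla\chi_T$ has entries $\partial_i\chi_{T,j}^{\alpha\beta}$, and $|\psi-\nabla\chi_T|^2=\sum_{i,j,\alpha,\beta}|\psi_{ij}^{\alpha\beta}-\partial_i\chi_{T,j}^{\alpha\beta}|^2$. $\rho(R)=\sup_{y}\inf_{|z|\le R}\|A(\cdot+y)-A(\cdot+z)\|_{L^\infty}$ and $\Theta_\sigma(T)=\inf_{0<R\le T}\{\rho(R)+(R/T)^\sigma\}$. *)

theory Defs
  imports "HOL-Analysis.Analysis"
begin

(* Points of R^d are  real^'d ; the unknowns take values in R^m, indexed by 'm.
   A coefficient field  A y i j \<alpha> \<beta>  stands for  a_{ij}^{\<alpha>\<beta>}(y). *)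

type_synonym ('d, 'm) coeff = "real^'d \<Rightarrow> 'd \<Rightarrow> 'd \<Rightarrow> 'm \<Rightarrow> 'm \<Rightarrow> real"

definition partial :: "'d::finite \<Rightarrow> (real^'d \<Rightarrow> real) \<Rightarrow> real^'d \<Rightarrow> real" where
  "partial i f x = deriv (\<lambda>t. f (x + t *\<^sub>R axis i 1)) 0"

fun iter_partial :: "'d::finite list \<Rightarrow> (real^'d \<Rightarrow> real) \<Rightarrow> real^'d \<Rightarrow> real" where
  "iter_partial [] f = f"
| "iter_partial (i # is) f = partial i (iter_partial is f)"

definition C_inf :: "(real^'d::finite \<Rightarrow> real) \<Rightarrow> bool" where
  "C_inf f \<longleftrightarrow> (\<forall>is. continuous_on UNIV (iter_partial is f) \<and>
      (\<forall>i x. (\<lambda>t. iter_partial is f (x + t *\<^sub>R axis i 1)) differentiable (at 0)))"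

definition test_fun :: "(real^'d::finite \<Rightarrow> real) \<Rightarrow> bool" where
  "test_fun f \<longleftrightarrow> C_inf f \<and> compact (closure {x. f x \<noteq> 0})"

definition loc_L2 :: "(real^'d::finite \<Rightarrow> real) \<Rightarrow> bool" where
  "loc_L2 f \<longleftrightarrow> f \<in> borel_measurable lborel \<and>
      (\<forall>K. compact K \<longrightarrow> set_integrable lborel K (\<lambda>x. (f x)\<^sup>2))"

definition ball_avg :: "(real^'d::finite \<Rightarrow> real) \<Rightarrow> real \<Rightarrow> real" where
  "ball_avg f R = (set_lebesgue_integral lborel (ball 0 R) f) / measure lborel (ball (0::real^'d) R)"

definition mean :: "(real^'d::finite \<Rightarrow> real) \<Rightarrow> real" where
  "mean f = Lim at_top (\<lambda>L. ball_avg f L)"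

definition B2_norm :: "(real^'d::finite \<Rightarrow> 'i::finite \<Rightarrow> real) \<Rightarrow> ereal" where
  "B2_norm f = Limsup at_top (\<lambda>R. ereal (sqrt (ball_avg (\<lambda>x. \<Sum>k\<in>UNIV. (f x k)\<^sup>2) R)))"

definition trig_poly :: "(real^'d::finite \<Rightarrow> real) \<Rightarrow> bool" where
  "trig_poly p \<longleftrightarrow> (\<exists>F a b. finite F \<and>
      (\<forall>y. p y = (\<Sum>\<xi>\<in>F. a \<xi> * cos (\<xi> \<bullet> y) + b \<xi> * sin (\<xi> \<bullet> y))))"

definition unif_ap :: "(real^'d::finite \<Rightarrow> real) \<Rightarrow> bool" where
  "unif_ap f \<longleftrightarrow> (\<forall>\<epsilon>>0. \<exists>p. trig_poly p \<and> (\<forall>y. \<bar>f y - p y\<bar> \<le> \<epsilon>))"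

definition B2 :: "(real^'d::finite \<Rightarrow> 'i::finite \<Rightarrow> real) \<Rightarrow> bool" where
  "B2 f \<longleftrightarrow> (\<forall>k. loc_L2 (\<lambda>x. f x k)) \<and>
      (\<forall>\<epsilon>>0. \<exists>p. (\<forall>k. trig_poly (\<lambda>x. p x k)) \<and> B2_norm (\<lambda>x k. f x k - p x k) < ereal \<epsilon>)"

definition grad :: "(real^'d::finite \<Rightarrow> 'm \<Rightarrow> real) \<Rightarrow> real^'d \<Rightarrow> 'd \<times> 'm \<Rightarrow> real" where
  "grad g y = (\<lambda>(i, \<alpha>). partial i (\<lambda>x. g x \<alpha>) y)"

definition V2pot :: "(real^'d::finite \<Rightarrow> 'd \<times> 'm::finite \<Rightarrow> real) \<Rightarrow> bool" where
  "V2pot \<phi> \<longleftrightarrow> (\<forall>k. loc_L2 (\<lambda>x. \<phi> x k)) \<and>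
      (\<forall>\<epsilon>>0. \<exists>g::real^'d \<Rightarrow> 'm \<Rightarrow> real. (\<forall>\<alpha>. trig_poly (\<lambda>x. g x \<alpha>)) \<and>
          B2_norm (\<lambda>x k. \<phi> x k - grad g x k) < ereal \<epsilon>)"

definition elliptic :: "real \<Rightarrow> ('d::finite, 'm::finite) coeff \<Rightarrow> bool" where
  "elliptic \<mu> A \<longleftrightarrow> \<mu> > 0 \<and> (\<forall>y (\<xi>::'d \<Rightarrow> 'm \<Rightarrow> real).
      \<mu> * (\<Sum>i\<in>UNIV. \<Sum>\<alpha>\<in>UNIV. (\<xi> i \<alpha>)\<^sup>2)
        \<le> (\<Sum>i\<in>UNIV. \<Sum>j\<in>UNIV. \<Sum>\<alpha>\<in>UNIV. \<Sum>\<beta>\<in>UNIV. A y i j \<alpha> \<beta> * \<xi> i \<alpha> * \<xi> j \<beta>) \<and>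
      (\<Sum>i\<in>UNIV. \<Sum>j\<in>UNIV. \<Sum>\<alpha>\<in>UNIV. \<Sum>\<beta>\<in>UNIV. A y i j \<alpha> \<beta> * \<xi> i \<alpha> * \<xi> j \<beta>)
        \<le> (1 / \<mu>) * (\<Sum>i\<in>UNIV. \<Sum>\<alpha>\<in>UNIV. (\<xi> i \<alpha>)\<^sup>2))"

(* \<psi> j \<beta> y (i,\<alpha>) = \<psi>_{ij}^{\<alpha>\<beta>}(y): the (exact) corrector gradient in V^2_pot *)
definition is_psi :: "('d::finite, 'm::finite) coeff \<Rightarrow> ('d \<Rightarrow> 'm \<Rightarrow> real^'d \<Rightarrow> 'd \<times> 'm \<Rightarrow> real) \<Rightarrow> bool" where
  "is_psi A \<psi> \<longleftrightarrow> (\<forall>j \<beta>. V2pot (\<psi> j \<beta>) \<and>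
      (\<forall>\<phi>. V2pot \<phi> \<longrightarrow>
        mean (\<lambda>y. \<Sum>i\<in>UNIV. \<Sum>k\<in>UNIV. \<Sum>\<alpha>\<in>UNIV. \<Sum>\<gamma>\<in>UNIV. A y i k \<alpha> \<gamma> * \<psi> j \<beta> y (k, \<gamma>) * \<phi> y (i, \<alpha>))
        = - mean (\<lambda>y. \<Sum>i\<in>UNIV. \<Sum>\<alpha>\<in>UNIV. A y i j \<alpha> \<beta> * \<phi> y (i, \<alpha>))))"

(* u = \<chi>_{T,j}^\<beta> \<in> H^1_loc with weak gradient Du (Du x (i,\<alpha>) = \<partial>_i u^\<alpha>), uniformly locally
   bounded energy, weak solution of  -div(A\<nabla>u) + T^{-2} u = div(A\<nabla>P_j^\<beta>),  P_j^\<beta>(y) = y_j e^\<beta> *)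
definition approx_corrector :: "('d::finite, 'm::finite) coeff \<Rightarrow> real \<Rightarrow> 'd \<Rightarrow> 'm
      \<Rightarrow> (real^'d \<Rightarrow> 'm \<Rightarrow> real) \<Rightarrow> (real^'d \<Rightarrow> 'd \<times> 'm \<Rightarrow> real) \<Rightarrow> bool" where
  "approx_corrector A T j \<beta> u Du \<longleftrightarrow>
     (\<forall>\<alpha>. loc_L2 (\<lambda>x. u x \<alpha>)) \<and> (\<forall>k. loc_L2 (\<lambda>x. Du x k)) \<and>
     (\<forall>\<phi>. test_fun \<phi> \<longrightarrow> (\<forall>i \<alpha>.
        (\<integral>x. u x \<alpha> * partial i \<phi> x \<partial>lborel) = - (\<integral>x. Du x (i, \<alpha>) * \<phi> x \<partial>lborel))) \<and>
     (\<exists>M. \<forall>x. set_lebesgue_integral lborel (ball x 1)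
              (\<lambda>y. (\<Sum>k\<in>UNIV. (Du y k)\<^sup>2) + (\<Sum>\<alpha>\<in>UNIV. (u y \<alpha>)\<^sup>2)) \<le> M) \<and>
     (\<forall>\<phi>::real^'d \<Rightarrow> 'm \<Rightarrow> real. (\<forall>\<alpha>. test_fun (\<lambda>x. \<phi> x \<alpha>)) \<longrightarrow>
        (\<integral>x. (\<Sum>i\<in>UNIV. \<Sum>k\<in>UNIV. \<Sum>\<alpha>\<in>UNIV. \<Sum>\<gamma>\<in>UNIV.
               A x i k \<alpha> \<gamma> * Du x (k, \<gamma>) * partial i (\<lambda>y. \<phi> y \<alpha>) x) \<partial>lborel)
        + (1 / T\<^sup>2) * (\<integral>x. (\<Sum>\<alpha>\<in>UNIV. u x \<alpha> * \<phi> x \<alpha>) \<partial>lborel)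
        = - (\<integral>x. (\<Sum>i\<in>UNIV. \<Sum>\<alpha>\<in>UNIV. A x i j \<alpha> \<beta> * partial i (\<lambda>y. \<phi> y \<alpha>) x) \<partial>lborel))"

definition tensor_dist :: "('d::finite \<Rightarrow> 'd \<Rightarrow> 'm::finite \<Rightarrow> 'm \<Rightarrow> real)
      \<Rightarrow> ('d \<Rightarrow> 'd \<Rightarrow> 'm \<Rightarrow> 'm \<Rightarrow> real) \<Rightarrow> real" where
  "tensor_dist a b = sqrt (\<Sum>i\<in>UNIV. \<Sum>j\<in>UNIV. \<Sum>\<alpha>\<in>UNIV. \<Sum>\<beta>\<in>UNIV. (a i j \<alpha> \<beta> - b i j \<alpha> \<beta>)\<^sup>2)"

(* \<rho>(R) = sup_y inf_{|z|\<le>R} ||A(.+y) - A(.+z)||_{L^\<infinity>}  (A is continuous, so L^\<infinity> = sup) *)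
definition rho :: "('d::finite, 'm::finite) coeff \<Rightarrow> real \<Rightarrow> real" where
  "rho A R = (SUP y. INF z\<in>cball 0 R. SUP x. tensor_dist (A (x + y)) (A (x + z)))"

definition Theta :: "('d::finite, 'm::finite) coeff \<Rightarrow> real \<Rightarrow> real \<Rightarrow> real" where
  "Theta A \<sigma> T = (INF R\<in>{0<..T}. rho A R + (R / T) powr \<sigma>)"

end

(* Put k = 1/T and measure a trigonometric polynomial h by its jet (grad h, k h) in the semi-inner
   product given by the mean value.  Richardson iteration of the elliptic form on jets produces
   trigonometric polynomials g_T that solve the approximate corrector equation up to an arbitrarily
   small residual.

   If |z| <= R and A(. + y) is close to A(. + z), then g_T(. + y) and g_T(. + z) are close by the
   energy estimate, while g_T(. + z) - g_T is of size R |grad g_T|.  Hence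
   k |g_T(. + y) - g_T| <= C (rho(R) + R/T) uniformly in y, and averaging over y removes the
   translate: k |g_T| <= C Theta_1(T) <= C Theta_sigma(T).  Since g_T - g_2T solves the equation
   with a right-hand side controlled by k |g_2T|, telescoping over the scales T, 2T, 4T, ... bounds
   |grad g_T - psi| by a dyadic sum of Theta_sigma, hence by the integral.

   The actual corrector chi_T is only locally H^1 with uniformly bounded local energy; a Caccioppoli
   estimate on large balls, applied to mollifications of chi_T - g_T, shows that grad chi_T and
   grad g_T agree in the mean up to the residual. *)

theory Submission
  imports Defs
begin

section \<open>Averages over balls\<close>

text \<open>The exact objects live only in B^2 or H^1_loc, where \<open>mean\<close> is a
  \<open>Lim\<close> whose existence is not given. All energy estimates therefore run on
  trigonometric polynomials, where means exist and derivatives have mean zero. The price is that no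
  exact solution is at hand: a uniformly almost-periodic matrix times a gradient is not a
  trigonometric polynomial. Each equation is carried with an error \<epsilon>, chosen only after the
  number of dyadic scales has been fixed. A residual must be usable against two kinds of test
  fields: trigonometric ones in the mean, and compactly supported ones for the true corrector. It is
  represented by a jet \<open>jet \<kappa> r\<close> with the same formal divergence as the
  approximated flux; this identity between functions serves both. Averaging over translates controls
  g_T only up to its mean value, which is bounded separately by testing with a constant field. The
  bound \<sigma> < 1 enters through R/T <= (R/T)^\<sigma> for R <= T, so that the translation
  argument may work with R/T.\<close>

lemma emeasure_ball_less_top [simp]: "emeasure lborel (ball c r :: 'a::euclidean_space set) < top"
  using emeasure_lborel_ball_finite[of c r] by simp

definition loc_int :: "(real^'d::finite \<Rightarrow> real) \<Rightarrow> bool" where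
  "loc_int f \<longleftrightarrow> (\<forall>R. set_integrable lborel (ball 0 R) f)"

lemma loc_int_add [intro]: "loc_int f \<Longrightarrow> loc_int g \<Longrightarrow> loc_int (\<lambda>x. f x + g x)"
  by (auto simp: loc_int_def intro!: set_integral_add)

lemma loc_int_cmult [intro]: "loc_int f \<Longrightarrow> loc_int (\<lambda>x. c * f x)"
  by (auto simp: loc_int_def intro!: set_integrable_mult_right)

lemma loc_int_minus [intro]: "loc_int f \<Longrightarrow> loc_int (\<lambda>x. - f x)"
  using loc_int_cmult[of f "-1"] by simp

lemma loc_int_diff [intro]: "loc_int f \<Longrightarrow> loc_int g \<Longrightarrow> loc_int (\<lambda>x. f x - g x)"
  by (auto simp: loc_int_def intro!: set_integral_diff)

lemma loc_int_bounded:
  assumes "f \<in> borel_measurable borel" and "\<And>x. \<bar>f x\<bar> \<le> M"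
  shows "loc_int f"
  unfolding loc_int_def set_integrable_def
proof
  fix R :: real
  show "integrable lborel (\<lambda>x. indicator (ball 0 R) x *\<^sub>R f x)"
  proof (rule Bochner_Integration.integrable_bound)
    show "integrable lborel (\<lambda>x::real^'a. indicator (ball 0 R) x *\<^sub>R M)"
      by (intro integrable_scaleR_left integrable_real_indicator) auto
    show "AE x in lborel. norm (indicator (ball 0 R) x *\<^sub>R f x) \<le> norm (indicator (ball 0 R) x *\<^sub>R M)"
      using assms(2) by (intro always_eventually allI) (auto simp: indicator_def intro: order_trans[OF _ abs_ge_self])
  qed (use assms(1) in \<open>auto intro!: borel_measurable_times borel_measurable_indicator\<close>)
qed

lemma loc_int_const [intro]: "loc_int (\<lambda>_. c)"
  by (rule loc_int_bounded[of _ "\<bar>c\<bar>"]) auto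

lemma loc_int_sum [intro]: "(\<And>k. k \<in> S \<Longrightarrow> loc_int (f k)) \<Longrightarrow> loc_int (\<lambda>x. \<Sum>k\<in>S. f k x)"
  by (induction S rule: infinite_finite_induct) auto

lemma ball_avg_add: "loc_int f \<Longrightarrow> loc_int g \<Longrightarrow> ball_avg (\<lambda>x. f x + g x) R = ball_avg f R + ball_avg g R"
  by (simp add: ball_avg_def loc_int_def set_integral_add add_divide_distrib)

lemma ball_avg_diff: "loc_int f \<Longrightarrow> loc_int g \<Longrightarrow> ball_avg (\<lambda>x. f x - g x) R = ball_avg f R - ball_avg g R"
  by (simp add: ball_avg_def loc_int_def set_integral_diff diff_divide_distrib)

lemma ball_avg_cmult: "ball_avg (\<lambda>x. c * f x) R = c * ball_avg f R"
  by (simp add: ball_avg_def)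

lemma ball_avg_mono:
  assumes "loc_int f" "loc_int g" "\<And>x. f x \<le> g x"
  shows "ball_avg f R \<le> ball_avg g R"
  unfolding ball_avg_def using assms
  by (intro divide_right_mono set_integral_mono) (auto simp: loc_int_def)

lemma ball_avg_const: "R > 0 \<Longrightarrow> ball_avg (\<lambda>_::real^'d::finite. c) R = c"
  by (simp add: ball_avg_def set_lebesgue_integral_def)

lemma ball_avg_abs_le:
  assumes "loc_int f" "loc_int g" "\<And>x. \<bar>f x\<bar> \<le> g x"
  shows "\<bar>ball_avg f R\<bar> \<le> ball_avg g R"
proof -
  have "ball_avg f R \<le> ball_avg g R" 
    using assms by (intro ball_avg_mono) (auto intro: order_trans[OF abs_ge_self])
  moreover have "ball_avg (\<lambda>x. - 1 * f x) R \<le> ball_avg g R" 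
    using assms by (intro ball_avg_mono) (auto intro!: loc_int_cmult intro: order_trans[OF abs_ge_minus_self])
  ultimately show ?thesis unfolding ball_avg_cmult by linarith
qed

text \<open>\<open>mean\<close> is a \<open>Lim\<close>, an arbitrary value when the averages
  diverge. This predicate keeps existence of the limit together with local integrability, so that
  means can be added and compared.\<close>

definition has_mean :: "(real^'d::finite \<Rightarrow> real) \<Rightarrow> real \<Rightarrow> bool" where
  "has_mean f m \<longleftrightarrow> loc_int f \<and> (ball_avg f \<longlongrightarrow> m) at_top"

lemma has_mean_eq: "has_mean f m \<Longrightarrow> mean f = m"
  unfolding has_mean_def mean_def by (intro tendsto_Lim) auto

lemma has_mean_add: "has_mean f m \<Longrightarrow> has_mean g n \<Longrightarrow> has_mean (\<lambda>x. f x + g x) (m + n)"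
proof -
  assume *: "has_mean f m" "has_mean g n"
  then have "ball_avg (\<lambda>x. f x + g x) = (\<lambda>R. ball_avg f R + ball_avg g R)"
    unfolding has_mean_def by (intro ext ball_avg_add) auto
  with * show ?thesis by (auto simp: has_mean_def intro!: tendsto_add)
qed

lemma has_mean_cmult: "has_mean f m \<Longrightarrow> has_mean (\<lambda>x. c * f x) (c * m)"
proof -
  assume *: "has_mean f m"
  have "ball_avg (\<lambda>x. c * f x) = (\<lambda>R. c * ball_avg f R)"
    by (intro ext ball_avg_cmult)
  with * show ?thesis by (auto simp: has_mean_def intro!: tendsto_mult_left)
qed

lemma has_mean_const: "has_mean (\<lambda>_. c) c"
  unfolding has_mean_def
  by (auto intro!: tendsto_eventually eventually_mono[OF eventually_gt_at_top[of 0]] ball_avg_const)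

lemma has_mean_mono:
  assumes "has_mean f m" "has_mean g n" "\<And>x. f x \<le> g x"
  shows "m \<le> n"
  using assms unfolding has_mean_def
  by (intro tendsto_le[of at_top "ball_avg g" n "ball_avg f" m] always_eventually allI ball_avg_mono) auto

text \<open>The limits of ever better approximants form a Cauchy sequence, and its limit is the
  limit of \<open>f\<close>. This later supplies means for functions that are only approximated by
  trigonometric polynomials.\<close>

lemma tendsto_at_top_approx:
  fixes f :: "real \<Rightarrow> real"
  assumes "\<And>e. e > 0 \<Longrightarrow> \<exists>g m. (g \<longlongrightarrow> m) at_top \<and> eventually (\<lambda>R. \<bar>f R - g R\<bar> \<le> e) at_top"
  shows "\<exists>m. (f \<longlongrightarrow> m) at_top"
proof -
  have "\<exists>m. eventually (\<lambda>R. \<bar>f R - m\<bar> \<le> e) at_top" if "e > 0" for e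
  proof -
    obtain g m where g: "(g \<longlongrightarrow> m) at_top" "eventually (\<lambda>R. \<bar>f R - g R\<bar> \<le> e/2) at_top"
      using assms[of "e/2"] \<open>e > 0\<close> by auto
    have "eventually (\<lambda>R. dist (g R) m < e/2) at_top"
      using g(1) \<open>e > 0\<close> by (intro tendstoD) auto
    with g(2) have "eventually (\<lambda>R. \<bar>f R - m\<bar> \<le> e) at_top"
      by eventually_elim (unfold dist_real_def, linarith)
    then show ?thesis ..
  qed
  then obtain M where M: "\<And>e. e > 0 \<Longrightarrow> eventually (\<lambda>R. \<bar>f R - M e\<bar> \<le> e) at_top"
    by metis
  have dist: "\<bar>M e - M d\<bar> \<le> e + d" if "e > 0" "d > 0" for e d
  proof -
    have "eventually (\<lambda>R. \<bar>f R - M e\<bar> \<le> e \<and> \<bar>f R - M d\<bar> \<le> d) at_top"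
      using M that by (auto intro: eventually_conj)
    then obtain R where "\<bar>f R - M e\<bar> \<le> e \<and> \<bar>f R - M d\<bar> \<le> d"
      using eventually_happens trivial_limit_at_top_linorder by blast
    then show ?thesis by linarith
  qed
  have "Cauchy (\<lambda>n. M (1 / real (Suc n)))"
  proof (rule metric_CauchyI)
    fix e :: real assume "e > 0"
    then obtain N where N: "1 / real (Suc N) < e/2" using nat_approx_posE[of "e/2"] by auto
    have small: "1 / real (Suc n) < e/2" if "n \<ge> N" for n
      using N that by (smt (verit) frac_le of_nat_Suc of_nat_le_iff of_nat_0_le_iff)
    show "\<exists>N. \<forall>m\<ge>N. \<forall>n\<ge>N. dist (M (1 / real (Suc m))) (M (1 / real (Suc n))) < e"
    proof (intro exI allI impI)
      fix m n assume "m \<ge> N" "n \<ge> N"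
      then show "dist (M (1 / real (Suc m))) (M (1 / real (Suc n))) < e"
        using dist[of "1 / real (Suc m)" "1 / real (Suc n)"] small[of m] small[of n]
        unfolding dist_real_def by (simp del: of_nat_Suc)
    qed
  qed
  then obtain m where m: "(\<lambda>n. M (1 / real (Suc n))) \<longlonglongrightarrow> m"
    using Cauchy_convergent_iff convergent_def by blast
  have Mm: "\<bar>M e - m\<bar> \<le> e" if "e > 0" for e
  proof (rule tendsto_le[of sequentially "\<lambda>n. e + 1 / real (Suc n)" e "\<lambda>n. \<bar>M e - M (1 / real (Suc n))\<bar>"])
    show "(\<lambda>n. e + 1 / real (Suc n)) \<longlonglongrightarrow> e"
      using LIMSEQ_inverse_real_of_nat_add[of e] by (simp add: inverse_eq_divide)
    show "(\<lambda>n. \<bar>M e - M (1 / real (Suc n))\<bar>) \<longlonglongrightarrow> \<bar>M e - m\<bar>"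
      by (intro tendsto_intros m)
    show "\<forall>\<^sub>F n in sequentially. \<bar>M e - M (1 / real (Suc n))\<bar> \<le> e + 1 / real (Suc n)"
      using that by (intro always_eventually allI dist) auto
  qed simp
  have "(f \<longlongrightarrow> m) at_top"
  proof (rule tendstoI)
    fix e :: real assume "e > 0"
    then have "e/3 > 0" by simp
    from M[OF this] show "eventually (\<lambda>R. dist (f R) m < e) at_top"
      by eventually_elim (use Mm[OF \<open>e/3 > 0\<close>] \<open>e > 0\<close> in \<open>unfold dist_real_def, linarith\<close>)
  qed
  then show ?thesis ..
qed

lemma has_mean_approx:
  fixes f :: "real^'d::finite \<Rightarrow> real"
  assumes "loc_int f"
    and "\<And>e. e > 0 \<Longrightarrow> \<exists>(g :: real^'d \<Rightarrow> real) m. has_mean g m \<and> eventually (\<lambda>R. \<bar>ball_avg f R - ball_avg g R\<bar> \<le> e) at_top"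
  shows "\<exists>m. has_mean f m"
proof -
  have "\<exists>m. (ball_avg f \<longlongrightarrow> m) at_top"
    by (rule tendsto_at_top_approx) (use assms(2) in \<open>unfold has_mean_def, blast\<close>)
  with assms(1) show ?thesis by (auto simp: has_mean_def)
qed

text \<open>Moving the centre by v changes the ball only inside the shell between the radii R - |v|
  and R + |v|, whose share of the volume tends to zero.\<close>

lemma ball_avg_translate:
  fixes f :: "real^'d::finite \<Rightarrow> real"
  assumes bdd: "\<And>x. \<bar>f x\<bar> \<le> M" and fm [measurable]: "f \<in> borel_measurable borel"
  shows "((\<lambda>R. ball_avg (\<lambda>x. f (x + v)) R - ball_avg f R) \<longlongrightarrow> 0) at_top"
proof -
  define d where "d = CARD('d)"
  define \<omega> where "\<omega> = unit_ball_vol (real d)"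
  have \<omega>: "\<omega> > 0" unfolding \<omega>_def by (simp add: unit_ball_vol_pos)
  have vol: "measure lborel (ball c r :: (real^'d) set) = \<omega> * r ^ d" if "r \<ge> 0" for c r
    using content_ball[OF that, of c] that by (simp add: \<omega>_def d_def)
  have M: "M \<ge> 0" using bdd[of 0] by linarith
  \<comment> \<open>The bound for \<open>f\<close> times the relative volume of that shell.\<close>
  define E where "E = (\<lambda>R. M * ((1 + norm v / R) ^ d - (1 - norm v / R) ^ d))"
  have est: "\<bar>ball_avg (\<lambda>x. f (x + v)) R - ball_avg f R\<bar> \<le> E R" if R: "R > norm v" for R
  proof -
    have R0: "R > 0" using R norm_ge_zero[of v] by linarith
    have shift: "(\<integral>x. indicator (ball 0 R) x *\<^sub>R f (x + v) \<partial>lborel) = (\<integral>x. indicator (ball v R) x *\<^sub>R f x \<partial>lborel)"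
    proof -
      have "(\<integral>x. indicator (ball v R) x *\<^sub>R f x \<partial>lborel) = (\<integral>x. indicator (ball v R) x *\<^sub>R f x \<partial>(distr lborel borel ((+) v)))"
        by (simp add: lborel_distr_plus)
      also have "\<dots> = (\<integral>x. indicator (ball v R) (v + x) *\<^sub>R f (v + x) \<partial>lborel)"
        by (intro integral_distr borel_measurable_scaleR borel_measurable_indicator fm) auto
      also have "\<dots> = (\<integral>x. indicator (ball 0 R) x *\<^sub>R f (x + v) \<partial>lborel)"
        by (intro Bochner_Integration.integral_cong) (auto simp: indicator_def dist_norm add.commute)
      finally show ?thesis by simp
    qed
    have intg: "integrable lborel (\<lambda>x. indicator (ball c r) x *\<^sub>R f x)" for c r
    proof (rule Bochner_Integration.integrable_bound)
      show "integrable lborel (\<lambda>x::real^'d. indicator (ball c r) x *\<^sub>R M)"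
        by (intro integrable_scaleR_left integrable_real_indicator) auto
    qed (use bdd in \<open>auto simp: indicator_def intro!: order_trans[OF bdd abs_ge_self]\<close>)
    have "\<bar>(\<integral>x. indicator (ball v R) x *\<^sub>R f x \<partial>lborel) - (\<integral>x. indicator (ball 0 R) x *\<^sub>R f x \<partial>lborel)\<bar>
        = norm (\<integral>x. indicator (ball v R) x *\<^sub>R f x - indicator (ball 0 R) x *\<^sub>R f x \<partial>lborel)"
      using intg by simp
    also have "\<dots> \<le> (\<integral>x. M * (indicator (ball (0::real^'d) (R + norm v)) x - indicator (ball 0 (R - norm v)) x) \<partial>lborel)"
    proof (rule order_trans[OF integral_norm_bound Bochner_Integration.integral_mono])
      show "integrable lborel (\<lambda>x::real^'d. M * (indicator (ball 0 (R + norm v)) x - indicator (ball 0 (R - norm v)) x))"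
        by (intro integrable_mult_right Bochner_Integration.integrable_diff integrable_real_indicator) auto
      fix x :: "real^'d"
      have 1: "x \<in> ball v R \<Longrightarrow> x \<in> ball 0 (R + norm v)"
        using norm_triangle_ineq[of "x - v" v] by (simp add: dist_norm norm_minus_commute)
      have 2: "x \<in> ball 0 (R - norm v) \<Longrightarrow> x \<in> ball v R"
        using norm_triangle_ineq4[of v x] by (simp add: dist_norm)
      have 3: "x \<in> ball 0 (R - norm v) \<Longrightarrow> x \<in> ball 0 R" using norm_ge_zero[of v] by (auto simp: dist_norm simp del: norm_ge_zero)
      have 4: "x \<in> ball 0 R \<Longrightarrow> x \<in> ball 0 (R + norm v)" using norm_ge_zero[of v] by (auto simp: dist_norm simp del: norm_ge_zero)
      show "norm (indicator (ball v R) x *\<^sub>R f x - indicator (ball 0 R) x *\<^sub>R f x)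
        \<le> M * (indicator (ball 0 (R + norm v)) x - indicator (ball 0 (R - norm v)) x)"
        using 1 2 3 4 bdd[of x] M unfolding indicator_def by (auto split: if_splits)
    qed (use intg in \<open>intro integrable_norm Bochner_Integration.integrable_diff\<close>)
    also have "\<dots> = M * (measure lborel (ball (0::real^'d) (R + norm v)) - measure lborel (ball (0::real^'d) (R - norm v)))"
    proof -
      have i: "integrable lborel (indicat_real (ball (0::real^'d) r))" for r
        by (intro integrable_real_indicator) auto
      show ?thesis
        by (simp only: integral_mult_right_zero Bochner_Integration.integral_diff[OF i i] 
            Bochner_Integration.integral_indicator space_lborel) simp
    qed
    also have "\<dots> = M * (\<omega> * (R + norm v) ^ d - \<omega> * (R - norm v) ^ d)"
      using vol[of "R + norm v" 0] vol[of "R - norm v" 0] R R0 by simp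
    finally have "\<bar>ball_avg (\<lambda>x. f (x + v)) R - ball_avg f R\<bar> \<le> M * (\<omega> * (R + norm v) ^ d - \<omega> * (R - norm v) ^ d) / (\<omega> * R ^ d)"
      unfolding ball_avg_def set_lebesgue_integral_def shift using vol[of R 0] R0 \<omega>
      by (simp flip: diff_divide_distrib add: divide_right_mono)
    also have "\<dots> = E R"
    proof -
      have "1 + norm v / R = (R + norm v) / R" "1 - norm v / R = (R - norm v) / R"
        using R0 by (simp_all add: add_divide_distrib diff_divide_distrib)
      then have "E R = M * ((R + norm v) ^ d / R ^ d - (R - norm v) ^ d / R ^ d)"
        by (simp only: E_def power_divide)
      moreover have "M * (\<omega> * (R + norm v) ^ d - \<omega> * (R - norm v) ^ d) = \<omega> * (M * ((R + norm v) ^ d - (R - norm v) ^ d))"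
        by (simp add: algebra_simps)
      ultimately show ?thesis using \<omega>
        by (simp only:) (simp add: diff_divide_distrib[symmetric])
    qed
    finally show ?thesis .
  qed
  have "(E \<longlongrightarrow> M * ((1 + 0) ^ d - (1 - 0) ^ d)) at_top"
    unfolding E_def by (intro tendsto_intros tendsto_divide_0[OF tendsto_const] filterlim_at_top_imp_at_infinity filterlim_ident)
  then have "(E \<longlongrightarrow> 0) at_top" by simp
  then show ?thesis
    by (rule Lim_null_comparison[rotated]) (use est in \<open>auto intro: eventually_mono[OF eventually_gt_at_top[of "norm v"]]\<close>)
qed

lemma has_mean_translate:
  assumes m: "has_mean f m" and bdd: "\<And>x. \<bar>f x\<bar> \<le> M" and [measurable]: "f \<in> borel_measurable borel"
  shows "has_mean (\<lambda>x. f (x + v)) m"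
proof -
  have "loc_int (\<lambda>x. f (x + v))"
    using bdd by (auto intro!: loc_int_bounded[of _ M])
  moreover have "(ball_avg (\<lambda>x. f (x + v)) \<longlongrightarrow> m) at_top"
    using tendsto_add[OF ball_avg_translate[OF bdd assms(3), where v = v], of "ball_avg f" m] m unfolding has_mean_def by fastforce
  ultimately show ?thesis by (simp add: has_mean_def)
qed

section \<open>Trigonometric polynomials\<close>

lemma trig_cos: "trig_poly (\<lambda>y. cos (\<xi> \<bullet> y))"
  unfolding trig_poly_def by (rule exI[of _ "{\<xi>}"], rule exI[of _ "\<lambda>_. 1"], rule exI[of _ "\<lambda>_. 0"]) simp

lemma trig_sin: "trig_poly (\<lambda>y. sin (\<xi> \<bullet> y))"
  unfolding trig_poly_def by (rule exI[of _ "{\<xi>}"], rule exI[of _ "\<lambda>_. 0"], rule exI[of _ "\<lambda>_. 1"]) simp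

lemma trig_cmult:
  assumes "trig_poly p" shows "trig_poly (\<lambda>y. c * p y)"
proof -
  from assms obtain F a b where "finite F" "\<forall>y. p y = (\<Sum>\<xi>\<in>F. a \<xi> * cos (\<xi> \<bullet> y) + b \<xi> * sin (\<xi> \<bullet> y))"
    unfolding trig_poly_def by blast
  then have "\<forall>y. c * p y = (\<Sum>\<xi>\<in>F. (c * a \<xi>) * cos (\<xi> \<bullet> y) + (c * b \<xi>) * sin (\<xi> \<bullet> y))"
    by (simp add: sum_distrib_left algebra_simps)
  with \<open>finite F\<close> show ?thesis unfolding trig_poly_def by (intro exI[of _ F] exI conjI)
qed

lemma trig_add:
  assumes "trig_poly p" "trig_poly q" shows "trig_poly (\<lambda>y. p y + q y)"
proof -
  from assms(1) obtain F a b where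
    F: "finite F" "\<And>y. p y = (\<Sum>\<xi>\<in>F. a \<xi> * cos (\<xi> \<bullet> y) + b \<xi> * sin (\<xi> \<bullet> y))"
    unfolding trig_poly_def by blast
  from assms(2) obtain G c d where
    G: "finite G" "\<And>y. q y = (\<Sum>\<xi>\<in>G. c \<xi> * cos (\<xi> \<bullet> y) + d \<xi> * sin (\<xi> \<bullet> y))"
    unfolding trig_poly_def by blast
  \<comment> \<open>Both coefficient families are extended by zero to the union, so that common
    frequencies are added.\<close>
  let ?a = "\<lambda>\<xi>. (if \<xi> \<in> F then a \<xi> else 0) + (if \<xi> \<in> G then c \<xi> else 0)"
  let ?b = "\<lambda>\<xi>. (if \<xi> \<in> F then b \<xi> else 0) + (if \<xi> \<in> G then d \<xi> else 0)"
  have "p y + q y = (\<Sum>\<xi>\<in>F \<union> G. ?a \<xi> * cos (\<xi> \<bullet> y) + ?b \<xi> * sin (\<xi> \<bullet> y))" for y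
  proof -
    have pe: "p y = (\<Sum>\<xi>\<in>F \<union> G. (if \<xi> \<in> F then a \<xi> else 0) * cos (\<xi> \<bullet> y) + (if \<xi> \<in> F then b \<xi> else 0) * sin (\<xi> \<bullet> y))"
      unfolding F(2) using F(1) G(1) by (intro sum.mono_neutral_cong_left) auto
    have qe: "q y = (\<Sum>\<xi>\<in>F \<union> G. (if \<xi> \<in> G then c \<xi> else 0) * cos (\<xi> \<bullet> y) + (if \<xi> \<in> G then d \<xi> else 0) * sin (\<xi> \<bullet> y))"
      unfolding G(2) using F(1) G(1) by (intro sum.mono_neutral_cong_left) auto
    have "p y + q y = (\<Sum>\<xi>\<in>F \<union> G. ((if \<xi> \<in> F then a \<xi> else 0) * cos (\<xi> \<bullet> y) + (if \<xi> \<in> F then b \<xi> else 0) * sin (\<xi> \<bullet> y))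
        + ((if \<xi> \<in> G then c \<xi> else 0) * cos (\<xi> \<bullet> y) + (if \<xi> \<in> G then d \<xi> else 0) * sin (\<xi> \<bullet> y)))"
      unfolding pe qe by (rule sum.distrib[symmetric])
    also have "\<dots> = (\<Sum>\<xi>\<in>F \<union> G. ?a \<xi> * cos (\<xi> \<bullet> y) + ?b \<xi> * sin (\<xi> \<bullet> y))"
      by (intro sum.cong refl) (simp only: algebra_simps)
    finally show ?thesis .
  qed
  moreover have "finite (F \<union> G)" using F(1) G(1) by simp
  ultimately show ?thesis unfolding trig_poly_def by (intro exI[of _ "F \<union> G"] exI conjI allI)
qed

lemma trig_const: "trig_poly (\<lambda>_. c)"
  using trig_cmult[OF trig_cos[of 0], of c] by simp

lemma trig_diff: "trig_poly p \<Longrightarrow> trig_poly q \<Longrightarrow> trig_poly (\<lambda>y. p y - q y)"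
  using trig_add[OF _ trig_cmult[of q "-1"], of p] by simp

lemma trig_sum: "(\<And>k. k \<in> S \<Longrightarrow> trig_poly (f k)) \<Longrightarrow> trig_poly (\<lambda>y. \<Sum>k\<in>S. f k y)"
  by (induction S rule: infinite_finite_induct) (auto intro: trig_add trig_const)

text \<open>Reduces facts that are linear in a trigonometric polynomial to single waves, so that
  most later proofs do not handle the frequency set.\<close>

lemma trig_induct [consumes 1, case_names cos sin cmult add]:
  assumes "trig_poly p"
    and cos: "\<And>\<xi>. P (\<lambda>y. cos (\<xi> \<bullet> y))" and sin: "\<And>\<xi>. P (\<lambda>y. sin (\<xi> \<bullet> y))"
    and cmult: "\<And>c p. trig_poly p \<Longrightarrow> P p \<Longrightarrow> P (\<lambda>y. c * p y)"
    and add: "\<And>p q. trig_poly p \<Longrightarrow> trig_poly q \<Longrightarrow> P p \<Longrightarrow> P q \<Longrightarrow> P (\<lambda>y. p y + q y)"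
  shows "P p"
proof -
  from assms(1) obtain F a b where F: "finite F" and
    p: "p = (\<lambda>y. \<Sum>\<xi>\<in>F. a \<xi> * cos (\<xi> \<bullet> y) + b \<xi> * sin (\<xi> \<bullet> y))"
    unfolding trig_poly_def fun_eq_iff by blast
  have t: "trig_poly (\<lambda>y. a \<xi> * cos (\<xi> \<bullet> y) + b \<xi> * sin (\<xi> \<bullet> y))" for \<xi>
    by (intro trig_add trig_cmult trig_cos trig_sin)
  have P: "P (\<lambda>y. a \<xi> * cos (\<xi> \<bullet> y) + b \<xi> * sin (\<xi> \<bullet> y))" for \<xi>
    by (intro add trig_cmult trig_cos trig_sin cmult cos sin)
  show ?thesis unfolding p using F
  proof (induction F rule: finite_induct)
    case empty
    then show ?case using cmult[OF trig_cos cos, of 0 0] by simp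
  next
    case (insert \<xi> F)
    then show ?case using add[OF t trig_sum[OF t] P insert.IH] by simp
  qed
qed

lemma trig_mult:
  assumes "trig_poly p" "trig_poly q" shows "trig_poly (\<lambda>y. p y * q y)"
  using assms
proof (induction p rule: trig_induct)
  case (cos \<xi>)
  show ?case using \<open>trig_poly q\<close>
  proof (induction q rule: trig_induct)
    case (cos \<eta>)
    have "cos (\<xi> \<bullet> y) * cos (\<eta> \<bullet> y) = 1/2 * cos ((\<xi> - \<eta>) \<bullet> y) + 1/2 * cos ((\<xi> + \<eta>) \<bullet> y)" for y
      by (simp add: cos_times_cos inner_left_distrib inner_diff_left add_divide_distrib)
    then show ?case by (simp only:) (intro trig_add trig_cmult trig_cos)
  next
    case (sin \<eta>)
    have "cos (\<xi> \<bullet> y) * sin (\<eta> \<bullet> y) = 1/2 * sin ((\<xi> + \<eta>) \<bullet> y) - 1/2 * sin ((\<xi> - \<eta>) \<bullet> y)" for y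
      by (simp add: cos_times_sin inner_left_distrib inner_diff_left diff_divide_distrib)
    then show ?case by (simp only:) (intro trig_diff trig_cmult trig_sin)
  next
    case (cmult c q)
    then show ?case using trig_cmult[of "\<lambda>y. cos (\<xi> \<bullet> y) * q y" c] by (simp add: mult.left_commute)
  next
    case (add p q)
    then show ?case by (simp add: distrib_left trig_add)
  qed
next
  case (sin \<xi>)
  show ?case using \<open>trig_poly q\<close>
  proof (induction q rule: trig_induct)
    case (cos \<eta>)
    have "sin (\<xi> \<bullet> y) * cos (\<eta> \<bullet> y) = 1/2 * sin ((\<xi> + \<eta>) \<bullet> y) + 1/2 * sin ((\<xi> - \<eta>) \<bullet> y)" for y
      by (simp add: sin_times_cos inner_left_distrib inner_diff_left add_divide_distrib)
    then show ?case by (simp only:) (intro trig_add trig_cmult trig_sin)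
  next
    case (sin \<eta>)
    have "sin (\<xi> \<bullet> y) * sin (\<eta> \<bullet> y) = 1/2 * cos ((\<xi> - \<eta>) \<bullet> y) - 1/2 * cos ((\<xi> + \<eta>) \<bullet> y)" for y
      by (simp add: sin_times_sin inner_left_distrib inner_diff_left diff_divide_distrib)
    then show ?case by (simp only:) (intro trig_diff trig_cmult trig_cos)
  next
    case (cmult c q)
    then show ?case using trig_cmult[of "\<lambda>y. sin (\<xi> \<bullet> y) * q y" c] by (simp add: mult.left_commute)
  next
    case (add p q)
    then show ?case by (simp add: distrib_left trig_add)
  qed
next
  case (cmult c p)
  then show ?case using trig_cmult[of "\<lambda>y. p y * q y" c] by (simp add: mult.assoc)
next
  case (add p p')
  then show ?case by (simp add: distrib_right trig_add)
qed

lemma trig_translate: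
  assumes "trig_poly p" shows "trig_poly (\<lambda>y. p (y + v))"
  using assms
proof (induction p rule: trig_induct)
  case (cos \<xi>)
  have "cos (\<xi> \<bullet> (y + v)) = cos (\<xi> \<bullet> v) * cos (\<xi> \<bullet> y) - sin (\<xi> \<bullet> v) * sin (\<xi> \<bullet> y)" for y
    by (simp add: inner_right_distrib cos_add mult.commute)
  then show ?case by (simp only:) (intro trig_diff trig_cmult trig_cos trig_sin)
next
  case (sin \<xi>)
  have "sin (\<xi> \<bullet> (y + v)) = cos (\<xi> \<bullet> v) * sin (\<xi> \<bullet> y) + sin (\<xi> \<bullet> v) * cos (\<xi> \<bullet> y)" for y
    by (simp add: inner_right_distrib sin_add mult.commute)
  then show ?case by (simp only:) (intro trig_add trig_cmult trig_cos trig_sin)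
qed (auto intro: trig_cmult trig_add)

lemma trig_continuous:
  assumes "trig_poly p" shows "continuous_on S p"
proof -
  obtain F a b where "p = (\<lambda>y. \<Sum>\<xi>\<in>F. a \<xi> * cos (\<xi> \<bullet> y) + b \<xi> * sin (\<xi> \<bullet> y))"
    using assms unfolding trig_poly_def fun_eq_iff by blast
  then show ?thesis by (simp only:) (intro continuous_intros)
qed

lemma trig_bounded:
  assumes "trig_poly p" obtains M where "M > 0" "\<And>x. \<bar>p x\<bar> \<le> M"
proof -
  have "\<exists>M>0. \<forall>x. \<bar>p x\<bar> \<le> M" using assms
  proof (induction p rule: trig_induct)
    case (cos \<xi>)
    show ?case by (rule exI[of _ 1]) simp
  next
    case (sin \<xi>)
    show ?case by (rule exI[of _ 1]) simp
  next
    case (cmult c p)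
    then obtain M where M: "M > 0" "\<And>x. \<bar>p x\<bar> \<le> M" by auto
    have "\<bar>c * p x\<bar> \<le> (\<bar>c\<bar> + 1) * M" for x
      unfolding abs_mult using M by (intro mult_mono) auto
    then show ?case using M(1) by (intro exI[of _ "(\<bar>c\<bar> + 1) * M"]) auto
  next
    case (add p q)
    then obtain M N where M: "M > 0" "\<And>x. \<bar>p x\<bar> \<le> M" "N > 0" "\<And>x. \<bar>q x\<bar> \<le> N" by auto
    have "\<bar>p x + q x\<bar> \<le> M + N" for x using M(2)[of x] M(4)[of x] by linarith
    then show ?case using M(1,3) by (intro exI[of _ "M + N"]) auto
  qed
  then show thesis using that by blast
qed

lemma partial_eqI:
  "((\<lambda>t. f (x + t *\<^sub>R axis i 1)) has_real_derivative D) (at 0) \<Longrightarrow> partial i f x = D"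
  unfolding partial_def by (rule DERIV_imp_deriv)

lemma trig_partial:
  fixes p :: "real^'d::finite \<Rightarrow> real"
  assumes "trig_poly p"
  shows trig_poly_partial: "trig_poly (partial i p)"
    and trig_has_partial: "((\<lambda>t. p (x + t *\<^sub>R axis i 1)) has_real_derivative partial i p x) (at 0)"
proof -
  have "\<exists>q. trig_poly q \<and> (\<forall>x. ((\<lambda>t. p (x + t *\<^sub>R axis i 1)) has_real_derivative q x) (at 0))"
    using assms
  proof (induction p rule: trig_induct)
    case (cos \<xi>)
    show ?case
      by (rule exI[of _ "\<lambda>x. (- \<xi> $ i) * sin (\<xi> \<bullet> x)"], intro conjI allI trig_cmult trig_sin)
         (auto simp: inner_right_distrib inner_axis intro!: derivative_eq_intros)
  next
    case (sin \<xi>)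
    show ?case
      by (rule exI[of _ "\<lambda>x. (\<xi> $ i) * cos (\<xi> \<bullet> x)"], intro conjI allI trig_cmult trig_cos)
         (auto simp: inner_right_distrib inner_axis intro!: derivative_eq_intros)
  next
    case (cmult c p)
    then obtain q where q: "trig_poly q" "\<And>x. ((\<lambda>t. p (x + t *\<^sub>R axis i 1)) has_real_derivative q x) (at 0)" by auto
    show ?case by (intro exI[of _ "\<lambda>x. c * q x"] conjI allI trig_cmult q DERIV_cmult)
  next
    case (add p r)
    then obtain q s where q: "trig_poly q" "\<And>x. ((\<lambda>t. p (x + t *\<^sub>R axis i 1)) has_real_derivative q x) (at 0)"
      "trig_poly s" "\<And>x. ((\<lambda>t. r (x + t *\<^sub>R axis i 1)) has_real_derivative s x) (at 0)" by auto
    show ?case by (intro exI[of _ "\<lambda>x. q x + s x"] conjI allI trig_add q DERIV_add)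
  qed
  then obtain q where q: "trig_poly q" "\<And>x. ((\<lambda>t. p (x + t *\<^sub>R axis i 1)) has_real_derivative q x) (at 0)"
    by blast
  have "partial i p = q" by (intro ext partial_eqI q)
  with q show "trig_poly (partial i p)"
    "((\<lambda>t. p (x + t *\<^sub>R axis i 1)) has_real_derivative partial i p x) (at 0)" by auto
qed

lemma partial_cos: "partial i (\<lambda>y. cos (\<xi> \<bullet> y)) x = - \<xi> $ i * sin (\<xi> \<bullet> x)"
  by (rule partial_eqI) (auto simp: inner_right_distrib inner_axis intro!: derivative_eq_intros)

lemma partial_sin: "partial i (\<lambda>y. sin (\<xi> \<bullet> y)) x = \<xi> $ i * cos (\<xi> \<bullet> x)"
  by (rule partial_eqI) (auto simp: inner_right_distrib inner_axis intro!: derivative_eq_intros)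

lemma partial_cmult: "trig_poly p \<Longrightarrow> partial i (\<lambda>y. c * p y) x = c * partial i p x"
  by (intro partial_eqI DERIV_cmult trig_has_partial)

lemma partial_add: "trig_poly p \<Longrightarrow> trig_poly q \<Longrightarrow> partial i (\<lambda>y. p y + q y) x = partial i p x + partial i q x"
  by (intro partial_eqI DERIV_add trig_has_partial)

lemma partial_mult: "trig_poly p \<Longrightarrow> trig_poly q \<Longrightarrow> partial i (\<lambda>y. p y * q y) x = partial i p x * q x + p x * partial i q x"
  using DERIV_mult[OF trig_has_partial[where p = p and x = x and i = i] trig_has_partial[where p = q and x = x and i = i]] by (intro partial_eqI) (simp add: mult.commute add.commute)

lemma partial_translate: "partial i (\<lambda>y. p (y + v)) x = partial i p (x + v)"
  unfolding partial_def by (simp add: add_ac)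

text \<open>Mean value inequality for \<open>g\<close>, whose derivative is at most |h| because the
  sine is 1-Lipschitz. The constant 1 in place of 1/2 is enough.\<close>

lemma abs_cos_taylor: "\<bar>cos (a + h) - cos a + h * sin a\<bar> \<le> (h::real)\<^sup>2"
proof -
  have sin_lip: "\<bar>sin (a + t) - sin a\<bar> \<le> \<bar>t\<bar>" for t :: real
    using field_differentiable_bound[of UNIV "sin :: real \<Rightarrow> real" cos 1 "a + t" a]
    by (auto intro!: derivative_eq_intros)
  define g where "g = (\<lambda>t. cos (a + t) + t * sin a)"
  have "norm (g h - g 0) \<le> \<bar>h\<bar> * norm (h - 0)"
  proof (rule field_differentiable_bound[of "cball 0 \<bar>h\<bar>"])
    fix z :: real assume "z \<in> cball 0 \<bar>h\<bar>"
    show "(g has_field_derivative (sin a - sin (a + z))) (at z within cball 0 \<bar>h\<bar>)"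
      unfolding g_def by (auto intro!: derivative_eq_intros)
    show "norm (sin a - sin (a + z)) \<le> \<bar>h\<bar>"
      using sin_lip[of z] \<open>z \<in> _\<close> by (auto simp: dist_norm)
  qed auto
  then show ?thesis by (simp add: g_def power2_eq_square algebra_simps)
qed

lemma abs_sin_taylor: "\<bar>sin (a + h) - sin a - h * cos a\<bar> \<le> (h::real)\<^sup>2"
  using abs_cos_taylor[of "a - pi/2" h] by (simp add: cos_add sin_add cos_diff sin_diff)

lemma sum_inner_mult: "(\<Sum>i\<in>UNIV. z $ i * (\<xi> $ i * c)) = (\<xi> \<bullet> z) * (c::real)"
  by (simp add: inner_vec_def sum_distrib_left mult_ac)

text \<open>The constant does not depend on the base point, so the remainder estimate can be
  averaged over x.\<close>

lemma trig_taylor: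
  fixes p :: "real^'d::finite \<Rightarrow> real"
  assumes "trig_poly p"
  obtains K where "K \<ge> 0" "\<And>x z. \<bar>p (x + z) - p x - (\<Sum>i\<in>UNIV. z $ i * partial i p x)\<bar> \<le> K * (norm z)\<^sup>2"
proof -
  have "\<exists>K\<ge>0. \<forall>x z. \<bar>p (x + z) - p x - (\<Sum>i\<in>UNIV. z $ i * partial i p x)\<bar> \<le> K * (norm z)\<^sup>2"
    using assms
  proof (induction p rule: trig_induct)
    case (cos \<xi>)
    have "\<bar>cos (\<xi> \<bullet> (x + z)) - cos (\<xi> \<bullet> x) - (\<Sum>i\<in>UNIV. z $ i * partial i (\<lambda>y. cos (\<xi> \<bullet> y)) x)\<bar> \<le> (norm \<xi>)\<^sup>2 * (norm z)\<^sup>2" for x z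
    proof -
      have "(\<Sum>i\<in>UNIV. z $ i * partial i (\<lambda>y. cos (\<xi> \<bullet> y)) x) = - (\<xi> \<bullet> z) * sin (\<xi> \<bullet> x)"
        by (simp add: partial_cos sum_negf sum_inner_mult)
      then have "\<bar>cos (\<xi> \<bullet> (x + z)) - cos (\<xi> \<bullet> x) - (\<Sum>i\<in>UNIV. z $ i * partial i (\<lambda>y. cos (\<xi> \<bullet> y)) x)\<bar> \<le> (\<xi> \<bullet> z)\<^sup>2"
        using abs_cos_taylor[of "\<xi> \<bullet> x" "\<xi> \<bullet> z"] by (simp add: inner_right_distrib)
      also have "\<dots> \<le> (norm \<xi>)\<^sup>2 * (norm z)\<^sup>2"
        using Cauchy_Schwarz_ineq[of \<xi> z] by (simp add: power2_norm_eq_inner)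
      finally show ?thesis .
    qed
    then show ?case by (intro exI[of _ "(norm \<xi>)\<^sup>2"]) auto
  next
    case (sin \<xi>)
    have "\<bar>sin (\<xi> \<bullet> (x + z)) - sin (\<xi> \<bullet> x) - (\<Sum>i\<in>UNIV. z $ i * partial i (\<lambda>y. sin (\<xi> \<bullet> y)) x)\<bar> \<le> (norm \<xi>)\<^sup>2 * (norm z)\<^sup>2" for x z
    proof -
      have "(\<Sum>i\<in>UNIV. z $ i * partial i (\<lambda>y. sin (\<xi> \<bullet> y)) x) = (\<xi> \<bullet> z) * cos (\<xi> \<bullet> x)"
        by (simp add: partial_sin sum_inner_mult)
      then have "\<bar>sin (\<xi> \<bullet> (x + z)) - sin (\<xi> \<bullet> x) - (\<Sum>i\<in>UNIV. z $ i * partial i (\<lambda>y. sin (\<xi> \<bullet> y)) x)\<bar> \<le> (\<xi> \<bullet> z)\<^sup>2"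
        using abs_sin_taylor[of "\<xi> \<bullet> x" "\<xi> \<bullet> z"] by (simp add: inner_right_distrib)
      also have "\<dots> \<le> (norm \<xi>)\<^sup>2 * (norm z)\<^sup>2"
        using Cauchy_Schwarz_ineq[of \<xi> z] by (simp add: power2_norm_eq_inner)
      finally show ?thesis .
    qed
    then show ?case by (intro exI[of _ "(norm \<xi>)\<^sup>2"]) auto
  next
    case (cmult c p)
    then obtain K where K: "K \<ge> 0" "\<And>x z. \<bar>p (x + z) - p x - (\<Sum>i\<in>UNIV. z $ i * partial i p x)\<bar> \<le> K * (norm z)\<^sup>2" by auto
    have "\<bar>c * p (x + z) - c * p x - (\<Sum>i\<in>UNIV. z $ i * partial i (\<lambda>y. c * p y) x)\<bar> \<le> (\<bar>c\<bar> * K) * (norm z)\<^sup>2" for x z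
    proof -
      have "c * p (x + z) - c * p x - (\<Sum>i\<in>UNIV. z $ i * partial i (\<lambda>y. c * p y) x)
         = c * (p (x + z) - p x - (\<Sum>i\<in>UNIV. z $ i * partial i p x))"
        by (simp add: partial_cmult cmult algebra_simps sum_distrib_left)
      then show ?thesis using mult_left_mono[OF K(2), of "\<bar>c\<bar>" x z] by (simp add: abs_mult mult_ac)
    qed
    then show ?case using K(1) by (intro exI[of _ "\<bar>c\<bar> * K"]) auto
  next
    case (add p q)
    then obtain K L where K: "K \<ge> 0" "\<And>x z. \<bar>p (x + z) - p x - (\<Sum>i\<in>UNIV. z $ i * partial i p x)\<bar> \<le> K * (norm z)\<^sup>2"
      and L: "L \<ge> 0" "\<And>x z. \<bar>q (x + z) - q x - (\<Sum>i\<in>UNIV. z $ i * partial i q x)\<bar> \<le> L * (norm z)\<^sup>2" by auto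
    have "\<bar>(p (x + z) + q (x + z)) - (p x + q x) - (\<Sum>i\<in>UNIV. z $ i * partial i (\<lambda>y. p y + q y) x)\<bar> \<le> (K + L) * (norm z)\<^sup>2" for x z
      using K(2)[of x z] L(2)[of x z] by (simp add: partial_add add distrib_left sum.distrib distrib_right)
    then show ?case using K(1) L(1) by (intro exI[of _ "K + L"]) auto
  qed
  then show thesis using that by blast
qed

lemma trig_loc_int: "trig_poly p \<Longrightarrow> loc_int p"
  by (metis trig_bounded loc_int_bounded borel_measurable_continuous_onI trig_continuous)


text \<open>Ball averages are asymptotically invariant under translation, while this translation
  flips the sign; hence twice the average tends to zero.\<close>

lemma has_mean_antiperiodic:
  assumes p: "trig_poly p" and anti: "\<And>y. p (y + v) = - p y"
  shows "has_mean p 0"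
proof -
  obtain M where M: "\<And>x. \<bar>p x\<bar> \<le> M" using trig_bounded[OF p] by metis
  have "p \<in> borel_measurable borel" using p by (intro borel_measurable_continuous_onI trig_continuous)
  from ball_avg_translate[OF M this, of v]
  have "((\<lambda>R. ball_avg (\<lambda>x. - 1 * p x) R - ball_avg p R) \<longlongrightarrow> 0) at_top" by (simp add: anti)
  from tendsto_mult_left[OF this, of "-1/2"] have "(ball_avg p \<longlongrightarrow> 0) at_top"
    unfolding ball_avg_cmult by simp
  then show ?thesis using trig_loc_int[OF p] by (simp add: has_mean_def)
qed

lemma has_mean_cos: "has_mean (\<lambda>y. cos (\<xi> \<bullet> y)) (if \<xi> = 0 then 1 else 0)"
proof (cases "\<xi> = 0")
  case True then show ?thesis using has_mean_const[of 1] by simp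
next
  case False
  then have "has_mean (\<lambda>y. cos (\<xi> \<bullet> y)) 0"
    \<comment> \<open>Translation by this vector moves the phase by pi, which flips the sign of the
      wave.\<close>
    by (intro has_mean_antiperiodic[where v = "(pi / (\<xi> \<bullet> \<xi>)) *\<^sub>R \<xi>"] trig_cos) (simp add: inner_right_distrib)
  with False show ?thesis by simp
qed

lemma has_mean_sin: "has_mean (\<lambda>y. sin (\<xi> \<bullet> y)) 0"
proof (cases "\<xi> = 0")
  case True then show ?thesis using has_mean_const[of 0] by simp
next
  case False
  then show ?thesis
    by (intro has_mean_antiperiodic[where v = "(pi / (\<xi> \<bullet> \<xi>)) *\<^sub>R \<xi>"] trig_sin) (simp add: inner_right_distrib)
qed

lemma trig_has_mean:
  assumes "trig_poly p" shows "has_mean p (mean p)"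
proof -
  have "\<exists>m. has_mean p m" using assms
    by (induction p rule: trig_induct) (blast intro: has_mean_cos has_mean_sin has_mean_add has_mean_cmult)+
  then show ?thesis using has_mean_eq by metis
qed

text \<open>Differentiation kills the constant mode, and every other wave has mean zero. This is
  what makes integration by parts free of boundary terms under \<open>mean\<close>.\<close>

lemma mean_partial_trig:
  assumes "trig_poly p" shows "mean (partial i p) = 0"
proof -
  have "has_mean (partial i p) 0" using assms
  proof (induction p rule: trig_induct)
    case (cos \<xi>)
    show ?case using has_mean_cmult[OF has_mean_sin, of "- \<xi> $ i" \<xi>] by (simp add: partial_cos[abs_def])
  next
    case (sin \<xi>)
    show ?case using has_mean_cmult[OF has_mean_cos, of "\<xi> $ i" \<xi>] by (simp add: partial_sin[abs_def] split: if_splits)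
  next
    case (cmult c p)
    have "partial i (\<lambda>y. c * p y) = (\<lambda>x. c * partial i p x)" using cmult by (intro ext partial_cmult)
    then show ?case using has_mean_cmult[OF cmult.IH, of c] by simp
  next
    case (add p q)
    have "partial i (\<lambda>y. p y + q y) = (\<lambda>x. partial i p x + partial i q x)" using add by (intro ext partial_add)
    then show ?case using has_mean_add[OF add.IH] by simp
  qed
  then show ?thesis by (rule has_mean_eq)
qed

text \<open>Averaging over the shift y leaves only the zero frequency of \<open>p\<close>, so the
  double mean factors. This removes the translate in \<open>ip_le_shift\<close>.\<close>

lemma trig_correlation:
  assumes p: "trig_poly p" and q: "trig_poly q"
  shows "trig_poly (\<lambda>y. mean (\<lambda>x. p (x + y) * q x)) \<and> mean (\<lambda>y. mean (\<lambda>x. p (x + y) * q x)) = mean p * mean q"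
  using p
proof (induction p rule: trig_induct)
  case (cos \<xi>)
  let ?a = "mean (\<lambda>x. cos (\<xi> \<bullet> x) * q x)" and ?b = "mean (\<lambda>x. sin (\<xi> \<bullet> x) * q x)"
  have eq: "cos (\<xi> \<bullet> (x + y)) * q x = cos (\<xi> \<bullet> y) * (cos (\<xi> \<bullet> x) * q x) + - sin (\<xi> \<bullet> y) * (sin (\<xi> \<bullet> x) * q x)" for x y
    by (simp add: inner_right_distrib cos_add algebra_simps)
  have h: "has_mean (\<lambda>x. cos (\<xi> \<bullet> y) * (cos (\<xi> \<bullet> x) * q x) + - sin (\<xi> \<bullet> y) * (sin (\<xi> \<bullet> x) * q x))
     (cos (\<xi> \<bullet> y) * ?a + - sin (\<xi> \<bullet> y) * ?b)" for y
    by (intro has_mean_add has_mean_cmult trig_has_mean trig_mult trig_cos trig_sin q)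
  then have "mean (\<lambda>x. cos (\<xi> \<bullet> (x + y)) * q x) = ?a * cos (\<xi> \<bullet> y) + - ?b * sin (\<xi> \<bullet> y)" for y
    unfolding eq has_mean_eq[OF h] by (simp add: mult.commute)
  then have *: "(\<lambda>y. mean (\<lambda>x. cos (\<xi> \<bullet> (x + y)) * q x)) = (\<lambda>y. ?a * cos (\<xi> \<bullet> y) + - ?b * sin (\<xi> \<bullet> y))" by blast
  have "mean (\<lambda>y. ?a * cos (\<xi> \<bullet> y) + - ?b * sin (\<xi> \<bullet> y)) = ?a * (if \<xi> = 0 then 1 else 0) + - ?b * 0"
    by (intro has_mean_eq has_mean_add has_mean_cmult has_mean_cos has_mean_sin)
  also have "\<dots> = mean (\<lambda>y. cos (\<xi> \<bullet> y)) * mean q"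
    using has_mean_eq[OF has_mean_cos, of \<xi>] by simp
  finally show ?case unfolding * by (intro conjI trig_add trig_cmult trig_cos trig_sin)
next
  case (sin \<xi>)
  let ?a = "mean (\<lambda>x. cos (\<xi> \<bullet> x) * q x)" and ?b = "mean (\<lambda>x. sin (\<xi> \<bullet> x) * q x)"
  have eq: "sin (\<xi> \<bullet> (x + y)) * q x = sin (\<xi> \<bullet> y) * (cos (\<xi> \<bullet> x) * q x) + cos (\<xi> \<bullet> y) * (sin (\<xi> \<bullet> x) * q x)" for x y
    by (simp add: inner_right_distrib sin_add algebra_simps)
  have h: "has_mean (\<lambda>x. sin (\<xi> \<bullet> y) * (cos (\<xi> \<bullet> x) * q x) + cos (\<xi> \<bullet> y) * (sin (\<xi> \<bullet> x) * q x))
     (sin (\<xi> \<bullet> y) * ?a + cos (\<xi> \<bullet> y) * ?b)" for y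
    by (intro has_mean_add has_mean_cmult trig_has_mean trig_mult trig_cos trig_sin q)
  then have "mean (\<lambda>x. sin (\<xi> \<bullet> (x + y)) * q x) = ?a * sin (\<xi> \<bullet> y) + ?b * cos (\<xi> \<bullet> y)" for y
    unfolding eq has_mean_eq[OF h] by (simp add: mult.commute)
  then have *: "(\<lambda>y. mean (\<lambda>x. sin (\<xi> \<bullet> (x + y)) * q x)) = (\<lambda>y. ?a * sin (\<xi> \<bullet> y) + ?b * cos (\<xi> \<bullet> y))" by blast
  have "mean (\<lambda>y. ?a * sin (\<xi> \<bullet> y) + ?b * cos (\<xi> \<bullet> y)) = ?a * 0 + ?b * (if \<xi> = 0 then 1 else 0)"
    by (intro has_mean_eq has_mean_add has_mean_cmult has_mean_cos has_mean_sin)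
  also have "\<dots> = mean (\<lambda>y. sin (\<xi> \<bullet> y)) * mean q"
    using has_mean_eq[OF has_mean_sin, of \<xi>] has_mean_eq[OF has_mean_cmult[OF trig_has_mean[OF q], of 0]] by simp
  finally show ?case unfolding * by (intro conjI trig_add trig_cmult trig_cos trig_sin)
next
  case (cmult c p)
  have *: "(\<lambda>y. mean (\<lambda>x. c * p (x + y) * q x)) = (\<lambda>y. c * mean (\<lambda>x. p (x + y) * q x))"
    unfolding mult.assoc
    by (intro ext has_mean_eq has_mean_cmult trig_has_mean trig_mult trig_translate cmult q)
  have "mean (\<lambda>y. c * mean (\<lambda>x. p (x + y) * q x)) = c * (mean p * mean q)"
    using has_mean_eq[OF has_mean_cmult[OF trig_has_mean[OF conjunct1[OF cmult.IH]], of c]] conjunct2[OF cmult.IH] by simp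
  moreover have "mean (\<lambda>y. c * p y) = c * mean p"
    using has_mean_eq[OF has_mean_cmult[OF trig_has_mean[OF cmult.hyps], of c]] by simp
  ultimately show ?case unfolding * using cmult.IH by (auto intro: trig_cmult)
next
  case (add p r)
  have *: "(\<lambda>y. mean (\<lambda>x. (p (x + y) + r (x + y)) * q x)) = (\<lambda>y. mean (\<lambda>x. p (x + y) * q x) + mean (\<lambda>x. r (x + y) * q x))"
    unfolding distrib_right
    by (intro ext has_mean_eq has_mean_add trig_has_mean trig_mult trig_translate add q)
  have "mean (\<lambda>y. mean (\<lambda>x. p (x + y) * q x) + mean (\<lambda>x. r (x + y) * q x)) = mean p * mean q + mean r * mean q"
    using has_mean_eq[OF has_mean_add[OF trig_has_mean[OF conjunct1[OF add.IH(1)]] trig_has_mean[OF conjunct1[OF add.IH(2)]]]]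
      conjunct2[OF add.IH(1)] conjunct2[OF add.IH(2)] by simp
  moreover have "mean (\<lambda>y. p y + r y) = mean p + mean r"
    using has_mean_eq[OF has_mean_add[OF trig_has_mean[OF add.hyps(1)] trig_has_mean[OF add.hyps(2)]]] by simp
  ultimately show ?case unfolding * using add.IH by (auto intro: trig_add simp: distrib_right)
qed

text \<open>On the wave of frequency \<xi> the operator is multiplication by c + \<xi> \<bullet>
  \<xi>, which is positive, so it is inverted wave by wave.\<close>

lemma Helmholtz_trig:
  fixes s :: "real^'d::finite \<Rightarrow> real"
  assumes "trig_poly s" and c: "c > 0"
  shows "\<exists>r. trig_poly r \<and> (\<forall>x. c * r x - (\<Sum>i\<in>UNIV. partial i (partial i r) x) = s x)"
  using assms(1)
proof (induction s rule: trig_induct)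
  case (cos \<xi>)
  let ?k = "1 / (c + \<xi> \<bullet> \<xi>)"
  have k: "c + \<xi> \<bullet> \<xi> > 0" using c inner_ge_zero[of \<xi>] by linarith
  have "partial i (\<lambda>x. ?k * cos (\<xi> \<bullet> x)) = (\<lambda>x. (- ?k * \<xi> $ i) * sin (\<xi> \<bullet> x))" for i
    by (intro ext) (simp add: partial_cmult[OF trig_cos] partial_cos del: times_divide_eq_left)
  then have "partial i (partial i (\<lambda>x. ?k * cos (\<xi> \<bullet> x))) x = \<xi> $ i * (\<xi> $ i * (- ?k * cos (\<xi> \<bullet> x)))" for i x
    by (simp only: partial_cmult[OF trig_sin] partial_sin) (simp add: field_simps)
  then have "c * (?k * cos (\<xi> \<bullet> x)) - (\<Sum>i\<in>UNIV. partial i (partial i (\<lambda>x. ?k * cos (\<xi> \<bullet> x))) x)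
      = (c * ?k + ?k * (\<xi> \<bullet> \<xi>)) * cos (\<xi> \<bullet> x)" for x
    unfolding sum_inner_mult by (simp only: sum_inner_mult distrib_right) (simp add: mult_ac)
  moreover have "c * ?k + ?k * (\<xi> \<bullet> \<xi>) = 1" using k by (simp add: add_divide_distrib[symmetric])
  ultimately show ?case by (intro exI[of _ "\<lambda>x. ?k * cos (\<xi> \<bullet> x)"] conjI allI trig_cmult trig_cos) simp
next
  case (sin \<xi>)
  let ?k = "1 / (c + \<xi> \<bullet> \<xi>)"
  have k: "c + \<xi> \<bullet> \<xi> > 0" using c inner_ge_zero[of \<xi>] by linarith
  have "partial i (\<lambda>x. ?k * sin (\<xi> \<bullet> x)) = (\<lambda>x. (?k * \<xi> $ i) * cos (\<xi> \<bullet> x))" for i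
    by (intro ext) (simp add: partial_cmult[OF trig_sin] partial_sin del: times_divide_eq_left)
  then have "partial i (partial i (\<lambda>x. ?k * sin (\<xi> \<bullet> x))) x = \<xi> $ i * (\<xi> $ i * (- ?k * sin (\<xi> \<bullet> x)))" for i x
    by (simp only: partial_cmult[OF trig_cos] partial_cos) (simp add: field_simps)
  then have "c * (?k * sin (\<xi> \<bullet> x)) - (\<Sum>i\<in>UNIV. partial i (partial i (\<lambda>x. ?k * sin (\<xi> \<bullet> x))) x)
      = (c * ?k + ?k * (\<xi> \<bullet> \<xi>)) * sin (\<xi> \<bullet> x)" for x
    unfolding sum_inner_mult by (simp only: sum_inner_mult distrib_right) (simp add: mult_ac)
  moreover have "c * ?k + ?k * (\<xi> \<bullet> \<xi>) = 1" using k by (simp add: add_divide_distrib[symmetric])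
  ultimately show ?case by (intro exI[of _ "\<lambda>x. ?k * sin (\<xi> \<bullet> x)"] conjI allI trig_cmult trig_sin) simp
next
  case (cmult k s)
  then obtain r where r: "trig_poly r" "\<And>x. c * r x - (\<Sum>i\<in>UNIV. partial i (partial i r) x) = s x" by blast
  have "partial i (partial i (\<lambda>x. k * r x)) x = k * partial i (partial i r) x" for i x
    by (simp add: partial_cmult[OF r(1), abs_def] partial_cmult[OF trig_poly_partial[OF r(1)]])
  then show ?case
    by (intro exI[of _ "\<lambda>x. k * r x"]) (auto simp: trig_cmult r(1) r(2)[symmetric] sum_distrib_left right_diff_distrib mult.left_commute)
next
  case (add s s')
  then obtain r r' where r: "trig_poly r" "\<And>x. c * r x - (\<Sum>i\<in>UNIV. partial i (partial i r) x) = s x"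
     "trig_poly r'" "\<And>x. c * r' x - (\<Sum>i\<in>UNIV. partial i (partial i r') x) = s' x" by blast
  have "partial i (partial i (\<lambda>x. r x + r' x)) x = partial i (partial i r) x + partial i (partial i r') x" for i x
    by (simp add: partial_add[OF r(1) r(3), abs_def] partial_add[OF trig_poly_partial[OF r(1)] trig_poly_partial[OF r(3)]])
  then show ?case
    by (intro exI[of _ "\<lambda>x. r x + r' x"]) (auto simp: trig_add r(1,3) r(2,4)[symmetric] sum.distrib distrib_left)
qed

section \<open>Uniformly almost-periodic functions\<close>

lemma unif_ap_trig: "trig_poly p \<Longrightarrow> unif_ap p"
  unfolding unif_ap_def by (auto intro!: exI[of _ p])

lemma unif_ap_bounded:
  assumes "unif_ap f" obtains M where "M > 0" "\<And>x. \<bar>f x\<bar> \<le> M"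
proof -
  obtain p where p: "trig_poly p" "\<And>y. \<bar>f y - p y\<bar> \<le> 1"
    using assms unfolding unif_ap_def by (meson zero_less_one)
  obtain M where M: "M > 0" "\<And>x. \<bar>p x\<bar> \<le> M" using trig_bounded[OF p(1)] by blast
  have "\<bar>f x\<bar> \<le> M + 1" for x using p(2)[of x] M(2)[of x] by linarith
  with M(1) show thesis by (intro that[of "M + 1"]) auto
qed

lemma unif_ap_continuous: assumes "unif_ap f" shows "continuous_on UNIV f"
proof -
  have "\<exists>p. trig_poly p \<and> (\<forall>y. \<bar>f y - p y\<bar> \<le> 1 / real (Suc n))" for n
    using assms unfolding unif_ap_def by (simp del: of_nat_Suc)
  then obtain p where p: "\<And>n. trig_poly (p n)" "\<And>n y. \<bar>f y - p n y\<bar> \<le> 1 / real (Suc n)"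
    by metis
  have "uniform_limit UNIV p f sequentially"
  proof (rule uniform_limitI)
    fix e :: real assume "e > 0"
    have "(\<lambda>n. 1 / real (Suc n)) \<longlonglongrightarrow> 0" by (rule LIMSEQ_Suc[OF lim_1_over_n])
    then have "\<forall>\<^sub>F n in sequentially. 1 / real (Suc n) < e" using \<open>e > 0\<close> by (rule order_tendstoD)
    then show "\<forall>\<^sub>F n in sequentially. \<forall>x\<in>UNIV. dist (p n x) (f x) < e"
      by eventually_elim (use p(2) in \<open>simp add: dist_real_def abs_minus_commute, meson le_less_trans\<close>)
  qed
  then show ?thesis
    by (rule uniform_limit_theorem[rotated]) (auto intro!: always_eventually trig_continuous p)
qed

lemma unif_ap_borel: "unif_ap f \<Longrightarrow> f \<in> borel_measurable borel"
  by (intro borel_measurable_continuous_onI unif_ap_continuous)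

lemma unif_ap_loc_int: "unif_ap f \<Longrightarrow> loc_int f"
  by (rule unif_ap_bounded, assumption) (auto intro: loc_int_bounded unif_ap_borel)

lemma unif_ap_add: assumes "unif_ap f" "unif_ap g" shows "unif_ap (\<lambda>x. f x + g x)"
  unfolding unif_ap_def
proof (intro allI impI)
  fix e :: real assume "e > 0"
  then have "e/2 > 0" by simp
  from assms(1) this obtain p where p: "trig_poly p" "\<forall>y. \<bar>f y - p y\<bar> \<le> e/2" unfolding unif_ap_def by blast
  from assms(2) \<open>e/2 > 0\<close> obtain q where q: "trig_poly q" "\<forall>y. \<bar>g y - q y\<bar> \<le> e/2" unfolding unif_ap_def by blast
  have "\<bar>f y + g y - (p y + q y)\<bar> \<le> e" for y using p(2)[rule_format, of y] q(2)[rule_format, of y] by linarith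
  then show "\<exists>p. trig_poly p \<and> (\<forall>y. \<bar>f y + g y - p y\<bar> \<le> e)"
    by (intro exI[of _ "\<lambda>y. p y + q y"] conjI trig_add p q) auto
qed

lemma unif_ap_mult: assumes f: "unif_ap f" and g: "unif_ap g" shows "unif_ap (\<lambda>x. f x * g x)"
  unfolding unif_ap_def
proof (intro allI impI)
  fix e :: real assume "e > 0"
  obtain M where M: "M > 0" "\<And>x. \<bar>f x\<bar> \<le> M" using unif_ap_bounded[OF f] by blast
  have "e / (2 * M) > 0" using M \<open>e > 0\<close> by simp
  with g obtain q where q: "trig_poly q" "\<And>y. \<bar>g y - q y\<bar> \<le> e / (2 * M)" unfolding unif_ap_def by blast
  \<comment> \<open>The approximant of \<open>g\<close> is fixed before that of \<open>f\<close>,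
    because the accuracy demanded for \<open>f\<close> depends on its bound
    \<open>L\<close>.\<close>
  obtain L where L: "L > 0" "\<And>x. \<bar>q x\<bar> \<le> L" using trig_bounded[OF q(1)] by blast
  have "e / (2 * L) > 0" using L \<open>e > 0\<close> by simp
  with f obtain p where p: "trig_poly p" "\<And>y. \<bar>f y - p y\<bar> \<le> e / (2 * L)" unfolding unif_ap_def by blast
  have "\<bar>f y * g y - p y * q y\<bar> \<le> e" for y
  proof -
    have "\<bar>f y * g y - p y * q y\<bar> = \<bar>f y * (g y - q y) + (f y - p y) * q y\<bar>" by (simp add: algebra_simps)
    also have "\<dots> \<le> \<bar>f y\<bar> * \<bar>g y - q y\<bar> + \<bar>f y - p y\<bar> * \<bar>q y\<bar>" by (simp flip: abs_mult)
    also have "\<dots> \<le> M * (e / (2 * M)) + (e / (2 * L)) * L"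
      using M L p(2) q(2) \<open>e / (2 * L) > 0\<close> by (intro add_mono mult_mono) auto
    also have "\<dots> = e" using M L by (simp add: field_simps)
    finally show ?thesis .
  qed
  then show "\<exists>p. trig_poly p \<and> (\<forall>y. \<bar>f y * g y - p y\<bar> \<le> e)"
    by (intro exI[of _ "\<lambda>y. p y * q y"] conjI trig_mult p q) auto
qed

lemma unif_ap_const: "unif_ap (\<lambda>_. c)"
  by (intro unif_ap_trig trig_const)

lemma unif_ap_cmult: "unif_ap f \<Longrightarrow> unif_ap (\<lambda>x. c * f x)"
  by (intro unif_ap_mult unif_ap_const)

lemma unif_ap_sum: "(\<And>k. k \<in> S \<Longrightarrow> unif_ap (f k)) \<Longrightarrow> unif_ap (\<lambda>y. \<Sum>k\<in>S. f k y)"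
  by (induction S rule: infinite_finite_induct) (auto intro: unif_ap_add unif_ap_const)

lemma unif_ap_translate: assumes "unif_ap f" shows "unif_ap (\<lambda>x. f (x + v))"
  unfolding unif_ap_def
proof (intro allI impI)
  fix e :: real assume "e > 0"
  with assms obtain p where p: "trig_poly p" "\<forall>y. \<bar>f y - p y\<bar> \<le> e" unfolding unif_ap_def by blast
  then show "\<exists>p. trig_poly p \<and> (\<forall>y. \<bar>f (y + v) - p y\<bar> \<le> e)"
    by (intro exI[of _ "\<lambda>y. p (y + v)"] conjI trig_translate p) auto
qed

lemma unif_ap_has_mean:
  fixes f :: "real^'d::finite \<Rightarrow> real"
  assumes f: "unif_ap f" shows "has_mean f (mean f)"
proof -
  have "\<exists>m. has_mean f m"
  proof (rule has_mean_approx[OF unif_ap_loc_int[OF f]])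
    fix e :: real assume "e > 0"
    with f obtain p where p: "trig_poly p" "\<And>y. \<bar>f y - p y\<bar> \<le> e" unfolding unif_ap_def by blast
    have close: "\<bar>ball_avg f R - ball_avg p R\<bar> \<le> e" if "R > 0" for R
      using ball_avg_abs_le[OF loc_int_diff[OF unif_ap_loc_int[OF f] trig_loc_int[OF p(1)]] loc_int_const p(2), of R]
      by (simp add: ball_avg_diff unif_ap_loc_int f trig_loc_int p(1) ball_avg_const that)
    have "\<forall>\<^sub>F R in at_top. \<bar>ball_avg f R - ball_avg p R\<bar> \<le> e"
      using eventually_gt_at_top[of 0] by eventually_elim (rule close)
    then show "\<exists>(g :: real^'d \<Rightarrow> real) m. has_mean g m \<and> (\<forall>\<^sub>F R in at_top. \<bar>ball_avg f R - ball_avg g R\<bar> \<le> e)"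
      using trig_has_mean[OF p(1)] by blast
  qed
  then obtain m where "has_mean f m" ..
  then show ?thesis using has_mean_eq by fastforce
qed

lemma mean_add: "unif_ap f \<Longrightarrow> unif_ap g \<Longrightarrow> mean (\<lambda>x. f x + g x) = mean f + mean g"
  by (intro has_mean_eq has_mean_add unif_ap_has_mean)

lemma mean_cmult: "unif_ap f \<Longrightarrow> mean (\<lambda>x. c * f x) = c * mean f"
  by (intro has_mean_eq has_mean_cmult unif_ap_has_mean)

lemma mean_const: "mean (\<lambda>_. c) = c"
  by (intro has_mean_eq has_mean_const)

lemma mean_sum: "(\<And>k. k \<in> S \<Longrightarrow> unif_ap (f k)) \<Longrightarrow> mean (\<lambda>y. \<Sum>k\<in>S. f k y) = (\<Sum>k\<in>S. mean (f k))"
proof (induction S rule: infinite_finite_induct)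
  case (insert x F)
  have "mean (\<lambda>y. f x y + (\<Sum>k\<in>F. f k y)) = mean (f x) + mean (\<lambda>y. \<Sum>k\<in>F. f k y)"
    using insert by (intro mean_add unif_ap_sum) auto
  with insert show ?case by simp
qed (simp_all add: mean_const)

lemma mean_mono: "unif_ap f \<Longrightarrow> unif_ap g \<Longrightarrow> (\<And>x. f x \<le> g x) \<Longrightarrow> mean f \<le> mean g"
  by (rule has_mean_mono[OF unif_ap_has_mean unif_ap_has_mean])

lemma mean_translate: assumes "unif_ap f" shows "mean (\<lambda>x. f (x + v)) = mean f"
  by (rule unif_ap_bounded[OF assms])
     (rule has_mean_eq[OF has_mean_translate[OF unif_ap_has_mean[OF assms] _ unif_ap_borel[OF assms]]])

section \<open>Semi-inner products\<close>

text \<open>The discriminant of a nonnegative quadratic is nonpositive. The case c = 0 is separate,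
  since the quadratic degenerates to an affine function there.\<close>

lemma quadratic_nonneg_imp:
  fixes a b c :: real
  assumes "\<And>t. 0 \<le> a + 2 * t * b + t\<^sup>2 * c" and c: "c \<ge> 0"
  shows "\<bar>b\<bar> \<le> sqrt a * sqrt c"
proof -
  have a: "a \<ge> 0" using assms(1)[of 0] by simp
  have "b\<^sup>2 \<le> a * c"
  proof (cases "c = 0")
    case True
    have "b = 0"
    proof (rule ccontr)
      assume "b \<noteq> 0"
      \<comment> \<open>At this t the affine function a + 2 t b takes the value -1.\<close>
      then show False using assms(1)[of "- (a + 1) / (2 * b)"] True a by (simp add: field_simps)
    qed
    with True show ?thesis by simp
  next
    case False
    with c have "c > 0" by simp
    have "0 \<le> a + 2 * (- b / c) * b + (- b / c)\<^sup>2 * c" by (rule assms(1))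
    also have "\<dots> = a - b\<^sup>2 / c" using \<open>c > 0\<close> by (simp add: power2_eq_square field_simps)
    finally show ?thesis using \<open>c > 0\<close> by (simp add: field_simps)
  qed
  then have "sqrt (b\<^sup>2) \<le> sqrt (a * c)" by (rule real_sqrt_le_mono)
  then show ?thesis by (simp add: real_sqrt_mult)
qed

text \<open>One Hilbert space calculus for two forms: the mean value form on almost-periodic fields
  and the average over a fixed ball on locally square-integrable fields. The predicate
  \<open>ok\<close> is present because bilinearity holds only where the averages exist.\<close>

locale semi_inner =
  fixes ok :: "('x \<Rightarrow> 'k \<Rightarrow> real) \<Rightarrow> bool" and B :: "('x \<Rightarrow> 'k \<Rightarrow> real) \<Rightarrow> ('x \<Rightarrow> 'k \<Rightarrow> real) \<Rightarrow> real"
  assumes ok_axpy: "\<And>F G c. ok F \<Longrightarrow> ok G \<Longrightarrow> ok (\<lambda>x k. F x k + c * G x k)"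
    and sym: "\<And>F G. B F G = B G F"
    and lin: "\<And>F G H c. ok F \<Longrightarrow> ok G \<Longrightarrow> ok H \<Longrightarrow> B (\<lambda>x k. F x k + c * G x k) H = B F H + c * B G H"
    and pos: "\<And>F. ok F \<Longrightarrow> B F F \<ge> 0"
begin

definition nrm where "nrm F = sqrt (B F F)"

lemma nrm_nonneg: "ok F \<Longrightarrow> nrm F \<ge> 0"
  by (simp add: nrm_def pos)

lemma nrm_sq: "ok F \<Longrightarrow> (nrm F)\<^sup>2 = B F F"
  by (simp add: nrm_def pos)

lemma axpy_sq:
  assumes "ok F" "ok G"
  shows "B (\<lambda>x k. F x k + c * G x k) (\<lambda>x k. F x k + c * G x k) = B F F + 2 * c * B F G + c\<^sup>2 * B G G"
proof -
  let ?H = "\<lambda>x k. F x k + c * G x k"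
  have "B ?H ?H = B F ?H + c * B G ?H" by (intro lin ok_axpy assms)
  also have "B F ?H = B F F + c * B G F" by (subst sym) (intro lin assms)
  also have "B G ?H = B F G + c * B G G" by (subst sym) (intro lin assms)
  finally show ?thesis by (simp add: sym[of G F] algebra_simps power2_eq_square)
qed

lemma cauchy_schwarz:
  assumes "ok F" "ok G"
  shows "\<bar>B F G\<bar> \<le> nrm F * nrm G"
  unfolding nrm_def
proof (rule quadratic_nonneg_imp)
  fix t show "0 \<le> B F F + 2 * t * B F G + t\<^sup>2 * B G G"
    using axpy_sq[OF assms, of t] pos[OF ok_axpy[OF assms, of t]] by simp
qed (rule pos assms)+

lemma nrm_axpy:
  assumes "ok F" "ok G"
  shows "nrm (\<lambda>x k. F x k + c * G x k) \<le> nrm F + \<bar>c\<bar> * nrm G"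
proof (rule power2_le_imp_le)
  have "c * B F G \<le> \<bar>c\<bar> * \<bar>B F G\<bar>" by (simp flip: abs_mult)
  also have "\<dots> \<le> \<bar>c\<bar> * (nrm F * nrm G)" by (intro mult_left_mono cauchy_schwarz assms) auto
  finally show "(nrm (\<lambda>x k. F x k + c * G x k))\<^sup>2 \<le> (nrm F + \<bar>c\<bar> * nrm G)\<^sup>2"
    using assms by (simp add: nrm_sq ok_axpy axpy_sq power2_sum power_mult_distrib algebra_simps)
  show "0 \<le> nrm F + \<bar>c\<bar> * nrm G" using assms by (simp add: nrm_nonneg)
qed

lemma nrm_diff: "ok F \<Longrightarrow> ok G \<Longrightarrow> nrm (\<lambda>x k. F x k - G x k) \<le> nrm F + nrm G"
  using nrm_axpy[of F G "-1"] by simp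

lemma nrm_triangle: "ok F \<Longrightarrow> ok G \<Longrightarrow> nrm (\<lambda>x k. F x k + G x k) \<le> nrm F + nrm G"
  using nrm_axpy[of F G 1] by simp

lemma ok_diff: "ok F \<Longrightarrow> ok G \<Longrightarrow> ok (\<lambda>x k. F x k - G x k)"
  using ok_axpy[of F G "-1"] by simp

lemma ok_add: "ok F \<Longrightarrow> ok G \<Longrightarrow> ok (\<lambda>x k. F x k + G x k)"
  using ok_axpy[of F G 1] by simp

lemma B_diff: "ok F \<Longrightarrow> ok G \<Longrightarrow> ok H \<Longrightarrow> B (\<lambda>x k. F x k - G x k) H = B F H - B G H"
  using lin[of F G H "-1"] by simp

lemma B_add: "ok F \<Longrightarrow> ok G \<Longrightarrow> ok H \<Longrightarrow> B (\<lambda>x k. F x k + G x k) H = B F H + B G H"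
  using lin[of F G H 1] by simp

lemma nrm_le_diff: 
  assumes "ok F" "ok G" 
  shows "\<bar>nrm F - nrm G\<bar> \<le> nrm (\<lambda>x k. F x k - G x k)"
proof -
  have "nrm (\<lambda>x k. G x k + (F x k - G x k)) \<le> nrm G + nrm (\<lambda>x k. F x k - G x k)"
    using assms by (intro nrm_triangle ok_diff)
  moreover have "nrm (\<lambda>x k. F x k - (F x k - G x k)) \<le> nrm F + nrm (\<lambda>x k. F x k - G x k)"
    using assms by (intro nrm_diff ok_diff)
  ultimately show ?thesis by simp
qed

end

definition ap :: "(real^'d::finite \<Rightarrow> 'k::finite \<Rightarrow> real) \<Rightarrow> bool" where
  "ap F \<longleftrightarrow> (\<forall>k. unif_ap (\<lambda>x. F x k))"

definition ip :: "(real^'d::finite \<Rightarrow> 'k::finite \<Rightarrow> real) \<Rightarrow> (real^'d \<Rightarrow> 'k \<Rightarrow> real) \<Rightarrow> real" where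
  "ip F G = mean (\<lambda>x. \<Sum>k\<in>UNIV. F x k * G x k)"

lemma ap_prod: "ap F \<Longrightarrow> ap G \<Longrightarrow> unif_ap (\<lambda>x. \<Sum>k\<in>UNIV. F x k * G x k)"
  unfolding ap_def by (intro unif_ap_sum unif_ap_mult) auto

interpretation ap: semi_inner ap ip
proof
  fix F G H :: "real^'d::finite \<Rightarrow> 'k::finite \<Rightarrow> real" and c :: real
  show "ap F \<Longrightarrow> ap G \<Longrightarrow> ap (\<lambda>x k. F x k + c * G x k)"
    unfolding ap_def by (auto intro!: unif_ap_add unif_ap_cmult)
  show "ip F G = ip G F" unfolding ip_def by (simp only: mult.commute)
  assume F: "ap F"
  have "mean (\<lambda>_::real^'d. 0) \<le> mean (\<lambda>x. \<Sum>k\<in>UNIV. F x k * F x k)"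
    by (intro mean_mono unif_ap_const ap_prod F) (auto intro!: sum_nonneg)
  then show "ip F F \<ge> 0" by (simp add: ip_def mean_const)
  assume G: "ap G" and H: "ap H"
  have "ip (\<lambda>x k. F x k + c * G x k) H = mean (\<lambda>x. (\<Sum>k\<in>UNIV. F x k * H x k) + c * (\<Sum>k\<in>UNIV. G x k * H x k))"
    unfolding ip_def by (simp add: distrib_right sum.distrib sum_distrib_left mult.assoc)
  also have "\<dots> = ip F H + c * ip G H"
    unfolding ip_def by (subst mean_add) (simp_all add: mean_cmult unif_ap_cmult ap_prod F G H)
  finally show "ip (\<lambda>x k. F x k + c * G x k) H = ip F H + c * ip G H" .
qed

abbreviation nm where "nm \<equiv> ap.nrm"

lemma nm_mono:
  assumes "ap F" "ap G" "c \<ge> 0" "\<And>x. (\<Sum>k\<in>UNIV. (F x k)\<^sup>2) \<le> c\<^sup>2 * (\<Sum>k\<in>UNIV. (G x k)\<^sup>2)"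
  shows "nm F \<le> c * nm G"
proof -
  have "ip F F \<le> mean (\<lambda>x. c\<^sup>2 * (\<Sum>k\<in>UNIV. G x k * G x k))"
    unfolding ip_def using assms by (intro mean_mono ap_prod unif_ap_cmult) (auto simp: power2_eq_square)
  also have "\<dots> = c\<^sup>2 * ip G G" unfolding ip_def by (intro mean_cmult ap_prod assms)
  finally have "sqrt (ip F F) \<le> sqrt (c\<^sup>2 * ip G G)" by (rule real_sqrt_le_mono)
  then show ?thesis using \<open>c \<ge> 0\<close> by (simp add: ap.nrm_def real_sqrt_mult)
qed

lemma nm_const: "nm (\<lambda>_ k. e k) = sqrt (\<Sum>k\<in>UNIV. (e k)\<^sup>2)"
  by (simp add: ap.nrm_def ip_def mean_const power2_eq_square)

lemma ap_const: "ap (\<lambda>_ k. e k)"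
  unfolding ap_def by (simp add: unif_ap_const)

lemma nm_le_const:
  fixes F :: "real^'d::finite \<Rightarrow> 'k::finite \<Rightarrow> real"
  assumes "ap F" "c \<ge> 0" "\<And>x. (\<Sum>k\<in>UNIV. (F x k)\<^sup>2) \<le> c\<^sup>2"
  shows "nm F \<le> c"
proof -
  have "ip F F \<le> mean (\<lambda>_::real^'d. c\<^sup>2)"
    unfolding ip_def using assms by (intro mean_mono ap_prod unif_ap_const) (auto simp: power2_eq_square)
  then have "sqrt (ip F F) \<le> sqrt (c\<^sup>2)" by (intro real_sqrt_le_mono) (simp add: mean_const)
  then show ?thesis using \<open>c \<ge> 0\<close> by (simp add: ap.nrm_def)
qed

lemma ap_translate: "ap F \<Longrightarrow> ap (\<lambda>x. F (x + v))"
  unfolding ap_def using unif_ap_translate by blast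

lemma ip_translate: "ap F \<Longrightarrow> ap G \<Longrightarrow> ip (\<lambda>x. F (x + v)) (\<lambda>x. G (x + v)) = ip F G"
  unfolding ip_def by (rule mean_translate[OF ap_prod])

lemma nm_translate: "ap F \<Longrightarrow> nm (\<lambda>x. F (x + v)) = nm F"
  unfolding ap.nrm_def by (simp add: ip_translate)

lemma nm_cmult: "ap F \<Longrightarrow> nm (\<lambda>x k. c * F x k) = \<bar>c\<bar> * nm F"
proof -
  assume F: "ap F"
  have "ip (\<lambda>x k. c * F x k) (\<lambda>x k. c * F x k) = mean (\<lambda>x. c\<^sup>2 * (\<Sum>k\<in>UNIV. F x k * F x k))"
    unfolding ip_def by (simp add: sum_distrib_left power2_eq_square mult_ac)
  also have "\<dots> = c\<^sup>2 * ip F F" unfolding ip_def by (intro mean_cmult ap_prod F)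
  finally show ?thesis by (simp add: ap.nrm_def real_sqrt_mult)
qed

section \<open>Approximate solutions by Richardson iteration\<close>

lemma sum_UNIV_sum:
  fixes f :: "'a::finite + 'b::finite \<Rightarrow> 'c::comm_monoid_add"
  shows "(\<Sum>s\<in>UNIV. f s) = (\<Sum>k\<in>UNIV. f (Inl k)) + (\<Sum>k\<in>UNIV. f (Inr k))"
  by (simp add: UNIV_Plus_UNIV[symmetric] sum.Plus del: UNIV_Plus_UNIV)

lemma sum_UNIV_prod: "(\<Sum>p\<in>UNIV. f p) = (\<Sum>i\<in>UNIV. \<Sum>\<alpha>\<in>UNIV. f (i, \<alpha>))"
  by (simp add: UNIV_Times_UNIV[symmetric] sum.cartesian_product del: UNIV_Times_UNIV)

definition tv :: "(real^'d::finite \<Rightarrow> 'm \<Rightarrow> real) \<Rightarrow> bool" where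
  "tv g \<longleftrightarrow> (\<forall>\<alpha>. trig_poly (\<lambda>x. g x \<alpha>))"

text \<open>The scaled jet \<open>(\<nabla>g, \<kappa> g)\<close> with \<open>\<kappa> = 1/T\<close>: the approximate corrector equation becomes
  an elliptic equation for the jet without zeroth-order term.\<close>

definition jet :: "real \<Rightarrow> (real^'d::finite \<Rightarrow> 'm \<Rightarrow> real) \<Rightarrow> real^'d \<Rightarrow> ('d \<times> 'm) + 'm \<Rightarrow> real" where
  "jet \<kappa> g x s = (case s of Inl k \<Rightarrow> grad g x k | Inr \<alpha> \<Rightarrow> \<kappa> * g x \<alpha>)"

text \<open>The coefficient matrix on the gradient slots and the identity on the zeroth-order slots;
  with the factor \<kappa> in both jets of a pairing, the identity part yields the term T^{-2}
  u.\<close>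

definition block :: "(real^'d \<Rightarrow> 'k::finite \<Rightarrow> 'k \<Rightarrow> real) \<Rightarrow> (real^'d::finite \<Rightarrow> 'k + 'm \<Rightarrow> real) \<Rightarrow> real^'d \<Rightarrow> 'k + 'm \<Rightarrow> real" where
  "block a F x s = (case s of Inl k \<Rightarrow> (\<Sum>l\<in>UNIV. a x k l * F x (Inl l)) | Inr \<alpha> \<Rightarrow> F x (Inr \<alpha>))"

text \<open>The formal adjoint of \<open>jet \<kappa>\<close>. The approximate corrector equation
  says that it annihilates the flux.\<close>

definition dual_div :: "real \<Rightarrow> (real^'d::finite \<Rightarrow> ('d \<times> 'm) + 'm \<Rightarrow> real) \<Rightarrow> real^'d \<Rightarrow> 'm \<Rightarrow> real" where
  "dual_div \<kappa> P x \<alpha> = \<kappa> * P x (Inr \<alpha>) - (\<Sum>i\<in>UNIV. partial i (\<lambda>x. P x (Inl (i, \<alpha>))) x)"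

lemma jet_simps [simp]:
  "grad g x (i, \<alpha>) = partial i (\<lambda>x. g x \<alpha>) x" "jet \<kappa> g x (Inl k) = grad g x k" "jet \<kappa> g x (Inr \<alpha>) = \<kappa> * g x \<alpha>"
  by (simp_all add: jet_def grad_def)

lemma block_simps [simp]:
  "block a F x (Inl k) = (\<Sum>l\<in>UNIV. a x k l * F x (Inl l))" "block a F x (Inr \<alpha>) = F x (Inr \<alpha>)"
  by (simp_all add: block_def)

lemma trig_jet: "tv g \<Longrightarrow> trig_poly (\<lambda>x. jet \<kappa> g x s)"
  by (cases s) (auto simp: tv_def jet_def grad_def split: prod.splits intro: trig_cmult trig_poly_partial)

lemma ap_trig: "(\<And>s. trig_poly (\<lambda>x. P x s)) \<Longrightarrow> ap P"
  by (simp add: ap_def unif_ap_trig)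

lemma ap_jet: "tv g \<Longrightarrow> ap (jet \<kappa> g)"
  by (intro ap_trig trig_jet)

lemma ap_tv: "tv g \<Longrightarrow> ap g"
  by (simp add: tv_def ap_trig)

lemma tv_axpy: "tv g \<Longrightarrow> tv h \<Longrightarrow> tv (\<lambda>x \<alpha>. g x \<alpha> + c * h x \<alpha>)"
  unfolding tv_def by (intro allI trig_add trig_cmult) auto

lemma tv_diff: "tv g \<Longrightarrow> tv h \<Longrightarrow> tv (\<lambda>x \<alpha>. g x \<alpha> - h x \<alpha>)"
  unfolding tv_def by (intro allI trig_diff) auto

lemma tv_translate: "tv g \<Longrightarrow> tv (\<lambda>x. g (x + v))"
  unfolding tv_def using trig_translate by blast

lemma tv_const: "tv (\<lambda>_. c)"
  by (simp add: tv_def trig_const)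

lemma jet_axpy:
  assumes "tv g" "tv h"
  shows "jet \<kappa> (\<lambda>x \<alpha>. g x \<alpha> + c * h x \<alpha>) = (\<lambda>x s. jet \<kappa> g x s + c * jet \<kappa> h x s)"
proof (intro ext)
  fix x s
  show "jet \<kappa> (\<lambda>x \<alpha>. g x \<alpha> + c * h x \<alpha>) x s = jet \<kappa> g x s + c * jet \<kappa> h x s"
    using assms unfolding tv_def
    by (cases s) (auto simp: grad_def partial_add partial_cmult trig_cmult algebra_simps split: prod.splits)
qed

lemma jet_diff: "tv g \<Longrightarrow> tv h \<Longrightarrow> jet \<kappa> (\<lambda>x \<alpha>. g x \<alpha> - h x \<alpha>) = (\<lambda>x s. jet \<kappa> g x s - jet \<kappa> h x s)"
  using jet_axpy[of g h \<kappa> "-1"] by simp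

lemma jet_translate: "jet \<kappa> (\<lambda>x. g (x + v)) = (\<lambda>x. jet \<kappa> g (x + v))"
proof (intro ext)
  fix x s
  show "jet \<kappa> (\<lambda>x. g (x + v)) x s = jet \<kappa> g (x + v) s"
    by (cases s) (auto simp: grad_def partial_translate[of _ "\<lambda>x. g x _"] split: prod.splits)
qed

text \<open>The two integrands differ by \<open>?Q\<close>, a sum of derivatives of products of
  components of \<open>P\<close> and \<open>h\<close>, and such derivatives have mean zero.\<close>

lemma ip_jet_by_parts:
  fixes P :: "real^'d::finite \<Rightarrow> ('d \<times> 'm::finite) + 'm \<Rightarrow> real"
  assumes P: "\<And>s. trig_poly (\<lambda>x. P x s)" and h: "tv h"
  shows "ip P (jet \<kappa> h) = ip (dual_div \<kappa> P) h"
proof -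
  have h': "trig_poly (\<lambda>x. h x \<alpha>)" for \<alpha> using h by (simp add: tv_def)
  let ?Q = "\<lambda>x. \<Sum>i\<in>UNIV. \<Sum>\<alpha>\<in>UNIV. partial i (\<lambda>y. P y (Inl (i, \<alpha>)) * h y \<alpha>) x"
  have Q: "trig_poly ?Q"
    by (intro trig_sum trig_poly_partial trig_mult P h')
  have mQ: "mean ?Q = 0"
    by (simp add: mean_sum unif_ap_sum unif_ap_trig trig_poly_partial trig_mult P h' mean_partial_trig)
  have D: "ap (dual_div \<kappa> P)"
    unfolding dual_div_def by (intro ap_trig trig_diff trig_cmult trig_sum trig_poly_partial P)
  have "(\<Sum>s\<in>UNIV. P x s * jet \<kappa> h x s) = (\<Sum>\<alpha>\<in>UNIV. dual_div \<kappa> P x \<alpha> * h x \<alpha>) + ?Q x" for x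
  proof -
    have "?Q x = (\<Sum>i\<in>UNIV. \<Sum>\<alpha>\<in>UNIV. partial i (\<lambda>y. P y (Inl (i, \<alpha>))) x * h x \<alpha>)
        + (\<Sum>i\<in>UNIV. \<Sum>\<alpha>\<in>UNIV. P x (Inl (i, \<alpha>)) * partial i (\<lambda>y. h y \<alpha>) x)"
      by (simp add: partial_mult P h' sum.distrib)
    moreover have "(\<Sum>\<alpha>\<in>UNIV. dual_div \<kappa> P x \<alpha> * h x \<alpha>) = (\<Sum>\<alpha>\<in>UNIV. \<kappa> * P x (Inr \<alpha>) * h x \<alpha>)
        - (\<Sum>i\<in>UNIV. \<Sum>\<alpha>\<in>UNIV. partial i (\<lambda>y. P y (Inl (i, \<alpha>))) x * h x \<alpha>)"
      by (simp add: dual_div_def left_diff_distrib sum_subtractf sum_distrib_right) (rule sum.swap)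
    ultimately show ?thesis
      by (simp add: sum_UNIV_sum sum_UNIV_prod mult_ac)
  qed
  then have "ip P (jet \<kappa> h) = mean (\<lambda>x. (\<Sum>\<alpha>\<in>UNIV. dual_div \<kappa> P x \<alpha> * h x \<alpha>) + ?Q x)"
    unfolding ip_def by presburger
  also have "\<dots> = ip (dual_div \<kappa> P) h + mean ?Q"
    unfolding ip_def by (intro mean_add ap_prod D ap_tv h unif_ap_trig Q)
  finally show ?thesis using mQ by simp
qed

text \<open>Riesz representation within jets: the adjoint applied to \<open>jet \<kappa> r\<close>
  is \<kappa>^2 r minus the Laplacian of r, so r is found by solving a Helmholtz equation and stays
  a trigonometric polynomial.\<close>

lemma riesz_jet:
  fixes P :: "real^'d::finite \<Rightarrow> ('d \<times> 'm::finite) + 'm \<Rightarrow> real"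
  assumes P: "\<And>s. trig_poly (\<lambda>x. P x s)" and \<kappa>: "\<kappa> > 0"
  obtains r where "tv r" "dual_div \<kappa> (jet \<kappa> r) = dual_div \<kappa> P"
    "\<And>h. tv h \<Longrightarrow> ip P (jet \<kappa> h) = ip (jet \<kappa> r) (jet \<kappa> h)"
proof -
  have "\<exists>r. trig_poly r \<and> (\<forall>x. \<kappa>\<^sup>2 * r x - (\<Sum>i\<in>UNIV. partial i (partial i r) x) = dual_div \<kappa> P x \<alpha>)" for \<alpha>
    unfolding dual_div_def using \<kappa> by (intro Helmholtz_trig trig_diff trig_cmult trig_sum trig_poly_partial P) simp
  then obtain r where r: "\<And>\<alpha>. trig_poly (r \<alpha>)"
     "\<And>\<alpha> x. \<kappa>\<^sup>2 * r \<alpha> x - (\<Sum>i\<in>UNIV. partial i (partial i (r \<alpha>)) x) = dual_div \<kappa> P x \<alpha>"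
    by metis
  let ?r = "\<lambda>x \<alpha>. r \<alpha> x"
  have tv: "tv ?r" using r(1) by (simp add: tv_def)
  have eq: "dual_div \<kappa> (jet \<kappa> ?r) = dual_div \<kappa> P"
    by (intro ext) (simp add: dual_div_def[of \<kappa> "jet \<kappa> ?r"] r(2)[symmetric] power2_eq_square grad_def)
  have "ip P (jet \<kappa> h) = ip (jet \<kappa> ?r) (jet \<kappa> h)" if "tv h" for h
    using ip_jet_by_parts[OF P that, where \<kappa> = \<kappa>] ip_jet_by_parts[OF trig_jet[OF tv] that, where \<kappa> = \<kappa>] eq by simp
  with tv eq show thesis by (rule that)
qed

lemma nm_block_le:
  assumes "ap F" "ap (block a F)" "L \<ge> 0"
    and "\<And>x \<xi>. (\<Sum>k\<in>UNIV. (\<Sum>l\<in>UNIV. a x k l * \<xi> l)\<^sup>2) \<le> L\<^sup>2 * (\<Sum>k\<in>UNIV. (\<xi> k)\<^sup>2)" "L \<ge> 1"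
  shows "nm (block a F) \<le> L * nm F"
proof (rule nm_mono)
  fix x
  have "(\<Sum>k\<in>UNIV. (F x (Inr k))\<^sup>2) \<le> L\<^sup>2 * (\<Sum>k\<in>UNIV. (F x (Inr k))\<^sup>2)"
    using \<open>L \<ge> 1\<close> mult_right_mono[of 1 "L\<^sup>2" "\<Sum>k\<in>UNIV. (F x (Inr k))\<^sup>2"] by (simp add: sum_nonneg)
  then show "(\<Sum>k\<in>UNIV. (block a F x k)\<^sup>2) \<le> L\<^sup>2 * (\<Sum>k\<in>UNIV. (F x k)\<^sup>2)"
    using assms(4)[of x "\<lambda>l. F x (Inl l)"] by (simp add: sum_UNIV_sum distrib_left)
qed (use assms in auto)

text \<open>The system over index pairs (i, \<alpha>), with a fixed constant forcing
  \<open>e\<close> that stands for the gradient of P_j^\<beta>. The operator bound \<open>K\<close>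
  is a parameter of its own, since an upper bound on the quadratic form does not control the
  antisymmetric part of the matrix.\<close>

locale elliptic_system =
  fixes a :: "real^'d::finite \<Rightarrow> ('d \<times> 'm::finite) \<Rightarrow> ('d \<times> 'm) \<Rightarrow> real" and \<mu> K :: real
    and e :: "'d \<times> 'm \<Rightarrow> real"
  assumes a_ap: "\<And>k l. unif_ap (\<lambda>x. a x k l)"
    and \<mu>: "0 < \<mu>" "\<mu> \<le> 1" and K: "1 \<le> K"
    and coercive: "\<And>x \<xi>. \<mu> * (\<Sum>k\<in>UNIV. (\<xi> k)\<^sup>2) \<le> (\<Sum>k\<in>UNIV. \<xi> k * (\<Sum>l\<in>UNIV. a x k l * \<xi> l))"
    and bounded: "\<And>x \<xi>. (\<Sum>k\<in>UNIV. (\<Sum>l\<in>UNIV. a x k l * \<xi> l)\<^sup>2) \<le> K\<^sup>2 * (\<Sum>k\<in>UNIV. (\<xi> k)\<^sup>2)"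
begin

definition et :: "('d \<times> 'm) + 'm \<Rightarrow> real" where
  "et s = (case s of Inl k \<Rightarrow> e k | Inr _ \<Rightarrow> 0)"

text \<open>The field a(\<nabla>g + e) together with \<kappa> g; the approximate corrector equation
  is its orthogonality to all jets.\<close>

definition flux :: "real \<Rightarrow> (real^'d \<Rightarrow> 'm \<Rightarrow> real) \<Rightarrow> real^'d \<Rightarrow> ('d \<times> 'm) + 'm \<Rightarrow> real" where
  "flux \<kappa> g = block a (\<lambda>x s. jet \<kappa> g x s + et s)"

definition E0 where "E0 = nm (\<lambda>_::real^'d. et)"

lemma ap_et: "ap (\<lambda>_. et)" by (rule ap_const)

lemma E0_nonneg: "E0 \<ge> 0" unfolding E0_def by (intro ap.nrm_nonneg ap_et)

lemma ap_block: "ap F \<Longrightarrow> ap (block a F)"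
  unfolding ap_def
proof
  fix s assume F: "\<forall>k. unif_ap (\<lambda>x. F x k)"
  show "unif_ap (\<lambda>x. block a F x s)"
    using F by (cases s) (auto intro!: unif_ap_sum unif_ap_mult a_ap)
qed

lemma ap_flux: "tv g \<Longrightarrow> ap (flux \<kappa> g)"
  unfolding flux_def by (intro ap_block ap.ok_add ap_jet ap_et)

lemma nm_block: "ap F \<Longrightarrow> nm (block a F) \<le> K * nm F"
  using K by (intro nm_block_le ap_block bounded) auto

lemma block_axpy: "block b (\<lambda>x s. F x s + c * G x s) = (\<lambda>x s. block b F x s + c * block b G x s)"
proof (intro ext)
  fix x s show "block b (\<lambda>x s. F x s + c * G x s) x s = block b F x s + c * block b G x s"
    by (cases s) (simp_all add: distrib_left sum.distrib sum_distrib_left mult.left_commute)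
qed

lemma block_add: "block b (\<lambda>x s. F x s + G x s) = (\<lambda>x s. block b F x s + block b G x s)"
  using block_axpy[of b F 1 G] by simp

lemma block_diff: "block b (\<lambda>x s. F x s - G x s) = (\<lambda>x s. block b F x s - block b G x s)"
  using block_axpy[of b F "-1" G] by simp

lemma flux_axpy:
  assumes "tv g" "tv h"
  shows "flux \<kappa> (\<lambda>x \<alpha>. g x \<alpha> + c * h x \<alpha>) = (\<lambda>x s. flux \<kappa> g x s + c * block a (jet \<kappa> h) x s)"
proof -
  have "(\<lambda>x s. jet \<kappa> g x s + c * jet \<kappa> h x s + et s) = (\<lambda>x s. (jet \<kappa> g x s + et s) + c * jet \<kappa> h x s)"
    by (simp add: fun_eq_iff)
  then show ?thesis unfolding flux_def jet_axpy[OF assms] block_axpy[symmetric] by (rule arg_cong)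
qed

text \<open>The identity slots have constant 1, which is at least \<mu>, so the coercivity of
  \<open>a\<close> extends to the whole jet.\<close>

lemma block_coercive_pointwise:
  fixes F :: "real^'d \<Rightarrow> ('d \<times> 'm) + 'm \<Rightarrow> real"
  shows
  "\<mu> * (\<Sum>s\<in>UNIV. (F x s)\<^sup>2) \<le> (\<Sum>s\<in>UNIV. block a F x s * F x s)"
proof -
  have "\<mu> * (\<Sum>k\<in>UNIV. (F x (Inr k))\<^sup>2) \<le> (\<Sum>k\<in>UNIV. (F x (Inr k))\<^sup>2)"
    using mult_right_mono[OF \<mu>(2), of "\<Sum>k\<in>UNIV. (F x (Inr k))\<^sup>2"] by (simp add: sum_nonneg)
  moreover have "(\<Sum>s\<in>UNIV. block a F x s * F x s)
      = (\<Sum>k\<in>UNIV. F x (Inl k) * (\<Sum>l\<in>UNIV. a x k l * F x (Inl l))) + (\<Sum>k\<in>UNIV. (F x (Inr k))\<^sup>2)"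
    by (simp add: sum_UNIV_sum power2_eq_square mult.commute)
  ultimately show ?thesis
    using coercive[of "\<lambda>l. F x (Inl l)" x] by (simp add: sum_UNIV_sum distrib_left)
qed

lemma block_coercive:
  fixes F :: "real^'d \<Rightarrow> ('d \<times> 'm) + 'm \<Rightarrow> real"
  assumes F: "ap F" shows "\<mu> * (nm F)\<^sup>2 \<le> ip (block a F) F"
proof -
  have "\<mu> * ip F F = mean (\<lambda>x. \<mu> * (\<Sum>s\<in>UNIV. F x s * F x s))"
    unfolding ip_def by (rule mean_cmult[symmetric, OF ap_prod[OF F F]])
  also have "\<dots> \<le> ip (block a F) F"
    unfolding ip_def using block_coercive_pointwise
    by (intro mean_mono unif_ap_cmult ap_prod F ap_block) (simp add: power2_eq_square)
  finally show ?thesis by (simp add: ap.nrm_sq F)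
qed

text \<open>With \<open>\<tau> = \<mu>/K\<^sup>2\<close>, the map \<open>I - \<tau> A\<close> is a contraction with factor \<open>rate\<close>, which drives a
  Richardson iteration for the approximate corrector equation.\<close>

definition rate where "rate = sqrt (1 - \<mu>\<^sup>2 / K\<^sup>2)"

lemma rate: "0 \<le> rate" "rate < 1"
proof -
  have "\<mu>\<^sup>2 \<le> K\<^sup>2" using \<mu> K by (intro power_mono) auto
  moreover have "\<mu>\<^sup>2 / K\<^sup>2 > 0" using \<mu> K by simp
  ultimately show "0 \<le> rate" "rate < 1" using K by (simp_all add: rate_def)
qed

lemma rate_sq: "rate\<^sup>2 = 1 - \<mu>\<^sup>2 / K\<^sup>2"
proof -
  have "\<mu>\<^sup>2 \<le> K\<^sup>2" using \<mu> K by (intro power_mono) auto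
  then show ?thesis using K by (simp add: rate_def)
qed

text \<open>Expanding the square and inserting coercivity and boundedness gives the factor 1 - 2
  \<tau> \<mu> + \<tau>^2 K^2. It is smallest at \<tau> = \<mu>/K^2, where it equals 1 -
  \<mu>^2/K^2.\<close>

lemma richardson_pointwise:
  fixes F :: "real^'d \<Rightarrow> ('d \<times> 'm) + 'm \<Rightarrow> real"
  shows
  "(\<Sum>s\<in>UNIV. (F x s - \<mu> / K\<^sup>2 * block a F x s)\<^sup>2) \<le> rate\<^sup>2 * (\<Sum>s\<in>UNIV. (F x s)\<^sup>2)"
proof -
  define \<tau> where "\<tau> = \<mu> / K\<^sup>2"
  have \<tau>: "\<tau> > 0" using \<mu> K by (simp add: \<tau>_def)
  define X where "X = (\<Sum>s\<in>UNIV. (F x s)\<^sup>2)"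
  have b: "(\<Sum>s\<in>UNIV. (block a F x s)\<^sup>2) \<le> K\<^sup>2 * X"
  proof -
    have "(\<Sum>k\<in>UNIV. (F x (Inr k))\<^sup>2) \<le> K\<^sup>2 * (\<Sum>k\<in>UNIV. (F x (Inr k))\<^sup>2)"
      using K mult_right_mono[of 1 "K\<^sup>2" "\<Sum>k\<in>UNIV. (F x (Inr k))\<^sup>2"] by (simp add: sum_nonneg)
    then show ?thesis unfolding X_def
      using bounded[of x "\<lambda>l. F x (Inl l)"] by (simp add: sum_UNIV_sum distrib_left)
  qed
  have "(\<Sum>s\<in>UNIV. (F x s - \<tau> * block a F x s)\<^sup>2)
      = X - 2 * \<tau> * (\<Sum>s\<in>UNIV. block a F x s * F x s) + \<tau>\<^sup>2 * (\<Sum>s\<in>UNIV. (block a F x s)\<^sup>2)"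
    unfolding X_def by (simp add: power2_diff sum.distrib sum_subtractf sum_distrib_left power_mult_distrib mult_ac)
  also have "\<dots> \<le> X - 2 * \<tau> * (\<mu> * X) + \<tau>\<^sup>2 * (K\<^sup>2 * X)"
    using block_coercive_pointwise[of F x] b \<tau> unfolding X_def
    by (intro add_mono diff_mono mult_left_mono) auto
  also have "\<dots> = rate\<^sup>2 * X"
    unfolding rate_sq \<tau>_def using K by (simp add: power2_eq_square field_simps)
  finally show ?thesis unfolding \<tau>_def X_def .
qed

lemma richardson:
  fixes F :: "real^'d \<Rightarrow> ('d \<times> 'm) + 'm \<Rightarrow> real"
  assumes F: "ap F" shows "nm (\<lambda>x s. F x s - \<mu> / K\<^sup>2 * block a F x s) \<le> rate * nm F"
proof (rule nm_mono)
  show "ap (\<lambda>x s. F x s - \<mu> / K\<^sup>2 * block a F x s)"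
    using ap.ok_axpy[OF F ap_block[OF F], of "- (\<mu> / K\<^sup>2)"] by simp
qed (use F rate richardson_pointwise in auto)

text \<open>The flux is only uniformly almost-periodic, so it is replaced by a trigonometric
  \<open>P\<close> within \<delta>, and \<open>r\<close> is the Riesz representative of
  \<open>P\<close>. The last two clauses express one identity in two forms: the equality of
  divergences is tested with compactly supported functions, the equality of pairings with
  trigonometric ones.\<close>

definition residual :: "real \<Rightarrow> real \<Rightarrow> (real^'d \<Rightarrow> 'm \<Rightarrow> real) \<Rightarrow> (real^'d \<Rightarrow> ('d \<times> 'm) + 'm \<Rightarrow> real)
    \<Rightarrow> (real^'d \<Rightarrow> 'm \<Rightarrow> real) \<Rightarrow> bool" where
  "residual \<kappa> \<delta> g P r \<longleftrightarrow> tv g \<and> (\<forall>s. trig_poly (\<lambda>x. P x s)) \<and> tv r \<and> (\<forall>x s. \<bar>flux \<kappa> g x s - P x s\<bar> \<le> \<delta>)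
     \<and> dual_div \<kappa> (jet \<kappa> r) = dual_div \<kappa> P \<and> (\<forall>h. tv h \<longrightarrow> ip P (jet \<kappa> h) = ip (jet \<kappa> r) (jet \<kappa> h))"

lemma residual_exists:
  assumes "tv g" "\<kappa> > 0" "\<delta> > 0" shows "\<exists>P r. residual \<kappa> \<delta> g P r"
proof -
  have "\<exists>p. trig_poly p \<and> (\<forall>x. \<bar>flux \<kappa> g x s - p x\<bar> \<le> \<delta>)" for s
    using ap_flux[OF assms(1), of \<kappa>] \<open>\<delta> > 0\<close> unfolding ap_def unif_ap_def by blast
  then obtain p where p: "\<And>s. trig_poly (p s)" "\<And>s x. \<bar>flux \<kappa> g x s - p s x\<bar> \<le> \<delta>" by metis
  let ?P = "\<lambda>x s. p s x"
  obtain r where "tv r" "dual_div \<kappa> (jet \<kappa> r) = dual_div \<kappa> ?P"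
    "\<And>h. tv h \<Longrightarrow> ip ?P (jet \<kappa> h) = ip (jet \<kappa> r) (jet \<kappa> h)"
    using riesz_jet[of ?P, OF p(1) \<open>\<kappa> > 0\<close>] by blast
  with p assms(1) have "residual \<kappa> \<delta> g ?P r" by (simp add: residual_def)
  then show ?thesis by blast
qed

definition N where "N = sqrt (real (CARD(('d \<times> 'm) + 'm)))"

lemma residual_nm: assumes "residual \<kappa> \<delta> g P r" "\<delta> \<ge> 0" shows "nm (\<lambda>x s. flux \<kappa> g x s - P x s) \<le> N * \<delta>"
proof (rule nm_le_const)
  show "ap (\<lambda>x s. flux \<kappa> g x s - P x s)"
    using assms by (intro ap.ok_diff ap_flux ap_trig) (auto simp: residual_def)
  fix x
  have "(\<Sum>s\<in>UNIV. (flux \<kappa> g x s - P x s)\<^sup>2) \<le> (\<Sum>s\<in>(UNIV :: (('d \<times> 'm) + 'm) set). \<delta>\<^sup>2)"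
    using assms by (intro sum_mono) (auto simp: residual_def abs_le_square_iff[symmetric])
  then show "(\<Sum>s\<in>UNIV. (flux \<kappa> g x s - P x s)\<^sup>2) \<le> (N * \<delta>)\<^sup>2"
    by (simp add: N_def power_mult_distrib del: card_sum)
qed (use assms in \<open>simp add: N_def\<close>)

lemma residual_flux:
  assumes R: "residual \<kappa> \<delta> g P r" "\<delta> \<ge> 0" and h: "tv h"
  shows "\<bar>ip (flux \<kappa> g) (jet \<kappa> h) - ip (jet \<kappa> r) (jet \<kappa> h)\<bar> \<le> N * \<delta> * nm (jet \<kappa> h)"
proof -
  have aps: "ap (flux \<kappa> g)" "ap P" using R by (auto simp: residual_def intro: ap_flux ap_trig)
  have eq: "ip (flux \<kappa> g) (jet \<kappa> h) - ip (jet \<kappa> r) (jet \<kappa> h) = ip (\<lambda>x s. flux \<kappa> g x s - P x s) (jet \<kappa> h)"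
    using R h aps by (simp add: residual_def ap.B_diff ap_jet)
  have "\<bar>ip (\<lambda>x s. flux \<kappa> g x s - P x s) (jet \<kappa> h)\<bar> \<le> nm (\<lambda>x s. flux \<kappa> g x s - P x s) * nm (jet \<kappa> h)"
    by (intro ap.cauchy_schwarz ap.ok_diff aps ap_jet h)
  also have "\<dots> \<le> N * \<delta> * nm (jet \<kappa> h)"
    by (rule mult_right_mono[OF residual_nm[OF R] ap.nrm_nonneg[OF ap_jet[OF h]]])
  finally show ?thesis unfolding eq .
qed

text \<open>The update is g - \<tau> r. Testing the new residual r' with itself gives, up to the
  errors of the two trigonometric replacements, the pairing of (I - \<tau> A) jet r with jet r', so
  that the contraction applies. These two errors are the summand 2 N \<delta>.\<close>

lemma residual_step:
  assumes R: "residual \<kappa> \<delta> g P r" and "\<kappa> > 0" "\<delta> > 0"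
  shows "\<exists>g' P' r'. residual \<kappa> \<delta> g' P' r' \<and> nm (jet \<kappa> r') \<le> rate * nm (jet \<kappa> r) + 2 * N * \<delta>"
proof -
  let ?\<tau> = "\<mu> / K\<^sup>2"
  let ?g = "\<lambda>x \<alpha>. g x \<alpha> + (- ?\<tau>) * r x \<alpha>"
  have gr: "tv g" "tv r" using R by (auto simp: residual_def)
  have g': "tv ?g" by (intro tv_axpy gr)
  then obtain P' r' where R': "residual \<kappa> \<delta> ?g P' r'" using residual_exists \<open>\<kappa> > 0\<close> \<open>\<delta> > 0\<close> by blast
  then have r': "tv r'" by (simp add: residual_def)
  let ?J = "jet \<kappa> r" and ?J' = "jet \<kappa> r'"
  have J: "ap ?J" "ap ?J'" by (intro ap_jet gr r')+
  have "nm ?J' * nm ?J' = ip ?J' ?J'" using ap.nrm_sq[OF J(2)] by (simp add: power2_eq_square)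
  moreover have "\<bar>ip (flux \<kappa> ?g) ?J' - ip ?J' ?J'\<bar> \<le> N * \<delta> * nm ?J'"
    using residual_flux[OF R' _ r'] \<open>\<delta> > 0\<close> by simp
  moreover have "ip (flux \<kappa> ?g) ?J' = ip (flux \<kappa> g) ?J' + (- ?\<tau>) * ip (block a ?J) ?J'"
    unfolding flux_axpy[OF gr] by (intro ap.lin ap_flux ap_block J gr)
  moreover have "\<bar>ip (flux \<kappa> g) ?J' - ip ?J ?J'\<bar> \<le> N * \<delta> * nm ?J'"
    using residual_flux[OF R _ r'] \<open>\<delta> > 0\<close> by simp
  moreover have "ip (\<lambda>x s. ?J x s + (- ?\<tau>) * block a ?J x s) ?J' = ip ?J ?J' + (- ?\<tau>) * ip (block a ?J) ?J'"
    by (intro ap.lin J ap_block)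
  moreover have "ip (\<lambda>x s. ?J x s + (- ?\<tau>) * block a ?J x s) ?J' \<le> nm (\<lambda>x s. ?J x s + (- ?\<tau>) * block a ?J x s) * nm ?J'"
    using ap.cauchy_schwarz[OF ap.ok_axpy[OF J(1) ap_block[OF J(1)]] J(2), of "- ?\<tau>"] by linarith
  moreover have "nm (\<lambda>x s. ?J x s + (- ?\<tau>) * block a ?J x s) * nm ?J' \<le> rate * nm ?J * nm ?J'"
    using richardson[OF J(1)] by (intro mult_right_mono ap.nrm_nonneg J) simp
  ultimately have "nm ?J' * nm ?J' \<le> rate * nm ?J * nm ?J' + 2 * (N * \<delta> * nm ?J')" by linarith
  then have *: "nm ?J' * nm ?J' \<le> (rate * nm ?J + 2 * N * \<delta>) * nm ?J'" by (simp add: algebra_simps)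
  have "nm ?J' \<le> rate * nm ?J + 2 * N * \<delta>"
  proof (cases "nm ?J' = 0")
    case True
    then show ?thesis using rate ap.nrm_nonneg[OF J(1)] \<open>\<delta> > 0\<close> by (simp add: N_def)
  next
    case False
    then have "nm ?J' > 0" using ap.nrm_nonneg[OF J(2)] by simp
    with * show ?thesis by simp
  qed
  with R' show ?thesis by blast
qed

lemma small_residual:
  assumes "\<kappa> > 0" "\<epsilon> > 0"
  obtains g P r where "residual \<kappa> \<epsilon> g P r" "nm (jet \<kappa> r) \<le> \<epsilon>"
proof -
  have N: "N > 0" by (simp add: N_def del: card_sum)
  \<comment> \<open>The errors of all steps sum to a geometric series with total at most 2 N
    \<delta>/(1 - rate); this choice keeps it below \<epsilon>/2. The cap at \<epsilon> makes a
    \<delta>-residual an \<epsilon>-residual.\<close>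
  define \<delta> where "\<delta> = min \<epsilon> (\<epsilon> * (1 - rate) / (4 * N))"
  have \<delta>: "\<delta> > 0" "\<delta> \<le> \<epsilon>" using assms rate N by (auto simp: \<delta>_def)
  have N\<delta>: "2 * N * \<delta> \<le> (1 - rate) * (\<epsilon> / 2)"
  proof -
    have "2 * N * \<delta> \<le> 2 * N * (\<epsilon> * (1 - rate) / (4 * N))" using N by (intro mult_left_mono) (auto simp: \<delta>_def)
    also have "\<dots> = (1 - rate) * (\<epsilon> / 2)" using N by simp
    finally show ?thesis .
  qed
  obtain P0 r0 where R0: "residual \<kappa> \<delta> (\<lambda>_ _. 0) P0 r0"
    using residual_exists[OF tv_const \<open>\<kappa> > 0\<close> \<delta>(1)] by blast
  have iter: "\<exists>g P r. residual \<kappa> \<delta> g P r \<and> nm (jet \<kappa> r) \<le> rate ^ n * nm (jet \<kappa> r0) + \<epsilon> / 2" for n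
  proof (induction n)
    case 0
    show ?case using R0 \<open>\<epsilon> > 0\<close> by (intro exI[of _ "\<lambda>_ _. 0"] exI[of _ P0] exI[of _ r0]) simp
  next
    case (Suc n)
    then obtain g P r where R: "residual \<kappa> \<delta> g P r" and IH: "nm (jet \<kappa> r) \<le> rate ^ n * nm (jet \<kappa> r0) + \<epsilon> / 2" by blast
    obtain g' P' r' where R': "residual \<kappa> \<delta> g' P' r'" "nm (jet \<kappa> r') \<le> rate * nm (jet \<kappa> r) + 2 * N * \<delta>"
      using residual_step[OF R \<open>\<kappa> > 0\<close> \<delta>(1)] by blast
    have "rate * nm (jet \<kappa> r) + 2 * N * \<delta> \<le> rate * (rate ^ n * nm (jet \<kappa> r0) + \<epsilon> / 2) + (1 - rate) * (\<epsilon> / 2)"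
      using IH rate N\<delta> by (intro add_mono mult_left_mono) auto
    also have "\<dots> = rate ^ Suc n * nm (jet \<kappa> r0) + \<epsilon> / 2" by (simp add: field_simps)
    finally show ?case using R' by (meson order_trans)
  qed
  have "(\<lambda>n. rate ^ n * nm (jet \<kappa> r0)) \<longlonglongrightarrow> 0 * nm (jet \<kappa> r0)"
    using rate by (intro tendsto_mult_right LIMSEQ_power_zero) auto
  then have "\<forall>\<^sub>F n in sequentially. rate ^ n * nm (jet \<kappa> r0) < \<epsilon> / 2"
    by (rule order_tendstoD) (use \<open>\<epsilon> > 0\<close> in simp)
  then obtain n where n: "rate ^ n * nm (jet \<kappa> r0) < \<epsilon> / 2" by (auto simp: eventually_sequentially)
  obtain g P r where R: "residual \<kappa> \<delta> g P r" "nm (jet \<kappa> r) \<le> rate ^ n * nm (jet \<kappa> r0) + \<epsilon> / 2" using iter by blast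
  show thesis
  proof (rule that)
    show "residual \<kappa> \<epsilon> g P r" using R(1) \<delta>(2) unfolding residual_def by (meson order_trans)
    show "nm (jet \<kappa> r) \<le> \<epsilon>" using R(2) n by linarith
  qed
qed

end

section \<open>Energy and translation estimates\<close>

text \<open>The shift is cut into n + 1 equal steps. Translation invariance makes them equally
  large, and each is its linear part plus a Taylor error of order 1/n^2; the errors sum to order 1/n
  and vanish. No integral along the segment is required.\<close>

lemma nm_shift_le:
  fixes g :: "real^'d::finite \<Rightarrow> 'm::finite \<Rightarrow> real"
  assumes g: "tv g"
  shows "nm (\<lambda>x \<alpha>. g (x + z) \<alpha> - g x \<alpha>) \<le> norm z * nm (jet \<kappa> g)"
proof -
  have g': "trig_poly (\<lambda>x. g x \<alpha>)" for \<alpha> using g by (simp add: tv_def)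
  define F where "F = (\<lambda>t x \<alpha>. g (x + t *\<^sub>R z) \<alpha> - g x \<alpha>)"
  define G where "G = (\<lambda>x \<alpha>. \<Sum>i\<in>UNIV. z $ i * partial i (\<lambda>y. g y \<alpha>) x)"
  have F: "ap (F t)" for t
    unfolding F_def by (intro ap_tv tv_diff tv_translate g)
  have G: "ap G" unfolding G_def by (intro ap_trig trig_sum trig_cmult trig_poly_partial g')
  have iter: "nm (F (real n * s)) \<le> real n * nm (F s)" for n s
  proof (induction n)
    case 0
    then show ?case by (simp add: F_def nm_const[of "\<lambda>_. 0"])
  next
    case (Suc n)
    have "F (real (Suc n) * s) = (\<lambda>x \<alpha>. F (real n * s) x \<alpha> + (\<lambda>x. F s (x + (real n * s) *\<^sub>R z)) x \<alpha>)"
      by (simp add: F_def fun_eq_iff algebra_simps)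
    then have "nm (F (real (Suc n) * s)) \<le> nm (F (real n * s)) + nm (\<lambda>x. F s (x + (real n * s) *\<^sub>R z))"
      by (simp only:) (rule ap.nrm_triangle[OF F ap_translate[OF F]])
    also have "\<dots> \<le> real n * nm (F s) + nm (F s)" using Suc nm_translate[OF F] by simp
    finally show ?case by (simp add: algebra_simps)
  qed
  define Q where "Q = (\<lambda>\<alpha> L. L \<ge> 0 \<and> (\<forall>x z. \<bar>g (x + z) \<alpha> - g x \<alpha> - (\<Sum>i\<in>UNIV. z $ i * partial i (\<lambda>y. g y \<alpha>) x)\<bar> \<le> L * (norm z)\<^sup>2))"
  have "\<exists>L. Q \<alpha> L" for \<alpha>
    unfolding Q_def by (rule trig_taylor[OF g'[of \<alpha>]]) blast
  then obtain L where "\<And>\<alpha>. Q \<alpha> (L \<alpha>)" by metis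
  then have L: "L \<alpha> \<ge> 0"
    "\<bar>g (x + z) \<alpha> - g x \<alpha> - (\<Sum>i\<in>UNIV. z $ i * partial i (\<lambda>y. g y \<alpha>) x)\<bar> \<le> L \<alpha> * (norm z)\<^sup>2" for \<alpha> x z
    unfolding Q_def by blast+
  define C where "C = sqrt (\<Sum>\<alpha>\<in>UNIV. (L \<alpha> * (norm z)\<^sup>2)\<^sup>2)"
  have C: "C \<ge> 0" by (simp add: C_def sum_nonneg)
  have small: "nm (F s) \<le> \<bar>s\<bar> * nm G + s\<^sup>2 * C" for s
  proof -
    have "nm (\<lambda>x \<alpha>. F s x \<alpha> - s * G x \<alpha>) \<le> s\<^sup>2 * C"
    proof (rule nm_le_const)
      show "ap (\<lambda>x \<alpha>. F s x \<alpha> - s * G x \<alpha>)" using ap.ok_axpy[OF F G, of s "-s"] by simp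
      fix x
      have "(F s x \<alpha> - s * G x \<alpha>)\<^sup>2 \<le> (s\<^sup>2)\<^sup>2 * (L \<alpha> * (norm z)\<^sup>2)\<^sup>2" for \<alpha>
      proof -
        have "\<bar>F s x \<alpha> - s * G x \<alpha>\<bar> \<le> s\<^sup>2 * (L \<alpha> * (norm z)\<^sup>2)"
          using L(2)[of x "s *\<^sub>R z" \<alpha>] unfolding F_def G_def
          by (simp add: sum_distrib_left power_mult_distrib mult_ac)
        from power_mono[OF this, of 2] show ?thesis by (simp add: power_mult_distrib)
      qed
      then have "(\<Sum>\<alpha>\<in>UNIV. (F s x \<alpha> - s * G x \<alpha>)\<^sup>2) \<le> (\<Sum>\<alpha>\<in>UNIV. (s\<^sup>2)\<^sup>2 * (L \<alpha> * (norm z)\<^sup>2)\<^sup>2)"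
        by (intro sum_mono)
      also have "\<dots> = (s\<^sup>2 * C)\<^sup>2" by (simp add: C_def power_mult_distrib[of _ "sqrt _"] sum_distrib_left sum_nonneg)
      finally show "(\<Sum>\<alpha>\<in>UNIV. (F s x \<alpha> - s * G x \<alpha>)\<^sup>2) \<le> (s\<^sup>2 * C)\<^sup>2" .
    qed (use C in simp)
    moreover have "nm (\<lambda>x \<alpha>. (F s x \<alpha> - s * G x \<alpha>) + s * G x \<alpha>) \<le> nm (\<lambda>x \<alpha>. F s x \<alpha> - s * G x \<alpha>) + \<bar>s\<bar> * nm G"
      using ap.ok_axpy[OF F G, of s "-s"] by (intro ap.nrm_axpy G) simp
    ultimately show ?thesis by (simp add: eta_contract_eq)
  qed
  have "nm (F 1) \<le> nm G + C / real (Suc n)" for n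
  proof -
    have "nm (F (real (Suc n) * (1 / real (Suc n)))) \<le> real (Suc n) * nm (F (1 / real (Suc n)))" by (rule iter)
    also have "\<dots> \<le> real (Suc n) * (\<bar>1 / real (Suc n)\<bar> * nm G + (1 / real (Suc n))\<^sup>2 * C)"
      by (intro mult_left_mono small) simp
    also have "\<dots> = nm G + C / real (Suc n)"
      by (simp del: of_nat_Suc add: distrib_left power2_eq_square)
    finally show ?thesis by (simp del: of_nat_Suc)
  qed
  moreover have "(\<lambda>n. nm G + C / real (Suc n)) \<longlonglongrightarrow> nm G + 0"
    by (intro tendsto_add tendsto_const LIMSEQ_Suc[OF lim_const_over_n])
  ultimately have "nm (F 1) \<le> nm G"
    by (intro tendsto_lowerbound[of "\<lambda>n. nm G + C / real (Suc n)"]) (auto intro: always_eventually)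
  also have "nm G \<le> norm z * nm (jet \<kappa> g)"
  proof (rule nm_mono[OF G ap_jet[OF g]])
    fix x
    have "(\<Sum>\<alpha>\<in>UNIV. (G x \<alpha>)\<^sup>2) \<le> (\<Sum>\<alpha>\<in>UNIV. (norm z)\<^sup>2 * (\<Sum>i\<in>UNIV. (partial i (\<lambda>y. g y \<alpha>) x)\<^sup>2))"
    proof (rule sum_mono)
      fix \<alpha>
      have "(norm z)\<^sup>2 = (\<Sum>i\<in>UNIV. (z $ i)\<^sup>2)" unfolding power2_norm_eq_inner inner_vec_def by (simp add: power2_eq_square)
      then show "(G x \<alpha>)\<^sup>2 \<le> (norm z)\<^sup>2 * (\<Sum>i\<in>UNIV. (partial i (\<lambda>y. g y \<alpha>) x)\<^sup>2)"
        unfolding G_def by (simp only:) (rule Cauchy_Schwarz_ineq_sum)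
    qed
    also have "\<dots> = (norm z)\<^sup>2 * (\<Sum>k\<in>UNIV. (jet \<kappa> g x (Inl k))\<^sup>2)"
      unfolding sum_UNIV_prod by (subst sum.swap) (simp add: sum_distrib_left)
    also have "\<dots> \<le> (norm z)\<^sup>2 * (\<Sum>s\<in>UNIV. (jet \<kappa> g x s)\<^sup>2)"
      unfolding sum_UNIV_sum by (intro mult_left_mono) (auto intro: sum_nonneg)
    finally show "(\<Sum>\<alpha>\<in>UNIV. (G x \<alpha>)\<^sup>2) \<le> (norm z)\<^sup>2 * (\<Sum>s\<in>UNIV. (jet \<kappa> g x s)\<^sup>2)" .
  qed simp
  finally show ?thesis by (simp add: F_def)
qed

text \<open>Averaging \<open>\<parallel>g(\<cdot> + y) - g\<parallel>\<^sup>2 = 2\<parallel>g\<parallel>\<^sup>2 - 2\<langle>g(\<cdot> + y), g\<rangle>\<close> over \<open>y\<close>.\<close>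

lemma ip_le_shift:
  fixes g :: "real^'d::finite \<Rightarrow> 'm::finite \<Rightarrow> real"
  assumes g: "tv g" and D: "\<And>y. nm (\<lambda>x \<alpha>. g (x + y) \<alpha> - g x \<alpha>) \<le> D"
  shows "ip g g \<le> D\<^sup>2 / 2 + (\<Sum>\<alpha>\<in>UNIV. (mean (\<lambda>x. g x \<alpha>))\<^sup>2)"
proof -
  have g': "trig_poly (\<lambda>x. g x \<alpha>)" for \<alpha> using g by (simp add: tv_def)
  define c where "c = (\<lambda>\<alpha> y. mean (\<lambda>x. g (x + y) \<alpha> * g x \<alpha>))"
  have c: "trig_poly (c \<alpha>)" "mean (c \<alpha>) = (mean (\<lambda>x. g x \<alpha>))\<^sup>2" for \<alpha>
    using trig_correlation[OF g' g', of \<alpha> \<alpha>] by (auto simp: c_def power2_eq_square)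
  have low: "ip g g - D\<^sup>2 / 2 \<le> (\<Sum>\<alpha>\<in>UNIV. c \<alpha> y)" for y
  proof -
    let ?h = "\<lambda>x. g (x + y)"
    have aps: "ap ?h" "ap g" by (intro ap_tv tv_translate g)+
    have "ip ?h g = (\<Sum>\<alpha>\<in>UNIV. c \<alpha> y)"
      unfolding ip_def c_def by (intro mean_sum unif_ap_trig trig_mult g' trig_translate[OF g'])
    moreover have "ip ?h ?h = ip g g" by (intro ip_translate ap_tv g)
    moreover have "(nm (\<lambda>x \<alpha>. ?h x \<alpha> - g x \<alpha>))\<^sup>2 \<le> D\<^sup>2"
      by (intro power_mono D ap.nrm_nonneg ap.ok_diff aps)
    moreover have "(nm (\<lambda>x \<alpha>. ?h x \<alpha> - g x \<alpha>))\<^sup>2 = ip ?h ?h + 2 * (-1) * ip ?h g + (-1)\<^sup>2 * ip g g"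
      using ap.axpy_sq[OF aps, of "-1"] by (subst ap.nrm_sq) (auto intro: ap.ok_diff aps)
    ultimately show ?thesis by simp
  qed
  have "ip g g - D\<^sup>2 / 2 = mean (\<lambda>_::real^'d. ip g g - D\<^sup>2 / 2)" by (simp add: mean_const)
  also have "\<dots> \<le> mean (\<lambda>y. \<Sum>\<alpha>\<in>UNIV. c \<alpha> y)"
    by (intro mean_mono unif_ap_const unif_ap_sum unif_ap_trig c low)
  also have "\<dots> = (\<Sum>\<alpha>\<in>UNIV. (mean (\<lambda>x. g x \<alpha>))\<^sup>2)"
    by (subst mean_sum) (simp_all add: unif_ap_trig c)
  finally show ?thesis by simp
qed

lemma le_of_square_le:
  fixes x c \<mu> :: real
  assumes "\<mu> > 0" "x \<ge> 0" "c \<ge> 0" "\<mu> * x\<^sup>2 \<le> c * x"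
  shows "x \<le> c / \<mu>"
proof (cases "x = 0")
  case False
  with assms have "x > 0" by simp
  have "(\<mu> * x) * x \<le> c * x" using assms(4) by (simp add: power2_eq_square mult.assoc)
  then have "\<mu> * x \<le> c" using \<open>x > 0\<close> by simp
  then show ?thesis using \<open>\<mu> > 0\<close> by (simp add: field_simps)
qed (use assms in simp)

lemma block_translate: "block (\<lambda>x. a (x + y)) (\<lambda>x. F (x + y)) = (\<lambda>x. block a F (x + y))"
  by (intro ext) (simp add: block_def split: sum.splits)

lemma partial_const: "partial i (\<lambda>_. c) x = 0"
  by (rule partial_eqI) simp

lemma nm_le_jet: 
  assumes "tv g" shows "nm (grad g) \<le> nm (jet \<kappa> g)" "\<bar>\<kappa>\<bar> * nm g \<le> nm (jet \<kappa> g)"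
proof -
  have G: "ap (grad g)"
    using assms by (intro ap_trig) (auto simp: grad_def tv_def split: prod.splits intro: trig_poly_partial)
  have "nm (grad g) \<le> 1 * nm (jet \<kappa> g)"
    by (rule nm_mono[OF G ap_jet[OF assms]]) (auto simp: sum_UNIV_sum intro: sum_nonneg)
  then show "nm (grad g) \<le> nm (jet \<kappa> g)" by simp
  have "nm (\<lambda>x \<alpha>. \<kappa> * g x \<alpha>) \<le> 1 * nm (jet \<kappa> g)"
  proof (rule nm_mono)
    show "ap (\<lambda>x \<alpha>. \<kappa> * g x \<alpha>)"
      using assms by (intro ap_trig trig_cmult) (simp add: tv_def)
  qed (auto simp: sum_UNIV_sum ap_jet assms intro: sum_nonneg)
  then show "\<bar>\<kappa>\<bar> * nm g \<le> nm (jet \<kappa> g)" using nm_cmult[OF ap_tv[OF assms]] by simp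
qed

context elliptic_system
begin

lemma elliptic_system_translate: "elliptic_system (\<lambda>x. a (x + y)) \<mu> K"
  using elliptic_system_axioms unfolding elliptic_system_def
  by (auto intro!: unif_ap_translate[of "\<lambda>x. a x _ _"])

text \<open>An approximate weak solution, with the error measured against the jet norm. For \<kappa>
  = 0 it is the equation of the exact corrector, so the approximants of \<psi> and of the
  approximate correctors obey the same predicate.\<close>

definition weak :: "real \<Rightarrow> real \<Rightarrow> (real^'d \<Rightarrow> 'm \<Rightarrow> real) \<Rightarrow> bool" where
  "weak \<kappa> \<epsilon> g \<longleftrightarrow> tv g \<and> (\<forall>h. tv h \<longrightarrow> \<bar>ip (flux \<kappa> g) (jet \<kappa> h)\<bar> \<le> \<epsilon> * nm (jet \<kappa> h))"

lemma weak_of_residual: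
  assumes R: "residual \<kappa> \<epsilon> g P r" and small: "nm (jet \<kappa> r) \<le> \<epsilon>"
  shows "weak \<kappa> ((1 + N) * \<epsilon>) g"
  unfolding weak_def
proof (intro conjI allI impI)
  have tv: "tv g" "tv r" using R by (auto simp: residual_def)
  show "tv g" by fact
  have \<epsilon>: "\<epsilon> \<ge> 0" using small ap.nrm_nonneg[OF ap_jet[OF tv(2)]] by (rule order_trans[rotated])
  fix h :: "real^'d \<Rightarrow> 'm \<Rightarrow> real" assume h: "tv h"
  have "\<bar>ip (jet \<kappa> r) (jet \<kappa> h)\<bar> \<le> nm (jet \<kappa> r) * nm (jet \<kappa> h)"
    by (intro ap.cauchy_schwarz ap_jet tv h)
  also have "\<dots> \<le> \<epsilon> * nm (jet \<kappa> h)" by (intro mult_right_mono small ap.nrm_nonneg ap_jet h)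
  finally show "\<bar>ip (flux \<kappa> g) (jet \<kappa> h)\<bar> \<le> (1 + N) * \<epsilon> * nm (jet \<kappa> h)"
    using residual_flux[OF R \<epsilon> h] by (simp add: algebra_simps)
qed

lemma energy_le:
  assumes w: "tv w" and c: "c \<ge> 0" and le: "ip (block a (jet \<kappa> w)) (jet \<kappa> w) \<le> c * nm (jet \<kappa> w)"
  shows "nm (jet \<kappa> w) \<le> c / \<mu>"
  using order_trans[OF block_coercive[OF ap_jet[OF w]] le]
  by (intro le_of_square_le \<mu> ap.nrm_nonneg ap_jet w c)

text \<open>Testing with g itself; \<epsilon> and the forcing \<open>e\<close> are the only sources,
  so the bound does not involve T.\<close>

lemma weak_energy:
  assumes "weak \<kappa> \<epsilon> g" "\<epsilon> \<ge> 0"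
  shows "nm (jet \<kappa> g) \<le> (\<epsilon> + K * E0) / \<mu>"
proof (rule energy_le)
  have g: "tv g" using assms by (simp add: weak_def)
  show "tv g" by fact
  let ?J = "jet \<kappa> g"
  have eq: "flux \<kappa> g = (\<lambda>x s. block a ?J x s + block a (\<lambda>_. et) x s)"
    unfolding flux_def by (rule block_add)
  have "ip (flux \<kappa> g) ?J = ip (block a ?J) ?J + ip (block a (\<lambda>_. et)) ?J"
    unfolding eq by (intro ap.B_add ap_block ap_jet g ap_et)
  moreover have "\<bar>ip (flux \<kappa> g) ?J\<bar> \<le> \<epsilon> * nm ?J" using assms g by (simp add: weak_def)
  moreover have "\<bar>ip (block a (\<lambda>_. et)) ?J\<bar> \<le> nm (block a (\<lambda>_. et)) * nm ?J"
    by (intro ap.cauchy_schwarz ap_block ap_jet g ap_et)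
  moreover have "nm (block a (\<lambda>_. et)) * nm ?J \<le> (K * E0) * nm ?J"
    unfolding E0_def by (intro mult_right_mono nm_block ap_et ap.nrm_nonneg ap_jet g)
  ultimately show "ip (block a ?J) ?J \<le> (\<epsilon> + K * E0) * nm ?J" unfolding distrib_right by linarith
  show "\<epsilon> + K * E0 \<ge> 0" using assms K E0_nonneg by simp
qed

text \<open>A translate of g solves the equation with translated coefficients: the translation is
  moved onto the test field, whose jet norm it preserves.\<close>

lemma weak_translate:
  assumes W: "weak \<kappa> \<epsilon> g" and h: "tv h"
  shows "\<bar>ip (block (\<lambda>x. a (x + y)) (\<lambda>x s. jet \<kappa> g (x + y) s + et s)) (jet \<kappa> h)\<bar> \<le> \<epsilon> * nm (jet \<kappa> h)"
proof -
  let ?h = "\<lambda>x. h (x + (- y))"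
  have g: "tv g" and h': "tv ?h" using W h by (auto simp: weak_def intro: tv_translate simp del: add_uminus_conv_diff)
  have J: "(\<lambda>x. jet \<kappa> ?h (x + y)) = jet \<kappa> h"
    unfolding jet_translate by simp
  have "ip (block (\<lambda>x. a (x + y)) (\<lambda>x s. jet \<kappa> g (x + y) s + et s)) (jet \<kappa> h)
      = ip (\<lambda>x. flux \<kappa> g (x + y)) (\<lambda>x. jet \<kappa> ?h (x + y))"
    unfolding J flux_def block_translate[symmetric] ..
  also have "\<dots> = ip (flux \<kappa> g) (jet \<kappa> ?h)"
    by (intro ip_translate ap_flux ap_jet g h')
  finally have eq: "ip (block (\<lambda>x. a (x + y)) (\<lambda>x s. jet \<kappa> g (x + y) s + et s)) (jet \<kappa> h) = ip (flux \<kappa> g) (jet \<kappa> ?h)" .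
  have "\<bar>ip (flux \<kappa> g) (jet \<kappa> ?h)\<bar> \<le> \<epsilon> * nm (jet \<kappa> ?h)" using W h' by (simp add: weak_def)
  also have "nm (jet \<kappa> ?h) = nm (jet \<kappa> h)" unfolding jet_translate by (intro nm_translate ap_jet h)
  finally show ?thesis unfolding eq .
qed

text \<open>The difference of two translates solves the equation for a(x + y), with the forcing (a(x
  + y) - a(x + z)) (\<nabla>g(x + z) + e) up to sign; the energy estimate turns the oscillation
  bound \<eta> into a bound on the jet.\<close>

lemma weak_translate_diff:
  assumes W: "weak \<kappa> \<epsilon> g" "\<epsilon> \<ge> 0" and \<eta>: "\<eta> \<ge> 0"
    and osc: "\<And>x \<xi>. (\<Sum>k\<in>UNIV. (\<Sum>l\<in>UNIV. (a (x + y) k l - a (x + z) k l) * \<xi> l)\<^sup>2) \<le> \<eta>\<^sup>2 * (\<Sum>k\<in>UNIV. (\<xi> k)\<^sup>2)"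
  shows "nm (jet \<kappa> (\<lambda>x \<alpha>. g (x + y) \<alpha> - g (x + z) \<alpha>)) \<le> (2 * \<epsilon> + \<eta> * (nm (jet \<kappa> g) + E0)) / \<mu>"
proof -
  interpret Y: elliptic_system "\<lambda>x. a (x + y)" \<mu> K e by (rule elliptic_system_translate)
  interpret Z: elliptic_system "\<lambda>x. a (x + z)" \<mu> K e by (rule elliptic_system_translate)
  have g: "tv g" using W by (simp add: weak_def)
  define w where "w = (\<lambda>x \<alpha>. g (x + y) \<alpha> - g (x + z) \<alpha>)"
  have w: "tv w" unfolding w_def by (intro tv_diff tv_translate g)
  let ?b = "\<lambda>x. a (x + y)" and ?c = "\<lambda>x. a (x + z)"
  let ?Gy = "\<lambda>x s. jet \<kappa> g (x + y) s + et s" and ?Gz = "\<lambda>x s. jet \<kappa> g (x + z) s + et s"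
  let ?J = "jet \<kappa> w"
  have J: "?J = (\<lambda>x s. ?Gy x s - ?Gz x s)"
    unfolding w_def using jet_diff[OF tv_translate[OF g] tv_translate[OF g], of \<kappa> y z] by (simp add: jet_translate)
  have aps: "ap ?Gy" "ap ?Gz" "ap ?J"
    using ap_translate[OF ap_jet[OF g]] ap_et by (auto intro!: ap.ok_add ap_jet w)
  let ?D = "\<lambda>x s. block ?b ?Gz x s - block ?c ?Gz x s"
  have D: "ap ?D" by (intro ap.ok_diff Y.ap_block Z.ap_block aps)
  have nD: "nm ?D \<le> \<eta> * nm ?Gz"
  proof (rule nm_mono[OF D aps(2) \<eta>])
    fix x
    have "(\<Sum>s\<in>UNIV. (?D x s)\<^sup>2) = (\<Sum>k\<in>UNIV. (\<Sum>l\<in>UNIV. (a (x + y) k l - a (x + z) k l) * ?Gz x (Inl l))\<^sup>2)"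
      by (simp add: sum_UNIV_sum left_diff_distrib sum_subtractf)
    also have "\<dots> \<le> \<eta>\<^sup>2 * (\<Sum>k\<in>UNIV. (?Gz x (Inl k))\<^sup>2)" by (rule osc)
    also have "\<dots> \<le> \<eta>\<^sup>2 * (\<Sum>s\<in>UNIV. (?Gz x s)\<^sup>2)"
      unfolding sum_UNIV_sum[of "\<lambda>s. (?Gz x s)\<^sup>2"] by (intro mult_left_mono) (auto intro: sum_nonneg)
    finally show "(\<Sum>s\<in>UNIV. (?D x s)\<^sup>2) \<le> \<eta>\<^sup>2 * (\<Sum>s\<in>UNIV. (?Gz x s)\<^sup>2)" .
  qed
  have "nm ?Gz \<le> nm (\<lambda>x. jet \<kappa> g (x + z)) + nm (\<lambda>_::real^'d. et)"
    by (rule ap.nrm_triangle[OF ap_translate[OF ap_jet[OF g]] ap_et])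
  then have nGz: "nm ?Gz \<le> nm (jet \<kappa> g) + E0"
    unfolding E0_def nm_translate[OF ap_jet[OF g]] .
  have "nm ?J \<le> (2 * \<epsilon> + \<eta> * (nm (jet \<kappa> g) + E0)) / \<mu>"
  proof (rule Y.energy_le[OF w])
    have "block ?b ?J = (\<lambda>x s. (block ?b ?Gy x s - block ?c ?Gz x s) - ?D x s)"
      unfolding J block_diff by (simp add: fun_eq_iff)
    then have "ip (block ?b ?J) ?J = ip (\<lambda>x s. block ?b ?Gy x s - block ?c ?Gz x s) ?J - ip ?D ?J"
      by (simp only:) (intro ap.B_diff D ap.ok_diff Y.ap_block Z.ap_block aps)
    also have "ip (\<lambda>x s. block ?b ?Gy x s - block ?c ?Gz x s) ?J = ip (block ?b ?Gy) ?J - ip (block ?c ?Gz) ?J"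
      by (intro ap.B_diff Y.ap_block Z.ap_block aps)
    finally have "ip (block ?b ?J) ?J = ip (block ?b ?Gy) ?J - ip (block ?c ?Gz) ?J - ip ?D ?J" .
    moreover have "\<bar>ip (block ?b ?Gy) ?J\<bar> \<le> \<epsilon> * nm ?J" by (rule weak_translate[OF W(1) w])
    moreover have "\<bar>ip (block ?c ?Gz) ?J\<bar> \<le> \<epsilon> * nm ?J" by (rule weak_translate[OF W(1) w])
    moreover have "\<bar>ip ?D ?J\<bar> \<le> nm ?D * nm ?J" by (intro ap.cauchy_schwarz D aps)
    moreover have "nm ?D * nm ?J \<le> \<eta> * (nm (jet \<kappa> g) + E0) * nm ?J"
      by (intro mult_right_mono order_trans[OF nD] mult_left_mono nGz \<eta> ap.nrm_nonneg aps)
    ultimately show "ip (block ?b ?J) ?J \<le> (2 * \<epsilon> + \<eta> * (nm (jet \<kappa> g) + E0)) * nm ?J"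
      unfolding distrib_right by linarith
    show "0 \<le> 2 * \<epsilon> + \<eta> * (nm (jet \<kappa> g) + E0)"
      using W(2) \<eta> E0_nonneg ap.nrm_nonneg[OF ap_jet[OF g], of \<kappa>] by simp
  qed
  then show ?thesis by (simp add: w_def)
qed

text \<open>The test field is the constant equal to the mean of g. Its gradient vanishes, so the
  pairing reduces to \<kappa>^2 times the squared mean. This supplies the term that averaging over
  translates leaves behind.\<close>

lemma weak_mean:
  assumes W: "weak \<kappa> \<epsilon> g" and "\<kappa> > 0" "\<epsilon> \<ge> 0"
  shows "\<kappa>\<^sup>2 * (\<Sum>\<alpha>\<in>UNIV. (mean (\<lambda>x. g x \<alpha>))\<^sup>2) \<le> \<epsilon>\<^sup>2"
proof -
  have g: "tv g" using W by (simp add: weak_def)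
  then have g': "trig_poly (\<lambda>x. g x \<alpha>)" for \<alpha> by (simp add: tv_def)
  define m where "m = (\<lambda>\<alpha>. mean (\<lambda>x. g x \<alpha>))"
  define S where "S = (\<Sum>\<alpha>\<in>UNIV. (m \<alpha>)\<^sup>2)"
  have S: "S \<ge> 0" by (simp add: S_def sum_nonneg)
  let ?h = "\<lambda>_::real^'d. m"
  have jet: "jet \<kappa> ?h = (\<lambda>_ s. case s of Inl _ \<Rightarrow> 0 | Inr \<alpha> \<Rightarrow> \<kappa> * m \<alpha>)"
    by (auto simp: fun_eq_iff jet_def grad_def partial_const split: sum.splits)
  have "(\<Sum>s\<in>UNIV. flux \<kappa> g x s * jet \<kappa> ?h x s) = (\<Sum>\<alpha>\<in>UNIV. (\<kappa>\<^sup>2 * m \<alpha>) * g x \<alpha>)" for x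
    unfolding jet sum_UNIV_sum by (simp add: flux_def et_def power2_eq_square mult_ac)
  then have "ip (flux \<kappa> g) (jet \<kappa> ?h) = (\<Sum>\<alpha>\<in>UNIV. (\<kappa>\<^sup>2 * m \<alpha>) * m \<alpha>)"
    unfolding ip_def by (simp only:) (simp add: mean_sum mean_cmult unif_ap_cmult unif_ap_trig g' m_def del: mult.assoc)
  then have "ip (flux \<kappa> g) (jet \<kappa> ?h) = \<kappa>\<^sup>2 * S"
    by (simp add: S_def sum_distrib_left power2_eq_square mult_ac)
  moreover have "nm (jet \<kappa> ?h) = \<kappa> * sqrt S"
    unfolding jet using \<open>\<kappa> > 0\<close>
    by (subst nm_const) (simp add: sum_UNIV_sum S_def power_mult_distrib real_sqrt_mult flip: sum_distrib_left)
  moreover have "\<bar>ip (flux \<kappa> g) (jet \<kappa> ?h)\<bar> \<le> \<epsilon> * nm (jet \<kappa> ?h)" using W tv_const by (auto simp: weak_def)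
  ultimately have "\<kappa>\<^sup>2 * S \<le> \<epsilon> * (\<kappa> * sqrt S)" by simp
  then have "1 * (\<kappa> * sqrt S)\<^sup>2 \<le> \<epsilon> * (\<kappa> * sqrt S)" using S by (simp add: power_mult_distrib)
  then have "\<kappa> * sqrt S \<le> \<epsilon> / 1" using assms S by (intro le_of_square_le) auto
  from power_mono[OF this, of 2] show ?thesis using S assms by (simp add: power_mult_distrib S_def m_def)
qed

text \<open>The three summands come from comparing the translates by y and by z, from moving z back
  to 0 with \<open>nm_shift_le\<close>, and from the mean value bounded in
  \<open>weak_mean\<close>.\<close>

lemma weak_norm_le:
  assumes W: "weak \<kappa> \<epsilon> g" and \<kappa>: "\<kappa> > 0" and \<epsilon>: "\<epsilon> \<ge> 0" and \<eta>: "\<eta> \<ge> 0"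
    and osc: "\<And>y. \<exists>z. norm z \<le> R \<and> (\<forall>x \<xi>. (\<Sum>k\<in>UNIV. (\<Sum>l\<in>UNIV. (a (x + y) k l - a (x + z) k l) * \<xi> l)\<^sup>2) \<le> \<eta>\<^sup>2 * (\<Sum>k\<in>UNIV. (\<xi> k)\<^sup>2))"
  shows "\<kappa> * nm g \<le> (2 * \<epsilon> + \<eta> * (nm (jet \<kappa> g) + E0)) / \<mu> + \<kappa> * R * nm (jet \<kappa> g) + \<epsilon>"
proof -
  have g: "tv g" using W by (simp add: weak_def)
  define c where "c = (2 * \<epsilon> + \<eta> * (nm (jet \<kappa> g) + E0)) / \<mu> + \<kappa> * R * nm (jet \<kappa> g)"
  have shift: "nm (\<lambda>x \<alpha>. g (x + y) \<alpha> - g x \<alpha>) \<le> c / \<kappa>" for y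
  proof -
    from osc[of y] obtain z where z: "norm z \<le> R"
      "\<And>x \<xi>. (\<Sum>k\<in>UNIV. (\<Sum>l\<in>UNIV. (a (x + y) k l - a (x + z) k l) * \<xi> l)\<^sup>2) \<le> \<eta>\<^sup>2 * (\<Sum>k\<in>UNIV. (\<xi> k)\<^sup>2)" by blast
    let ?u = "\<lambda>x \<alpha>. g (x + y) \<alpha> - g (x + z) \<alpha>" and ?v = "\<lambda>x \<alpha>. g (x + z) \<alpha> - g x \<alpha>"
    have tv: "tv ?u" "tv ?v" by (intro tv_diff tv_translate g)+
    have "nm (\<lambda>x \<alpha>. ?u x \<alpha> + ?v x \<alpha>) \<le> nm ?u + nm ?v" by (intro ap.nrm_triangle ap_tv tv)
    then have "\<kappa> * nm (\<lambda>x \<alpha>. g (x + y) \<alpha> - g x \<alpha>) \<le> \<kappa> * nm ?u + \<kappa> * nm ?v"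
      using \<kappa> by (simp flip: distrib_left)
    also have "\<kappa> * nm ?u \<le> (2 * \<epsilon> + \<eta> * (nm (jet \<kappa> g) + E0)) / \<mu>"
      using nm_le_jet(2)[OF tv(1), of \<kappa>] weak_translate_diff[OF W \<epsilon> \<eta> z(2)] \<kappa> by simp
    also have "nm ?v \<le> R * nm (jet \<kappa> g)"
      using nm_shift_le[OF g, of z \<kappa>] mult_right_mono[OF z(1) ap.nrm_nonneg[OF ap_jet[OF g]], of \<kappa>] by linarith
    finally have "\<kappa> * nm (\<lambda>x \<alpha>. g (x + y) \<alpha> - g x \<alpha>) \<le> c"
      using \<kappa> by (simp add: c_def mult.assoc)
    then show ?thesis using \<kappa> by (simp add: field_simps)
  qed
  have c: "c \<ge> 0"
  proof -
    have "0 \<le> c / \<kappa>" using shift[of 0] ap.nrm_nonneg[OF ap_const[of "\<lambda>_::'m. 0"]] by (auto intro: order_trans)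
    then show ?thesis using \<kappa> by (simp add: zero_le_divide_iff)
  qed
  have "(\<kappa> * nm g)\<^sup>2 = \<kappa>\<^sup>2 * ip g g" by (simp add: power_mult_distrib ap.nrm_sq ap_tv g)
  also have "\<dots> \<le> \<kappa>\<^sup>2 * ((c / \<kappa>)\<^sup>2 / 2 + (\<Sum>\<alpha>\<in>UNIV. (mean (\<lambda>x. g x \<alpha>))\<^sup>2))"
    by (intro mult_left_mono ip_le_shift g shift) simp
  also have "\<dots> = c\<^sup>2 / 2 + \<kappa>\<^sup>2 * (\<Sum>\<alpha>\<in>UNIV. (mean (\<lambda>x. g x \<alpha>))\<^sup>2)"
    using \<kappa> by (simp add: distrib_left power_divide)
  also have "\<dots> \<le> c\<^sup>2 + \<epsilon>\<^sup>2" using weak_mean[OF W \<kappa> \<epsilon>] zero_le_power2[of c] by linarith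
  also have "\<dots> \<le> (c + \<epsilon>)\<^sup>2" using c \<epsilon> by (simp add: power2_sum)
  finally have "\<kappa> * nm g \<le> c + \<epsilon>" using c \<epsilon> by (rule_tac power2_le_imp_le) auto
  then show ?thesis by (simp add: c_def)
qed

text \<open>Isolates the dependence on \<kappa>, so that equations at two scales can be compared on
  one test field.\<close>

lemma flux_jet_expand:
  assumes "tv g" "tv h"
  shows "ip (flux \<kappa> g) (jet \<kappa> h) = ip (flux 0 g) (jet 0 h) + \<kappa>\<^sup>2 * ip g h"
proof -
  have "(\<Sum>s\<in>UNIV. flux \<kappa> g x s * jet \<kappa> h x s) = (\<Sum>s\<in>UNIV. flux 0 g x s * jet 0 h x s) + \<kappa>\<^sup>2 * (\<Sum>\<alpha>\<in>UNIV. g x \<alpha> * h x \<alpha>)" for x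
    by (simp add: sum_UNIV_sum flux_def et_def sum_distrib_left power2_eq_square mult_ac)
  then have "ip (flux \<kappa> g) (jet \<kappa> h) = mean (\<lambda>x. (\<Sum>s\<in>UNIV. flux 0 g x s * jet 0 h x s) + \<kappa>\<^sup>2 * (\<Sum>\<alpha>\<in>UNIV. g x \<alpha> * h x \<alpha>))"
    unfolding ip_def by (simp only:)
  also have "\<dots> = ip (flux 0 g) (jet 0 h) + \<kappa>\<^sup>2 * ip g h"
    unfolding ip_def by (subst mean_add) (simp_all add: mean_cmult unif_ap_cmult ap_prod ap_flux ap_jet ap_tv assms)
  finally show ?thesis .
qed

text \<open>The change of \<kappa> produces a zeroth-order term of size (\<kappa>^2 - \<kappa>'^2)
  g'. One factor \<kappa> is absorbed by the jet of the difference, and \<kappa> |g'| remains. The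
  case \<kappa>' = 0 compares with an approximation of the exact corrector.\<close>

lemma weak_diff:
  assumes W: "weak \<kappa> \<epsilon> g" "weak \<kappa>' \<epsilon>' g'" and \<kappa>: "0 \<le> \<kappa>'" "\<kappa>' \<le> \<kappa>" and \<epsilon>: "\<epsilon> \<ge> 0" "\<epsilon>' \<ge> 0"
  shows "nm (jet \<kappa> (\<lambda>x \<alpha>. g x \<alpha> - g' x \<alpha>)) \<le> (\<epsilon> + \<epsilon>' + \<kappa> * nm g') / \<mu>"
proof -
  have g: "tv g" "tv g'" using W by (auto simp: weak_def)
  define w where "w = (\<lambda>x \<alpha>. g x \<alpha> + (-1) * g' x \<alpha>)"
  have w: "tv w" unfolding w_def by (intro tv_axpy g)
  let ?J = "jet \<kappa> w"
  have "nm ?J \<le> (\<epsilon> + \<epsilon>' + \<kappa> * nm g') / \<mu>"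
  proof (rule energy_le[OF w])
    have eq: "block a ?J = (\<lambda>x s. flux \<kappa> g x s - flux \<kappa> g' x s)"
      unfolding w_def jet_axpy[OF g] flux_def block_diff[symmetric] by simp
    have "ip (block a ?J) ?J = ip (flux \<kappa> g) ?J - ip (flux \<kappa> g') ?J"
      unfolding eq by (intro ap.B_diff ap_flux ap_jet g w)
    also have "ip (flux \<kappa> g') ?J = ip (flux \<kappa>' g') (jet \<kappa>' w) + (\<kappa>\<^sup>2 - \<kappa>'\<^sup>2) * ip g' w"
      using flux_jet_expand[OF g(2) w, of \<kappa>] flux_jet_expand[OF g(2) w, of \<kappa>'] by (simp add: algebra_simps)
    finally have "ip (block a ?J) ?J = ip (flux \<kappa> g) ?J - ip (flux \<kappa>' g') (jet \<kappa>' w) - (\<kappa>\<^sup>2 - \<kappa>'\<^sup>2) * ip g' w" by simp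
    moreover have "\<bar>ip (flux \<kappa> g) ?J\<bar> \<le> \<epsilon> * nm ?J" using W(1) w by (simp add: weak_def)
    moreover have "\<bar>ip (flux \<kappa>' g') (jet \<kappa>' w)\<bar> \<le> \<epsilon>' * nm (jet \<kappa>' w)" using W(2) w by (simp add: weak_def)
    moreover have "\<epsilon>' * nm (jet \<kappa>' w) \<le> \<epsilon>' * nm ?J"
    proof (intro mult_left_mono \<epsilon>)
      have "nm (jet \<kappa>' w) \<le> 1 * nm ?J"
      proof (rule nm_mono)
        fix x
        have "(\<kappa>' * w x \<alpha>)\<^sup>2 \<le> (\<kappa> * w x \<alpha>)\<^sup>2" for \<alpha>
          unfolding power_mult_distrib using \<kappa> by (intro mult_right_mono power_mono) auto
        then show "(\<Sum>s\<in>UNIV. (jet \<kappa>' w x s)\<^sup>2) \<le> 1\<^sup>2 * (\<Sum>s\<in>UNIV. (jet \<kappa> w x s)\<^sup>2)"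
          by (simp add: sum_UNIV_sum sum_mono)
      qed (simp_all add: ap_jet w)
      then show "nm (jet \<kappa>' w) \<le> nm ?J" by simp
    qed
    moreover have "\<bar>(\<kappa>\<^sup>2 - \<kappa>'\<^sup>2) * ip g' w\<bar> \<le> \<kappa> * nm g' * nm ?J"
    proof -
      have "\<bar>(\<kappa>\<^sup>2 - \<kappa>'\<^sup>2) * ip g' w\<bar> \<le> \<kappa>\<^sup>2 * (nm g' * nm w)"
        unfolding abs_mult
        using \<kappa> power_mono[OF \<kappa>(2) \<kappa>(1), of 2] by (intro mult_mono ap.cauchy_schwarz ap_tv g w) auto
      also have "\<dots> = (\<kappa> * nm g') * (\<bar>\<kappa>\<bar> * nm w)" using \<kappa> by (simp add: power2_eq_square)
      also have "\<dots> \<le> (\<kappa> * nm g') * nm ?J"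
        using \<kappa> ap.nrm_nonneg[OF ap_tv[OF g(2)]] by (intro mult_left_mono nm_le_jet(2) w) auto
      finally show ?thesis .
    qed
    ultimately show "ip (block a ?J) ?J \<le> (\<epsilon> + \<epsilon>' + \<kappa> * nm g') * nm ?J"
      unfolding distrib_right by linarith
    show "0 \<le> \<epsilon> + \<epsilon>' + \<kappa> * nm g'" using \<epsilon> \<kappa> ap.nrm_nonneg[OF ap_tv[OF g(2)]] by simp
  qed
  then show ?thesis by (simp add: w_def)
qed

end

section \<open>Smooth functions and compactly supported kernels\<close>

fun smooth_upto :: "nat \<Rightarrow> (real^'d::finite \<Rightarrow> real) \<Rightarrow> bool" where
  "smooth_upto 0 f \<longleftrightarrow> continuous_on UNIV f"
| "smooth_upto (Suc n) f \<longleftrightarrow> continuous_on UNIV f \<and>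
     (\<forall>i x. ((\<lambda>t. f (x + t *\<^sub>R axis i 1)) has_real_derivative partial i f x) (at 0)) \<and>
     (\<forall>i. smooth_upto n (partial i f))"

lemma smooth_upto_cont: "smooth_upto n f \<Longrightarrow> continuous_on UNIV f"
  by (cases n) auto

lemma smooth_upto_Suc: "smooth_upto (Suc n) f \<Longrightarrow> smooth_upto n f"
  by (induction n arbitrary: f) auto

lemma smooth_upto_add: "smooth_upto n f \<Longrightarrow> smooth_upto n g \<Longrightarrow> smooth_upto n (\<lambda>x. f x + g x)"
proof (induction n arbitrary: f g)
  case (Suc n)
  have d: "((\<lambda>t. f (x + t *\<^sub>R axis i 1) + g (x + t *\<^sub>R axis i 1)) has_real_derivative partial i f x + partial i g x) (at 0)" for i x
    using Suc.prems by (intro DERIV_add) auto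
  have p: "partial i (\<lambda>x. f x + g x) = (\<lambda>x. partial i f x + partial i g x)" for i
    by (intro ext partial_eqI d)
  show ?case
    unfolding smooth_upto.simps p using Suc d by (intro conjI allI continuous_on_add) auto
qed (auto intro: continuous_on_add)

lemma smooth_upto_mult: "smooth_upto n f \<Longrightarrow> smooth_upto n g \<Longrightarrow> smooth_upto n (\<lambda>x. f x * g x)"
proof (induction n arbitrary: f g)
  case (Suc n)
  have d: "((\<lambda>t. f (x + t *\<^sub>R axis i 1) * g (x + t *\<^sub>R axis i 1)) has_real_derivative partial i f x * g x + f x * partial i g x) (at 0)" for i x
    using DERIV_mult[of "\<lambda>t. f (x + t *\<^sub>R axis i 1)" "partial i f x" 0 UNIV "\<lambda>t. g (x + t *\<^sub>R axis i 1)" "partial i g x"] Suc.prems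
    by (simp add: mult.commute add.commute)
  have p: "partial i (\<lambda>x. f x * g x) = (\<lambda>x. partial i f x * g x + f x * partial i g x)" for i
    by (intro ext partial_eqI d)
  have "smooth_upto n (\<lambda>x. partial i f x * g x + f x * partial i g x)" for i
    using Suc.prems smooth_upto_Suc by (intro smooth_upto_add Suc.IH) auto
  then show ?case
    unfolding smooth_upto.simps p using Suc.prems d by (intro conjI allI continuous_on_mult) auto
qed (auto intro: continuous_on_mult)

lemma smooth_upto_const: "smooth_upto n (\<lambda>_. c)"
proof (induction n arbitrary: c)
  case (Suc n)
  have "partial i (\<lambda>_::real^'a. c) = (\<lambda>_. 0)" for i by (intro ext partial_const)
  then show ?case using Suc by simp
qed simp

lemma smooth_upto_prod: "finite S \<Longrightarrow> (\<And>k. k \<in> S \<Longrightarrow> smooth_upto n (f k)) \<Longrightarrow> smooth_upto n (\<lambda>x. \<Prod>k\<in>S. f k x)"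
  by (induction S rule: finite_induct) (auto intro: smooth_upto_mult smooth_upto_const)

lemma has_real_derivative_reflect:
  fixes f :: "'a::real_vector \<Rightarrow> real"
  assumes "((\<lambda>t. f (y - x + t *\<^sub>R v)) has_real_derivative D) (at 0)"
  shows "((\<lambda>t. f (y - (x + t *\<^sub>R v))) has_real_derivative - D) (at 0)"
proof -
  have "((\<lambda>t. f (y - x + (- t) *\<^sub>R v)) has_real_derivative D * (- 1)) (at 0)"
    by (rule DERIV_chain2[where f = "\<lambda>t. f (y - x + t *\<^sub>R v)"]) (use assms in \<open>auto intro!: derivative_eq_intros\<close>)
  then show ?thesis by (simp add: diff_diff_eq)
qed

lemma smooth_upto_reflect: "smooth_upto n f \<Longrightarrow> smooth_upto n (\<lambda>x. f (y - x))"
proof (induction n arbitrary: f)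
  case 0
  then show ?case by (auto intro!: continuous_intros continuous_on_compose2[of UNIV f])
next
  case (Suc n)
  have d: "((\<lambda>t. f (y - (x + t *\<^sub>R axis i 1))) has_real_derivative - partial i f (y - x)) (at 0)" for i x
    using Suc.prems by (intro has_real_derivative_reflect) auto
  have p: "partial i (\<lambda>x. f (y - x)) = (\<lambda>x. - 1 * partial i f (y - x))" for i
    by (intro ext partial_eqI) (use d in simp)
  have "smooth_upto n (\<lambda>x. - 1 * partial i f (y - x))" for i
    using Suc by (intro smooth_upto_mult smooth_upto_const) auto
  moreover have "continuous_on UNIV (\<lambda>x. f (y - x))"
    using Suc.prems by (auto intro!: continuous_intros continuous_on_compose2[of UNIV f])
  ultimately show ?case unfolding smooth_upto.simps p using d by auto
qed

text \<open>\<open>C_inf\<close> speaks of all iterated partial derivatives at once, which hampers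
  product rules. The graded notion \<open>smooth_upto\<close> allows induction on the order and is
  converted here at the end.\<close>

lemma C_inf_of_smooth_upto:
  assumes "\<And>n. smooth_upto n f" shows "C_inf f"
proof -
  have "\<forall>n. smooth_upto n (iter_partial is f)" for "is"
  proof (induction "is")
    case (Cons i "is")
    show ?case
    proof
      fix n
      have "smooth_upto (Suc n) (iter_partial is f)" using Cons by blast
      then show "smooth_upto n (iter_partial (i # is) f)" by simp
    qed
  qed (use assms in simp)
  then have s: "smooth_upto 1 (iter_partial is f)" for "is" by blast
  show ?thesis unfolding C_inf_def
    using s by (auto simp: real_differentiable_def)
qed

lemma poly_mult_exp_minus_tendsto_0: "((\<lambda>x. poly p x * exp (- x)) \<longlongrightarrow> (0::real)) at_top"
proof -
  have "((\<lambda>x. \<Sum>i\<le>degree p. coeff p i * (x ^ i / exp x)) \<longlongrightarrow> (\<Sum>i\<le>degree p. coeff p i * 0)) at_top"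
    by (intro tendsto_sum tendsto_mult tendsto_const tendsto_power_div_exp_0)
  then show ?thesis by (simp add: poly_altdef sum_distrib_right exp_minus divide_inverse mult.assoc)
qed

text \<open>For t > 0 the n-th derivative of exp(-1/t) is \<open>poly (bump_poly n) (1 / t)\<close>
  times exp(-1/t); one more differentiation replaces p by p - p' and multiplies by the square of
  1/t.\<close>

primrec bump_poly :: "nat \<Rightarrow> real poly" where
  "bump_poly 0 = 1"
| "bump_poly (Suc n) = [:0, 0, 1:] * (bump_poly n - pderiv (bump_poly n))"

definition bump1 :: "nat \<Rightarrow> real \<Rightarrow> real" where
  "bump1 n t = (if t > 0 then poly (bump_poly n) (1 / t) * exp (- (1 / t)) else 0)"

lemma bump1_deriv: "(bump1 n has_real_derivative bump1 (Suc n) t) (at t)"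
proof -
  consider "t < 0" | "t = 0" | "t > 0" by linarith
  then show ?thesis
  proof cases
    case 1
    have "((\<lambda>_. 0) has_real_derivative 0) (at t)" by simp
    then have "(bump1 n has_real_derivative 0) (at t)"
      by (rule has_field_derivative_transform_within_open[where S = "{..<0}"]) (use 1 in \<open>auto simp: bump1_def\<close>)
    with 1 show ?thesis by (simp add: bump1_def)
  next
    case 3
    have "((\<lambda>t. poly (bump_poly n) (1 / t) * exp (- (1 / t))) has_real_derivative
        (poly (pderiv (bump_poly n)) (1 / t) * (- 1 / t\<^sup>2)) * exp (- (1 / t)) + exp (- (1 / t)) * (1 / t\<^sup>2) * poly (bump_poly n) (1 / t)) (at t)"
      by (rule DERIV_mult DERIV_chain2[OF poly_DERIV])+
         (use 3 in \<open>auto intro!: derivative_eq_intros simp: power2_eq_square divide_simps\<close>)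
    then have "((\<lambda>t. poly (bump_poly n) (1 / t) * exp (- (1 / t))) has_real_derivative bump1 (Suc n) t) (at t)"
      by (rule DERIV_cong) (use 3 in \<open>simp add: bump1_def power2_eq_square field_simps\<close>)
    then show ?thesis
      by (rule has_field_derivative_transform_within_open[where S = "{0<..}"]) (use 3 in \<open>auto simp: bump1_def\<close>)
  next
    case 2
    have "((\<lambda>h. (bump1 n (0 + h) - bump1 n 0) / h) \<longlongrightarrow> 0) (at_right 0)"
    proof -
      have "filterlim (\<lambda>h. 1 / h) at_top (at_right (0::real))"
        using filterlim_inverse_at_top_right by (simp add: inverse_eq_divide)
      \<comment> \<open>The extra factor X of the polynomial is the division by h in the difference
        quotient at 0, since X is evaluated at 1/h.\<close>
      from filterlim_compose[OF poly_mult_exp_minus_tendsto_0[of "[:0, 1:] * bump_poly n"] this]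
      have "((\<lambda>h. poly ([:0, 1:] * bump_poly n) (1 / h) * exp (- (1 / h))) \<longlongrightarrow> 0) (at_right 0)" .
      then show ?thesis
        by (rule Lim_transform_eventually)
           (auto simp: bump1_def eventually_at_right_field intro!: exI[of _ 1])
    qed
    moreover have "((\<lambda>h. (bump1 n (0 + h) - bump1 n 0) / h) \<longlongrightarrow> 0) (at_left 0)"
      by (rule tendsto_eventually) (auto simp: bump1_def eventually_at_left_field intro!: exI[of _ "-1"])
    ultimately have "(bump1 n has_real_derivative 0) (at 0)"
      unfolding DERIV_def by (rule filterlim_split_at_real[rotated])
    with 2 show ?thesis by (simp add: bump1_def)
  qed
qed

lemma smooth_upto_bump1: "smooth_upto n (\<lambda>x::real^'d::finite. bump1 m (c + s * x $ j))"
proof (induction n arbitrary: m)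
  case 0
  have "continuous_on UNIV (bump1 m)"
    by (intro continuous_at_imp_continuous_on ballI DERIV_isCont[OF bump1_deriv])
  then show ?case by (auto intro!: continuous_intros continuous_on_compose2[of UNIV "bump1 m"])
next
  case (Suc n)
  have d: "((\<lambda>t. bump1 m (c + s * (x + t *\<^sub>R axis i 1) $ j)) has_real_derivative (if i = j then s else 0) * bump1 (Suc m) (c + s * x $ j)) (at 0)"
    for i and x :: "real^'d"
  proof -
    have "((\<lambda>t. c + s * (x + t *\<^sub>R axis i 1) $ j) has_real_derivative (if i = j then s else 0)) (at 0)"
      by (auto simp: axis_def intro!: derivative_eq_intros)
    from DERIV_chain2[OF bump1_deriv this] show ?thesis by (simp add: mult.commute)
  qed
  have p: "partial i (\<lambda>x::real^'d. bump1 m (c + s * x $ j)) = (\<lambda>x. (if i = j then s else 0) * bump1 (Suc m) (c + s * x $ j))" for i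
    by (intro ext partial_eqI d)
  have "smooth_upto n (\<lambda>x::real^'d. (if i = j then s else 0) * bump1 (Suc m) (c + s * x $ j))" for i
    by (intro smooth_upto_mult smooth_upto_const Suc.IH)
  moreover have "continuous_on UNIV (\<lambda>x::real^'d. bump1 m (c + s * x $ j))"
    using smooth_upto_cont[OF Suc.IH] .
  ultimately show ?case unfolding smooth_upto.simps p using d by auto
qed

lemma integral_pos_continuous:
  fixes f :: "real^'d::finite \<Rightarrow> real"
  assumes c: "continuous_on UNIV f" and nn: "\<And>x. f x \<ge> 0" and "f 0 > 0" and i: "integrable lborel f"
  shows "(\<integral>x. f x \<partial>lborel) > 0"
proof -
  have "\<exists>d>0. \<forall>x. dist x 0 < d \<longrightarrow> dist (f x) (f 0) < f 0 / 2"
    using c \<open>f 0 > 0\<close> unfolding continuous_on_iff by (metis UNIV_I half_gt_zero)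
  then obtain d where d: "d > 0" "\<And>x. dist x 0 < d \<Longrightarrow> dist (f x) (f 0) < f 0 / 2" by blast
  have "0 < f 0 / 2 * measure lborel (ball (0::real^'d) d)" using d \<open>f 0 > 0\<close> by simp
  also have "\<dots> = (\<integral>x. f 0 / 2 * indicator (ball (0::real^'d) d) x \<partial>lborel)" by simp
  also have "\<dots> \<le> (\<integral>x. f x \<partial>lborel)"
  proof (rule integral_mono[OF _ i])
    show "integrable lborel (\<lambda>x. f 0 / 2 * indicator (ball (0::real^'d) d) x)"
      by (intro integrable_mult_right integrable_real_indicator) auto
    show "f 0 / 2 * indicator (ball 0 d) x \<le> f x" for x
    proof (cases "x \<in> ball 0 d")
      case True
      then have "\<bar>f x - f 0\<bar> < f 0 / 2" using d(2)[of x] by (simp add: dist_commute dist_real_def abs_minus_commute)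
      then have "f 0 / 2 \<le> f x" by arith
      with True show ?thesis by simp
    qed (use nn in simp)
  qed
  finally show ?thesis .
qed

lemma integrable_continuous_support:
  fixes f :: "real^'d::finite \<Rightarrow> real"
  assumes c: "continuous_on UNIV f" and s: "\<And>x. norm x \<ge> R \<Longrightarrow> f x = 0"
  shows "integrable lborel f"
proof -
  have "integrable lborel (\<lambda>x. indicator (cball 0 R) x *\<^sub>R f x)"
    using borel_integrable_compact[of "cball 0 R" f] continuous_on_subset[OF c, of "cball 0 R"] by simp
  moreover have "(\<lambda>x. indicator (cball 0 R) x *\<^sub>R f x) = f"
    using s by (auto simp: fun_eq_iff indicator_def)
  ultimately show ?thesis by simp
qed

lemma mollifier_exists:
  fixes \<epsilon> :: real assumes "\<epsilon> > 0"
  obtains k :: "real^'d::finite \<Rightarrow> real" where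
    "\<And>n. smooth_upto n k" "\<And>x. k x \<ge> 0" "(\<integral>x. k x \<partial>lborel) = 1" "\<And>x. norm x \<ge> \<epsilon> \<Longrightarrow> k x = 0"
proof -
  \<comment> \<open>Every factor below lives on |x_i| < e, so points of the support have l1 norm
    below \<epsilon>, and hence Euclidean norm below \<epsilon>.\<close>
  define e where "e = \<epsilon> / real CARD('d)"
  have e: "e > 0" using assms by (simp add: e_def)
  define k0 where "k0 = (\<lambda>x::real^'d. \<Prod>i\<in>UNIV. bump1 0 (e + 1 * x $ i) * bump1 0 (e + (-1) * x $ i))"
  have sm: "smooth_upto n k0" for n
    unfolding k0_def by (intro smooth_upto_prod smooth_upto_mult smooth_upto_bump1) simp
  have nn: "k0 x \<ge> 0" for x unfolding k0_def by (intro prod_nonneg) (simp add: bump1_def)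
  have supp: "k0 x = 0" if "norm x \<ge> \<epsilon>" for x
  proof (rule ccontr)
    assume "k0 x \<noteq> 0"
    then have nz: "bump1 0 (e + 1 * x $ i) * bump1 0 (e + (-1) * x $ i) \<noteq> 0" for i
      unfolding k0_def by (simp add: prod_zero_iff)
    have "\<bar>x $ i\<bar> < e" for i using nz[of i] by (auto simp: bump1_def split: if_splits)
    then have "(\<Sum>i\<in>UNIV. \<bar>x $ i\<bar>) < (\<Sum>i\<in>(UNIV::'d set). e)" by (intro sum_strict_mono) auto
    with norm_le_l1_cart[of x] that show False by (simp add: e_def)
  qed
  have "k0 0 > 0" unfolding k0_def using e by (intro prod_pos) (simp add: bump1_def)
  have i: "integrable lborel k0" by (rule integrable_continuous_support[OF smooth_upto_cont[OF sm] supp])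
  define I where "I = (\<integral>x. k0 x \<partial>lborel)"
  have I: "I > 0" unfolding I_def by (rule integral_pos_continuous[OF smooth_upto_cont[OF sm] nn \<open>k0 0 > 0\<close> i])
  show thesis
  proof (rule that[of "\<lambda>x. (1 / I) * k0 x"])
    show "smooth_upto n (\<lambda>x. (1 / I) * k0 x)" for n by (intro smooth_upto_mult smooth_upto_const sm)
    show "(\<integral>x. (1 / I) * k0 x \<partial>lborel) = 1" using I by (simp add: I_def[symmetric])
  qed (use I nn supp in auto)
qed

text \<open>As a function of x the reflected kernel is an admissible test function; inserting it
  into a weak equation mollifies that equation at the point y.\<close>

lemma test_fun_reflect:
  assumes "\<And>n. smooth_upto n k" and supp: "\<And>x. norm x \<ge> \<epsilon> \<Longrightarrow> k x = 0"
  shows "test_fun (\<lambda>x. k (y - x))"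
proof -
  have "{x. k (y - x) \<noteq> 0} \<subseteq> cball y \<epsilon>"
    using supp by (auto simp: dist_norm) (meson linear)
  then have "closure {x. k (y - x) \<noteq> 0} \<subseteq> cball y \<epsilon>" by (intro closure_minimal) auto
  then have "compact (closure {x. k (y - x) \<noteq> 0})"
    by (meson bounded_cball bounded_subset closed_closure compact_eq_bounded_closed)
  moreover have "C_inf (\<lambda>x. k (y - x))" by (intro C_inf_of_smooth_upto smooth_upto_reflect assms)
  ultimately show ?thesis by (simp add: test_fun_def)
qed

lemma partial_reflect:
  assumes "smooth_upto 1 k"
  shows "partial i (\<lambda>x. k (y - x)) x = - partial i k (y - x)"
  by (rule partial_eqI, rule has_real_derivative_reflect) (use assms in simp)

section \<open>Local square-integrability\<close>

lemma loc_L2_borel: "loc_L2 f \<Longrightarrow> f \<in> borel_measurable borel"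
  by (simp add: loc_L2_def)

lemma loc_int_borel: assumes "loc_int f" shows "f \<in> borel_measurable borel"
proof -
  have m: "(\<lambda>x. indicator (ball 0 (real n)) x *\<^sub>R f x) \<in> borel_measurable borel" for n
    using assms borel_measurable_integrable unfolding loc_int_def set_integrable_def by fastforce
  have lim: "(\<lambda>n. indicator (ball 0 (real n)) x *\<^sub>R f x) \<longlonglongrightarrow> f x" for x
  proof (rule tendsto_eventually)
    obtain N where "norm x < real N" using reals_Archimedean2 by blast
    then show "\<forall>\<^sub>F n in sequentially. indicator (ball 0 (real n)) x *\<^sub>R f x = f x"
      by (intro eventually_sequentiallyI[of N]) auto
  qed
  show ?thesis by (rule borel_measurable_LIMSEQ_real[OF lim m])
qed

lemma loc_int_bound:
  assumes "loc_int g" "f \<in> borel_measurable borel" "\<And>x. \<bar>f x\<bar> \<le> g x"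
  shows "loc_int f"
  unfolding loc_int_def set_integrable_def
proof
  fix R
  show "integrable lborel (\<lambda>x. indicator (ball 0 R) x *\<^sub>R f x)"
  proof (rule Bochner_Integration.integrable_bound)
    show "integrable lborel (\<lambda>x. indicator (ball 0 R) x *\<^sub>R g x)"
      using assms(1) by (simp add: loc_int_def set_integrable_def)
    show "AE x in lborel. norm (indicator (ball 0 R) x *\<^sub>R f x) \<le> norm (indicator (ball 0 R) x *\<^sub>R g x)"
      using assms(3) by (intro always_eventually allI) (auto simp: indicator_def intro: order_trans[OF _ abs_ge_self])
  qed (use assms(2) in \<open>auto intro!: borel_measurable_times borel_measurable_indicator\<close>)
qed

text \<open>Every compact set lies in a ball, so the compact sets of \<open>loc_L2\<close> are
  exchanged for the balls over which averages are taken.\<close>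

lemma loc_L2_iff: "loc_L2 f \<longleftrightarrow> f \<in> borel_measurable borel \<and> loc_int (\<lambda>x. (f x)\<^sup>2)"
proof (intro iffI conjI)
  assume f: "loc_L2 f"
  then show "f \<in> borel_measurable borel" by (rule loc_L2_borel)
  show "loc_int (\<lambda>x. (f x)\<^sup>2)" unfolding loc_int_def
  proof
    fix R :: real
    show "set_integrable lborel (ball 0 R) (\<lambda>x. (f x)\<^sup>2)"
      by (rule set_integrable_subset[of _ "cball 0 R"]) (use f in \<open>auto simp: loc_L2_def\<close>)
  qed
next
  assume f: "f \<in> borel_measurable borel \<and> loc_int (\<lambda>x. (f x)\<^sup>2)"
  show "loc_L2 f" unfolding loc_L2_def
  proof (intro conjI allI impI)
    show "f \<in> borel_measurable lborel" using f by simp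
    fix C :: "(real^'a) set" assume C: "compact C"
    then obtain R where "C \<subseteq> ball 0 R" using bounded_subset_ballD compact_imp_bounded by blast
    moreover have "C \<in> sets lborel" using C by (simp add: borel_compact)
    ultimately show "set_integrable lborel C (\<lambda>x. (f x)\<^sup>2)"
      using f by (auto simp: loc_int_def intro: set_integrable_subset[of lborel "ball 0 R"])
  qed
qed

lemma loc_int_mult:
  assumes "loc_L2 f" "loc_L2 g" shows "loc_int (\<lambda>x. f x * g x)"
proof (rule loc_int_bound)
  show "loc_int (\<lambda>x. (f x)\<^sup>2 + (g x)\<^sup>2)" using assms by (auto simp: loc_L2_iff)
  show "(\<lambda>x. f x * g x) \<in> borel_measurable borel" using assms by (auto simp: loc_L2_iff)
  fix x
  have "2 * (\<bar>f x\<bar> * \<bar>g x\<bar>) \<le> (f x)\<^sup>2 + (g x)\<^sup>2" using sum_squares_bound[of "\<bar>f x\<bar>" "\<bar>g x\<bar>"] by (simp add: mult.assoc)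
  moreover have "0 \<le> \<bar>f x\<bar> * \<bar>g x\<bar>" by simp
  ultimately show "\<bar>f x * g x\<bar> \<le> (f x)\<^sup>2 + (g x)\<^sup>2" unfolding abs_mult by linarith
qed

lemma loc_L2_bounded: "f \<in> borel_measurable borel \<Longrightarrow> (\<And>x. \<bar>f x\<bar> \<le> M) \<Longrightarrow> loc_L2 f"
  unfolding loc_L2_iff
proof
  assume f: "f \<in> borel_measurable borel" and M: "\<And>x. \<bar>f x\<bar> \<le> M"
  show "loc_int (\<lambda>x. (f x)\<^sup>2)"
    by (rule loc_int_bounded[of _ "M\<^sup>2"]) (use f power_mono[OF M, of _ 2] in auto)
qed

lemma loc_L2_const: "loc_L2 (\<lambda>_. c)"
  by (rule loc_L2_bounded[of _ "\<bar>c\<bar>"]) auto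

lemma loc_int_of_L2: "loc_L2 f \<Longrightarrow> loc_int f"
  using loc_int_mult[OF _ loc_L2_const[of 1]] by simp

lemma loc_L2_mult_bounded:
  assumes f: "loc_L2 f" and b: "b \<in> borel_measurable borel" "\<And>x. \<bar>b x\<bar> \<le> M"
  shows "loc_L2 (\<lambda>x. b x * f x)"
  unfolding loc_L2_iff
proof
  show "(\<lambda>x. b x * f x) \<in> borel_measurable borel" using f b by (auto simp: loc_L2_iff)
  show "loc_int (\<lambda>x. (b x * f x)\<^sup>2)"
  proof (rule loc_int_bound)
    show "loc_int (\<lambda>x. M\<^sup>2 * (f x)\<^sup>2)" using f by (auto simp: loc_L2_iff)
    show "\<bar>(b x * f x)\<^sup>2\<bar> \<le> M\<^sup>2 * (f x)\<^sup>2" for x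
      using mult_right_mono[OF power_mono[OF b(2)[of x] abs_ge_zero, of 2], of "(f x)\<^sup>2"] by (simp add: power_mult_distrib)
  qed (use f b in \<open>auto simp: loc_L2_iff\<close>)
qed

lemma loc_L2_cmult: "loc_L2 f \<Longrightarrow> loc_L2 (\<lambda>x. c * f x)"
  by (rule loc_L2_mult_bounded[of _ _ "\<bar>c\<bar>"]) auto

lemma loc_L2_add: assumes "loc_L2 f" "loc_L2 g" shows "loc_L2 (\<lambda>x. f x + g x)"
proof -
  have "loc_int (\<lambda>x. (f x)\<^sup>2 + (g x)\<^sup>2 + 2 * (f x * g x))"
    using assms loc_int_mult[OF assms] by (auto simp: loc_L2_iff)
  moreover have "(\<lambda>x. f x + g x) \<in> borel_measurable borel" using assms by (auto simp: loc_L2_iff)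
  ultimately show ?thesis by (simp add: loc_L2_iff power2_sum mult.assoc)
qed

lemma loc_L2_diff: "loc_L2 f \<Longrightarrow> loc_L2 g \<Longrightarrow> loc_L2 (\<lambda>x. f x - g x)"
  using loc_L2_add[OF _ loc_L2_cmult[of g "-1"], of f] by simp

lemma loc_L2_sum: "(\<And>k. k \<in> S \<Longrightarrow> loc_L2 (f k)) \<Longrightarrow> loc_L2 (\<lambda>x. \<Sum>k\<in>S. f k x)"
  by (induction S rule: infinite_finite_induct) (auto intro: loc_L2_add loc_L2_const)

lemma unif_ap_loc_L2: "unif_ap f \<Longrightarrow> loc_L2 f"
  by (rule unif_ap_bounded, assumption) (auto intro: loc_L2_bounded unif_ap_borel)

lemma integrable_mult_support:
  assumes f: "loc_int f" and v: "v \<in> borel_measurable borel" "\<And>x. \<bar>v x\<bar> \<le> L" "\<And>x. norm x \<ge> R \<Longrightarrow> v x = 0"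
  shows "integrable lborel (\<lambda>x. v x * f x)"
proof (rule Bochner_Integration.integrable_bound)
  show "integrable lborel (\<lambda>x. L * (indicator (ball 0 R) x *\<^sub>R f x))"
    using f by (auto simp: loc_int_def set_integrable_def)
  show "AE x in lborel. norm (v x * f x) \<le> norm (L * (indicator (ball 0 R) x *\<^sub>R f x))"
  proof (intro always_eventually allI)
    fix x
    have "\<bar>v x\<bar> * \<bar>f x\<bar> \<le> \<bar>L\<bar> * \<bar>f x\<bar>" using v(2)[of x] by (intro mult_right_mono) auto
    then show "norm (v x * f x) \<le> norm (L * (indicator (ball 0 R) x *\<^sub>R f x))"
      using v(3)[of x] by (auto simp: abs_mult indicator_def)
  qed
qed (use v loc_int_borel[OF f] in auto)

section \<open>Mean-square inner products on balls\<close>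

definition bip :: "real \<Rightarrow> (real^'d::finite \<Rightarrow> 'k::finite \<Rightarrow> real) \<Rightarrow> (real^'d \<Rightarrow> 'k \<Rightarrow> real) \<Rightarrow> real" where
  "bip R F G = ball_avg (\<lambda>x. \<Sum>k\<in>UNIV. F x k * G x k) R"

definition lL2 :: "(real^'d::finite \<Rightarrow> 'k::finite \<Rightarrow> real) \<Rightarrow> bool" where
  "lL2 F \<longleftrightarrow> (\<forall>k. loc_L2 (\<lambda>x. F x k))"

lemma loc_int_bip: "lL2 F \<Longrightarrow> lL2 G \<Longrightarrow> loc_int (\<lambda>x. \<Sum>k\<in>UNIV. F x k * G x k)"
  by (intro loc_int_sum loc_int_mult) (auto simp: lL2_def)

text \<open>The exact corrector and the true approximate corrector are only locally
  square-integrable, so distances involving them are estimated on each ball, and R tends to infinity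
  at the end.\<close>

interpretation bal: semi_inner lL2 "bip R" for R
proof
  fix F G H :: "real^'d::finite \<Rightarrow> 'k::finite \<Rightarrow> real" and c :: real
  show "lL2 F \<Longrightarrow> lL2 G \<Longrightarrow> lL2 (\<lambda>x k. F x k + c * G x k)"
    unfolding lL2_def by (intro allI loc_L2_add loc_L2_cmult) auto
  show "bip R F G = bip R G F" unfolding bip_def by (simp only: mult.commute)
  assume F: "lL2 F"
  have "ball_avg (\<lambda>_::real^'d. 0) R \<le> bip R F F"
    unfolding bip_def by (intro ball_avg_mono loc_int_const loc_int_bip F sum_nonneg) simp
  then show "bip R F F \<ge> 0" by (simp add: ball_avg_def)
  assume G: "lL2 G" and H: "lL2 H"
  have "bip R (\<lambda>x k. F x k + c * G x k) H = ball_avg (\<lambda>x. (\<Sum>k\<in>UNIV. F x k * H x k) + c * (\<Sum>k\<in>UNIV. G x k * H x k)) R"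
    unfolding bip_def by (simp add: distrib_right sum.distrib sum_distrib_left mult.assoc)
  also have "\<dots> = bip R F H + c * bip R G H"
    unfolding bip_def by (simp add: ball_avg_add ball_avg_cmult loc_int_cmult loc_int_bip F G H)
  finally show "bip R (\<lambda>x k. F x k + c * G x k) H = bip R F H + c * bip R G H" .
qed

lemma (in semi_inner) tendsto_B:
  assumes ok: "\<And>n. ok (F n)" "\<And>n. ok (G n)" "ok F'" "ok G'"
    and F: "(\<lambda>n. nrm (\<lambda>x k. F n x k - F' x k)) \<longlonglongrightarrow> 0" and G: "(\<lambda>n. nrm (\<lambda>x k. G n x k - G' x k)) \<longlonglongrightarrow> 0"
  shows "(\<lambda>n. B (F n) (G n)) \<longlonglongrightarrow> B F' G'"
proof (rule LIM_zero_cancel, rule Lim_null_comparison)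
  let ?dF = "\<lambda>n x k. F n x k - F' x k" and ?dG = "\<lambda>n x k. G n x k - G' x k"
  have okd: "ok (?dF n)" "ok (?dG n)" for n by (intro ok_diff ok)+
  show "\<forall>\<^sub>F n in sequentially. norm (B (F n) (G n) - B F' G') \<le> nrm (?dF n) * (nrm (?dG n) + nrm G') + nrm F' * nrm (?dG n)"
  proof (intro always_eventually allI)
    fix n
    have "B (?dF n) (G n) = B (F n) (G n) - B F' (G n)" by (intro B_diff ok)
    moreover have "B F' (?dG n) = B F' (G n) - B F' G'" by (simp add: sym[of F'] B_diff ok)
    moreover have "\<bar>B (?dF n) (G n)\<bar> \<le> nrm (?dF n) * nrm (G n)" by (intro cauchy_schwarz ok okd)
    moreover have "nrm (?dF n) * nrm (G n) \<le> nrm (?dF n) * (nrm (?dG n) + nrm G')"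
      using nrm_triangle[OF okd(2)[of n] ok(4)] by (intro mult_left_mono nrm_nonneg okd) simp
    moreover have "\<bar>B F' (?dG n)\<bar> \<le> nrm F' * nrm (?dG n)" by (intro cauchy_schwarz ok okd)
    ultimately show "norm (B (F n) (G n) - B F' G') \<le> nrm (?dF n) * (nrm (?dG n) + nrm G') + nrm F' * nrm (?dG n)"
      unfolding real_norm_def by linarith
  qed
  have "(\<lambda>n. nrm (?dF n) * (nrm (?dG n) + nrm G') + nrm F' * nrm (?dG n)) \<longlonglongrightarrow> 0 * (0 + nrm G') + nrm F' * 0"
    by (intro tendsto_intros F G)
  then show "(\<lambda>n. nrm (?dF n) * (nrm (?dG n) + nrm G') + nrm F' * nrm (?dG n)) \<longlonglongrightarrow> 0" by simp
qed

section \<open>Mollification\<close>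

lemma continuous_support_bounded:
  fixes v :: "real^'d::finite \<Rightarrow> real"
  assumes c: "continuous_on UNIV v" and s: "\<And>x. norm x \<ge> R \<Longrightarrow> v x = 0"
  obtains L where "L \<ge> 0" "\<And>x. \<bar>v x\<bar> \<le> L"
proof -
  have "compact (v ` cball 0 R)" by (intro compact_continuous_image continuous_on_subset[OF c]) auto
  then have "bounded (v ` cball 0 R)" by (rule compact_imp_bounded)
  then obtain L where "\<forall>y\<in>v ` cball 0 R. norm y \<le> L" unfolding bounded_iff by blast
  then have L: "\<And>x. x \<in> cball 0 R \<Longrightarrow> \<bar>v x\<bar> \<le> L" by simp
  have "\<bar>v x\<bar> \<le> max L 0" for x
    using L[of x] s[of x] by (cases "norm x \<le> R") auto
  then show thesis by (intro that[of "max L 0"]) auto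
qed

text \<open>Dominated convergence along an arbitrary null sequence of increments. The difference
  quotients are bounded by the Lipschitz constant \<open>L\<close>, and the bound \<open>B\<close>
  on the increments keeps their supports in the ball of radius R + B.\<close>

lemma deriv_under_integral:
  fixes v v' f :: "real^'d::finite \<Rightarrow> real"
  assumes c: "continuous_on UNIV v" "continuous_on UNIV v'"
    and d: "\<And>x. ((\<lambda>t. v (x + t *\<^sub>R axis i 1)) has_real_derivative v' x) (at 0)"
    and s: "\<And>x. norm x \<ge> R \<Longrightarrow> v x = 0" "\<And>x. norm x \<ge> R \<Longrightarrow> v' x = 0" and f: "loc_int f"
  shows "((\<lambda>t. \<integral>x. v (x + t *\<^sub>R axis i 1) * f x \<partial>lborel) has_real_derivative (\<integral>x. v' x * f x \<partial>lborel)) (at 0)"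
proof -
  let ?e = "axis i 1 :: real^'d"
  obtain L where L: "L \<ge> 0" "\<And>x. \<bar>v' x\<bar> \<le> L" using continuous_support_bounded[OF c(2) s(2)] by blast
  obtain L0 where L0: "\<And>x. \<bar>v x\<bar> \<le> L0" using continuous_support_bounded[OF c(1) s(1)] by blast
  have d': "((\<lambda>t. v (x + t *\<^sub>R ?e)) has_real_derivative v' (x + t *\<^sub>R ?e)) (at t)" for x t
  proof -
    have "((\<lambda>u. v (x + t *\<^sub>R ?e + u *\<^sub>R ?e)) has_real_derivative v' (x + t *\<^sub>R ?e)) (at 0)" by (rule d)
    then have "((\<lambda>u. v (x + (u + t) *\<^sub>R ?e)) has_real_derivative v' (x + t *\<^sub>R ?e)) (at 0)"
      by (simp add: scaleR_left_distrib add_ac)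
    then show ?thesis using DERIV_shift[of "\<lambda>t. v (x + t *\<^sub>R ?e)" _ 0 t] by simp
  qed
  have lip: "\<bar>v (x + t *\<^sub>R ?e) - v x\<bar> \<le> L * \<bar>t\<bar>" for x t
    using field_differentiable_bound[of UNIV "\<lambda>t. v (x + t *\<^sub>R ?e)" "\<lambda>t. v' (x + t *\<^sub>R ?e)" L t 0] d' L by simp
  have [measurable]: "v \<in> borel_measurable borel" "v' \<in> borel_measurable borel" "f \<in> borel_measurable borel"
    using c loc_int_borel[OF f] by (auto intro: borel_measurable_continuous_onI)
  have int: "integrable lborel (\<lambda>x. v (x + t *\<^sub>R ?e) * f x)" for t
  proof (rule integrable_mult_support[OF f, of _ L0 "R + \<bar>t\<bar>"])
    fix x :: "real^'d" assume "norm x \<ge> R + \<bar>t\<bar>"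
    then have "norm (x + t *\<^sub>R ?e) \<ge> R" using norm_triangle_ineq4[of "x + t *\<^sub>R ?e" "t *\<^sub>R ?e"] by simp
    then show "v (x + t *\<^sub>R ?e) = 0" by (rule s)
  qed (use L0 in auto)
  show ?thesis
    unfolding DERIV_def tendsto_at_iff_sequentially comp_def
  proof (intro allI impI)
    fix X :: "nat \<Rightarrow> real" assume X: "\<forall>n. X n \<in> UNIV - {0}" "X \<longlonglongrightarrow> 0"
    obtain B where B: "\<And>n. \<bar>X n\<bar> \<le> B" using convergent_imp_Bseq[OF convergentI[OF X(2)]]
      unfolding Bseq_def by auto
    have eq: "((\<integral>x. v (x + (0 + X n) *\<^sub>R ?e) * f x \<partial>lborel) - (\<integral>x. v (x + 0 *\<^sub>R ?e) * f x \<partial>lborel)) / X n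
        = (\<integral>x. (v (x + X n *\<^sub>R ?e) - v x) / X n * f x \<partial>lborel)" for n
    proof -
      have "(\<integral>x. v (x + X n *\<^sub>R ?e) * f x \<partial>lborel) - (\<integral>x. v (x + 0 *\<^sub>R ?e) * f x \<partial>lborel)
          = (\<integral>x. v (x + X n *\<^sub>R ?e) * f x - v (x + 0 *\<^sub>R ?e) * f x \<partial>lborel)"
        by (rule Bochner_Integration.integral_diff[symmetric, OF int int])
      moreover have "(\<integral>x. (v (x + X n *\<^sub>R ?e) - v x) / X n * f x \<partial>lborel)
          = (\<integral>x. (1 / X n) * (v (x + X n *\<^sub>R ?e) * f x - v (x + 0 *\<^sub>R ?e) * f x) \<partial>lborel)"
        by (intro Bochner_Integration.integral_cong refl) (simp add: left_diff_distrib)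
      ultimately show ?thesis by (simp only: add_0_left integral_mult_right_zero) simp
    qed
    show "(\<lambda>n. ((\<integral>x. v (x + (0 + X n) *\<^sub>R ?e) * f x \<partial>lborel) - (\<integral>x. v (x + 0 *\<^sub>R ?e) * f x \<partial>lborel)) / X n)
        \<longlonglongrightarrow> (\<integral>x. v' x * f x \<partial>lborel)"
      unfolding eq
    proof (rule integral_dominated_convergence)
      show "integrable lborel (\<lambda>x. (L * indicator (ball 0 (R + B)) x) * \<bar>f x\<bar>)"
      proof (rule integrable_mult_support[of _ _ L "R + B"])
        show "loc_int (\<lambda>x. \<bar>f x\<bar>)"
          using f unfolding loc_int_def by (intro allI set_integrable_abs) auto
      qed (use L in \<open>auto simp: indicator_def\<close>)
      show "AE x in lborel. (\<lambda>n. (v (x + X n *\<^sub>R ?e) - v x) / X n * f x) \<longlonglongrightarrow> v' x * f x"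
      proof (intro always_eventually allI tendsto_mult tendsto_const)
        fix x
        have "((\<lambda>h. (v (x + (0 + h) *\<^sub>R ?e) - v (x + 0 *\<^sub>R ?e)) / h) \<longlongrightarrow> v' x) (at 0)" using d[of x] unfolding DERIV_def .
        then show "(\<lambda>n. (v (x + X n *\<^sub>R ?e) - v x) / X n) \<longlonglongrightarrow> v' x"
          using X unfolding tendsto_at_iff_sequentially comp_def by simp
      qed
      show "AE x in lborel. norm ((v (x + X n *\<^sub>R ?e) - v x) / X n * f x) \<le> (L * indicator (ball 0 (R + B)) x) * \<bar>f x\<bar>" for n
      proof (intro always_eventually allI)
        fix x
        have X0: "\<bar>X n\<bar> > 0" using X(1) by auto
        have "\<bar>(v (x + X n *\<^sub>R ?e) - v x) / X n\<bar> \<le> L * indicator (ball 0 (R + B)) x"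
        proof (cases "x \<in> ball 0 (R + B)")
          case True
          then show ?thesis using lip[of x "X n"] X0 by (simp add: abs_divide field_simps)
        next
          case False
          then have "norm x \<ge> R + \<bar>X n\<bar>" using B[of n] by simp
          then have "norm (x + X n *\<^sub>R ?e) \<ge> R" "norm x \<ge> R"
            using norm_triangle_ineq4[of "x + X n *\<^sub>R ?e" "X n *\<^sub>R ?e"] by simp_all
          then show ?thesis using False by (simp add: s)
        qed
        then show "norm ((v (x + X n *\<^sub>R ?e) - v x) / X n * f x) \<le> (L * indicator (ball 0 (R + B)) x) * \<bar>f x\<bar>"
          unfolding real_norm_def abs_mult by (intro mult_right_mono) auto
      qed
    qed measurable
  qed
qed

lemma integral_translate:
  fixes f :: "real^'d::finite \<Rightarrow> real"
  assumes "f \<in> borel_measurable borel"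
  shows "(\<integral>x. f (x + v) \<partial>lborel) = (\<integral>x. f x \<partial>lborel)"
proof -
  have "(\<integral>x. f x \<partial>lborel) = (\<integral>x. f x \<partial>(distr lborel borel ((+) v)))" by (simp add: lborel_distr_plus)
  also have "\<dots> = (\<integral>x. f (v + x) \<partial>lborel)" by (intro integral_distr) (use assms in auto)
  finally show ?thesis by (simp add: add.commute)
qed

text \<open>By translation invariance the integral of v(x + t e_i) is constant in t, so its
  derivative at 0, the integral of \<open>v'\<close>, vanishes.\<close>

lemma integral_partial_zero:
  fixes v v' :: "real^'d::finite \<Rightarrow> real"
  assumes c: "continuous_on UNIV v" "continuous_on UNIV v'"
    and d: "\<And>x. ((\<lambda>t. v (x + t *\<^sub>R axis i 1)) has_real_derivative v' x) (at 0)"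
    and s: "\<And>x. norm x \<ge> R \<Longrightarrow> v x = 0" "\<And>x. norm x \<ge> R \<Longrightarrow> v' x = 0"
  shows "(\<integral>x. v' x \<partial>lborel) = 0"
proof -
  have "(\<integral>x. v (x + t *\<^sub>R axis i 1) * 1 \<partial>lborel) = (\<integral>x. v x \<partial>lborel)" for t
    using integral_translate[of v] c by (simp add: borel_measurable_continuous_onI)
  then have "((\<lambda>t::real. \<integral>x. v x \<partial>lborel) has_real_derivative (\<integral>x. v' x * 1 \<partial>lborel)) (at 0)"
    using deriv_under_integral[OF c d s loc_int_const[of 1]] by simp
  then show ?thesis using DERIV_unique[OF _ DERIV_const] by force
qed

definition conv :: "(real^'d::finite \<Rightarrow> real) \<Rightarrow> (real^'d \<Rightarrow> real) \<Rightarrow> real^'d \<Rightarrow> real" where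
  "conv k f y = (\<integral>x. k (y - x) * f x \<partial>lborel)"

locale mollifier =
  fixes k :: "real^'d::finite \<Rightarrow> real" and \<epsilon> :: real
  assumes smooth: "\<And>n. smooth_upto n k" and k_nonneg: "\<And>x. k x \<ge> 0" and k_int: "(\<integral>x. k x \<partial>lborel) = 1"
    and k_supp: "\<And>x. norm x \<ge> \<epsilon> \<Longrightarrow> k x = 0" and \<epsilon>: "0 < \<epsilon>" "\<epsilon> \<le> 1"
begin

lemma k_cont: "continuous_on UNIV k" using smooth_upto_cont smooth by blast

lemma partial_k_cont: "continuous_on UNIV (partial i k)"
  using smooth[of 1] by simp

text \<open>The radius is 1 rather than \<epsilon>: when \<epsilon> < 1, the kernel vanishes on a
  whole neighbourhood of such an x, which settles the derivative.\<close>

lemma partial_k_supp: "norm x \<ge> 1 \<Longrightarrow> \<epsilon> < 1 \<Longrightarrow> partial i k x = 0"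
proof (rule partial_eqI)
  assume x: "norm x \<ge> 1" "\<epsilon> < 1"
  have "((\<lambda>t::real. 0) has_real_derivative 0) (at 0)" by simp
  then show "((\<lambda>t. k (x + t *\<^sub>R axis i 1)) has_real_derivative 0) (at 0)"
  proof (rule has_field_derivative_transform_within_open[where S = "ball 0 (1 - \<epsilon>)"])
    fix t :: real assume t: "t \<in> ball 0 (1 - \<epsilon>)"
    have "norm (x + t *\<^sub>R axis i 1) \<ge> \<epsilon>"
      using norm_triangle_ineq4[of "x + t *\<^sub>R axis i 1" "t *\<^sub>R axis i 1"] x t by simp
    then show "0 = k (x + t *\<^sub>R axis i 1)" by (simp add: k_supp)
  qed (use x in auto)
qed

end

lemma conv_integrable:
  fixes v f :: "real^'d::finite \<Rightarrow> real"
  assumes c: "continuous_on UNIV v" and s: "\<And>x. norm x \<ge> R \<Longrightarrow> v x = 0" and f: "loc_int f"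
  shows "integrable lborel (\<lambda>x. v (y - x) * f x)"
proof -
  obtain L where L: "\<And>x. \<bar>v x\<bar> \<le> L" using continuous_support_bounded[OF c s] by blast
  have v: "v \<in> borel_measurable borel" using c by (rule borel_measurable_continuous_onI)
  show ?thesis
  proof (rule integrable_mult_support[OF f, of _ L "R + norm y"])
    fix x :: "real^'d" assume "norm x \<ge> R + norm y"
    then have "norm (y - x) \<ge> R" using norm_triangle_ineq2[of x y] by (simp add: norm_minus_commute)
    then show "v (y - x) = 0" by (rule s)
  qed (use v L in auto)
qed

lemma conv_continuous:
  fixes v f :: "real^'d::finite \<Rightarrow> real"
  assumes c: "continuous_on UNIV v" and s: "\<And>x. norm x \<ge> R \<Longrightarrow> v x = 0" and f: "loc_int f"
  shows "continuous_on UNIV (conv v f)"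
  unfolding continuous_on_sequentially comp_def conv_def
proof (intro ballI allI impI)
  fix X and y :: "real^'d" assume X: "(\<forall>n. X n \<in> UNIV) \<and> X \<longlonglongrightarrow> y"
  obtain L where L: "L \<ge> 0" "\<And>x. \<bar>v x\<bar> \<le> L" using continuous_support_bounded[OF c s] by blast
  obtain B where B: "\<And>n. norm (X n) \<le> B" using X convergent_imp_Bseq[OF convergentI, of X y]
    unfolding Bseq_def by auto
  have [measurable]: "v \<in> borel_measurable borel" "f \<in> borel_measurable borel"
    using c loc_int_borel[OF f] by (auto intro: borel_measurable_continuous_onI)
  show "(\<lambda>n. \<integral>x. v (X n - x) * f x \<partial>lborel) \<longlonglongrightarrow> (\<integral>x. v (y - x) * f x \<partial>lborel)"
  proof (rule integral_dominated_convergence)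
    show "integrable lborel (\<lambda>x. (L * indicator (ball 0 (R + B)) x) * \<bar>f x\<bar>)"
    proof (rule integrable_mult_support[of _ _ L "R + B"])
      show "loc_int (\<lambda>x. \<bar>f x\<bar>)"
        using f unfolding loc_int_def by (intro allI set_integrable_abs) auto
    qed (use L in \<open>auto simp: indicator_def\<close>)
    show "AE x in lborel. (\<lambda>n. v (X n - x) * f x) \<longlonglongrightarrow> v (y - x) * f x"
    proof (intro always_eventually allI tendsto_mult tendsto_const)
      fix x
      have "isCont v (y - x)" using c by (simp add: continuous_on_eq_continuous_at)
      moreover have "(\<lambda>n. X n - x) \<longlonglongrightarrow> y - x" using X by (intro tendsto_intros) auto
      ultimately show "(\<lambda>n. v (X n - x)) \<longlonglongrightarrow> v (y - x)" by (rule isCont_tendsto_compose)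
    qed
    show "AE x in lborel. norm (v (X n - x) * f x) \<le> (L * indicator (ball 0 (R + B)) x) * \<bar>f x\<bar>" for n
    proof (intro always_eventually allI)
      fix x
      have "\<bar>v (X n - x)\<bar> \<le> L * indicator (ball 0 (R + B)) x"
      proof (cases "x \<in> ball 0 (R + B)")
        case False
        then have "norm (X n - x) \<ge> R" using B[of n] norm_triangle_ineq2[of x "X n"] by (simp add: norm_minus_commute)
        then show ?thesis using False by (simp add: s)
      qed (use L in simp)
      then show "norm (v (X n - x) * f x) \<le> (L * indicator (ball 0 (R + B)) x) * \<bar>f x\<bar>"
        unfolding real_norm_def abs_mult by (intro mult_right_mono) auto
    qed
  qed measurable
qed

text \<open>Moving y moves the kernel, so the derivative falls on \<open>v\<close> while
  \<open>f\<close> is merely locally integrable.\<close>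

lemma conv_deriv:
  fixes v v' f :: "real^'d::finite \<Rightarrow> real"
  assumes c: "continuous_on UNIV v" "continuous_on UNIV v'"
    and d: "\<And>x. ((\<lambda>t. v (x + t *\<^sub>R axis i 1)) has_real_derivative v' x) (at 0)"
    and s: "\<And>x. norm x \<ge> R \<Longrightarrow> v x = 0" "\<And>x. norm x \<ge> R \<Longrightarrow> v' x = 0" and f: "loc_int f"
  shows "((\<lambda>t. conv v f (y + t *\<^sub>R axis i 1)) has_real_derivative conv v' f y) (at 0)"
proof -
  have far: "norm (y - x) \<ge> R" if "norm x \<ge> R + norm y" for x
    using norm_triangle_ineq2[of x y] that by (simp add: norm_minus_commute)
  have "((\<lambda>t. \<integral>x. v (y - (x + t *\<^sub>R axis i 1)) * f x \<partial>lborel) has_real_derivative (\<integral>x. - v' (y - x) * f x \<partial>lborel)) (at 0)"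
  proof (rule deriv_under_integral[where R = "R + norm y"])
    show "((\<lambda>t. v (y - (x + t *\<^sub>R axis i 1))) has_real_derivative - v' (y - x)) (at 0)" for x
      by (intro has_real_derivative_reflect d)
  qed (use c f far s in \<open>auto intro!: continuous_intros continuous_on_compose2[of UNIV v] continuous_on_compose2[of UNIV v']\<close>)
  then have *: "((\<lambda>t. conv v f (y - t *\<^sub>R axis i 1)) has_real_derivative - conv v' f y) (at 0)"
    by (simp add: conv_def diff_diff_eq add.commute)
  have "((\<lambda>t. conv v f (y - (- t) *\<^sub>R axis i 1)) has_real_derivative (- conv v' f y) * (- 1)) (at 0)"
    by (rule DERIV_chain2[where f = "\<lambda>t. conv v f (y - t *\<^sub>R axis i 1)"]) (use * in \<open>auto intro!: derivative_eq_intros\<close>)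
  then show ?thesis by simp
qed

lemma pred_ball [measurable]: "Measurable.pred borel (\<lambda>x::'a::euclidean_space. x \<in> ball c r)"
  by auto

lemma lborel_reflect: "distr lborel borel (\<lambda>x. y - x) = (lborel :: (real^'d::finite) measure)"
  using lborel_affine[of "-1" y] by (simp add: density_1)

lemma integral_reflect:
  fixes f :: "real^'d::finite \<Rightarrow> real"
  assumes "f \<in> borel_measurable borel"
  shows "(\<integral>x. f (y - x) \<partial>lborel) = (\<integral>x. f x \<partial>lborel)"
proof -
  have "(\<integral>x. f x \<partial>lborel) = (\<integral>x. f x \<partial>(distr lborel borel (\<lambda>x. y - x)))" by (simp add: lborel_reflect)
  also have "\<dots> = (\<integral>x. f (y - x) \<partial>lborel)" by (intro integral_distr) (use assms in auto)
  finally show ?thesis by simp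
qed

definition en :: "real \<Rightarrow> (real^'d::finite \<Rightarrow> real) \<Rightarrow> real" where
  "en R f = (\<integral>x. indicator (ball 0 R) x * (f x)\<^sup>2 \<partial>lborel)"

lemma en_integrable: "loc_L2 f \<Longrightarrow> integrable lborel (\<lambda>x. indicator (ball 0 R) x * (f x)\<^sup>2)"
  by (simp add: loc_L2_iff loc_int_def set_integrable_def)

lemma en_ball_avg: "ball_avg (\<lambda>x. (f x)\<^sup>2) R = en R f / measure lborel (ball (0::real^'d::finite) R)" for f :: "real^'d \<Rightarrow> real"
  by (simp add: ball_avg_def en_def set_lebesgue_integral_def)

lemma en_nonneg: "en R f \<ge> 0"
  unfolding en_def by (intro integral_nonneg_AE) auto

lemma en_mono_radius: "loc_L2 f \<Longrightarrow> R \<le> S \<Longrightarrow> en R f \<le> en S f"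
  unfolding en_def by (intro integral_mono en_integrable) (auto simp: indicator_def)

lemma en_add3:
  assumes "loc_L2 f" "loc_L2 g" "loc_L2 h"
  shows "en R (\<lambda>x. f x + g x + h x) \<le> 3 * (en R f + en R g + en R h)"
proof -
  have "en R (\<lambda>x. f x + g x + h x)
    \<le> (\<integral>x. 3 * (indicator (ball 0 R) x * (f x)\<^sup>2 + indicator (ball 0 R) x * (g x)\<^sup>2 + indicator (ball 0 R) x * (h x)\<^sup>2) \<partial>lborel)"
    unfolding en_def
  proof (intro integral_mono)
    fix x
    have "(f x + g x + h x)\<^sup>2 \<le> 3 * ((f x)\<^sup>2 + (g x)\<^sup>2 + (h x)\<^sup>2)"
      using sum_squares_bound[of "f x" "g x"] sum_squares_bound[of "f x" "h x"] sum_squares_bound[of "g x" "h x"]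
      by (simp add: power2_eq_square algebra_simps)
    then show "indicator (ball 0 R) x * (f x + g x + h x)\<^sup>2
      \<le> 3 * (indicator (ball 0 R) x * (f x)\<^sup>2 + indicator (ball 0 R) x * (g x)\<^sup>2 + indicator (ball 0 R) x * (h x)\<^sup>2)"
      by (auto simp: indicator_def)
  qed (intro en_integrable loc_L2_add assms integrable_mult_right Bochner_Integration.integrable_add)+
  also have "\<dots> = 3 * (en R f + en R g + en R h)"
    unfolding en_def by (simp add: en_integrable assms)
  finally show ?thesis .
qed

lemma en_nn_integral:
  assumes "loc_L2 f"
  shows "(\<integral>\<^sup>+x. ennreal (indicator (ball 0 R) x * (f x)\<^sup>2) \<partial>lborel) = ennreal (en R f)"
  unfolding en_def by (intro nn_integral_eq_integral en_integrable assms) auto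

context mollifier
begin

lemma k_borel: "k \<in> borel_measurable borel"
  by (rule borel_measurable_continuous_onI[OF k_cont])

lemma conv_int: "loc_int f \<Longrightarrow> integrable lborel (\<lambda>x. k (y - x) * f x)"
  by (rule conv_integrable[OF k_cont k_supp])

lemma conv_const: "conv k (\<lambda>_. c) y = c"
  unfolding conv_def using integral_reflect[OF k_borel, of y] k_int by simp

lemma conv_cont: "loc_int f \<Longrightarrow> continuous_on UNIV (conv k f)"
  by (rule conv_continuous[OF k_cont k_supp])

lemma conv_diff: "loc_int f \<Longrightarrow> loc_int g \<Longrightarrow> conv k (\<lambda>x. f x - g x) y = conv k f y - conv k g y"
  unfolding conv_def by (simp add: right_diff_distrib conv_int)

text \<open>Jensen for the probability weight k(y - x): expand the nonnegative weighted variance of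
  \<open>f\<close> about its weighted mean.\<close>

lemma conv_sq_le:
  assumes f: "loc_L2 f"
  shows "(conv k f y)\<^sup>2 \<le> conv k (\<lambda>x. (f x)\<^sup>2) y"
proof -
  define m where "m = conv k f y"
  have f2: "loc_int (\<lambda>x. (f x)\<^sup>2)" using f by (simp add: loc_L2_iff)
  note i = conv_int[OF f2, of y] conv_int[OF loc_int_of_L2[OF f], of y] conv_int[OF loc_int_const[of 1], of y]
  have "0 \<le> (\<integral>x. k (y - x) * (f x - m)\<^sup>2 \<partial>lborel)" using k_nonneg by (intro integral_nonneg_AE) auto
  also have "\<dots> = (\<integral>x. k (y - x) * (f x)\<^sup>2 - 2 * m * (k (y - x) * f x) + m\<^sup>2 * (k (y - x) * 1) \<partial>lborel)"
    by (intro Bochner_Integration.integral_cong refl) (simp add: power2_eq_square algebra_simps)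
  also have "\<dots> = conv k (\<lambda>x. (f x)\<^sup>2) y - 2 * m * conv k f y + m\<^sup>2 * conv k (\<lambda>_. 1) y"
    unfolding conv_def using i by simp
  finally show ?thesis by (simp add: conv_const m_def power2_eq_square)
qed

text \<open>Jensen and Tonelli. A point x is seen from y only if |y - x| < \<epsilon> <= 1, hence
  the radius R + 1. Nonnegative integrals are used because square-integrability of the mollified
  function is a consequence of this bound.\<close>

lemma conv_L2_nn:
  assumes f: "loc_L2 f"
  shows "(\<integral>\<^sup>+y. ennreal (indicator (ball 0 R) y * (conv k f y)\<^sup>2) \<partial>lborel) \<le> ennreal (en (R + 1) f)"
proof -
  have f2: "loc_int (\<lambda>x. (f x)\<^sup>2)" using f by (simp add: loc_L2_iff)
  have [measurable]: "f \<in> borel_measurable borel" "k \<in> borel_measurable borel" using f k_borel by (auto simp: loc_L2_iff)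
  have "(\<integral>\<^sup>+y. ennreal (indicator (ball 0 R) y * (conv k f y)\<^sup>2) \<partial>lborel)
      \<le> (\<integral>\<^sup>+y. (\<integral>\<^sup>+x. ennreal (indicator (ball 0 R) y * (k (y - x) * (f x)\<^sup>2)) \<partial>lborel) \<partial>lborel)"
  proof (intro nn_integral_mono)
    fix y
    have "ennreal (indicator (ball 0 R) y * (conv k f y)\<^sup>2) \<le> ennreal (indicator (ball 0 R) y * conv k (\<lambda>x. (f x)\<^sup>2) y)"
      by (intro ennreal_leI mult_left_mono conv_sq_le f) auto
    also have "\<dots> = ennreal (\<integral>x. indicator (ball 0 R) y * (k (y - x) * (f x)\<^sup>2) \<partial>lborel)"
      by (simp add: conv_def)
    also have "\<dots> = (\<integral>\<^sup>+x. ennreal (indicator (ball 0 R) y * (k (y - x) * (f x)\<^sup>2)) \<partial>lborel)"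
      using k_nonneg by (intro nn_integral_eq_integral[symmetric] integrable_mult_right conv_int f2) auto
    finally show "ennreal (indicator (ball 0 R) y * (conv k f y)\<^sup>2)
        \<le> (\<integral>\<^sup>+x. ennreal (indicator (ball 0 R) y * (k (y - x) * (f x)\<^sup>2)) \<partial>lborel)" .
  qed
  also have "\<dots> = (\<integral>\<^sup>+x. (\<integral>\<^sup>+y. ennreal (indicator (ball 0 R) y * (k (y - x) * (f x)\<^sup>2)) \<partial>lborel) \<partial>lborel)"
  proof -
    have "(\<lambda>(x, y). ennreal (indicator (ball 0 R) y * (k (y - x) * (f x)\<^sup>2))) \<in> borel_measurable (lborel \<Otimes>\<^sub>M lborel)"
      by measurable
    from lborel_pair.Fubini'[OF this] show ?thesis by simp
  qed
  also have "\<dots> \<le> (\<integral>\<^sup>+x. ennreal (indicator (ball 0 (R + 1)) x * (f x)\<^sup>2) \<partial>lborel)"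
  proof (intro nn_integral_mono)
    fix x
    have "(\<integral>\<^sup>+y. ennreal (indicator (ball 0 R) y * (k (y - x) * (f x)\<^sup>2)) \<partial>lborel)
        \<le> (\<integral>\<^sup>+y. ennreal (indicator (ball 0 (R + 1)) x * (f x)\<^sup>2) * ennreal (k (y + - x)) \<partial>lborel)"
    proof (intro nn_integral_mono)
      fix y
      have "indicator (ball 0 R) y * (k (y - x) * (f x)\<^sup>2) \<le> indicator (ball 0 (R + 1)) x * (f x)\<^sup>2 * k (y + - x)"
      proof (cases "norm (y - x) \<ge> \<epsilon> \<or> y \<notin> ball 0 R")
        case True
        then show ?thesis using k_supp k_nonneg by auto
      next
        case False
        then have "norm x < R + 1" using \<epsilon> norm_triangle_ineq2[of x y] by (simp add: norm_minus_commute)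
        with False show ?thesis by simp
      qed
      then show "ennreal (indicator (ball 0 R) y * (k (y - x) * (f x)\<^sup>2))
          \<le> ennreal (indicator (ball 0 (R + 1)) x * (f x)\<^sup>2) * ennreal (k (y + - x))"
        using k_nonneg by (subst ennreal_mult[symmetric]) (auto intro: ennreal_leI)
    qed
    also have "\<dots> = ennreal (indicator (ball 0 (R + 1)) x * (f x)\<^sup>2) * (\<integral>\<^sup>+y. ennreal (k (y + - x)) \<partial>lborel)"
      by (intro nn_integral_cmult) measurable
    also have "(\<integral>\<^sup>+y. ennreal (k (y + - x)) \<partial>lborel) = ennreal (\<integral>y. k (y + - x) \<partial>lborel)"
    proof (intro nn_integral_eq_integral)
      show "integrable lborel (\<lambda>y. k (y + - x))"
      proof (rule integrable_continuous_support[where R = "norm x + \<epsilon>"])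
        show "continuous_on UNIV (\<lambda>y. k (y + - x))"
          by (intro continuous_on_compose2[OF k_cont] continuous_intros) auto
        fix y :: "real^'d" assume "norm y \<ge> norm x + \<epsilon>"
        then show "k (y + - x) = 0" using norm_triangle_ineq2[of y x] by (intro k_supp) simp
      qed
    qed (use k_nonneg in auto)
    also have "\<dots> = 1" using integral_translate[OF k_borel, of "- x"] k_int by simp
    finally show "(\<integral>\<^sup>+y. ennreal (indicator (ball 0 R) y * (k (y - x) * (f x)\<^sup>2)) \<partial>lborel)
        \<le> ennreal (indicator (ball 0 (R + 1)) x * (f x)\<^sup>2)" by simp
  qed
  also have "\<dots> = ennreal (en (R + 1) f)" by (rule en_nn_integral[OF f])
  finally show ?thesis .
qed

lemma loc_L2_conv:
  assumes f: "loc_L2 f" shows "loc_L2 (conv k f)"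
  unfolding loc_L2_iff loc_int_def set_integrable_def
proof (intro conjI allI)
  show [measurable]: "conv k f \<in> borel_measurable borel"
    by (intro borel_measurable_continuous_onI conv_cont loc_int_of_L2 f)
  fix R :: real
  show "integrable lborel (\<lambda>x. indicator (ball 0 R) x *\<^sub>R (conv k f x)\<^sup>2)"
  proof (rule integrableI_nonneg)
    show "(\<lambda>x. indicator (ball 0 R) x *\<^sub>R (conv k f x)\<^sup>2) \<in> borel_measurable lborel"
      by (auto intro!: borel_measurable_times borel_measurable_indicator)
    show "(\<integral>\<^sup>+x. ennreal (indicator (ball 0 R) x *\<^sub>R (conv k f x)\<^sup>2) \<partial>lborel) < \<infinity>"
      using conv_L2_nn[OF f, of R] by (simp add: ennreal_less_top le_less_trans)
  qed auto
qed

lemma en_conv_le: assumes f: "loc_L2 f" shows "en R (conv k f) \<le> en (R + 1) f"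
  using conv_L2_nn[OF f, of R] unfolding en_nn_integral[OF loc_L2_conv[OF f]]
  by (simp add: en_nonneg)

end

lemma en_le_const:
  fixes f :: "real^'d::finite \<Rightarrow> real"
  assumes "loc_L2 f" "\<And>x. x \<in> ball 0 R \<Longrightarrow> \<bar>f x\<bar> \<le> c"
  shows "en R f \<le> c\<^sup>2 * measure lborel (ball (0::real^'d) R)"
proof -
  have "en R f \<le> (\<integral>x. c\<^sup>2 * indicator (ball (0::real^'d) R) x \<partial>lborel)"
    unfolding en_def
  proof (intro integral_mono en_integrable assms)
    fix x
    show "indicator (ball 0 R) x * (f x)\<^sup>2 \<le> c\<^sup>2 * indicator (ball 0 R) x"
      using power_mono[OF assms(2)[of x] abs_ge_zero, of 2] by (auto simp: indicator_def)
  qed (auto intro!: integrable_mult_right integrable_real_indicator)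
  then show ?thesis by simp
qed

text \<open>\<open>f\<close> is clamped to a bounded range first. A measurable function is an almost
  everywhere limit of continuous functions, and clamping these too gives the constant bound for
  dominated convergence.\<close>

lemma loc_L2_dense:
  fixes f :: "real^'d::finite \<Rightarrow> real"
  assumes f: "loc_L2 f" and \<delta>: "\<delta> > 0"
  obtains c where "continuous_on UNIV c" "loc_L2 c" "en R (\<lambda>x. f x - c x) < \<delta>"
proof -
  have fm [measurable]: "f \<in> borel_measurable borel" using f by (simp add: loc_L2_iff)
  define cl where "cl = (\<lambda>M t::real. max (- M) (min M t))"
  have cl_cont: "continuous_on UNIV (cl M)" for M
    unfolding cl_def by (intro continuous_intros)
  have [measurable]: "cl M \<in> borel_measurable borel" for M
    by (rule borel_measurable_continuous_onI[OF cl_cont])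
  have cl_bd: "\<bar>cl M t\<bar> \<le> \<bar>M\<bar>" for M t by (auto simp: cl_def)
  have L2cl: "loc_L2 (\<lambda>x. cl M (g x))" if "g \<in> borel_measurable borel" for M and g :: "real^'d \<Rightarrow> real"
    by (rule loc_L2_bounded[of _ "\<bar>M\<bar>"]) (use that cl_bd in auto)
  have "(\<lambda>n. en R (\<lambda>x. f x - cl (real n) (f x))) \<longlonglongrightarrow> (\<integral>x. 0 \<partial>(lborel :: (real^'d) measure))"
    unfolding en_def
  proof (rule integral_dominated_convergence[where w = "\<lambda>x. indicator (ball 0 R) x * (f x)\<^sup>2"])
    show "AE x in lborel. (\<lambda>n. indicator (ball 0 R) x * (f x - cl (real n) (f x))\<^sup>2) \<longlonglongrightarrow> 0"
    proof (rule AE_I2, rule tendsto_eventually)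
      fix x
      obtain N where "\<bar>f x\<bar> < real N" using reals_Archimedean2 by blast
      then show "\<forall>\<^sub>F n in sequentially. indicator (ball 0 R) x * (f x - cl (real n) (f x))\<^sup>2 = 0"
        by (intro eventually_sequentiallyI[of N]) (auto simp: cl_def)
    qed
    show "AE x in lborel. norm (indicator (ball 0 R) x * (f x - cl (real n) (f x))\<^sup>2) \<le> indicator (ball 0 R) x * (f x)\<^sup>2" for n
    proof (intro always_eventually allI)
      fix x
      have "\<bar>f x - cl (real n) (f x)\<bar> \<le> \<bar>f x\<bar>" by (auto simp: cl_def)
      from power_mono[OF this, of 2] show "norm (indicator (ball 0 R) x * (f x - cl (real n) (f x))\<^sup>2) \<le> indicator (ball 0 R) x * (f x)\<^sup>2"
        by (auto simp: indicator_def)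
    qed
  qed (use en_integrable[OF f] in auto)
  \<comment> \<open>\<open>en_add3\<close> costs a factor 3, so two errors below \<delta>/6 stay
    below \<delta> together.\<close>
  then have "\<forall>\<^sub>F n in sequentially. en R (\<lambda>x. f x - cl (real n) (f x)) < \<delta> / 6"
    using \<delta> by (intro order_tendstoD) auto
  then obtain M where M: "en R (\<lambda>x. f x - cl (real M) (f x)) < \<delta> / 6"
    by (auto simp: eventually_sequentially)
  have "f \<in> borel_measurable lebesgue" using fm by (simp add: measurable_completion)
  then have "f measurable_on UNIV" by (intro lebesgue_measurable_imp_measurable_on) auto
  then obtain Z g where Z: "negligible Z" and g: "\<And>n. continuous_on UNIV (g n)"
    and lim: "\<And>x. x \<notin> Z \<Longrightarrow> (\<lambda>n. g n x) \<longlonglongrightarrow> f x"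
    unfolding measurable_on_def by auto
  have gm [measurable]: "g n \<in> borel_measurable borel" for n by (rule borel_measurable_continuous_onI[OF g])
  have AEZ: "AE x in lborel. x \<notin> Z"
    using Z AE_not_in[of Z lebesgue] by (simp add: negligible_iff_null_sets AE_completion_iff)
  have "(\<lambda>n. en R (\<lambda>x. cl (real M) (f x) - cl (real M) (g n x))) \<longlonglongrightarrow> (\<integral>x. 0 \<partial>(lborel :: (real^'d) measure))"
    unfolding en_def
  proof (rule integral_dominated_convergence[where w = "\<lambda>x. (2 * real M)\<^sup>2 * indicator (ball 0 R) x"])
    show "AE x in lborel. (\<lambda>n. indicator (ball 0 R) x * (cl (real M) (f x) - cl (real M) (g n x))\<^sup>2) \<longlonglongrightarrow> 0"
      using AEZ
    proof eventually_elim
      case (elim x)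
      have "isCont (cl (real M)) (f x)" using cl_cont by (simp add: continuous_on_eq_continuous_at)
      from isCont_tendsto_compose[OF this lim[OF elim]]
      have "(\<lambda>n. indicator (ball 0 R) x * (cl (real M) (f x) - cl (real M) (g n x))\<^sup>2)
        \<longlonglongrightarrow> indicator (ball 0 R) x * (cl (real M) (f x) - cl (real M) (f x))\<^sup>2"
        by (intro tendsto_intros)
      then show ?case by simp
    qed
    show "AE x in lborel. norm (indicator (ball 0 R) x * (cl (real M) (f x) - cl (real M) (g n x))\<^sup>2)
        \<le> (2 * real M)\<^sup>2 * indicator (ball 0 R) x" for n
    proof (intro always_eventually allI)
      fix x
      have "\<bar>cl (real M) (f x) - cl (real M) (g n x)\<bar> \<le> 2 * real M" by (auto simp: cl_def)
      from power_mono[OF this, of 2] show "norm (indicator (ball 0 R) x * (cl (real M) (f x) - cl (real M) (g n x))\<^sup>2)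
        \<le> (2 * real M)\<^sup>2 * indicator (ball 0 R) x"
        by (auto simp: indicator_def)
    qed
    show "integrable lborel (\<lambda>x::real^'d. (2 * real M)\<^sup>2 * indicator (ball 0 R) x)"
      by (intro integrable_mult_right integrable_real_indicator) auto
  qed measurable
  then have "\<forall>\<^sub>F n in sequentially. en R (\<lambda>x. cl (real M) (f x) - cl (real M) (g n x)) < \<delta> / 6"
    using \<delta> by (intro order_tendstoD) auto
  then obtain n where n: "en R (\<lambda>x. cl (real M) (f x) - cl (real M) (g n x)) < \<delta> / 6"
    by (auto simp: eventually_sequentially)
  show thesis
  proof (rule that[of "\<lambda>x. cl (real M) (g n x)"])
    show "continuous_on UNIV (\<lambda>x. cl (real M) (g n x))"
      by (rule continuous_on_compose2[OF cl_cont g]) auto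
    show "loc_L2 (\<lambda>x. cl (real M) (g n x))" by (rule L2cl[OF gm])
    have "en R (\<lambda>x. (f x - cl (real M) (f x)) + (cl (real M) (f x) - cl (real M) (g n x)) + 0)
      \<le> 3 * (en R (\<lambda>x. f x - cl (real M) (f x)) + en R (\<lambda>x. cl (real M) (f x) - cl (real M) (g n x)) + en R (\<lambda>_::real^'d. 0))"
      by (intro en_add3 loc_L2_diff L2cl f fm gm loc_L2_const)
    then show "en R (\<lambda>x. f x - cl (real M) (g n x)) < \<delta>" using M n by (simp add: en_def)
  qed
qed

text \<open>The kernel averages values of \<open>c\<close> at distance below \<epsilon>; uniform
  continuity on the ball of radius R + 1 makes d independent of the kernel.\<close>

lemma conv_uniform:
  fixes c :: "real^'d::finite \<Rightarrow> real"
  assumes c: "continuous_on UNIV c" "loc_L2 c" and "\<delta> > 0"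
  obtains d where "d > 0" "\<And>(k :: real^'d \<Rightarrow> real) \<epsilon> y. mollifier k \<epsilon> \<Longrightarrow> \<epsilon> \<le> d \<Longrightarrow> y \<in> ball 0 R \<Longrightarrow> \<bar>conv k c y - c y\<bar> \<le> \<delta>"
proof -
  have "uniformly_continuous_on (cball 0 (R + 1)) c"
    by (intro compact_uniformly_continuous continuous_on_subset[OF c(1)]) auto
  then obtain d where d: "d > 0" "\<And>x y. x \<in> cball 0 (R + 1) \<Longrightarrow> y \<in> cball 0 (R + 1) \<Longrightarrow> dist y x < d \<Longrightarrow> dist (c y) (c x) < \<delta>"
    using \<open>\<delta> > 0\<close> unfolding uniformly_continuous_on_def by meson
  show thesis
  proof (rule that[OF d(1)])
    fix k :: "real^'d \<Rightarrow> real" and \<epsilon> and y :: "real^'d" assume "mollifier k \<epsilon>" and e: "\<epsilon> \<le> d" and y: "y \<in> ball 0 R"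
    interpret mollifier k \<epsilon> by fact
    have ci: "loc_int c" using c(2) by (rule loc_int_of_L2)
    have "conv k c y - c y = conv k (\<lambda>x. c x - c y) y"
      using conv_diff[OF ci loc_int_const, of "c y" y] conv_const by simp
    also have "\<bar>\<dots>\<bar> \<le> (\<integral>x. k (y - x) * \<delta> \<partial>lborel)"
      unfolding conv_def real_norm_def[symmetric]
    proof (rule order_trans[OF integral_norm_bound integral_mono])
      show "integrable lborel (\<lambda>x. norm (k (y - x) * (c x - c y)))"
        by (intro integrable_norm conv_int loc_int_diff ci loc_int_const)
      show "integrable lborel (\<lambda>x. k (y - x) * \<delta>)" by (intro conv_int loc_int_const)
      fix x
      show "norm (k (y - x) * (c x - c y)) \<le> k (y - x) * \<delta>"
      proof (cases "norm (y - x) \<ge> \<epsilon>")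
        case False
        then have "norm x < R + 1" "dist x y < d"
          using y e \<epsilon> norm_triangle_ineq2[of x y] by (auto simp: norm_minus_commute dist_norm)
        then have "\<bar>c x - c y\<bar> \<le> \<delta>" using d(2)[of y x] y by (simp add: dist_real_def)
        then show ?thesis using k_nonneg by (simp add: abs_mult mult_left_mono)
      qed (simp add: k_supp)
    qed
    also have "\<dots> = \<delta>" using conv_const[of \<delta> y] by (simp add: conv_def)
    finally show "\<bar>conv k c y - c y\<bar> \<le> \<delta>" .
  qed
qed

text \<open>With c continuous and close to f, the error splits into the mollified f - c, the
  mollification error of c, and c - f. The outer two are small by the choice of c, the middle one by
  uniform continuity.\<close>

lemma conv_converges:
  fixes f :: "real^'d::finite \<Rightarrow> real"
  assumes m: "\<And>n. mollifier (k n) (e n)" and e: "e \<longlonglongrightarrow> 0" and f: "loc_L2 f"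
  shows "(\<lambda>n. en R (\<lambda>x. conv (k n) f x - f x)) \<longlonglongrightarrow> 0"
proof (rule order_tendstoI)
  fix a :: real assume "a < 0"
  then show "\<forall>\<^sub>F n in sequentially. a < en R (\<lambda>x. conv (k n) f x - f x)"
    using en_nonneg by (intro always_eventually) (auto intro: less_le_trans)
next
  fix a :: real assume a: "0 < a"
  define V where "V = measure lborel (ball (0::real^'d) R)"
  have V: "V \<ge> 0" by (simp add: V_def)
  obtain c where c: "continuous_on UNIV c" "loc_L2 c" "en (R + 1) (\<lambda>x. f x - c x) < a / 9"
    using loc_L2_dense[OF f, of "a / 9" "R + 1"] a by auto
  \<comment> \<open>A pointwise error \<delta> then has energy below a/9 on the ball of volume
    \<open>V\<close>; three such energies with the factor 3 of \<open>en_add3\<close> stay below a.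
    The 1 guards against a vanishing volume.\<close>
  define \<delta> where "\<delta> = sqrt (a / (9 * (V + 1)))"
  have \<delta>: "\<delta> > 0" "\<delta>\<^sup>2 * V < a / 9"
  proof -
    show "\<delta> > 0" using a V by (simp add: \<delta>_def)
    have eq: "\<delta>\<^sup>2 = a / (9 * (V + 1))" using a V by (simp add: \<delta>_def)
    have "\<delta>\<^sup>2 > 0" unfolding eq using a V by simp
    moreover have "\<delta>\<^sup>2 * (9 * (V + 1)) = a" unfolding eq using V by simp
    moreover have "\<delta>\<^sup>2 * (9 * (V + 1)) = 9 * (\<delta>\<^sup>2 * V) + 9 * \<delta>\<^sup>2" by (simp add: algebra_simps)
    ultimately show "\<delta>\<^sup>2 * V < a / 9" by linarith
  qed
  obtain d where d: "d > 0" "\<And>(k :: real^'d \<Rightarrow> real) \<epsilon> y. mollifier k \<epsilon> \<Longrightarrow> \<epsilon> \<le> d \<Longrightarrow> y \<in> ball 0 R \<Longrightarrow> \<bar>conv k c y - c y\<bar> \<le> \<delta>"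
    using conv_uniform[OF c(1,2) \<delta>(1)] by blast
  have "\<forall>\<^sub>F n in sequentially. e n < d" using e d(1) by (rule order_tendstoD)
  then show "\<forall>\<^sub>F n in sequentially. en R (\<lambda>x. conv (k n) f x - f x) < a"
  proof eventually_elim
    case (elim n)
    interpret mollifier "k n" "e n" by (rule m)
    have fc: "loc_L2 (\<lambda>x. f x - c x)" by (intro loc_L2_diff f c)
    have eq: "(\<lambda>x. conv (k n) f x - f x) = (\<lambda>x. conv (k n) (\<lambda>x. f x - c x) x + (conv (k n) c x - c x) + - 1 * (f x - c x))"
      using conv_diff[OF loc_int_of_L2[OF f] loc_int_of_L2[OF c(2)]] by (simp add: fun_eq_iff)
    have "en R (\<lambda>x. conv (k n) f x - f x)
      \<le> 3 * (en R (conv (k n) (\<lambda>x. f x - c x)) + en R (\<lambda>x. conv (k n) c x - c x) + en R (\<lambda>x. - 1 * (f x - c x)))"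
      unfolding eq by (intro en_add3 loc_L2_conv fc loc_L2_diff loc_L2_cmult c f)
    moreover have "en R (conv (k n) (\<lambda>x. f x - c x)) \<le> en (R + 1) (\<lambda>x. f x - c x)" by (rule en_conv_le[OF fc])
    moreover have "en R (\<lambda>x. conv (k n) c x - c x) \<le> \<delta>\<^sup>2 * V"
      unfolding V_def using d(2)[OF m] elim by (intro en_le_const loc_L2_diff loc_L2_conv c) auto
    moreover have "en R (\<lambda>x. - 1 * (f x - c x)) \<le> en (R + 1) (\<lambda>x. f x - c x)"
      using en_mono_radius[OF fc, of R "R + 1"] by (simp add: en_def power2_commute)
    moreover have "x \<le> 3 * (p + q + r) \<Longrightarrow> p \<le> s \<Longrightarrow> q \<le> t \<Longrightarrow> r \<le> s \<Longrightarrow> s < a / 9 \<Longrightarrow> t < a / 9 \<Longrightarrow> x < a" for x p q r s t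
      by simp
    ultimately show ?case using c(3) \<delta>(2) by blast
  qed
qed

section \<open>Comparison with the approximate corrector\<close>

definition cvg :: "real \<Rightarrow> (nat \<Rightarrow> real^'d::finite \<Rightarrow> real) \<Rightarrow> (real^'d \<Rightarrow> real) \<Rightarrow> bool" where
  "cvg R f g \<longleftrightarrow> (\<forall>n. loc_L2 (f n)) \<and> loc_L2 g \<and> (\<lambda>n. ball_avg (\<lambda>x. (f n x - g x)\<^sup>2) R) \<longlonglongrightarrow> 0"

lemma loc_int_sq: "loc_L2 f \<Longrightarrow> loc_int (\<lambda>x. (f x)\<^sup>2)"
  by (simp add: loc_L2_iff)

lemma ball_avg_nonneg: "loc_int f \<Longrightarrow> (\<And>x. f x \<ge> 0) \<Longrightarrow> ball_avg f R \<ge> 0"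
  using ball_avg_mono[OF loc_int_const[of 0], of f R] by (simp add: ball_avg_def)

lemma cvg_add:
  assumes "cvg R f g" "cvg R f' g'" shows "cvg R (\<lambda>n x. f n x + f' n x) (\<lambda>x. g x + g' x)"
  unfolding cvg_def
proof (intro conjI allI)
  have L: "\<And>n. loc_L2 (f n)" "loc_L2 g" "\<And>n. loc_L2 (f' n)" "loc_L2 g'" using assms by (auto simp: cvg_def)
  show "loc_L2 (\<lambda>x. f n x + f' n x)" "loc_L2 (\<lambda>x. g x + g' x)" for n by (intro loc_L2_add L)+
  let ?d = "\<lambda>n x. f n x - g x" and ?d' = "\<lambda>n x. f' n x - g' x"
  have Ld: "loc_int (\<lambda>x. (?d n x)\<^sup>2)" "loc_int (\<lambda>x. (?d' n x)\<^sup>2)" for n by (intro loc_int_sq loc_L2_diff L)+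
  have le: "ball_avg (\<lambda>x. (f n x + f' n x - (g x + g' x))\<^sup>2) R \<le> 2 * ball_avg (\<lambda>x. (?d n x)\<^sup>2) R + 2 * ball_avg (\<lambda>x. (?d' n x)\<^sup>2) R" for n
  proof -
    have "ball_avg (\<lambda>x. (f n x + f' n x - (g x + g' x))\<^sup>2) R \<le> ball_avg (\<lambda>x. 2 * (?d n x)\<^sup>2 + 2 * (?d' n x)\<^sup>2) R"
    proof (rule ball_avg_mono)
      show "loc_int (\<lambda>x. (f n x + f' n x - (g x + g' x))\<^sup>2)" by (intro loc_int_sq loc_L2_diff loc_L2_add L)
      show "loc_int (\<lambda>x. 2 * (?d n x)\<^sup>2 + 2 * (?d' n x)\<^sup>2)" by (intro loc_int_add loc_int_cmult Ld)
      show "(f n x + f' n x - (g x + g' x))\<^sup>2 \<le> 2 * (?d n x)\<^sup>2 + 2 * (?d' n x)\<^sup>2" for x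
        using sum_squares_bound[of "?d n x" "?d' n x"] by (simp add: power2_eq_square algebra_simps)
    qed
    also have "\<dots> = 2 * ball_avg (\<lambda>x. (?d n x)\<^sup>2) R + 2 * ball_avg (\<lambda>x. (?d' n x)\<^sup>2) R"
      by (simp add: ball_avg_add ball_avg_cmult loc_int_cmult Ld)
    finally show ?thesis .
  qed
  have "(\<lambda>n. 2 * ball_avg (\<lambda>x. (?d n x)\<^sup>2) R + 2 * ball_avg (\<lambda>x. (?d' n x)\<^sup>2) R) \<longlonglongrightarrow> 2 * 0 + 2 * 0"
    using assms by (intro tendsto_intros) (auto simp: cvg_def)
  then have lim: "(\<lambda>n. 2 * ball_avg (\<lambda>x. (?d n x)\<^sup>2) R + 2 * ball_avg (\<lambda>x. (?d' n x)\<^sup>2) R) \<longlonglongrightarrow> 0" by simp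
  show "(\<lambda>n. ball_avg (\<lambda>x. (f n x + f' n x - (g x + g' x))\<^sup>2) R) \<longlonglongrightarrow> 0"
    by (rule tendsto_sandwich[OF _ _ tendsto_const lim])
       (auto intro!: always_eventually ball_avg_nonneg loc_int_sq loc_L2_diff loc_L2_add L le)
qed

lemma cvg_mult_bounded:
  assumes "cvg R f g" and b: "b \<in> borel_measurable borel" "\<And>x. \<bar>b x\<bar> \<le> M"
  shows "cvg R (\<lambda>n x. b x * f n x) (\<lambda>x. b x * g x)"
  unfolding cvg_def
proof (intro conjI allI)
  have L: "\<And>n. loc_L2 (f n)" "loc_L2 g" using assms by (auto simp: cvg_def)
  show "loc_L2 (\<lambda>x. b x * f n x)" "loc_L2 (\<lambda>x. b x * g x)" for n by (intro loc_L2_mult_bounded[OF _ b] L)+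
  let ?d = "\<lambda>n x. f n x - g x"
  have Ld: "loc_int (\<lambda>x. (?d n x)\<^sup>2)" for n by (intro loc_int_sq loc_L2_diff L)
  have Lb: "loc_int (\<lambda>x. (b x * f n x - b x * g x)\<^sup>2)" for n
    by (intro loc_int_sq loc_L2_diff loc_L2_mult_bounded[OF _ b] L)
  have le: "ball_avg (\<lambda>x. (b x * f n x - b x * g x)\<^sup>2) R \<le> M\<^sup>2 * ball_avg (\<lambda>x. (?d n x)\<^sup>2) R" for n
    unfolding ball_avg_cmult[symmetric]
  proof (rule ball_avg_mono[OF Lb loc_int_cmult[OF Ld]])
    fix x
    have "(b x * f n x - b x * g x)\<^sup>2 = (b x)\<^sup>2 * (?d n x)\<^sup>2" by (simp add: power_mult_distrib right_diff_distrib[symmetric])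
    also have "\<dots> \<le> M\<^sup>2 * (?d n x)\<^sup>2" using power_mono[OF b(2)[of x] abs_ge_zero, of 2] by (intro mult_right_mono) auto
    finally show "(b x * f n x - b x * g x)\<^sup>2 \<le> M\<^sup>2 * (?d n x)\<^sup>2" .
  qed
  have "(\<lambda>n. M\<^sup>2 * ball_avg (\<lambda>x. (?d n x)\<^sup>2) R) \<longlonglongrightarrow> M\<^sup>2 * 0"
    using assms by (intro tendsto_intros) (auto simp: cvg_def)
  then have lim: "(\<lambda>n. M\<^sup>2 * ball_avg (\<lambda>x. (?d n x)\<^sup>2) R) \<longlonglongrightarrow> 0" by simp
  show "(\<lambda>n. ball_avg (\<lambda>x. (b x * f n x - b x * g x)\<^sup>2) R) \<longlonglongrightarrow> 0"
    by (rule tendsto_sandwich[OF _ _ tendsto_const lim]) (auto intro!: always_eventually ball_avg_nonneg Lb le)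
qed

lemma ball_avg_sum: "(\<And>k. k \<in> S \<Longrightarrow> loc_int (f k)) \<Longrightarrow> ball_avg (\<lambda>x. \<Sum>k\<in>S. f k x) R = (\<Sum>k\<in>S. ball_avg (f k) R)"
proof (induction S rule: infinite_finite_induct)
  case (insert k S)
  then have "ball_avg (\<lambda>x. f k x + (\<Sum>k\<in>S. f k x)) R = ball_avg (f k) R + ball_avg (\<lambda>x. \<Sum>k\<in>S. f k x) R"
    by (intro ball_avg_add loc_int_sum) auto
  with insert show ?case by simp
qed (simp_all add: ball_avg_def)

lemma nrm_cvg:
  fixes F :: "nat \<Rightarrow> real^'d::finite \<Rightarrow> 'k::finite \<Rightarrow> real"
  assumes c: "\<And>k. cvg R (\<lambda>n x. F n x k) (\<lambda>x. G x k)"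
  shows "lL2 (F n)" "lL2 G" "(\<lambda>n. bal.nrm R (\<lambda>x k. F n x k - G x k)) \<longlonglongrightarrow> 0"
proof -
  have L: "loc_L2 (\<lambda>x. F n x k)" "loc_L2 (\<lambda>x. G x k)" for n k using c[of k] by (auto simp: cvg_def)
  then show "lL2 (F n)" "lL2 G" by (auto simp: lL2_def)
  have eq: "bip R (\<lambda>x k. F n x k - G x k) (\<lambda>x k. F n x k - G x k) = (\<Sum>k\<in>UNIV. ball_avg (\<lambda>x. (F n x k - G x k)\<^sup>2) R)" for n
    unfolding bip_def power2_eq_square[symmetric] by (intro ball_avg_sum loc_int_sq loc_L2_diff L)
  have "(\<lambda>n. sqrt (\<Sum>k\<in>UNIV. ball_avg (\<lambda>x. (F n x k - G x k)\<^sup>2) R)) \<longlonglongrightarrow> sqrt (\<Sum>k\<in>(UNIV::'k set). 0)"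
    using c by (intro tendsto_real_sqrt tendsto_sum) (auto simp: cvg_def)
  then show "(\<lambda>n. bal.nrm R (\<lambda>x k. F n x k - G x k)) \<longlonglongrightarrow> 0" unfolding bal.nrm_def eq by simp
qed

lemma cvg_conv:
  assumes "\<And>n. mollifier (k n) (e n)" and "e \<longlonglongrightarrow> 0" and f: "loc_L2 f"
  shows "cvg R (\<lambda>n. conv (k n) f) f"
proof -
  have "loc_L2 (conv (k n) f)" for n
    using mollifier.loc_L2_conv[OF assms(1) f] .
  moreover have "(\<lambda>n. ball_avg (\<lambda>x. (conv (k n) f x - f x)\<^sup>2) R) \<longlonglongrightarrow> 0"
    unfolding en_ball_avg using tendsto_divide_zero[OF conv_converges[OF assms, of R]] .
  ultimately show ?thesis using f by (simp add: cvg_def)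
qed

lemma mollifier_sequence:
  obtains k :: "nat \<Rightarrow> real^'d::finite \<Rightarrow> real" and e where
    "\<And>n. mollifier (k n) (e n)" "\<And>n. e n < 1" "e \<longlonglongrightarrow> 0"
proof -
  define e where "e = (\<lambda>n. 1 / real (Suc (Suc n)))"
  have e: "e n > 0" "e n < 1" for n by (simp_all add: e_def)
  have "\<exists>k :: real^'d \<Rightarrow> real. mollifier k (e n)" for n
    by (rule mollifier_exists[OF e(1)[of n]]) (use e[of n] in \<open>auto simp: mollifier_def\<close>)
  then obtain k :: "nat \<Rightarrow> real^'d \<Rightarrow> real" where "\<And>n. mollifier (k n) (e n)" by metis
  moreover have "e \<longlonglongrightarrow> 0" unfolding e_def by (intro LIMSEQ_Suc[OF LIMSEQ_Suc[OF lim_1_over_n]])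
  ultimately show thesis using that e(2) by blast
qed

text \<open>Testing the mollified equation with the compactly supported \<open>C\<^sup>1\<close> field \<open>\<eta> (k * w)\<close> and removing
  the mollification yields the energy identity without any density of smooth functions in \<open>H\<^sup>1\<close>.\<close>

lemma energy_identity:
  fixes w :: "real^'d::finite \<Rightarrow> 'm::finite \<Rightarrow> real" and J F :: "real^'d \<Rightarrow> ('d \<times> 'm) + 'm \<Rightarrow> real"
    and \<eta> :: "real^'d \<Rightarrow> real" and \<eta>' :: "'d \<Rightarrow> real^'d \<Rightarrow> real"
  assumes w: "lL2 w" and J: "lL2 J" and F: "lL2 F" and Jr: "\<And>x \<alpha>. J x (Inr \<alpha>) = \<kappa> * w x \<alpha>"
    and weak_grad: "\<And>\<phi> i \<alpha>. test_fun \<phi> \<Longrightarrow> (\<integral>x. w x \<alpha> * partial i \<phi> x \<partial>lborel) = - (\<integral>x. J x (Inl (i, \<alpha>)) * \<phi> x \<partial>lborel)"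
    and weak_eq: "\<And>\<phi> \<alpha>. test_fun \<phi> \<Longrightarrow>
      (\<integral>x. (\<Sum>i\<in>UNIV. F x (Inl (i, \<alpha>)) * partial i \<phi> x) + \<kappa> * F x (Inr \<alpha>) * \<phi> x \<partial>lborel) = 0"
    and \<eta>: "continuous_on UNIV \<eta>" "\<And>i. continuous_on UNIV (\<eta>' i)"
      "\<And>x i. ((\<lambda>t. \<eta> (x + t *\<^sub>R axis i 1)) has_real_derivative \<eta>' i x) (at 0)"
      "\<And>x. norm x \<ge> R \<Longrightarrow> \<eta> x = 0" "\<And>x i. norm x \<ge> R \<Longrightarrow> \<eta>' i x = 0"
  shows "bip R F (\<lambda>x s. \<eta> x * J x s + (case s of Inl (i, \<alpha>) \<Rightarrow> \<eta>' i x * w x \<alpha> | Inr _ \<Rightarrow> 0)) = 0"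
proof -
  define Z where "Z = (\<lambda>(w :: real^'d \<Rightarrow> 'm \<Rightarrow> real) (J :: real^'d \<Rightarrow> ('d \<times> 'm) + 'm \<Rightarrow> real) x s.
     \<eta> x * J x s + (case s of Inl (i, \<alpha>) \<Rightarrow> \<eta>' i x * w x \<alpha> | Inr _ \<Rightarrow> 0))"
  define mw where "mw = (\<lambda>(k :: real^'d \<Rightarrow> real) x \<alpha>. conv k (\<lambda>x. w x \<alpha>) x)"
  define mJ where "mJ = (\<lambda>(k :: real^'d \<Rightarrow> real) x s. conv k (\<lambda>x. J x s) x)"
  \<comment> \<open>The flux is mollified as a whole, coefficients included, so no commutator
    between coefficients and mollifier appears.\<close>
  define mF where "mF = (\<lambda>(k :: real^'d \<Rightarrow> real) x s. conv k (\<lambda>x. F x s) x)"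
  have lw: "loc_int (\<lambda>x. w x \<alpha>)" for \<alpha> using w by (intro loc_int_of_L2) (simp add: lL2_def)
  have lJ: "loc_int (\<lambda>x. J x s)" for s using J by (intro loc_int_of_L2) (simp add: lL2_def)
  have lF: "loc_int (\<lambda>x. F x s)" for s using F by (intro loc_int_of_L2) (simp add: lL2_def)
  have zero: "bip R (mF k) (Z (mw k) (mJ k)) = 0" if m: "mollifier k \<epsilon>" and "\<epsilon> < 1" for k \<epsilon>
  proof -
    interpret mollifier k \<epsilon> by fact
    have sm: "smooth_upto 1 k" by (rule smooth)
    have dk: "((\<lambda>t. k (x + t *\<^sub>R axis i 1)) has_real_derivative partial i k x) (at 0)" for i x
      using sm by simp
    have ksupp: "k x = 0" "partial i k x = 0" if "norm x \<ge> 1" for x i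
      using that k_supp \<epsilon> partial_k_supp[OF that \<open>\<epsilon> < 1\<close>] by auto
    have test: "test_fun (\<lambda>x. k (y - x))" for y by (rule test_fun_reflect[OF smooth k_supp])
    have dconv: "((\<lambda>t. conv k f (y + t *\<^sub>R axis i 1)) has_real_derivative conv (partial i k) f y) (at 0)"
      if "loc_int f" for f i y
      by (rule conv_deriv[OF k_cont partial_k_cont dk ksupp that])
    have cont: "continuous_on UNIV (conv k f)" "continuous_on UNIV (conv (partial i k) f)" if "loc_int f" for f i
      using conv_continuous[OF k_cont ksupp(1) that] conv_continuous[OF partial_k_cont ksupp(2) that] by auto
    have int: "integrable lborel (\<lambda>x. partial i k (y - x) * f x)" if "loc_int f" for f i y
      by (rule conv_integrable[OF partial_k_cont ksupp(2) that])
    \<comment> \<open>The weak gradient tested with the reflected kernel: together with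
      \<open>dconv\<close> it makes the mollified gradient the classical derivative of the mollified
      field.\<close>
    have gradw: "conv (partial i k) (\<lambda>x. w x \<alpha>) y = mJ k y (Inl (i, \<alpha>))" for i \<alpha> y
      using weak_grad[OF test, of \<alpha> i y] unfolding partial_reflect[OF sm]
      by (simp add: conv_def mJ_def mult.commute)
    \<comment> \<open>In the same way the weak equation becomes a pointwise divergence identity for
      the mollified flux.\<close>
    have divF: "(\<Sum>i\<in>UNIV. conv (partial i k) (\<lambda>x. F x (Inl (i, \<alpha>))) y) = \<kappa> * mF k y (Inr \<alpha>)" for \<alpha> y
    proof -
      have "0 = (\<integral>x. (\<Sum>i\<in>UNIV. - (partial i k (y - x) * F x (Inl (i, \<alpha>)))) + \<kappa> * (k (y - x) * F x (Inr \<alpha>)) \<partial>lborel)"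
        using weak_eq[OF test, of \<alpha> y] unfolding partial_reflect[OF sm] by (simp add: mult_ac)
      also have "\<dots> = (\<Sum>i\<in>UNIV. - conv (partial i k) (\<lambda>x. F x (Inl (i, \<alpha>))) y) + \<kappa> * mF k y (Inr \<alpha>)"
        unfolding conv_def mF_def
        by (subst Bochner_Integration.integral_add)
           (auto intro!: Bochner_Integration.integrable_sum integrable_minus int[OF lF] integrable_mult_right conv_int[OF lF]
             simp: Bochner_Integration.integral_sum int[OF lF])
      finally show ?thesis by (simp add: sum_negf)
    qed
    \<comment> \<open>The i-th derivative of the compactly supported product of \<eta>, the
      mollified field and a component of the mollified flux; its integral is zero. Summed over i and
      \<alpha>, these derivatives are exactly the integrand, by \<open>divF\<close>.\<close>
    define v' where "v' = (\<lambda>i \<alpha> x. \<eta>' i x * mw k x \<alpha> * mF k x (Inl (i, \<alpha>)) + \<eta> x * mJ k x (Inl (i, \<alpha>)) * mF k x (Inl (i, \<alpha>))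
        + \<eta> x * mw k x \<alpha> * conv (partial i k) (\<lambda>x. F x (Inl (i, \<alpha>))) x)"
    have contmw: "continuous_on UNIV (\<lambda>x. mw k x \<alpha>)" for \<alpha> unfolding mw_def using cont(1)[OF lw] .
    have contmJ: "continuous_on UNIV (\<lambda>x. mJ k x s)" for s unfolding mJ_def using cont(1)[OF lJ] .
    have contmF: "continuous_on UNIV (\<lambda>x. mF k x s)" for s unfolding mF_def using cont(1)[OF lF] .
    have v'_cont: "continuous_on UNIV (v' i \<alpha>)" for i \<alpha>
      unfolding v'_def by (intro continuous_intros \<eta> contmw contmJ contmF cont(2) lF)
    have v'_zero: "v' i \<alpha> x = 0" if "norm x \<ge> R" for i \<alpha> x
      using \<eta>(4,5)[OF that] by (simp add: v'_def)
    have v'_int: "(\<integral>x. v' i \<alpha> x \<partial>lborel) = 0" for i \<alpha>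
    proof (rule integral_partial_zero[where v = "\<lambda>x. \<eta> x * mw k x \<alpha> * mF k x (Inl (i, \<alpha>))" and R = R, OF _ v'_cont _ _ v'_zero])
      show "continuous_on UNIV (\<lambda>x. \<eta> x * mw k x \<alpha> * mF k x (Inl (i, \<alpha>)))"
        by (intro continuous_intros \<eta> contmw contmF)
      fix x
      have 1: "((\<lambda>t. mw k (x + t *\<^sub>R axis i 1) \<alpha>) has_real_derivative mJ k x (Inl (i, \<alpha>))) (at 0)"
        using dconv[OF lw, of \<alpha> x i] unfolding gradw mw_def .
      have 2: "((\<lambda>t. mF k (x + t *\<^sub>R axis i 1) (Inl (i, \<alpha>))) has_real_derivative conv (partial i k) (\<lambda>x. F x (Inl (i, \<alpha>))) x) (at 0)"
        using dconv[OF lF] unfolding mF_def .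
      have "((\<lambda>t. \<eta> (x + t *\<^sub>R axis i 1) * mw k (x + t *\<^sub>R axis i 1) \<alpha> * mF k (x + t *\<^sub>R axis i 1) (Inl (i, \<alpha>))) has_real_derivative
          (\<eta>' i x * mw k (x + 0 *\<^sub>R axis i 1) \<alpha> + mJ k x (Inl (i, \<alpha>)) * \<eta> (x + 0 *\<^sub>R axis i 1)) * mF k (x + 0 *\<^sub>R axis i 1) (Inl (i, \<alpha>))
          + conv (partial i k) (\<lambda>x. F x (Inl (i, \<alpha>))) x * (\<eta> (x + 0 *\<^sub>R axis i 1) * mw k (x + 0 *\<^sub>R axis i 1) \<alpha>)) (at 0)"
        by (rule DERIV_mult[OF DERIV_mult[OF \<eta>(3) 1] 2])
      then show "((\<lambda>t. \<eta> (x + t *\<^sub>R axis i 1) * mw k (x + t *\<^sub>R axis i 1) \<alpha> * mF k (x + t *\<^sub>R axis i 1) (Inl (i, \<alpha>))) has_real_derivative v' i \<alpha> x) (at 0)"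
        by (rule DERIV_cong) (simp add: v'_def algebra_simps)
    qed (simp add: \<eta>(4))
    have pointwise: "(\<Sum>s\<in>UNIV. mF k x s * Z (mw k) (mJ k) x s) = (\<Sum>i\<in>UNIV. \<Sum>\<alpha>\<in>UNIV. v' i \<alpha> x)" for x
    proof -
      have mJr: "mJ k x (Inr \<alpha>) = \<kappa> * mw k x \<alpha>" for \<alpha>
        unfolding mJ_def mw_def conv_def by (simp add: Jr mult.left_commute)
      have "(\<Sum>i\<in>UNIV. \<Sum>\<alpha>\<in>UNIV. \<eta> x * mw k x \<alpha> * conv (partial i k) (\<lambda>x. F x (Inl (i, \<alpha>))) x)
          = (\<Sum>\<alpha>\<in>UNIV. \<eta> x * mw k x \<alpha> * (\<kappa> * mF k x (Inr \<alpha>)))"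
        unfolding divF[symmetric] by (subst sum.swap) (simp add: sum_distrib_left)
      then show ?thesis
        by (simp add: v'_def Z_def sum_UNIV_sum sum_UNIV_prod mJr sum.distrib distrib_left mult_ac)
    qed
    have "ball_avg (\<lambda>x. \<Sum>i\<in>UNIV. \<Sum>\<alpha>\<in>UNIV. v' i \<alpha> x) R = 0"
    proof -
      have eq: "indicator (ball 0 R) x *\<^sub>R (\<Sum>i\<in>UNIV. \<Sum>\<alpha>\<in>UNIV. v' i \<alpha> x) = (\<Sum>i\<in>UNIV. \<Sum>\<alpha>\<in>UNIV. v' i \<alpha> x)" for x :: "real^'d"
        using v'_zero[of x] by (cases "norm x < R") auto
      moreover have "(\<integral>x. (\<Sum>i\<in>UNIV. \<Sum>\<alpha>\<in>UNIV. v' i \<alpha> x) \<partial>lborel) = 0"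
        using integrable_continuous_support[OF v'_cont v'_zero] v'_int
        by (subst Bochner_Integration.integral_sum, simp) (simp add: Bochner_Integration.integral_sum)
      ultimately show ?thesis unfolding ball_avg_def set_lebesgue_integral_def eq by simp
    qed
    then show ?thesis unfolding bip_def pointwise .
  qed
  obtain k :: "nat \<Rightarrow> real^'d \<Rightarrow> real" and e where ke: "\<And>n. mollifier (k n) (e n)" "\<And>n. e n < 1" "e \<longlonglongrightarrow> 0"
    by (rule mollifier_sequence[where 'd = 'd]) blast
  obtain L where L: "\<And>x. \<bar>\<eta> x\<bar> \<le> L" using continuous_support_bounded[OF \<eta>(1) \<eta>(4)] by blast
  have m\<eta>: "\<eta> \<in> borel_measurable borel" "\<eta>' i \<in> borel_measurable borel" for i
    using \<eta> by (auto intro: borel_measurable_continuous_onI)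
  have cF: "cvg R (\<lambda>n x. mF (k n) x s) (\<lambda>x. F x s)" for s
    unfolding mF_def by (rule cvg_conv[OF ke(1,3)]) (use F in \<open>simp add: lL2_def\<close>)
  have cw: "cvg R (\<lambda>n x. mw (k n) x \<alpha>) (\<lambda>x. w x \<alpha>)" for \<alpha>
    unfolding mw_def by (rule cvg_conv[OF ke(1,3)]) (use w in \<open>simp add: lL2_def\<close>)
  have cJ: "cvg R (\<lambda>n x. mJ (k n) x s) (\<lambda>x. J x s)" for s
    unfolding mJ_def by (rule cvg_conv[OF ke(1,3)]) (use J in \<open>simp add: lL2_def\<close>)
  have cZ: "cvg R (\<lambda>n x. Z (mw (k n)) (mJ (k n)) x s) (\<lambda>x. Z w J x s)" for s
  proof (cases s)
    case (Inr \<alpha>)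
    then show ?thesis unfolding Z_def using cvg_mult_bounded[OF cJ m\<eta>(1) L, of s] by simp
  next
    case (Inl p)
    obtain i \<alpha> where p: "p = (i, \<alpha>)" by force
    obtain L' where L': "\<And>x. \<bar>\<eta>' i x\<bar> \<le> L'" using continuous_support_bounded[OF \<eta>(2) \<eta>(5)] by blast
    show ?thesis unfolding Z_def Inl p
      using cvg_add[OF cvg_mult_bounded[OF cJ m\<eta>(1) L] cvg_mult_bounded[OF cw m\<eta>(2) L']] by simp
  qed
  have "(\<lambda>n. bip R (mF (k n)) (Z (mw (k n)) (mJ (k n)))) \<longlonglongrightarrow> bip R F (Z w J)"
    by (rule bal.tendsto_B[OF nrm_cvg(1)[OF cF] nrm_cvg(1)[OF cZ] F nrm_cvg(2)[OF cZ] nrm_cvg(3)[OF cF] nrm_cvg(3)[OF cZ]])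
  moreover have "bip R (mF (k n)) (Z (mw (k n)) (mJ (k n))) = 0" for n by (rule zero[OF ke(1,2)])
  ultimately have "bip R F (Z w J) = 0" using LIMSEQ_unique[OF _ tendsto_const] by force
  then show ?thesis by (simp add: Z_def)
qed

section \<open>Cutoff functions and averages of uniformly locally bounded energies\<close>

lemma has_derivative_max_sq: "((\<lambda>s::real. (max 0 s)\<^sup>2) has_real_derivative 2 * max 0 s) (at s)"
proof -
  consider "s < 0" | "s = 0" | "s > 0" by linarith
  then show ?thesis
  proof cases
    case 1
    have "((\<lambda>_. 0::real) has_real_derivative 0) (at s)" by simp
    then have "((\<lambda>s::real. (max 0 s)\<^sup>2) has_real_derivative 0) (at s)"
      by (rule has_field_derivative_transform_within_open[where S = "{..<0}"]) (use 1 in auto)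
    with 1 show ?thesis by simp
  next
    case 3
    have "((\<lambda>s::real. s\<^sup>2) has_real_derivative 2 * s) (at s)" by (auto intro!: derivative_eq_intros)
    then have "((\<lambda>s::real. (max 0 s)\<^sup>2) has_real_derivative 2 * s) (at s)"
      by (rule has_field_derivative_transform_within_open[where S = "{0<..}"]) (use 3 in auto)
    with 3 show ?thesis by simp
  next
    case 2
    have "((\<lambda>h::real. max 0 h) \<longlongrightarrow> max 0 0) (at 0)" by (intro tendsto_intros)
    then have "((\<lambda>h::real. max 0 h) \<longlongrightarrow> 0) (at 0)" by simp
    then have "((\<lambda>h::real. ((max 0 (0 + h))\<^sup>2 - (max 0 0)\<^sup>2) / h) \<longlongrightarrow> 0) (at 0)"
      by (rule Lim_transform_eventually)
         (auto simp: eventually_at_filter max_def power2_eq_square intro!: always_eventually)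
    then show ?thesis unfolding 2 DERIV_def by simp
  qed
qed

text \<open>An explicit cutoff for the ball of radius S. Squaring the positive part makes it C^1
  across the boundary, which is the regularity that \<open>energy_identity\<close> asks of
  \<eta>.\<close>

definition cutoff :: "real \<Rightarrow> real^'d::finite \<Rightarrow> real" where
  "cutoff S x = (max 0 (1 - (x \<bullet> x) / S\<^sup>2))\<^sup>2"

definition cutoff' :: "real \<Rightarrow> 'd \<Rightarrow> real^'d::finite \<Rightarrow> real" where
  "cutoff' S i x = 2 * max 0 (1 - (x \<bullet> x) / S\<^sup>2) * (- (2 * x $ i / S\<^sup>2))"

lemma cutoff_cont: "continuous_on UNIV (cutoff S)" "continuous_on UNIV (cutoff' S i)"
  unfolding cutoff_def cutoff'_def divide_inverse by (intro continuous_intros)+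

lemma cutoff_deriv: "((\<lambda>t. cutoff S (x + t *\<^sub>R axis i 1)) has_real_derivative cutoff' S i x) (at 0)"
proof -
  have "((\<lambda>t. 1 - ((x + t *\<^sub>R axis i 1) \<bullet> (x + t *\<^sub>R axis i 1)) / S\<^sup>2) has_real_derivative - (2 * x $ i / S\<^sup>2)) (at 0)"
    unfolding divide_inverse
    by (auto simp: inner_add_left inner_add_right inner_axis inner_axis' intro!: derivative_eq_intros)
  from DERIV_chain2[OF has_derivative_max_sq this] show ?thesis
    unfolding cutoff_def cutoff'_def by simp
qed

text \<open>For |x| <= S/2 the bracket is at least 3/4, and 9/16 is its square. The gradient bound
  uses |x_i| <= S on the support.\<close>

lemma cutoff_bounds:
  assumes "S > 0"
  shows "0 \<le> cutoff S x" "cutoff S x \<le> 1" "norm x \<ge> S \<Longrightarrow> cutoff S x = 0" "norm x \<ge> S \<Longrightarrow> cutoff' S i x = 0"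
    "\<bar>cutoff' S i x\<bar> \<le> 4 / S" "norm x \<le> S / 2 \<Longrightarrow> 9 / 16 \<le> cutoff S x"
proof -
  let ?m = "max 0 (1 - (x \<bullet> x) / S\<^sup>2)"
  have m: "0 \<le> ?m" "?m \<le> 1" by simp_all
  show "0 \<le> cutoff S x" by (simp add: cutoff_def)
  show "cutoff S x \<le> 1" unfolding cutoff_def using m by (rule power_le_one)
  have out: "?m = 0" if "norm x \<ge> S"
  proof -
    have "S\<^sup>2 \<le> (norm x)\<^sup>2" using that \<open>S > 0\<close> by (intro power_mono) auto
    then show ?thesis using \<open>S > 0\<close> by (simp add: power2_norm_eq_inner)
  qed
  show "cutoff S x = 0" "cutoff' S i x = 0" if "norm x \<ge> S" using out[OF that] by (simp_all add: cutoff_def cutoff'_def)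
  show "\<bar>cutoff' S i x\<bar> \<le> 4 / S"
  proof (cases "norm x \<ge> S")
    case True
    then show ?thesis using out \<open>S > 0\<close> by (simp add: cutoff'_def)
  next
    case False
    have "\<bar>x $ i\<bar> \<le> S" using component_le_norm_cart[of x i] False by linarith
    have "\<bar>cutoff' S i x\<bar> = ?m * (4 * \<bar>x $ i\<bar> / S\<^sup>2)" by (simp add: cutoff'_def abs_mult)
    also have "\<dots> \<le> 1 * (4 * S / S\<^sup>2)"
      using m \<open>\<bar>x $ i\<bar> \<le> S\<close> by (intro mult_mono divide_right_mono) auto
    also have "\<dots> = 4 / S" using \<open>S > 0\<close> by (simp add: power2_eq_square)
    finally show ?thesis .
  qed
  assume x: "norm x \<le> S / 2"
  have "(norm x)\<^sup>2 \<le> (S / 2)\<^sup>2" using x by (intro power_mono) auto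
  then have "x \<bullet> x / S\<^sup>2 \<le> 1 / 4" using \<open>S > 0\<close> by (simp add: power2_norm_eq_inner power_divide field_simps)
  then have "3 / 4 \<le> ?m" by (simp add: le_max_iff_disj)
  from power_mono[OF this, of 2] show "9 / 16 \<le> cutoff S x" by (simp add: cutoff_def power2_eq_square)
qed

lemma measure_ball_scale:
  assumes "r > 0" "R > 0"
  shows "measure lborel (ball (c::real^'d::finite) r) / measure lborel (ball (c'::real^'d) R) = (r / R) ^ CARD('d)"
proof -
  have "unit_ball_vol (real CARD('d)) \<noteq> 0" by (rule less_imp_neq[OF unit_ball_vol_pos, symmetric]) simp
  then show ?thesis using assms by (simp add: content_ball power_divide)
qed

text \<open>The unit-ball bound is integrated over all centres. Tonelli counts each point of the
  ball of radius R with the volume of a unit ball, and only centres within R + 1 contribute; for R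
  >= 1 the quotient (R + 1)/R is at most 2. No covering is chosen.\<close>

lemma ball_avg_bounded_of_unif_loc:
  fixes g :: "real^'d::finite \<Rightarrow> real"
  assumes g: "loc_int g" and nn: "\<And>x. g x \<ge> 0" and M: "\<And>x. set_lebesgue_integral lborel (ball x 1) g \<le> M"
  obtains M' where "\<And>R. R \<ge> 1 \<Longrightarrow> ball_avg g R \<le> M'"
proof -
  have [measurable]: "g \<in> borel_measurable borel" by (rule loc_int_borel[OF g])
  have M0: "M \<ge> 0"
  proof -
    have "0 \<le> set_lebesgue_integral lborel (ball 0 1) g" unfolding set_lebesgue_integral_def using nn
      by (intro integral_nonneg_AE) auto
    with M[of 0] show ?thesis by linarith
  qed
  have int: "integrable lborel (\<lambda>y. indicator (ball x r) y * g y)" for x r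
  proof -
    have "ball x r \<subseteq> ball 0 (norm x + r)"
      using norm_triangle_ineq2 by (auto simp: dist_norm norm_minus_commute) (smt (verit) norm_triangle_ineq2)
    then show ?thesis
      using g set_integrable_subset[of lborel "ball 0 (norm x + r)" g "ball x r"] by (auto simp: loc_int_def set_integrable_def)
  qed
  define V where "V = measure lborel (ball (0::real^'d) 1)"
  have V: "V > 0" by (simp add: V_def)
  have vol: "emeasure lborel (ball (y::real^'d) r) = ennreal (measure lborel (ball y r))" for y r
    by (rule emeasure_eq_ennreal_measure) (rule less_imp_neq[OF emeasure_ball_less_top])
  have bound: "ball_avg g R \<le> M * 2 ^ CARD('d) / V" if R: "R \<ge> 1" for R
  proof -
    define I where "I = (\<integral>y. indicator (ball 0 R) y * g y \<partial>lborel)"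
    have "ennreal (V * I) = (\<integral>\<^sup>+y. ennreal V * ennreal (indicator (ball 0 R) y * g y) \<partial>lborel)"
    proof -
      have "I \<ge> 0" unfolding I_def using nn by (intro integral_nonneg_AE) auto
      moreover have "(\<integral>\<^sup>+y. ennreal (indicator (ball 0 R) y * g y) \<partial>lborel) = ennreal I"
        unfolding I_def using nn by (intro nn_integral_eq_integral[OF int]) auto
      moreover have "(\<integral>\<^sup>+y. ennreal V * ennreal (indicator (ball 0 R) y * g y) \<partial>lborel)
          = ennreal V * (\<integral>\<^sup>+y. ennreal (indicator (ball 0 R) y * g y) \<partial>lborel)"
        by (intro nn_integral_cmult) (auto intro!: borel_measurable_times borel_measurable_indicator)
      ultimately show ?thesis using V by (simp add: ennreal_mult)
    qed
    also have "\<dots> = (\<integral>\<^sup>+y. (\<integral>\<^sup>+x. indicator (ball y 1) x * ennreal (indicator (ball 0 R) y * g y) \<partial>lborel) \<partial>lborel)"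
    proof (intro nn_integral_cong)
      fix y
      have "(\<integral>\<^sup>+x. indicator (ball y 1) x * ennreal (indicator (ball 0 R) y * g y) \<partial>lborel)
          = emeasure lborel (ball y 1) * ennreal (indicator (ball 0 R) y * g y)"
        by (subst nn_integral_multc) (auto simp: nn_integral_indicator)
      also have "emeasure lborel (ball y 1) = ennreal V" unfolding vol V_def by (simp add: content_ball)
      finally show "ennreal V * ennreal (indicator (ball 0 R) y * g y) = (\<integral>\<^sup>+x. indicator (ball y 1) x * ennreal (indicator (ball 0 R) y * g y) \<partial>lborel)"
        by simp
    qed
    also have "\<dots> = (\<integral>\<^sup>+x. (\<integral>\<^sup>+y. indicator (ball y 1) x * ennreal (indicator (ball 0 R) y * g y) \<partial>lborel) \<partial>lborel)"
    proof -
      have "(\<lambda>(y, x). (if dist y x < 1 then 1 else 0) * ennreal (indicator (ball 0 R) y * g y)) \<in> borel_measurable (lborel \<Otimes>\<^sub>M lborel)"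
        by measurable
      note fub = lborel_pair.Fubini'[OF this, symmetric]
      have ind: "indicator (ball y 1) x = (if dist y x < 1 then 1 else (0::ennreal))" for x y :: "real^'d"
        by (simp add: indicator_def)
      show ?thesis using fub unfolding ind prod.case .
    qed
    also have "\<dots> \<le> (\<integral>\<^sup>+x. ennreal M * indicator (ball (0::real^'d) (R + 1)) x \<partial>lborel)"
    proof (intro nn_integral_mono)
      fix x :: "real^'d"
      show "(\<integral>\<^sup>+y. indicator (ball y 1) x * ennreal (indicator (ball 0 R) y * g y) \<partial>lborel) \<le> ennreal M * indicator (ball 0 (R + 1)) x"
      proof (cases "x \<in> ball 0 (R + 1)")
        case True
        have "(\<integral>\<^sup>+y. indicator (ball y 1) x * ennreal (indicator (ball 0 R) y * g y) \<partial>lborel)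
            \<le> (\<integral>\<^sup>+y. ennreal (indicator (ball x 1) y * g y) \<partial>lborel)"
          using nn by (intro nn_integral_mono) (auto simp: indicator_def dist_commute)
        also have "\<dots> = ennreal (set_lebesgue_integral lborel (ball x 1) g)"
          unfolding set_lebesgue_integral_def using nn by (subst nn_integral_eq_integral[OF int]) auto
        also have "\<dots> \<le> ennreal M" by (intro ennreal_leI M)
        finally show ?thesis using True by simp
      next
        case False
        have eq0: "indicator (ball y 1) x * ennreal (indicator (ball 0 R) y * g y) = 0" for y
          using False norm_triangle_ineq2[of x y] by (auto simp: indicator_def dist_norm norm_minus_commute)
        show ?thesis unfolding eq0 by simp
      qed
    qed
    also have "\<dots> = ennreal M * emeasure lborel (ball (0::real^'d) (R + 1))"
      by (simp add: nn_integral_cmult)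
    also have "\<dots> = ennreal (M * measure lborel (ball (0::real^'d) (R + 1)))"
      unfolding vol using M0 by (simp add: ennreal_mult)
    finally have "V * I \<le> M * measure lborel (ball (0::real^'d) (R + 1))"
      using M0 by (simp add: ennreal_le_iff)
    then have "I \<le> M * measure lborel (ball (0::real^'d) (R + 1)) / V"
      using V by (simp add: field_simps)
    then have "ball_avg g R \<le> M * measure lborel (ball (0::real^'d) (R + 1)) / V / measure lborel (ball (0::real^'d) R)"
      unfolding ball_avg_def set_lebesgue_integral_def I_def by (intro divide_right_mono) auto
    also have "\<dots> = M / V * (measure lborel (ball (0::real^'d) (R + 1)) / measure lborel (ball (0::real^'d) R))" by simp
    also have "\<dots> = M / V * ((R + 1) / R) ^ CARD('d)" using R by (subst measure_ball_scale) auto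
    also have "\<dots> \<le> M / V * 2 ^ CARD('d)" using R M0 V by (intro mult_left_mono power_mono) (auto simp: field_simps)
    finally show ?thesis by simp
  qed
  show thesis by (rule that[OF bound])
qed

section \<open>The Caccioppoli estimate on large balls\<close>

context elliptic_system
begin

text \<open>16/9 undoes the lower bound of the cutoff, 2^d is the volume ratio of the radii S and
  S/2, and 1/\<mu>^2 comes from Young's inequality followed by division by \<mu>/2.\<close>

definition caccioppoli_const :: real where
  "caccioppoli_const = 16 / 9 * 2 ^ CARD('d) / \<mu>\<^sup>2"

lemma block_bounded_pointwise:
  fixes F :: "real^'d \<Rightarrow> ('d \<times> 'm) + 'm \<Rightarrow> real"
  shows "(\<Sum>s\<in>UNIV. (block a F x s)\<^sup>2) \<le> K\<^sup>2 * (\<Sum>s\<in>UNIV. (F x s)\<^sup>2)"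
proof -
  have "(\<Sum>k\<in>UNIV. (F x (Inr k))\<^sup>2) \<le> K\<^sup>2 * (\<Sum>k\<in>UNIV. (F x (Inr k))\<^sup>2)"
    using K mult_right_mono[of 1 "K\<^sup>2" "\<Sum>k\<in>UNIV. (F x (Inr k))\<^sup>2"] by (simp add: sum_nonneg)
  then show ?thesis
    using bounded[of x "\<lambda>l. F x (Inl l)"] by (simp add: sum_UNIV_sum distrib_left)
qed

lemma lL2_block:
  fixes F :: "real^'d \<Rightarrow> ('d \<times> 'm) + 'm \<Rightarrow> real"
  assumes "lL2 F" shows "lL2 (block a F)"
  unfolding lL2_def
proof
  fix s
  have F: "loc_L2 (\<lambda>x. F x s)" for s using assms by (simp add: lL2_def)
  show "loc_L2 (\<lambda>x. block a F x s)"
  proof (cases s)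
    case (Inl k)
    have "loc_L2 (\<lambda>x. a x k l * F x (Inl l))" for l
      by (rule unif_ap_bounded[OF a_ap[of k l]]) (rule loc_L2_mult_bounded[OF F unif_ap_borel[OF a_ap]])
    then show ?thesis using Inl by (simp add: loc_L2_sum)
  qed (simp add: F)
qed

text \<open>The whole estimate is done on integrands, so that only monotonicity of the average is
  left. The cutoff gradient has size 1/S and multiplies w; the zeroth-order slot bounds |w|^2 by
  X/\<kappa>^2, so no Poincare inequality enters and the error is of order 1/S for fixed
  \<kappa>.\<close>

lemma caccioppoli_pointwise:
  fixes w :: "real^'d \<Rightarrow> 'm \<Rightarrow> real" and J f :: "real^'d \<Rightarrow> ('d \<times> 'm) + 'm \<Rightarrow> real"
  assumes \<kappa>: "\<kappa> > 0" and Jr: "\<And>\<alpha>. J x (Inr \<alpha>) = \<kappa> * w x \<alpha>" and S: "S > 0"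
  defines "X \<equiv> (\<Sum>s\<in>UNIV. (J x s)\<^sup>2)" and "Y \<equiv> (\<Sum>s\<in>UNIV. (f x s)\<^sup>2)"
  shows "\<mu> / 2 * (cutoff S x * X) - 1 / (2 * \<mu>) * Y - 2 / S * ((2 * K\<^sup>2 + real CARD('d) / \<kappa>\<^sup>2) * X + 2 * Y)
    \<le> (\<Sum>s\<in>UNIV. (block a J x s + f x s) * (cutoff S x * J x s + (case s of Inl (i, \<alpha>) \<Rightarrow> cutoff' S i x * w x \<alpha> | Inr _ \<Rightarrow> 0)))"
proof -
  let ?\<eta> = "cutoff S x"
  define F where "F = (\<lambda>s. block a J x s + f x s)"
  have XY: "X \<ge> 0" "Y \<ge> 0" by (simp_all add: X_def Y_def sum_nonneg)
  have "\<mu> / 2 * X - 1 / (2 * \<mu>) * Y \<le> (\<Sum>s\<in>UNIV. F s * J x s)"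
  proof -
    have "- (\<Sum>s\<in>UNIV. f x s * J x s) \<le> (\<Sum>s\<in>UNIV. \<mu> / 2 * (J x s)\<^sup>2 + 1 / (2 * \<mu>) * (f x s)\<^sup>2)"
      unfolding sum_negf[symmetric]
    proof (rule sum_mono)
      fix s
      have "0 \<le> (\<mu> * J x s + f x s)\<^sup>2 / (2 * \<mu>)" using \<mu> by simp
      also have "\<dots> = \<mu> / 2 * (J x s)\<^sup>2 + 1 / (2 * \<mu>) * (f x s)\<^sup>2 + f x s * J x s"
        using \<mu> by (simp add: power2_eq_square field_simps)
      finally show "- (f x s * J x s) \<le> \<mu> / 2 * (J x s)\<^sup>2 + 1 / (2 * \<mu>) * (f x s)\<^sup>2" by linarith
    qed
    also have "\<dots> = \<mu> / 2 * X + 1 / (2 * \<mu>) * Y" unfolding X_def Y_def by (simp only: sum.distrib sum_distrib_left)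
    finally have "- (\<Sum>s\<in>UNIV. f x s * J x s) \<le> \<mu> / 2 * X + 1 / (2 * \<mu>) * Y" .
    moreover have "\<mu> * X \<le> (\<Sum>s\<in>UNIV. block a J x s * J x s)" unfolding X_def by (rule block_coercive_pointwise)
    moreover have "(\<Sum>s\<in>UNIV. F s * J x s) = (\<Sum>s\<in>UNIV. block a J x s * J x s) + (\<Sum>s\<in>UNIV. f x s * J x s)"
      by (simp add: F_def distrib_right sum.distrib)
    ultimately show ?thesis by (simp add: field_simps)
  qed
  from mult_left_mono[OF this cutoff_bounds(1)[OF S, of x]]
  have main: "\<mu> / 2 * (?\<eta> * X) - ?\<eta> * (1 / (2 * \<mu>) * Y) \<le> ?\<eta> * (\<Sum>s\<in>UNIV. F s * J x s)"
    by (simp add: algebra_simps)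
  have \<eta>Y: "?\<eta> * (1 / (2 * \<mu>) * Y) \<le> 1 * (1 / (2 * \<mu>) * Y)"
    using cutoff_bounds(2)[OF S, of x] XY \<mu> by (intro mult_right_mono) auto
  define B where "B = (\<Sum>i\<in>UNIV. \<Sum>\<alpha>\<in>UNIV. F (Inl (i, \<alpha>)) * (cutoff' S i x * w x \<alpha>))"
  have "- B \<le> (\<Sum>i\<in>UNIV. \<Sum>\<alpha>\<in>UNIV. 2 / S * ((F (Inl (i, \<alpha>)))\<^sup>2 + (w x \<alpha>)\<^sup>2))"
    unfolding B_def sum_negf[symmetric]
  proof (intro sum_mono)
    fix i \<alpha>
    let ?F = "\<bar>F (Inl (i, \<alpha>))\<bar>" and ?w = "\<bar>w x \<alpha>\<bar>"
    have "- (F (Inl (i, \<alpha>)) * (cutoff' S i x * w x \<alpha>)) \<le> \<bar>cutoff' S i x\<bar> * (?F * ?w)"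
      using abs_ge_minus_self[of "F (Inl (i, \<alpha>)) * (cutoff' S i x * w x \<alpha>)"] by (simp add: abs_mult mult_ac)
    also have "\<dots> \<le> 4 / S * (?F * ?w)" by (intro mult_right_mono cutoff_bounds S) auto
    also have "\<dots> = 2 / S * (2 * ?F * ?w)" by simp
    also have "\<dots> \<le> 2 / S * (?F\<^sup>2 + ?w\<^sup>2)" using S by (intro mult_left_mono sum_squares_bound) auto
    finally show "- (F (Inl (i, \<alpha>)) * (cutoff' S i x * w x \<alpha>)) \<le> 2 / S * ((F (Inl (i, \<alpha>)))\<^sup>2 + (w x \<alpha>)\<^sup>2)" by simp
  qed
  also have "\<dots> = 2 / S * ((\<Sum>k\<in>UNIV. (F (Inl k))\<^sup>2) + real CARD('d) * (\<Sum>\<alpha>\<in>UNIV. (w x \<alpha>)\<^sup>2))"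
  proof -
    have "(\<Sum>i\<in>UNIV. \<Sum>\<alpha>\<in>UNIV. c * (p i \<alpha> + q \<alpha>)) = c * ((\<Sum>i\<in>UNIV. \<Sum>\<alpha>\<in>UNIV. p i \<alpha>) + real CARD('d) * (\<Sum>\<alpha>\<in>UNIV. q \<alpha>))"
      for c and p :: "'d \<Rightarrow> 'm \<Rightarrow> real" and q
      by (simp add: sum.distrib distrib_left sum_distrib_left mult.left_commute)
    then show ?thesis by (simp only: sum_UNIV_prod)
  qed
  also have "\<dots> \<le> 2 / S * ((2 * K\<^sup>2 * X + 2 * Y) + real CARD('d) * (X / \<kappa>\<^sup>2))"
  proof (intro mult_left_mono add_mono)
    have "(\<Sum>k\<in>UNIV. (F (Inl k))\<^sup>2) \<le> (\<Sum>s\<in>UNIV. (F s)\<^sup>2)" by (simp add: sum_UNIV_sum sum_nonneg)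
    also have "\<dots> \<le> (\<Sum>s\<in>UNIV. 2 * (block a J x s)\<^sup>2 + 2 * (f x s)\<^sup>2)"
    proof (rule sum_mono)
      fix s show "(F s)\<^sup>2 \<le> 2 * (block a J x s)\<^sup>2 + 2 * (f x s)\<^sup>2"
        using sum_squares_bound[of "block a J x s" "f x s"] by (simp add: F_def power2_sum)
    qed
    also have "\<dots> \<le> 2 * K\<^sup>2 * X + 2 * Y"
      using block_bounded_pointwise[of J x] by (simp add: sum.distrib sum_distrib_left[symmetric] X_def Y_def)
    finally show "(\<Sum>k\<in>UNIV. (F (Inl k))\<^sup>2) \<le> 2 * K\<^sup>2 * X + 2 * Y" .
    have "\<kappa>\<^sup>2 * (\<Sum>\<alpha>\<in>UNIV. (w x \<alpha>)\<^sup>2) \<le> X"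
      unfolding X_def by (simp add: sum_UNIV_sum Jr power_mult_distrib sum_distrib_left[symmetric] sum_nonneg)
    then show "(\<Sum>\<alpha>\<in>UNIV. (w x \<alpha>)\<^sup>2) \<le> X / \<kappa>\<^sup>2" using \<kappa> by (simp add: field_simps)
  qed (use S in auto)
  finally have B: "- B \<le> 2 / S * ((2 * K\<^sup>2 + real CARD('d) / \<kappa>\<^sup>2) * X + 2 * Y)" by (simp add: algebra_simps)
  have "(\<Sum>s\<in>UNIV. F s * (?\<eta> * J x s + (case s of Inl (i, \<alpha>) \<Rightarrow> cutoff' S i x * w x \<alpha> | Inr _ \<Rightarrow> 0)))
      = ?\<eta> * (\<Sum>s\<in>UNIV. F s * J x s) + B"
    by (simp add: sum_UNIV_sum sum_UNIV_prod distrib_left sum.distrib sum_distrib_left B_def mult.left_commute)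
  with main \<eta>Y B show ?thesis by (simp add: F_def)
qed

text \<open>The energy identity with a cutoff at radius S bounds the average over the half ball by
  that of the forcing plus terms of order 1/S. These vanish as S grows because the averages of the
  energy stay below \<open>M\<close>; only the mean \<open>Q\<close> of the forcing
  survives.\<close>

lemma caccioppoli:
  fixes w :: "real^'d \<Rightarrow> 'm \<Rightarrow> real" and J f :: "real^'d \<Rightarrow> ('d \<times> 'm) + 'm \<Rightarrow> real"
  assumes w: "lL2 w" and J: "lL2 J" and f: "lL2 f" and Jr: "\<And>x \<alpha>. J x (Inr \<alpha>) = \<kappa> * w x \<alpha>" and \<kappa>: "\<kappa> > 0"
    and weak_grad: "\<And>\<phi> i \<alpha>. test_fun \<phi> \<Longrightarrow> (\<integral>x. w x \<alpha> * partial i \<phi> x \<partial>lborel) = - (\<integral>x. J x (Inl (i, \<alpha>)) * \<phi> x \<partial>lborel)"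
    and weak_eq: "\<And>\<phi> \<alpha>. test_fun \<phi> \<Longrightarrow>
      (\<integral>x. (\<Sum>i\<in>UNIV. (block a J x (Inl (i, \<alpha>)) + f x (Inl (i, \<alpha>))) * partial i \<phi> x)
        + \<kappa> * (block a J x (Inr \<alpha>) + f x (Inr \<alpha>)) * \<phi> x \<partial>lborel) = 0"
    and M: "\<And>R. R \<ge> 1 \<Longrightarrow> ball_avg (\<lambda>x. \<Sum>s\<in>UNIV. (J x s)\<^sup>2) R \<le> M"
    and Q: "has_mean (\<lambda>x. \<Sum>s\<in>UNIV. (f x s)\<^sup>2) Q" and \<delta>: "\<delta> > 0"
  shows "\<forall>\<^sub>F R in at_top. ball_avg (\<lambda>x. \<Sum>s\<in>UNIV. (J x s)\<^sup>2) R \<le> caccioppoli_const * Q + \<delta>"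
proof -
  let ?X = "\<lambda>x. \<Sum>s\<in>UNIV. (J x s)\<^sup>2" and ?Y = "\<lambda>x. \<Sum>s\<in>UNIV. (f x s)\<^sup>2"
  let ?D = "2 ^ CARD('d) :: real"
  have lX: "loc_int ?X" "loc_int ?Y" using J f by (auto intro!: loc_int_sum loc_int_sq simp: lL2_def)
  define C1 where "C1 = 2 * K\<^sup>2 + real CARD('d) / \<kappa>\<^sup>2"
  have C1: "C1 \<ge> 0" by (simp add: C1_def)
  define bnd where "bnd = (\<lambda>S. 16 / 9 * ?D * (2 / \<mu> * (1 / (2 * \<mu>) * ball_avg ?Y S + 2 / S * (C1 * M + 2 * ball_avg ?Y S))))"
  have step: "ball_avg ?X (S / 2) \<le> bnd S" if S: "S \<ge> 2" for S
  proof -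
    have S0: "S > 0" using S by simp
    let ?\<zeta> = "\<lambda>x s. cutoff S x * J x s + (case s of Inl (i, \<alpha>) \<Rightarrow> cutoff' S i x * w x \<alpha> | Inr _ \<Rightarrow> 0)"
    have bF: "lL2 (\<lambda>x s. block a J x s + f x s)" by (intro bal.ok_add lL2_block J f)
    have m\<eta>: "cutoff S \<in> borel_measurable borel" "cutoff' S i \<in> borel_measurable borel" for i
      by (intro borel_measurable_continuous_onI cutoff_cont)+
    have \<eta>1: "\<bar>cutoff S x\<bar> \<le> 1" for x using cutoff_bounds(1,2)[OF S0, of x] by simp
    have zero: "bip S (\<lambda>x s. block a J x s + f x s) ?\<zeta> = 0"
      by (rule energy_identity[OF w J bF Jr weak_grad weak_eq cutoff_cont(1) cutoff_cont(2) cutoff_deriv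
          cutoff_bounds(3)[OF S0] cutoff_bounds(4)[OF S0]])
    have \<zeta>: "lL2 ?\<zeta>" unfolding lL2_def
    proof
      fix s :: "('d \<times> 'm) + 'm"
      have 1: "loc_L2 (\<lambda>x. cutoff S x * J x s)"
        by (rule loc_L2_mult_bounded[OF _ m\<eta>(1) \<eta>1]) (use J in \<open>simp add: lL2_def\<close>)
      have 2: "loc_L2 (\<lambda>x. cutoff' S i x * w x \<alpha>)" for i \<alpha>
        by (rule loc_L2_mult_bounded[OF _ m\<eta>(2) cutoff_bounds(5)[OF S0]]) (use w in \<open>simp add: lL2_def\<close>)
      show "loc_L2 (\<lambda>x. ?\<zeta> x s)"
        using loc_L2_add[OF 1 2] 1 by (cases s) (auto split: prod.splits)
    qed
    have l\<eta>X: "loc_int (\<lambda>x. cutoff S x * ?X x)"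
    proof (rule loc_int_bound[OF lX(1)])
      show "(\<lambda>x. cutoff S x * ?X x) \<in> borel_measurable borel" using m\<eta>(1) loc_int_borel[OF lX(1)] by (rule borel_measurable_times)
      show "\<bar>cutoff S x * ?X x\<bar> \<le> ?X x" for x
        using mult_right_mono[OF \<eta>1[of x], of "?X x"] by (simp add: abs_mult sum_nonneg)
    qed
    have avg: "ball_avg (\<lambda>x. c1 * p x - c2 * q x - c3 * (c4 * r x + c5 * q x)) S
        = c1 * ball_avg p S - c2 * ball_avg q S - c3 * (c4 * ball_avg r S + c5 * ball_avg q S)"
      if "loc_int p" "loc_int q" "loc_int r" for p q r :: "real^'d \<Rightarrow> real" and c1 c2 c3 c4 c5
      by (simp add: ball_avg_diff ball_avg_add ball_avg_cmult loc_int_diff loc_int_add loc_int_cmult that)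
    have "ball_avg (\<lambda>x. \<mu> / 2 * (cutoff S x * ?X x) - 1 / (2 * \<mu>) * ?Y x - 2 / S * (C1 * ?X x + 2 * ?Y x)) S
        \<le> bip S (\<lambda>x s. block a J x s + f x s) ?\<zeta>"
      unfolding bip_def
    proof (rule ball_avg_mono)
      show "loc_int (\<lambda>x. \<mu> / 2 * (cutoff S x * ?X x) - 1 / (2 * \<mu>) * ?Y x - 2 / S * (C1 * ?X x + 2 * ?Y x))"
        by (intro loc_int_diff loc_int_cmult loc_int_add l\<eta>X lX)
      show "loc_int (\<lambda>x. \<Sum>s\<in>UNIV. (block a J x s + f x s) * ?\<zeta> x s)" by (rule loc_int_bip[OF bF \<zeta>])
      show "\<mu> / 2 * (cutoff S x * ?X x) - 1 / (2 * \<mu>) * ?Y x - 2 / S * (C1 * ?X x + 2 * ?Y x)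
          \<le> (\<Sum>s\<in>UNIV. (block a J x s + f x s) * ?\<zeta> x s)" for x
        unfolding C1_def by (rule caccioppoli_pointwise[where w = w and J = J and x = x and \<kappa> = \<kappa>]) (use \<kappa> Jr S0 in auto)
    qed
    then have "\<mu> / 2 * ball_avg (\<lambda>x. cutoff S x * ?X x) S
        \<le> 1 / (2 * \<mu>) * ball_avg ?Y S + 2 / S * (C1 * ball_avg ?X S + 2 * ball_avg ?Y S)"
      unfolding zero avg[OF l\<eta>X lX(2) lX(1)] by linarith
    also have "\<dots> \<le> 1 / (2 * \<mu>) * ball_avg ?Y S + 2 / S * (C1 * M + 2 * ball_avg ?Y S)"
      using M[of S] S C1 by (intro add_left_mono mult_left_mono add_right_mono) auto
    finally have upper: "ball_avg (\<lambda>x. cutoff S x * ?X x) S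
        \<le> 2 / \<mu> * (1 / (2 * \<mu>) * ball_avg ?Y S + 2 / S * (C1 * M + 2 * ball_avg ?Y S))"
      using \<mu> by (simp add: field_simps)
    have "9 / 16 * (\<integral>x. indicator (ball 0 (S / 2)) x *\<^sub>R ?X x \<partial>lborel) \<le> (\<integral>x. indicator (ball 0 S) x *\<^sub>R (cutoff S x * ?X x) \<partial>lborel)"
      unfolding integral_mult_right_zero[symmetric]
    proof (rule integral_mono)
      show "integrable lborel (\<lambda>x. 9 / 16 * (indicator (ball 0 (S / 2)) x *\<^sub>R ?X x))"
        "integrable lborel (\<lambda>x. indicator (ball 0 S) x *\<^sub>R (cutoff S x * ?X x))"
        using lX(1) l\<eta>X by (auto simp only: loc_int_def set_integrable_def intro!: integrable_mult_right)
      fix x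
      show "9 / 16 * (indicator (ball 0 (S / 2)) x *\<^sub>R ?X x) \<le> indicator (ball 0 S) x *\<^sub>R (cutoff S x * ?X x)"
        using mult_right_mono[OF cutoff_bounds(6)[OF S0, of x], of "?X x"] cutoff_bounds(1)[OF S0, of x] S
        by (auto simp: indicator_def sum_nonneg)
    qed
    then have "9 / 16 * (ball_avg ?X (S / 2) * measure lborel (ball (0::real^'d) (S / 2))) / measure lborel (ball (0::real^'d) S)
        \<le> ball_avg (\<lambda>x. cutoff S x * ?X x) S"
      using S unfolding ball_avg_def set_lebesgue_integral_def by (intro divide_right_mono) auto
    moreover have "9 / 16 * (ball_avg ?X (S / 2) * measure lborel (ball (0::real^'d) (S / 2))) / measure lborel (ball (0::real^'d) S)
        = 9 / 16 * ball_avg ?X (S / 2) * (measure lborel (ball (0::real^'d) (S / 2)) / measure lborel (ball (0::real^'d) S))"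
      by simp
    moreover have "measure lborel (ball (0::real^'d) (S / 2)) / measure lborel (ball (0::real^'d) S) = 1 / ?D"
      using S by (subst measure_ball_scale) (auto simp: power_one_over[symmetric])
    ultimately have "9 / 16 * ball_avg ?X (S / 2) * (1 / ?D) \<le> ball_avg (\<lambda>x. cutoff S x * ?X x) S" by simp
    then have "ball_avg ?X (S / 2) \<le> 16 / 9 * ?D * ball_avg (\<lambda>x. cutoff S x * ?X x) S" by (simp add: field_simps)
    also have "\<dots> \<le> 16 / 9 * ?D * (2 / \<mu> * (1 / (2 * \<mu>) * ball_avg ?Y S + 2 / S * (C1 * M + 2 * ball_avg ?Y S)))"
      by (intro mult_left_mono upper) simp
    finally show ?thesis by (simp only: bnd_def)
  qed
  have "(bnd \<longlongrightarrow> 16 / 9 * ?D * (2 / \<mu> * (1 / (2 * \<mu>) * Q + 0 * (C1 * M + 2 * Q)))) at_top"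
    unfolding bnd_def using Q
    by (intro tendsto_intros tendsto_divide_0[OF tendsto_const] filterlim_at_top_imp_at_infinity filterlim_ident)
       (auto simp: has_mean_def)
  also have "16 / 9 * ?D * (2 / \<mu> * (1 / (2 * \<mu>) * Q + 0 * (C1 * M + 2 * Q))) = caccioppoli_const * Q"
    using \<mu> by (simp add: caccioppoli_const_def power2_eq_square)
  finally have "\<forall>\<^sub>F S in at_top. bnd S < caccioppoli_const * Q + \<delta>"
    using \<delta> by (intro order_tendstoD) auto
  then have "\<forall>\<^sub>F S in at_top. ball_avg ?X (S / 2) \<le> caccioppoli_const * Q + \<delta>"
    using eventually_ge_at_top[of 2] by eventually_elim (use step in fastforce)
  \<comment> \<open>With S = 2R the inner ball has radius R.\<close>
  moreover have "filterlim (\<lambda>R::real. 2 * R) at_top at_top"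
    by (rule filterlim_tendsto_pos_mult_at_top[OF tendsto_const _ filterlim_ident]) simp
  ultimately have "\<forall>\<^sub>F R in at_top. ball_avg ?X (2 * R / 2) \<le> caccioppoli_const * Q + \<delta>"
    by (rule eventually_compose_filterlim)
  then show ?thesis by simp
qed

end

section \<open>Integration by parts against test functions\<close>

lemma test_fun_props:
  fixes \<phi> :: "real^'d::finite \<Rightarrow> real"
  assumes "test_fun \<phi>"
  obtains R where "continuous_on UNIV \<phi>" "\<And>i. continuous_on UNIV (partial i \<phi>)"
    "\<And>i x. ((\<lambda>t. \<phi> (x + t *\<^sub>R axis i 1)) has_real_derivative partial i \<phi> x) (at 0)"
    "\<And>x. norm x \<ge> R \<Longrightarrow> \<phi> x = 0" "\<And>i x. norm x \<ge> R \<Longrightarrow> partial i \<phi> x = 0"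
proof -
  have C: "C_inf \<phi>" and comp: "compact (closure {x. \<phi> x \<noteq> 0})" using assms by (auto simp: test_fun_def)
  obtain R where R: "closure {x. \<phi> x \<noteq> 0} \<subseteq> ball 0 R"
    using bounded_subset_ballD[OF compact_imp_bounded[OF comp], of 0] by blast
  have cont: "continuous_on UNIV (iter_partial is \<phi>)" for "is" using C by (simp add: C_inf_def)
  have diff: "(\<lambda>t. iter_partial is \<phi> (x + t *\<^sub>R axis i 1)) differentiable (at 0)" for "is" i x
    using C by (simp add: C_inf_def)
  have d: "((\<lambda>t. \<phi> (x + t *\<^sub>R axis i 1)) has_real_derivative partial i \<phi> x) (at 0)" for i x
    using diff[of "[]" x i] unfolding partial_def by (simp add: DERIV_deriv_iff_real_differentiable)
  have z: "\<phi> x = 0" if "norm x \<ge> R" for x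
  proof (rule ccontr)
    assume "\<phi> x \<noteq> 0"
    then have "x \<in> closure {x. \<phi> x \<noteq> 0}" by (intro subsetD[OF closure_subset]) simp
    with R that show False by auto
  qed
  have z': "partial i \<phi> x = 0" if "norm x \<ge> R" for i x
  proof (rule partial_eqI)
    have "open (- closure {x. \<phi> x \<noteq> 0})" by (intro open_Compl closed_closure)
    moreover have "x \<in> - closure {x. \<phi> x \<noteq> 0}" using R that by auto
    ultimately obtain \<epsilon> where \<epsilon>: "\<epsilon> > 0" "ball x \<epsilon> \<subseteq> - closure {x. \<phi> x \<noteq> 0}"
      unfolding open_contains_ball by blast
    have "((\<lambda>_::real. 0) has_real_derivative 0) (at 0)" by simp
    then show "((\<lambda>t. \<phi> (x + t *\<^sub>R axis i 1)) has_real_derivative 0) (at 0)"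
    proof (rule has_field_derivative_transform_within_open[where S = "ball 0 \<epsilon>"])
      fix t :: real assume "t \<in> ball 0 \<epsilon>"
      then have "x + t *\<^sub>R axis i 1 \<in> ball x \<epsilon>" by (simp add: dist_norm)
      with \<epsilon>(2) have "x + t *\<^sub>R axis i 1 \<notin> closure {x. \<phi> x \<noteq> 0}" by blast
      moreover have "y \<in> closure {x. \<phi> x \<noteq> 0}" if "\<phi> y \<noteq> 0" for y
        using that by (intro subsetD[OF closure_subset]) simp
      ultimately show "0 = \<phi> (x + t *\<^sub>R axis i 1)" by metis
    qed (use \<epsilon> in auto)
  qed
  show thesis
    by (rule that[of R]) (use cont[of "[]"] cont[of "[_]"] d z z' in auto)
qed

lemma integrable_mult_test:
  assumes "loc_int f" "test_fun \<phi>"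
  shows "integrable lborel (\<lambda>x. f x * \<phi> x)" "integrable lborel (\<lambda>x. f x * partial i \<phi> x)"
proof -
  obtain R where \<phi>: "continuous_on UNIV \<phi>" "\<And>i. continuous_on UNIV (partial i \<phi>)"
    "\<And>x. norm x \<ge> R \<Longrightarrow> \<phi> x = 0" "\<And>i x. norm x \<ge> R \<Longrightarrow> partial i \<phi> x = 0"
    using test_fun_props[OF assms(2)] by metis
  obtain L where L: "\<And>x. \<bar>\<phi> x\<bar> \<le> L" using continuous_support_bounded[OF \<phi>(1,3)] by blast
  obtain L' where L': "\<And>x. \<bar>partial i \<phi> x\<bar> \<le> L'" using continuous_support_bounded[OF \<phi>(2,4)] by blast
  show "integrable lborel (\<lambda>x. f x * \<phi> x)"
    using integrable_mult_support[OF assms(1) borel_measurable_continuous_onI[OF \<phi>(1)] L \<phi>(3)] by (simp add: mult.commute)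
  show "integrable lborel (\<lambda>x. f x * partial i \<phi> x)"
    using integrable_mult_support[OF assms(1) borel_measurable_continuous_onI[OF \<phi>(2)] L' \<phi>(4)] by (simp add: mult.commute)
qed

lemma trig_by_parts_test:
  assumes p: "trig_poly p" and \<phi>: "test_fun \<phi>"
  shows "(\<integral>x. p x * partial i \<phi> x \<partial>lborel) = - (\<integral>x. partial i p x * \<phi> x \<partial>lborel)"
proof -
  obtain R where R: "continuous_on UNIV \<phi>" "\<And>i. continuous_on UNIV (partial i \<phi>)"
    "\<And>i x. ((\<lambda>t. \<phi> (x + t *\<^sub>R axis i 1)) has_real_derivative partial i \<phi> x) (at 0)"
    "\<And>x. norm x \<ge> R \<Longrightarrow> \<phi> x = 0" "\<And>i x. norm x \<ge> R \<Longrightarrow> partial i \<phi> x = 0"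
    using test_fun_props[OF \<phi>] by blast
  have "(\<integral>x. partial i p x * \<phi> x + p x * partial i \<phi> x \<partial>lborel) = 0"
  proof (rule integral_partial_zero[where v = "\<lambda>x. p x * \<phi> x" and R = R])
    show "continuous_on UNIV (\<lambda>x. p x * \<phi> x)" "continuous_on UNIV (\<lambda>x. partial i p x * \<phi> x + p x * partial i \<phi> x)"
      by (intro continuous_intros trig_continuous trig_poly_partial p R)+
    fix x
    show "((\<lambda>t. p (x + t *\<^sub>R axis i 1) * \<phi> (x + t *\<^sub>R axis i 1)) has_real_derivative partial i p x * \<phi> x + p x * partial i \<phi> x) (at 0)"
      by (rule DERIV_cong[OF DERIV_mult[OF trig_has_partial[OF p] R(3)]]) simp
  qed (use R in auto)
  then show ?thesis
    using integrable_mult_test[OF trig_loc_int[OF p] \<phi>] integrable_mult_test[OF trig_loc_int[OF trig_poly_partial[OF p]] \<phi>]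
    by simp
qed

text \<open>The adjoint relation of \<open>ip_jet_by_parts\<close> for compactly supported test
  functions: fields with equal \<open>dual_div\<close> are indistinguishable here too.\<close>

lemma dual_div_test:
  fixes P :: "real^'d::finite \<Rightarrow> ('d \<times> 'm) + 'm \<Rightarrow> real"
  assumes P: "\<And>s. trig_poly (\<lambda>x. P x s)" and \<phi>: "test_fun \<phi>"
  shows "(\<integral>x. (\<Sum>i\<in>UNIV. P x (Inl (i, \<alpha>)) * partial i \<phi> x) + \<kappa> * P x (Inr \<alpha>) * \<phi> x \<partial>lborel)
    = (\<integral>x. dual_div \<kappa> P x \<alpha> * \<phi> x \<partial>lborel)"
proof -
  note li = trig_loc_int[OF P] trig_loc_int[OF trig_poly_partial[OF P]]
  note int = integrable_mult_test[OF li(1) \<phi>] integrable_mult_test(1)[OF li(2) \<phi>]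
    integrable_mult_test(1)[OF loc_int_cmult[OF li(1)] \<phi>]
  have "(\<integral>x. (\<Sum>i\<in>UNIV. P x (Inl (i, \<alpha>)) * partial i \<phi> x) + \<kappa> * P x (Inr \<alpha>) * \<phi> x \<partial>lborel)
      = (\<Sum>i\<in>UNIV. (\<integral>x. P x (Inl (i, \<alpha>)) * partial i \<phi> x \<partial>lborel)) + (\<integral>x. \<kappa> * P x (Inr \<alpha>) * \<phi> x \<partial>lborel)"
    using int by (subst Bochner_Integration.integral_add) (auto intro!: Bochner_Integration.integrable_sum simp: Bochner_Integration.integral_sum)
  also have "\<dots> = (\<integral>x. \<kappa> * P x (Inr \<alpha>) * \<phi> x \<partial>lborel) - (\<Sum>i\<in>UNIV. (\<integral>x. partial i (\<lambda>x. P x (Inl (i, \<alpha>))) x * \<phi> x \<partial>lborel))"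
    by (simp add: trig_by_parts_test[OF P \<phi>] sum_negf)
  also have "\<dots> = (\<integral>x. \<kappa> * P x (Inr \<alpha>) * \<phi> x - (\<Sum>i\<in>UNIV. partial i (\<lambda>x. P x (Inl (i, \<alpha>))) x * \<phi> x) \<partial>lborel)"
    using int by (subst Bochner_Integration.integral_diff) (auto intro!: Bochner_Integration.integrable_sum simp: Bochner_Integration.integral_sum)
  also have "\<dots> = (\<integral>x. dual_div \<kappa> P x \<alpha> * \<phi> x \<partial>lborel)"
    by (simp add: dual_div_def left_diff_distrib sum_distrib_right)
  finally show ?thesis .
qed

lemma test_fun_zero: "test_fun (\<lambda>_. 0)"
  unfolding test_fun_def by (auto intro!: C_inf_of_smooth_upto smooth_upto_const)

lemma lL2_ap: "ap F \<Longrightarrow> lL2 F"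
  unfolding ap_def lL2_def by (auto intro: unif_ap_loc_L2)

lemma ap_has_mean_sq: "ap F \<Longrightarrow> has_mean (\<lambda>x. \<Sum>k\<in>UNIV. (F x k)\<^sup>2) (ip F F)"
  using unif_ap_has_mean[OF ap_prod] by (simp add: ip_def power2_eq_square)

context elliptic_system
begin

text \<open>This field is the forcing in the equation for the difference between the true and the
  trigonometric corrector. It is small because \<open>flux\<close> is uniformly close to
  \<open>P\<close> and \<open>jet \<kappa> r\<close> is small in mean square.\<close>

lemma residual_error_norm:
  assumes R: "residual \<kappa> \<epsilon> g P r" and small: "nm (jet \<kappa> r) \<le> \<epsilon>"
  shows "ap (\<lambda>x s. flux \<kappa> g x s - P x s + jet \<kappa> r x s)"
    "nm (\<lambda>x s. flux \<kappa> g x s - P x s + jet \<kappa> r x s) \<le> (N + 1) * \<epsilon>"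
proof -
  have tv: "tv g" "tv r" and P: "ap P" using R by (auto simp: residual_def intro: ap_trig)
  have \<epsilon>: "\<epsilon> \<ge> 0" using small ap.nrm_nonneg[OF ap_jet[OF tv(2)]] by (rule order_trans[rotated])
  have ap1: "ap (\<lambda>x s. flux \<kappa> g x s - P x s)" by (intro ap.ok_diff ap_flux tv P)
  then show "ap (\<lambda>x s. flux \<kappa> g x s - P x s + jet \<kappa> r x s)" by (intro ap.ok_add ap_jet tv)
  have "nm (\<lambda>x s. flux \<kappa> g x s - P x s + jet \<kappa> r x s) \<le> nm (\<lambda>x s. flux \<kappa> g x s - P x s) + nm (jet \<kappa> r)"
    by (intro ap.nrm_triangle ap1 ap_jet tv)
  with residual_nm[OF R \<epsilon>] small show "nm (\<lambda>x s. flux \<kappa> g x s - P x s + jet \<kappa> r x s) \<le> (N + 1) * \<epsilon>"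
    by (simp add: distrib_right)
qed

text \<open>The difference J of the two jets satisfies an exact equation with forcing f, the error
  of the trigonometric solution. Its ball averages are bounded, by the uniform local energy of u and
  the boundedness of trigonometric polynomials, so the Caccioppoli estimate leaves only the mean
  square of f.\<close>

lemma corrector_close:
  fixes u :: "real^'d \<Rightarrow> 'm \<Rightarrow> real" and Du :: "real^'d \<Rightarrow> 'd \<times> 'm \<Rightarrow> real"
  assumes u: "lL2 u" and Du: "lL2 Du"
    and weak_grad: "\<And>\<phi> i \<alpha>. test_fun \<phi> \<Longrightarrow> (\<integral>x. u x \<alpha> * partial i \<phi> x \<partial>lborel) = - (\<integral>x. Du x (i, \<alpha>) * \<phi> x \<partial>lborel)"
    and M: "\<And>x. set_lebesgue_integral lborel (ball x 1) (\<lambda>y. (\<Sum>k\<in>UNIV. (Du y k)\<^sup>2) + (\<Sum>\<alpha>\<in>UNIV. (u y \<alpha>)\<^sup>2)) \<le> M"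
    and eq: "\<And>\<phi> \<alpha>. test_fun \<phi> \<Longrightarrow>
       (\<integral>x. (\<Sum>i\<in>UNIV. (\<Sum>l\<in>UNIV. a x (i, \<alpha>) l * (Du x l + e l)) * partial i \<phi> x) + \<kappa>\<^sup>2 * u x \<alpha> * \<phi> x \<partial>lborel) = 0"
    and \<kappa>: "\<kappa> > 0" and R: "residual \<kappa> \<epsilon> g P r" and small: "nm (jet \<kappa> r) \<le> \<epsilon>" and \<delta>: "\<delta> > 0"
  shows "\<forall>\<^sub>F R in at_top. ball_avg (\<lambda>x. \<Sum>k\<in>UNIV. (Du x k - grad g x k)\<^sup>2) R \<le> caccioppoli_const * ((N + 1) * \<epsilon>)\<^sup>2 + \<delta>"
proof -
  have tv: "tv g" "tv r" and P: "\<And>s. trig_poly (\<lambda>x. P x s)" and dd: "dual_div \<kappa> (jet \<kappa> r) = dual_div \<kappa> P"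
    using R by (auto simp: residual_def)
  define Ju where "Ju = (\<lambda>x s. case s of Inl k \<Rightarrow> Du x k | Inr \<alpha> \<Rightarrow> \<kappa> * u x \<alpha>)"
  have Ju_simps [simp]: "Ju x (Inl k) = Du x k" "Ju x (Inr \<alpha>) = \<kappa> * u x \<alpha>" for x k \<alpha> by (simp_all add: Ju_def)
  define J where "J = (\<lambda>x s. Ju x s - jet \<kappa> g x s)"
  define w where "w = (\<lambda>x \<alpha>. u x \<alpha> - g x \<alpha>)"
  define f where "f = (\<lambda>x s. flux \<kappa> g x s - P x s + jet \<kappa> r x s)"
  have Ju: "lL2 Ju" unfolding lL2_def
  proof
    fix s show "loc_L2 (\<lambda>x. Ju x s)" using u Du by (cases s) (auto simp: lL2_def intro: loc_L2_cmult)
  qed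
  have jg: "lL2 (jet \<kappa> g)" by (intro lL2_ap ap_jet tv)
  have J: "lL2 J" unfolding J_def by (intro bal.ok_diff Ju jg)
  have w: "lL2 w" unfolding w_def by (intro bal.ok_diff u lL2_ap ap_tv tv)
  have f: "ap f" "nm f \<le> (N + 1) * \<epsilon>" unfolding f_def by (rule residual_error_norm[OF R small])+
  have Jr: "J x (Inr \<alpha>) = \<kappa> * w x \<alpha>" for x \<alpha> by (simp add: J_def w_def right_diff_distrib)
  have gt: "trig_poly (\<lambda>x. g x \<alpha>)" for \<alpha> using tv by (simp add: tv_def)
  have wg: "(\<integral>x. w x \<alpha> * partial i \<phi> x \<partial>lborel) = - (\<integral>x. J x (Inl (i, \<alpha>)) * \<phi> x \<partial>lborel)" if \<phi>: "test_fun \<phi>" for \<phi> i \<alpha>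
  proof -
    have lu: "loc_int (\<lambda>x. u x \<alpha>)" "loc_int (\<lambda>x. Du x (i, \<alpha>))"
      using u Du by (auto simp: lL2_def intro: loc_int_of_L2)
    have "(\<integral>x. w x \<alpha> * partial i \<phi> x \<partial>lborel) = (\<integral>x. u x \<alpha> * partial i \<phi> x \<partial>lborel) - (\<integral>x. g x \<alpha> * partial i \<phi> x \<partial>lborel)"
      unfolding w_def left_diff_distrib
      by (intro Bochner_Integration.integral_diff integrable_mult_test lu trig_loc_int gt \<phi>)
    also have "\<dots> = - ((\<integral>x. Du x (i, \<alpha>) * \<phi> x \<partial>lborel) - (\<integral>x. partial i (\<lambda>x. g x \<alpha>) x * \<phi> x \<partial>lborel))"
      by (simp add: weak_grad[OF \<phi>] trig_by_parts_test[OF gt \<phi>])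
    also have "(\<integral>x. Du x (i, \<alpha>) * \<phi> x \<partial>lborel) - (\<integral>x. partial i (\<lambda>x. g x \<alpha>) x * \<phi> x \<partial>lborel)
       = (\<integral>x. Du x (i, \<alpha>) * \<phi> x - partial i (\<lambda>x. g x \<alpha>) x * \<phi> x \<partial>lborel)"
      by (intro Bochner_Integration.integral_diff[symmetric] integrable_mult_test lu trig_loc_int trig_poly_partial gt \<phi>)
    finally show ?thesis by (simp add: J_def left_diff_distrib)
  qed
  define U where "U = (\<lambda>x s. Ju x s + et s)"
  have U: "lL2 U" unfolding U_def by (intro bal.ok_add Ju lL2_ap ap_et)
  \<comment> \<open>The flux of the true corrector is annihilated by every test function, and
    \<open>jet \<kappa> r\<close> and \<open>P\<close> have the same divergence; both summands on
    the right therefore drop out of the weak equation.\<close>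
  have Fsum: "block a J x s + f x s = block a U x s + (jet \<kappa> r x s - P x s)" for x s
  proof -
    have "block a U x s = block a J x s + flux \<kappa> g x s"
      unfolding flux_def block_add[symmetric, THEN fun_cong, THEN fun_cong] U_def J_def
      using fun_cong[OF fun_cong[OF block_add[of a "\<lambda>x s. Ju x s - jet \<kappa> g x s" "\<lambda>x s. jet \<kappa> g x s + et s"]], of x s]
      by (simp add: algebra_simps)
    then show ?thesis by (simp add: f_def)
  qed
  have we: "(\<integral>x. (\<Sum>i\<in>UNIV. (block a J x (Inl (i, \<alpha>)) + f x (Inl (i, \<alpha>))) * partial i \<phi> x)
        + \<kappa> * (block a J x (Inr \<alpha>) + f x (Inr \<alpha>)) * \<phi> x \<partial>lborel) = 0" if \<phi>: "test_fun \<phi>" for \<phi> \<alpha>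
  proof -
    have lU: "loc_int (\<lambda>x. block a U x s)" for s
      using lL2_block[OF U] by (auto simp: lL2_def intro: loc_int_of_L2)
    have rt: "trig_poly (\<lambda>x. jet \<kappa> r x s)" for s by (rule trig_jet[OF tv(2)])
    have intX: "integrable lborel (\<lambda>x. (\<Sum>i\<in>UNIV. X x (Inl (i, \<alpha>)) * partial i \<phi> x) + \<kappa> * X x (Inr \<alpha>) * \<phi> x)"
      if "\<And>s. loc_int (\<lambda>x. X x s)" for X :: "real^'d \<Rightarrow> ('d \<times> 'm) + 'm \<Rightarrow> real"
      by (intro Bochner_Integration.integrable_add Bochner_Integration.integrable_sum integrable_mult_test \<phi> that loc_int_cmult)
    note i1 = intX[of "block a U", OF lU] and i2 = intX[of "jet \<kappa> r", OF trig_loc_int[OF rt]]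
      and i3 = intX[of P, OF trig_loc_int[OF P]]
    let ?I = "\<lambda>X :: real^'d \<Rightarrow> ('d \<times> 'm) + 'm \<Rightarrow> real. (\<integral>x. (\<Sum>i\<in>UNIV. X x (Inl (i, \<alpha>)) * partial i \<phi> x) + \<kappa> * X x (Inr \<alpha>) * \<phi> x \<partial>lborel)"
    have "?I (\<lambda>x s. block a J x s + f x s) = (\<integral>x. ((\<Sum>i\<in>UNIV. block a U x (Inl (i, \<alpha>)) * partial i \<phi> x) + \<kappa> * block a U x (Inr \<alpha>) * \<phi> x)
        + (((\<Sum>i\<in>UNIV. jet \<kappa> r x (Inl (i, \<alpha>)) * partial i \<phi> x) + \<kappa> * jet \<kappa> r x (Inr \<alpha>) * \<phi> x)
        - ((\<Sum>i\<in>UNIV. P x (Inl (i, \<alpha>)) * partial i \<phi> x) + \<kappa> * P x (Inr \<alpha>) * \<phi> x)) \<partial>lborel)"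
      unfolding Fsum
      by (intro Bochner_Integration.integral_cong refl)
         (simp add: distrib_right distrib_left left_diff_distrib right_diff_distrib sum.distrib sum_subtractf)
    also have "\<dots> = ?I (block a U) + (?I (jet \<kappa> r) - ?I P)"
      by (simp only: Bochner_Integration.integral_add[OF i1 Bochner_Integration.integrable_diff[OF i2 i3]]
          Bochner_Integration.integral_diff[OF i2 i3])
    also have "?I (jet \<kappa> r) = ?I P"
      by (simp only: dual_div_test[where P = "jet \<kappa> r", OF rt \<phi>] dual_div_test[where P = P, OF P \<phi>] dd)
    also have "?I (block a U) = (\<integral>x. (\<Sum>i\<in>UNIV. (\<Sum>l\<in>UNIV. a x (i, \<alpha>) l * (Du x l + e l)) * partial i \<phi> x) + \<kappa>\<^sup>2 * u x \<alpha> * \<phi> x \<partial>lborel)"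
      by (simp add: U_def et_def power2_eq_square mult.assoc)
    also have "\<dots> = 0" by (rule eq[OF \<phi>])
    finally show ?thesis by simp
  qed
  define G where "G = (\<lambda>y. (\<Sum>k\<in>UNIV. (Du y k)\<^sup>2) + (\<Sum>\<alpha>\<in>UNIV. (u y \<alpha>)\<^sup>2))"
  have lG: "loc_int G" unfolding G_def using u Du by (intro loc_int_add loc_int_sum loc_int_sq) (auto simp: lL2_def)
  have G0: "G x \<ge> 0" for x by (simp add: G_def sum_nonneg)
  obtain M1 where M1: "\<And>R. R \<ge> 1 \<Longrightarrow> ball_avg G R \<le> M1"
    using ball_avg_bounded_of_unif_loc[OF lG G0, of M] M unfolding G_def by blast
  obtain B where B: "\<And>x. \<bar>\<Sum>s\<in>UNIV. jet \<kappa> g x s * jet \<kappa> g x s\<bar> \<le> B"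
    using unif_ap_bounded[OF ap_prod[OF ap_jet[OF tv(1)] ap_jet[OF tv(1)]]] by blast
  have bound: "ball_avg (\<lambda>x. \<Sum>s\<in>UNIV. (J x s)\<^sup>2) R \<le> 2 * (1 + \<kappa>\<^sup>2) * M1 + 2 * B" if "R \<ge> 1" for R
  proof -
    have "ball_avg (\<lambda>x. \<Sum>s\<in>UNIV. (J x s)\<^sup>2) R \<le> ball_avg (\<lambda>x. 2 * (1 + \<kappa>\<^sup>2) * G x + 2 * B) R"
    proof (rule ball_avg_mono)
      show "loc_int (\<lambda>x. \<Sum>s\<in>UNIV. (J x s)\<^sup>2)" using J by (auto intro!: loc_int_sum loc_int_sq simp: lL2_def)
      show "loc_int (\<lambda>x. 2 * (1 + \<kappa>\<^sup>2) * G x + 2 * B)" by (intro loc_int_add loc_int_cmult lG loc_int_const)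
      fix x
      have "(\<Sum>s\<in>UNIV. (J x s)\<^sup>2) \<le> (\<Sum>s\<in>UNIV. 2 * (Ju x s)\<^sup>2 + 2 * (jet \<kappa> g x s * jet \<kappa> g x s))"
      proof (rule sum_mono)
        fix s show "(J x s)\<^sup>2 \<le> 2 * (Ju x s)\<^sup>2 + 2 * (jet \<kappa> g x s * jet \<kappa> g x s)"
          using sum_squares_bound[of "Ju x s" "- jet \<kappa> g x s"] by (simp add: J_def power2_eq_square algebra_simps)
      qed
      also have "\<dots> = 2 * (\<Sum>s\<in>UNIV. (Ju x s)\<^sup>2) + 2 * (\<Sum>s\<in>UNIV. jet \<kappa> g x s * jet \<kappa> g x s)"
        by (simp add: sum.distrib sum_distrib_left)
      also have "\<dots> \<le> 2 * ((1 + \<kappa>\<^sup>2) * G x) + 2 * B"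
      proof (intro add_mono mult_left_mono)
        have "(\<Sum>s\<in>UNIV. (Ju x s)\<^sup>2) = 1 * (\<Sum>k\<in>UNIV. (Du x k)\<^sup>2) + \<kappa>\<^sup>2 * (\<Sum>\<alpha>\<in>UNIV. (u x \<alpha>)\<^sup>2)"
          by (simp add: sum_UNIV_sum power_mult_distrib sum_distrib_left)
        also have "\<dots> \<le> (1 + \<kappa>\<^sup>2) * (\<Sum>k\<in>UNIV. (Du x k)\<^sup>2) + (1 + \<kappa>\<^sup>2) * (\<Sum>\<alpha>\<in>UNIV. (u x \<alpha>)\<^sup>2)"
          by (intro add_mono mult_right_mono sum_nonneg) auto
        finally show "(\<Sum>s\<in>UNIV. (Ju x s)\<^sup>2) \<le> (1 + \<kappa>\<^sup>2) * G x" by (simp add: G_def distrib_left)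
      qed (use B[of x] in auto)
      finally show "(\<Sum>s\<in>UNIV. (J x s)\<^sup>2) \<le> 2 * (1 + \<kappa>\<^sup>2) * G x + 2 * B" by (simp only: mult.assoc)
    qed
    also have "\<dots> = 2 * (1 + \<kappa>\<^sup>2) * ball_avg G R + 2 * B"
      using that by (simp add: ball_avg_add ball_avg_cmult ball_avg_const loc_int_cmult lG loc_int_const)
    also have "\<dots> \<le> 2 * (1 + \<kappa>\<^sup>2) * M1 + 2 * B" using M1[OF that] by (intro add_right_mono mult_left_mono) auto
    finally show ?thesis .
  qed
  have "\<forall>\<^sub>F R in at_top. ball_avg (\<lambda>x. \<Sum>s\<in>UNIV. (J x s)\<^sup>2) R \<le> caccioppoli_const * ip f f + \<delta>"
    by (rule caccioppoli[OF w J lL2_ap[OF f(1)] Jr \<kappa> wg we bound ap_has_mean_sq[OF f(1)] \<delta>])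
  then show ?thesis
  proof eventually_elim
    case (elim R)
    have "ball_avg (\<lambda>x. \<Sum>k\<in>UNIV. (Du x k - grad g x k)\<^sup>2) R \<le> ball_avg (\<lambda>x. \<Sum>s\<in>UNIV. (J x s)\<^sup>2) R"
    proof (rule ball_avg_mono)
      have "loc_L2 (\<lambda>x. Du x k - grad g x k)" for k using J[unfolded lL2_def, rule_format, of "Inl k"] by (simp add: J_def)
      then show "loc_int (\<lambda>x. \<Sum>k\<in>UNIV. (Du x k - grad g x k)\<^sup>2)" by (intro loc_int_sum loc_int_sq)
      show "loc_int (\<lambda>x. \<Sum>s\<in>UNIV. (J x s)\<^sup>2)" using J by (auto intro!: loc_int_sum loc_int_sq simp: lL2_def)
      show "(\<Sum>k\<in>UNIV. (Du x k - grad g x k)\<^sup>2) \<le> (\<Sum>s\<in>UNIV. (J x s)\<^sup>2)" for x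
        by (simp add: sum_UNIV_sum J_def sum_nonneg)
    qed
    moreover have "caccioppoli_const * ip f f \<le> caccioppoli_const * ((N + 1) * \<epsilon>)\<^sup>2"
    proof (rule mult_left_mono)
      show "ip f f \<le> ((N + 1) * \<epsilon>)\<^sup>2"
        using power_mono[OF f(2) ap.nrm_nonneg[OF f(1)], of 2] by (simp add: ap.nrm_sq f(1))
      show "0 \<le> caccioppoli_const" using \<mu> by (simp add: caccioppoli_const_def)
    qed
    ultimately show ?case using elim by linarith
  qed
qed

end

section \<open>The exact corrector and the telescoping over scales\<close>

lemma nrm_tendsto_nm: "ap p \<Longrightarrow> ((\<lambda>R. bal.nrm R p) \<longlongrightarrow> nm p) at_top"
  unfolding bal.nrm_def ap.nrm_def bip_def ip_def
  using unif_ap_has_mean[OF ap_prod, of p p] by (intro tendsto_real_sqrt) (simp add: has_mean_def)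

lemma bip_tendsto_ip: "ap F \<Longrightarrow> ap G \<Longrightarrow> ((\<lambda>R. bip R F G) \<longlongrightarrow> ip F G) at_top"
  unfolding bip_def ip_def using unif_ap_has_mean[OF ap_prod, of F G] by (simp add: has_mean_def)

lemma nrm_ball_avg: "bal.nrm R F = sqrt (ball_avg (\<lambda>x. \<Sum>k\<in>UNIV. (F x k)\<^sup>2) R)"
  by (simp add: bal.nrm_def bip_def power2_eq_square)

lemma B2_norm_less: "B2_norm F < ereal \<delta> \<Longrightarrow> \<forall>\<^sub>F R in at_top. bal.nrm R F \<le> \<delta>"
  unfolding B2_norm_def nrm_ball_avg by (drule Limsup_lessD) (auto elim: eventually_mono)

context elliptic_system
begin

lemma nrm_block_le:
  fixes F :: "real^'d \<Rightarrow> ('d \<times> 'm) + 'm \<Rightarrow> real"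
  assumes "lL2 F" shows "bal.nrm R (block a F) \<le> K * bal.nrm R F"
proof -
  have "ball_avg (\<lambda>x. \<Sum>s\<in>UNIV. (block a F x s)\<^sup>2) R \<le> ball_avg (\<lambda>x. K\<^sup>2 * (\<Sum>s\<in>UNIV. (F x s)\<^sup>2)) R"
    using lL2_block[OF assms] assms block_bounded_pointwise
    by (intro ball_avg_mono loc_int_cmult loc_int_sum loc_int_sq) (auto simp: lL2_def)
  then have "sqrt (ball_avg (\<lambda>x. \<Sum>s\<in>UNIV. (block a F x s)\<^sup>2) R) \<le> sqrt (K\<^sup>2 * ball_avg (\<lambda>x. \<Sum>s\<in>UNIV. (F x s)\<^sup>2) R)"
    by (simp add: ball_avg_cmult)
  then show ?thesis using K by (simp add: nrm_ball_avg real_sqrt_mult)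
qed

text \<open>A trigonometric gradient within \<delta> of \<psi> inherits its equation up to K
  \<delta>. The hypothesis concerns \<open>mean\<close> of a product that is not almost-periodic, so
  the existence of that mean must be shown before it can be compared with averages over
  balls.\<close>

lemma psi_approx:
  fixes \<psi> :: "real^'d \<Rightarrow> 'd \<times> 'm \<Rightarrow> real"
  assumes V: "V2pot \<psi>"
    and eq: "\<And>h. tv h \<Longrightarrow> mean (\<lambda>x. \<Sum>k\<in>UNIV. (\<Sum>l\<in>UNIV. a x k l * \<psi> x l) * grad h x k)
      = - mean (\<lambda>x. \<Sum>k\<in>UNIV. (\<Sum>l\<in>UNIV. a x k l * e l) * grad h x k)"
    and \<delta>: "\<delta> > 0"
  obtains q where "tv q" "weak 0 (K * \<delta>) q" "\<forall>\<^sub>F R in at_top. bal.nrm R (\<lambda>x k. \<psi> x k - grad q x k) \<le> \<delta>"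
proof -
  \<comment> \<open>Padding by zero puts \<psi> into the jet format with \<kappa> = 0.\<close>
  define \<psi>' where "\<psi>' = (\<lambda>x s. case s of Inl k \<Rightarrow> \<psi> x k | Inr (_ :: 'm) \<Rightarrow> 0)"
  have \<psi>: "lL2 \<psi>" using V by (simp add: V2pot_def lL2_def)
  have \<psi>': "lL2 \<psi>'" unfolding lL2_def
  proof
    fix s show "loc_L2 (\<lambda>x. \<psi>' x s)" using \<psi> by (cases s) (auto simp: \<psi>'_def lL2_def loc_L2_const)
  qed
  have ex: "\<exists>q. tv q \<and> (\<forall>\<^sub>F R in at_top. bal.nrm R (\<lambda>x k. \<psi> x k - grad q x k) \<le> \<delta>)" if "\<delta> > 0" for \<delta>
  proof -
    obtain g :: "real^'d \<Rightarrow> 'm \<Rightarrow> real" where "\<forall>\<alpha>. trig_poly (\<lambda>x. g x \<alpha>)" "B2_norm (\<lambda>x k. \<psi> x k - grad g x k) < ereal \<delta>"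
      using V \<open>\<delta> > 0\<close> unfolding V2pot_def by blast
    then show ?thesis using B2_norm_less by (auto simp: tv_def)
  qed
  have nrm_eq: "bal.nrm R (\<lambda>x s. \<psi>' x s - jet 0 q x s) = bal.nrm R (\<lambda>x k. \<psi> x k - grad q x k)" for R q
    by (simp add: nrm_ball_avg sum_UNIV_sum \<psi>'_def)
  have close: "\<bar>bip R (block a \<psi>') (jet 0 h) - bip R (block a (jet 0 q)) (jet 0 h)\<bar> \<le> K * \<delta> * bal.nrm R (jet 0 h)"
    if q: "tv q" and h: "tv h" and le: "bal.nrm R (\<lambda>x k. \<psi> x k - grad q x k) \<le> \<delta>" for q h \<delta> R
  proof -
    have L: "lL2 (jet 0 q)" "lL2 (jet 0 h)" by (intro lL2_ap ap_jet q h)+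
    have d: "lL2 (\<lambda>x s. \<psi>' x s - jet 0 q x s)" by (intro bal.ok_diff \<psi>' L)
    have "bip R (block a \<psi>') (jet 0 h) - bip R (block a (jet 0 q)) (jet 0 h) = bip R (block a (\<lambda>x s. \<psi>' x s - jet 0 q x s)) (jet 0 h)"
      unfolding block_diff by (intro bal.B_diff[symmetric] lL2_block \<psi>' L)
    moreover have "\<bar>bip R (block a (\<lambda>x s. \<psi>' x s - jet 0 q x s)) (jet 0 h)\<bar>
        \<le> bal.nrm R (block a (\<lambda>x s. \<psi>' x s - jet 0 q x s)) * bal.nrm R (jet 0 h)"
      by (intro bal.cauchy_schwarz lL2_block d L)
    moreover have "bal.nrm R (block a (\<lambda>x s. \<psi>' x s - jet 0 q x s)) \<le> K * \<delta>"
      using nrm_block_le[OF d, of R, unfolded nrm_eq] mult_left_mono[OF le, of K] K by linarith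
    then have "bal.nrm R (block a (\<lambda>x s. \<psi>' x s - jet 0 q x s)) * bal.nrm R (jet 0 h) \<le> K * \<delta> * bal.nrm R (jet 0 h)"
      by (intro mult_right_mono bal.nrm_nonneg L)
    ultimately show ?thesis by linarith
  qed
  obtain q where q: "tv q" "\<forall>\<^sub>F R in at_top. bal.nrm R (\<lambda>x k. \<psi> x k - grad q x k) \<le> \<delta>"
    using ex[OF \<delta>] by blast
  have "weak 0 (K * \<delta>) q" unfolding weak_def
  proof (intro conjI allI impI)
    fix h :: "real^'d \<Rightarrow> 'm \<Rightarrow> real" assume h: "tv h"
    have aps: "ap (jet 0 h)" "ap (jet 0 q)" "ap (block a (jet 0 q))" "ap (block a (\<lambda>_. et))"
      by (intro ap_block ap_jet h q ap_et)+
    let ?X = "\<lambda>x. \<Sum>s\<in>UNIV. block a \<psi>' x s * jet 0 h x s"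
    have bal_X: "ball_avg ?X R = bip R (block a \<psi>') (jet 0 h)" for R by (simp add: bip_def)
    \<comment> \<open>Existence follows by replacing \<psi> with gradients of polynomials q' of
      increasing accuracy, whose pairings with the jet of h do have means.\<close>
    have "\<exists>m. has_mean ?X m"
    proof (rule has_mean_approx)
      show "loc_int ?X" by (intro loc_int_bip lL2_block \<psi>' lL2_ap aps)
      fix \<epsilon> :: real assume \<epsilon>: "\<epsilon> > 0"
      have n: "nm (jet 0 h) + 1 > 0" using ap.nrm_nonneg[OF aps(1)] by simp
      define \<delta>' where "\<delta>' = \<epsilon> / (K * (nm (jet 0 h) + 1))"
      have \<delta>': "\<delta>' > 0" using \<epsilon> K n by (simp add: \<delta>'_def)
      obtain q' where q': "tv q'" "\<forall>\<^sub>F R in at_top. bal.nrm R (\<lambda>x k. \<psi> x k - grad q' x k) \<le> \<delta>'" using ex[OF \<delta>'] by blast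
      have "\<forall>\<^sub>F R in at_top. bal.nrm R (jet 0 h) < nm (jet 0 h) + 1"
        using nrm_tendsto_nm[OF aps(1)] by (rule order_tendstoD) simp
      with q'(2) have "\<forall>\<^sub>F R in at_top. \<bar>ball_avg ?X R - ball_avg (\<lambda>x. \<Sum>s\<in>UNIV. block a (jet 0 q') x s * jet 0 h x s) R\<bar> \<le> \<epsilon>"
      proof eventually_elim
        case (elim R)
        have "K * \<delta>' * bal.nrm R (jet 0 h) \<le> K * \<delta>' * (nm (jet 0 h) + 1)"
          using elim(2) K \<delta>' by (intro mult_left_mono) auto
        also have "\<dots> = \<epsilon>" using K n by (simp add: \<delta>'_def)
        finally show ?case using close[OF q'(1) h elim(1)] by (simp add: bip_def)
      qed
      moreover have "has_mean (\<lambda>x. \<Sum>s\<in>UNIV. block a (jet 0 q') x s * jet 0 h x s) (ip (block a (jet 0 q')) (jet 0 h))"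
        unfolding ip_def by (intro unif_ap_has_mean ap_prod ap_block ap_jet q' h)
      ultimately show "\<exists>(g :: real^'d \<Rightarrow> real) m. has_mean g m \<and> (\<forall>\<^sub>F R in at_top. \<bar>ball_avg ?X R - ball_avg g R\<bar> \<le> \<epsilon>)"
        by blast
    qed
    then obtain m where m: "has_mean ?X m" ..
    have X_eq: "?X x = (\<Sum>k\<in>UNIV. (\<Sum>l\<in>UNIV. a x k l * \<psi> x l) * grad h x k)" for x
      by (simp add: sum_UNIV_sum \<psi>'_def)
    have "m = mean ?X" using has_mean_eq[OF m] by simp
    also have "\<dots> = - mean (\<lambda>x. \<Sum>k\<in>UNIV. (\<Sum>l\<in>UNIV. a x k l * e l) * grad h x k)"
      unfolding X_eq by (rule eq[OF h])
    also have "\<dots> = - ip (block a (\<lambda>_. et)) (jet 0 h)"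
      by (simp add: ip_def sum_UNIV_sum et_def)
    finally have m_eq: "m = - ip (block a (\<lambda>_. et)) (jet 0 h)" .
    have "\<bar>m - ip (block a (jet 0 q)) (jet 0 h)\<bar> \<le> K * \<delta> * nm (jet 0 h)"
    proof (rule tendsto_le[of at_top])
      show "((\<lambda>R. K * \<delta> * bal.nrm R (jet 0 h)) \<longlongrightarrow> K * \<delta> * nm (jet 0 h)) at_top"
        by (intro tendsto_intros nrm_tendsto_nm aps)
      show "((\<lambda>R. \<bar>bip R (block a \<psi>') (jet 0 h) - bip R (block a (jet 0 q)) (jet 0 h)\<bar>) \<longlongrightarrow> \<bar>m - ip (block a (jet 0 q)) (jet 0 h)\<bar>) at_top"
        using m by (intro tendsto_intros bip_tendsto_ip aps) (simp add: has_mean_def bip_def)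
      show "\<forall>\<^sub>F R in at_top. \<bar>bip R (block a \<psi>') (jet 0 h) - bip R (block a (jet 0 q)) (jet 0 h)\<bar> \<le> K * \<delta> * bal.nrm R (jet 0 h)"
        using q(2) by eventually_elim (rule close[OF q(1) h])
    qed simp
    moreover have "ip (flux 0 q) (jet 0 h) = ip (block a (jet 0 q)) (jet 0 h) + ip (block a (\<lambda>_. et)) (jet 0 h)"
      unfolding flux_def block_add by (intro ap.B_add aps)
    ultimately show "\<bar>ip (flux 0 q) (jet 0 h)\<bar> \<le> K * \<delta> * nm (jet 0 h)"
      unfolding m_eq by linarith
  qed (rule q)
  with q show thesis by (intro that)
qed

text \<open>The bound of \<open>weak_energy\<close> for \<epsilon> <= 1, uniform in the
  scale.\<close>

definition M0 where "M0 = (1 + K * E0) / \<mu>"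
text \<open>Collects the coefficients of \<open>weak_norm_le\<close> once \<epsilon>, \<eta>/2 and
  R/T are all bounded by \<theta>(T) + \<epsilon>.\<close>

definition C0 where "C0 = (2 + 2 * (M0 + E0)) / \<mu> + M0 + 1"

definition osc_le :: "real \<Rightarrow> real \<Rightarrow> bool" where
  "osc_le R \<eta> \<longleftrightarrow> (\<forall>y. \<exists>z. norm z \<le> R \<and>
     (\<forall>x \<xi>. (\<Sum>k\<in>UNIV. (\<Sum>l\<in>UNIV. (a (x + y) k l - a (x + z) k l) * \<xi> l)\<^sup>2) \<le> \<eta>\<^sup>2 * (\<Sum>k\<in>UNIV. (\<xi> k)\<^sup>2)))"

text \<open>All that the telescoping uses of \<open>Theta\<close>. Of the allowance 2 \<epsilon>,
  one \<epsilon> pays for a nearly optimal R and one for a nearly optimal z.\<close>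

definition controlled_osc :: "(real \<Rightarrow> real) \<Rightarrow> bool" where
  "controlled_osc \<theta> \<longleftrightarrow> (\<forall>T>0. \<theta> T \<ge> 0 \<and>
     (\<forall>\<epsilon>>0. \<exists>R \<eta>. 0 \<le> \<eta> \<and> \<eta> \<le> \<theta> T + 2 * \<epsilon> \<and> R / T \<le> \<theta> T + \<epsilon> \<and> osc_le R \<eta>))"

lemma M0_nonneg: "M0 \<ge> 0" using \<mu> K E0_nonneg by (simp add: M0_def)

lemma C0_nonneg: "C0 \<ge> 0" using \<mu> M0_nonneg E0_nonneg by (simp add: C0_def)

lemma weak_small:
  assumes \<theta>: "controlled_osc \<theta>" and W: "weak (1 / T) \<epsilon> g" and T: "T > 0" and \<epsilon>: "0 < \<epsilon>" "\<epsilon> \<le> 1"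
  shows "1 / T * nm g \<le> C0 * (\<theta> T + \<epsilon>)"
proof -
  obtain R \<eta> where R: "0 \<le> \<eta>" "\<eta> \<le> \<theta> T + 2 * \<epsilon>" "R / T \<le> \<theta> T + \<epsilon>" "osc_le R \<eta>"
    using \<theta> T \<epsilon>(1) unfolding controlled_osc_def by blast
  have \<theta>0: "\<theta> T \<ge> 0" using \<theta> T unfolding controlled_osc_def by blast
  have g: "tv g" using W by (simp add: weak_def)
  let ?n = "nm (jet (1 / T) g)"
  have n: "?n \<le> M0" "?n \<ge> 0"
  proof -
    have "?n \<le> (\<epsilon> + K * E0) / \<mu>" using W \<epsilon> by (intro weak_energy) auto
    also have "\<dots> \<le> M0" unfolding M0_def using \<epsilon> \<mu> by (intro divide_right_mono) auto
    finally show "?n \<le> M0" .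
  qed (intro ap.nrm_nonneg ap_jet g)
  have "1 / T * nm g \<le> (2 * \<epsilon> + \<eta> * (?n + E0)) / \<mu> + 1 / T * R * ?n + \<epsilon>"
    by (rule weak_norm_le[OF W _ _ R(1) R(4)[unfolded osc_le_def, rule_format]]) (use T \<epsilon> in auto)
  also have "\<dots> \<le> (2 * (\<theta> T + \<epsilon>) + 2 * (\<theta> T + \<epsilon>) * (M0 + E0)) / \<mu> + (\<theta> T + \<epsilon>) * M0 + (\<theta> T + \<epsilon>)"
  proof (intro add_mono divide_right_mono)
    show "\<eta> * (?n + E0) \<le> 2 * (\<theta> T + \<epsilon>) * (M0 + E0)"
      using R(1,2) n E0_nonneg \<theta>0 \<epsilon> by (intro mult_mono) auto
    have "1 / T * R * ?n \<le> (\<theta> T + \<epsilon>) * ?n" using R(3) n by (intro mult_right_mono) auto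
    also have "\<dots> \<le> (\<theta> T + \<epsilon>) * M0" using n \<theta>0 \<epsilon> by (intro mult_left_mono) auto
    finally show "1 / T * R * ?n \<le> (\<theta> T + \<epsilon>) * M0" .
  qed (use \<theta>0 \<epsilon> \<mu> in auto)
  also have "\<dots> = C0 * (\<theta> T + \<epsilon>)" using \<mu> by (simp add: C0_def field_simps)
  finally show ?thesis .
qed

text \<open>The residual is returned along with \<open>weak\<close>, since the comparison with the
  true corrector tests it with compactly supported functions. Dividing by 1 + N offsets the loss in
  \<open>weak_of_residual\<close>.\<close>

lemma weak_exists:
  assumes "T > 0" "\<epsilon> > 0"
  obtains g P r where "residual (1 / T) (\<epsilon> / (1 + N)) g P r" "nm (jet (1 / T) r) \<le> \<epsilon> / (1 + N)" "weak (1 / T) \<epsilon> g"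
proof -
  have N: "1 + N > 0" by (simp add: N_def add_pos_nonneg)
  obtain g P r where R: "residual (1 / T) (\<epsilon> / (1 + N)) g P r" "nm (jet (1 / T) r) \<le> \<epsilon> / (1 + N)"
    using small_residual[of "1 / T" "\<epsilon> / (1 + N)"] assms N by auto
  moreover have "weak (1 / T) \<epsilon> g" using weak_of_residual[OF R] N by simp
  ultimately show thesis by (rule that)
qed

lemma jet0_le:
  assumes "tv g" shows "nm (jet 0 g) \<le> nm (jet \<kappa> g)"
proof -
  have "nm (jet 0 g) \<le> 1 * nm (jet \<kappa> g)"
    by (rule nm_mono) (auto simp: ap_jet assms sum_UNIV_sum sum_nonneg)
  then show ?thesis by simp
qed

text \<open>Telescoping over the dyadic scales \<open>T, 2T, \<dots>, 2\<^sup>nT\<close>, at the end of which the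
  zeroth-order term is negligible.\<close>

lemma dyadic_chain:
  assumes \<theta>: "controlled_osc \<theta>" and q: "weak 0 \<delta> q" "\<delta> \<ge> 0" and \<epsilon>: "0 < \<epsilon>" "\<epsilon> \<le> 1"
  shows "T > 0 \<Longrightarrow> weak (1 / T) \<epsilon> g \<Longrightarrow>
    nm (jet 0 (\<lambda>x \<alpha>. g x \<alpha> - q x \<alpha>)) \<le> (\<Sum>j<n. 2 / \<mu> * (C0 * (\<theta> (2 ^ Suc j * T) + \<epsilon>) + \<epsilon>)) + (\<epsilon> + \<delta> + nm q / (2 ^ n * T)) / \<mu>"
proof (induction n arbitrary: T g)
  \<comment> \<open>The last comparison is with \<open>q\<close> itself, by \<open>weak_diff\<close>
    with \<kappa>' = 0. Nothing is known about the size of q; it is only divided by the last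
    scale.\<close>
  case 0
  have g: "tv g" "tv q" using 0 q by (auto simp: weak_def)
  have "nm (jet 0 (\<lambda>x \<alpha>. g x \<alpha> - q x \<alpha>)) \<le> nm (jet (1 / T) (\<lambda>x \<alpha>. g x \<alpha> - q x \<alpha>))"
    by (intro jet0_le tv_diff g)
  also have "\<dots> \<le> (\<epsilon> + \<delta> + 1 / T * nm q) / \<mu>"
    using weak_diff[OF 0(2) q(1)] 0(1) \<epsilon> q(2) by simp
  finally show ?case by simp
next
  case (Suc n)
  define T' where "T' = 2 * T"
  have T': "T' > 0" using Suc.prems by (simp add: T'_def)
  obtain g' where g': "weak (1 / T') \<epsilon> g'" using weak_exists[OF T' \<epsilon>(1)] by blast
  have tv: "tv g" "tv g'" "tv q" using Suc.prems g' q by (auto simp: weak_def)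
  have "nm (jet (1 / T) (\<lambda>x \<alpha>. g x \<alpha> - g' x \<alpha>)) \<le> (\<epsilon> + \<epsilon> + 1 / T * nm g') / \<mu>"
    using Suc.prems(1) \<epsilon> by (intro weak_diff[OF Suc.prems(2) g']) (auto simp: T'_def field_simps)
  also have "\<dots> \<le> 2 / \<mu> * (C0 * (\<theta> T' + \<epsilon>) + \<epsilon>)"
  proof -
    \<comment> \<open>Passing from T to 2T costs |g'|/T, which is twice the quantity that
      \<open>weak_small\<close> bounds at the scale 2T.\<close>
    have "1 / T * nm g' = 2 * (1 / T' * nm g')" by (simp add: T'_def)
    also have "\<dots> \<le> 2 * (C0 * (\<theta> T' + \<epsilon>))" by (intro mult_left_mono weak_small[OF \<theta> g' T' \<epsilon>]) simp
    finally have "\<epsilon> + \<epsilon> + 1 / T * nm g' \<le> 2 * (C0 * (\<theta> T' + \<epsilon>) + \<epsilon>)" by simp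
    from divide_right_mono[OF this, of \<mu>] show ?thesis using \<mu> by simp
  qed
  finally have 1: "nm (jet 0 (\<lambda>x \<alpha>. g x \<alpha> - g' x \<alpha>)) \<le> 2 / \<mu> * (C0 * (\<theta> T' + \<epsilon>) + \<epsilon>)"
    using jet0_le[OF tv_diff[OF tv(1,2)], of "1 / T"] by linarith
  have eq: "jet 0 (\<lambda>x \<alpha>. g x \<alpha> - q x \<alpha>) = (\<lambda>x s. jet 0 (\<lambda>x \<alpha>. g x \<alpha> - g' x \<alpha>) x s + jet 0 (\<lambda>x \<alpha>. g' x \<alpha> - q x \<alpha>) x s)"
    by (simp add: jet_diff tv)
  have tri: "nm (jet 0 (\<lambda>x \<alpha>. g x \<alpha> - q x \<alpha>)) \<le> nm (jet 0 (\<lambda>x \<alpha>. g x \<alpha> - g' x \<alpha>)) + nm (jet 0 (\<lambda>x \<alpha>. g' x \<alpha> - q x \<alpha>))"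
    unfolding eq by (intro ap.nrm_triangle ap_jet tv_diff tv)
  have scale: "2 ^ Suc j * T = 2 ^ j * T'" for j by (simp add: T'_def)
  have sums: "(\<Sum>j<Suc n. 2 / \<mu> * (C0 * (\<theta> (2 ^ Suc j * T) + \<epsilon>) + \<epsilon>))
      = 2 / \<mu> * (C0 * (\<theta> T' + \<epsilon>) + \<epsilon>) + (\<Sum>j<n. 2 / \<mu> * (C0 * (\<theta> (2 ^ Suc j * T') + \<epsilon>) + \<epsilon>))"
    unfolding scale sum.lessThan_Suc_shift by (simp only: power_0 mult_1)
  show ?case
    unfolding sums unfolding scale using tri 1 Suc.IH[OF T' g'] by linarith
qed

text \<open>The difference is approximated on large balls by the trigonometric field grad q - grad
  g. This gives both the existence of the limit, by the Cauchy criterion, and its bound. The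
  parameters are chosen in the order \<delta> and q, then the number n of scales, then \<epsilon>
  and g.\<close>

lemma psi_corrector_dist:
  fixes u :: "real^'d \<Rightarrow> 'm \<Rightarrow> real" and Du \<psi> :: "real^'d \<Rightarrow> 'd \<times> 'm \<Rightarrow> real"
  assumes \<theta>: "controlled_osc \<theta>" and T: "T > 0" and V: "V2pot \<psi>"
    and psi_eq: "\<And>h. tv h \<Longrightarrow> mean (\<lambda>x. \<Sum>k\<in>UNIV. (\<Sum>l\<in>UNIV. a x k l * \<psi> x l) * grad h x k)
      = - mean (\<lambda>x. \<Sum>k\<in>UNIV. (\<Sum>l\<in>UNIV. a x k l * e l) * grad h x k)"
    and u: "lL2 u" and Du: "lL2 Du"
    and weak_grad: "\<And>\<phi> i \<alpha>. test_fun \<phi> \<Longrightarrow> (\<integral>x. u x \<alpha> * partial i \<phi> x \<partial>lborel) = - (\<integral>x. Du x (i, \<alpha>) * \<phi> x \<partial>lborel)"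
    and M: "\<And>x. set_lebesgue_integral lborel (ball x 1) (\<lambda>y. (\<Sum>k\<in>UNIV. (Du y k)\<^sup>2) + (\<Sum>\<alpha>\<in>UNIV. (u y \<alpha>)\<^sup>2)) \<le> M"
    and eq: "\<And>\<phi> \<alpha>. test_fun \<phi> \<Longrightarrow>
       (\<integral>x. (\<Sum>i\<in>UNIV. (\<Sum>l\<in>UNIV. a x (i, \<alpha>) l * (Du x l + e l)) * partial i \<phi> x) + (1 / T)\<^sup>2 * u x \<alpha> * \<phi> x \<partial>lborel) = 0"
    and S: "\<And>n. (\<Sum>j<n. \<theta> (2 ^ Suc j * T)) \<le> S"
  obtains L where "((\<lambda>R. bal.nrm R (\<lambda>x k. \<psi> x k - Du x k)) \<longlongrightarrow> L) at_top" "0 \<le> L" "L \<le> 2 / \<mu> * C0 * S"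
proof -
  let ?D = "\<lambda>x k. \<psi> x k - Du x k"
  have \<psi>: "lL2 \<psi>" using V by (simp add: V2pot_def lL2_def)
  have D: "lL2 ?D" by (intro bal.ok_diff \<psi> Du)
  have approx: "\<exists>p :: real^'d \<Rightarrow> 'd \<times> 'm \<Rightarrow> real. ap p \<and> nm p \<le> 2 / \<mu> * C0 * S + s \<and> (\<forall>\<^sub>F R in at_top. \<bar>bal.nrm R ?D - bal.nrm R p\<bar> \<le> s)" if s: "s > 0" for s
  proof -
    \<comment> \<open>The first entry bounds the distance of \<psi> to grad q, the second the
      resulting error K \<delta>/\<mu> at the end of the telescoping.\<close>
    define \<delta> where "\<delta> = min (s / 2) (s * \<mu> / (4 * K))"
    have \<delta>: "\<delta> > 0" "\<delta> \<le> s / 2" "K * \<delta> / \<mu> \<le> s / 4"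
    proof -
      show "\<delta> > 0" "\<delta> \<le> s / 2" using s \<mu> K by (auto simp: \<delta>_def)
      have "K * \<delta> \<le> K * (s * \<mu> / (4 * K))" using K by (intro mult_left_mono) (auto simp: \<delta>_def)
      also have "\<dots> = s / 4 * \<mu>" using K by simp
      finally show "K * \<delta> / \<mu> \<le> s / 4" using \<mu> by (simp add: pos_divide_le_eq)
    qed
    obtain q where q: "tv q" "weak 0 (K * \<delta>) q" "\<forall>\<^sub>F R in at_top. bal.nrm R (\<lambda>x k. \<psi> x k - grad q x k) \<le> \<delta>"
      using psi_approx[OF V psi_eq \<delta>(1)] by blast
    have "(\<lambda>n. nm q / T / \<mu> * (1 / 2) ^ n) \<longlonglongrightarrow> nm q / T / \<mu> * 0"
      by (intro tendsto_mult tendsto_const LIMSEQ_power_zero) simp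
    then have "\<forall>\<^sub>F n in sequentially. nm q / T / \<mu> * (1 / 2) ^ n < s / 4"
      by (rule order_tendstoD) (use s in simp)
    then obtain n where n: "nm q / T / \<mu> * (1 / 2) ^ n < s / 4" by (auto simp: eventually_sequentially)
    \<comment> \<open>The total coefficient of \<epsilon> after n telescoping steps and the final
      comparison.\<close>
    define b where "b = 2 * real n / \<mu> * (C0 + 1) + 1 / \<mu>"
    have b: "b > 0" using \<mu> C0_nonneg by (simp add: b_def add_nonneg_pos)
    have cc: "caccioppoli_const \<ge> 0" using \<mu> by (simp add: caccioppoli_const_def)
    \<comment> \<open>The entry with b keeps the accumulated error below s/4. The last one bounds
      the Caccioppoli term by s^2/8, which with the slack s^2/8 of \<open>corrector_close\<close>
      stays below (s/2)^2.\<close>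
    define \<epsilon> where "\<epsilon> = min 1 (min (s / (4 * b)) (s\<^sup>2 / (8 * (caccioppoli_const + 1))))"
    have \<epsilon>: "0 < \<epsilon>" "\<epsilon> \<le> 1" "b * \<epsilon> \<le> s / 4" "caccioppoli_const * \<epsilon>\<^sup>2 \<le> s\<^sup>2 / 8"
    proof -
      show e0: "0 < \<epsilon>" "\<epsilon> \<le> 1" using s b cc by (auto simp: \<epsilon>_def)
      have "b * \<epsilon> \<le> b * (s / (4 * b))" using b by (intro mult_left_mono) (auto simp: \<epsilon>_def)
      then show "b * \<epsilon> \<le> s / 4" using b by simp
      have "caccioppoli_const * \<epsilon>\<^sup>2 \<le> (caccioppoli_const + 1) * \<epsilon>"
        using e0 cc by (intro mult_mono) (auto simp: power2_eq_square mult_left_le)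
      also have "\<dots> \<le> (caccioppoli_const + 1) * (s\<^sup>2 / (8 * (caccioppoli_const + 1)))"
        using cc by (intro mult_left_mono) (auto simp: \<epsilon>_def)
      also have "\<dots> = s\<^sup>2 / 8"
      proof -
        have cancel: "x \<noteq> 0 \<Longrightarrow> x * (y / (8 * x)) = y / 8" for x y :: real by simp
        show ?thesis by (rule cancel) (use cc in linarith)
      qed
      finally show "caccioppoli_const * \<epsilon>\<^sup>2 \<le> s\<^sup>2 / 8" .
    qed
    obtain g P r where R: "residual (1 / T) (\<epsilon> / (1 + N)) g P r" "nm (jet (1 / T) r) \<le> \<epsilon> / (1 + N)" "weak (1 / T) \<epsilon> g"
      using weak_exists[OF T \<epsilon>(1)] by blast
    have g: "tv g" using R by (simp add: weak_def)
    have G: "ap (grad g)" "ap (grad q)"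
      using g q(1) by (auto intro!: ap_trig simp: grad_def tv_def trig_poly_partial split: prod.splits)
    let ?p = "\<lambda>x k. grad q x k - grad g x k"
    have p: "ap ?p" by (intro ap.ok_diff G)
    have "nm ?p \<le> 1 * nm (jet 0 (\<lambda>x \<alpha>. g x \<alpha> - q x \<alpha>))"
    proof (rule nm_mono[OF p ap_jet[OF tv_diff[OF g q(1)]]])
      show "(\<Sum>k\<in>UNIV. (?p x k)\<^sup>2) \<le> 1\<^sup>2 * (\<Sum>s\<in>UNIV. (jet 0 (\<lambda>x \<alpha>. g x \<alpha> - q x \<alpha>) x s)\<^sup>2)" for x
        by (simp add: sum_UNIV_sum jet_diff g q(1) power2_commute)
    qed simp
    also have "1 * nm (jet 0 (\<lambda>x \<alpha>. g x \<alpha> - q x \<alpha>))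
      \<le> (\<Sum>j<n. 2 / \<mu> * (C0 * (\<theta> (2 ^ Suc j * T) + \<epsilon>) + \<epsilon>)) + (\<epsilon> + K * \<delta> + nm q / (2 ^ n * T)) / \<mu>"
      using dyadic_chain[OF \<theta> q(2) _ \<epsilon>(1,2) T R(3), of n] K \<delta>(1) by simp
    also have "\<dots> = 2 / \<mu> * C0 * (\<Sum>j<n. \<theta> (2 ^ Suc j * T)) + b * \<epsilon> + K * \<delta> / \<mu> + nm q / T / \<mu> * (1 / 2) ^ n"
    proof -
      have "(\<Sum>j<n. 2 / \<mu> * (C0 * (\<theta> (2 ^ Suc j * T) + \<epsilon>) + \<epsilon>))
          = (\<Sum>j<n. 2 / \<mu> * C0 * \<theta> (2 ^ Suc j * T)) + (\<Sum>j<n. 2 / \<mu> * (C0 + 1) * \<epsilon>)"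
        unfolding sum.distrib[symmetric] by (intro sum.cong refl) (simp add: algebra_simps add_divide_distrib)
      also have "\<dots> = 2 / \<mu> * C0 * (\<Sum>j<n. \<theta> (2 ^ Suc j * T)) + 2 * real n / \<mu> * (C0 + 1) * \<epsilon>"
        by (simp add: sum_distrib_left)
      finally have sums: "(\<Sum>j<n. 2 / \<mu> * (C0 * (\<theta> (2 ^ Suc j * T) + \<epsilon>) + \<epsilon>))
          = 2 / \<mu> * C0 * (\<Sum>j<n. \<theta> (2 ^ Suc j * T)) + 2 * real n / \<mu> * (C0 + 1) * \<epsilon>" .
      have "nm q / (2 ^ n * T) / \<mu> = nm q / T / \<mu> * (1 / 2) ^ n" by (simp add: power_one_over mult_ac)
      moreover have "b * \<epsilon> = 2 * real n / \<mu> * (C0 + 1) * \<epsilon> + \<epsilon> / \<mu>" by (simp add: b_def distrib_right)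
      ultimately show ?thesis unfolding sums add_divide_distrib[of _ _ \<mu>] by linarith
    qed
    also have "\<dots> \<le> 2 / \<mu> * C0 * S + s / 4 + s / 4 + s / 4"
      using S[of n] \<epsilon>(3) \<delta>(3) n C0_nonneg \<mu> by (intro add_mono mult_left_mono) auto
    also have "\<dots> \<le> 2 / \<mu> * C0 * S + s" using s by simp
    finally have nmp: "nm ?p \<le> 2 / \<mu> * C0 * S + s" .
    have "\<forall>\<^sub>F R in at_top. ball_avg (\<lambda>x. \<Sum>k\<in>UNIV. (Du x k - grad g x k)\<^sup>2) R
        \<le> caccioppoli_const * ((N + 1) * (\<epsilon> / (1 + N)))\<^sup>2 + s\<^sup>2 / 8"
      by (rule corrector_close[OF u Du weak_grad M eq _ R(1,2)]) (use T s in auto)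
    with q(3) have "\<forall>\<^sub>F R in at_top. \<bar>bal.nrm R ?D - bal.nrm R ?p\<bar> \<le> s"
    proof eventually_elim
      case (elim R)
      have "N + 1 > 0" by (simp add: N_def add_nonneg_pos)
      then have "(N + 1) * (\<epsilon> / (1 + N)) = \<epsilon>" by (simp add: add.commute)
      then have "ball_avg (\<lambda>x. \<Sum>k\<in>UNIV. (Du x k - grad g x k)\<^sup>2) R \<le> (s / 2)\<^sup>2"
        using elim(2) \<epsilon>(4) by (simp add: power_divide)
      from real_sqrt_le_mono[OF this] have 2: "bal.nrm R (\<lambda>x k. Du x k - grad g x k) \<le> s / 2"
        using s by (simp add: nrm_ball_avg)
      have L: "lL2 (\<lambda>x k. \<psi> x k - grad q x k)" "lL2 (\<lambda>x k. Du x k - grad g x k)" "lL2 ?p"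
        by (intro bal.ok_diff \<psi> Du lL2_ap G)+
      have "\<bar>bal.nrm R ?D - bal.nrm R ?p\<bar> \<le> bal.nrm R (\<lambda>x k. ?D x k - ?p x k)" by (intro bal.nrm_le_diff D L)
      also have "(\<lambda>x k. ?D x k - ?p x k) = (\<lambda>x k. (\<psi> x k - grad q x k) - (Du x k - grad g x k))" by (simp add: fun_eq_iff)
      also have "bal.nrm R \<dots> \<le> bal.nrm R (\<lambda>x k. \<psi> x k - grad q x k) + bal.nrm R (\<lambda>x k. Du x k - grad g x k)"
        by (intro bal.nrm_diff L)
      also have "\<dots> \<le> s" using elim(1) 2 \<delta>(2) by linarith
      finally show ?case .
    qed
    with p nmp show ?thesis by blast
  qed
  have "\<exists>L. ((\<lambda>R. bal.nrm R ?D) \<longlongrightarrow> L) at_top"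
    by (rule tendsto_at_top_approx) (use approx nrm_tendsto_nm in blast)
  then obtain L where L: "((\<lambda>R. bal.nrm R ?D) \<longlongrightarrow> L) at_top" ..
  have "0 \<le> L" by (rule tendsto_lowerbound[OF L]) (auto intro: always_eventually bal.nrm_nonneg D)
  moreover have "L \<le> 2 / \<mu> * C0 * S"
  proof (rule field_le_epsilon)
    fix t :: real assume "t > 0"
    then obtain p :: "real^'d \<Rightarrow> 'd \<times> 'm \<Rightarrow> real" where p: "ap p" "nm p \<le> 2 / \<mu> * C0 * S + t / 2" "\<forall>\<^sub>F R in at_top. \<bar>bal.nrm R ?D - bal.nrm R p\<bar> \<le> t / 2"
      using approx[of "t / 2"] by auto
    have "L \<le> nm p + t / 2"
    proof (rule tendsto_le[of at_top])
      show "((\<lambda>R. bal.nrm R p + t / 2) \<longlongrightarrow> nm p + t / 2) at_top" by (intro tendsto_intros nrm_tendsto_nm p)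
      show "\<forall>\<^sub>F R in at_top. bal.nrm R ?D \<le> bal.nrm R p + t / 2" using p(3) by eventually_elim linarith
    qed (use L in auto)
    with p(2) show "L \<le> 2 / \<mu> * C0 * S + t" by linarith
  qed
  ultimately show thesis using L that by blast
qed

end

section \<open>The coefficient tensor and the modulus of almost-periodicity\<close>

definition coeff_matrix :: "('d::finite, 'm::finite) coeff \<Rightarrow> real^'d \<Rightarrow> 'd \<times> 'm \<Rightarrow> 'd \<times> 'm \<Rightarrow> real" where
  "coeff_matrix A x k l = A x (fst k) (fst l) (snd k) (snd l)"

lemma coeff_matrix_form:
  "(\<Sum>k\<in>UNIV. (\<Sum>l\<in>UNIV. coeff_matrix A x k l * f l) * g k)
    = (\<Sum>i\<in>UNIV. \<Sum>j\<in>UNIV. \<Sum>\<alpha>\<in>UNIV. \<Sum>\<beta>\<in>UNIV. A x i j \<alpha> \<beta> * f (j, \<beta>) * g (i, \<alpha>))"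
proof -
  have "(\<Sum>k\<in>UNIV. (\<Sum>l\<in>UNIV. coeff_matrix A x k l * f l) * g k)
      = (\<Sum>i\<in>UNIV. \<Sum>\<alpha>\<in>UNIV. \<Sum>j\<in>UNIV. \<Sum>\<beta>\<in>UNIV. A x i j \<alpha> \<beta> * f (j, \<beta>) * g (i, \<alpha>))"
    by (simp add: sum_UNIV_prod coeff_matrix_def sum_distrib_right)
  also have "\<dots> = (\<Sum>i\<in>UNIV. \<Sum>j\<in>UNIV. \<Sum>\<alpha>\<in>UNIV. \<Sum>\<beta>\<in>UNIV. A x i j \<alpha> \<beta> * f (j, \<beta>) * g (i, \<alpha>))"
    by (intro sum.cong refl sum.swap)
  finally show ?thesis .
qed

text \<open>The Frobenius norm dominates the operator norm; this leads from
  \<open>tensor_dist\<close> and entrywise bounds to the matrix bounds of the locale.\<close>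

lemma sum_mult_sq_le:
  "(\<Sum>k\<in>(UNIV::'k::finite set). (\<Sum>l\<in>UNIV. b k l * \<xi> l)\<^sup>2) \<le> (\<Sum>k\<in>UNIV. \<Sum>l\<in>UNIV. (b k l)\<^sup>2) * (\<Sum>l\<in>UNIV. (\<xi> l :: real)\<^sup>2)"
proof -
  have "(\<Sum>k\<in>UNIV. (\<Sum>l\<in>UNIV. b k l * \<xi> l)\<^sup>2) \<le> (\<Sum>k\<in>UNIV. (\<Sum>l\<in>UNIV. (b k l)\<^sup>2) * (\<Sum>l\<in>UNIV. (\<xi> l)\<^sup>2))"
    by (intro sum_mono Cauchy_Schwarz_ineq_sum)
  then show ?thesis by (simp only: sum_distrib_right[symmetric])
qed

lemma tensor_dist_sq:
  "(tensor_dist (A x) (A y))\<^sup>2 = (\<Sum>k\<in>UNIV. \<Sum>l\<in>UNIV. (coeff_matrix A x k l - coeff_matrix A y k l)\<^sup>2)"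
proof -
  have "(\<Sum>k\<in>UNIV. \<Sum>l\<in>UNIV. (coeff_matrix A x k l - coeff_matrix A y k l)\<^sup>2)
      = (\<Sum>i\<in>UNIV. \<Sum>\<alpha>\<in>UNIV. \<Sum>j\<in>UNIV. \<Sum>\<beta>\<in>UNIV. (A x i j \<alpha> \<beta> - A y i j \<alpha> \<beta>)\<^sup>2)"
    by (simp add: sum_UNIV_prod coeff_matrix_def)
  also have "\<dots> = (\<Sum>i\<in>UNIV. \<Sum>j\<in>UNIV. \<Sum>\<alpha>\<in>UNIV. \<Sum>\<beta>\<in>UNIV. (A x i j \<alpha> \<beta> - A y i j \<alpha> \<beta>)\<^sup>2)"
    by (intro sum.cong refl sum.swap)
  finally show ?thesis by (simp add: tensor_dist_def sum_nonneg)
qed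

lemma tensor_dist_nonneg: "tensor_dist a b \<ge> 0"
  by (simp add: tensor_dist_def sum_nonneg)

lemma coeff_bounded:
  fixes A :: "('d::finite, 'm::finite) coeff"
  assumes ap: "\<forall>i j \<alpha> \<beta>. unif_ap (\<lambda>y. A y i j \<alpha> \<beta>)"
  obtains M where "M \<ge> 0" "\<And>x k l. \<bar>coeff_matrix A x k l\<bar> \<le> M"
proof -
  have "\<exists>M>0. \<forall>x. \<bar>coeff_matrix A x k l\<bar> \<le> M" for k l
    unfolding coeff_matrix_def by (rule unif_ap_bounded) (use ap in blast)+
  then obtain B where B: "\<And>k l. B k l > 0" "\<And>k l x. \<bar>coeff_matrix A x k l\<bar> \<le> B k l" by metis
  define M where "M = (\<Sum>k\<in>UNIV. \<Sum>l\<in>UNIV. B k l)"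
  have "B k l \<le> M" for k l
  proof -
    have "B k l \<le> (\<Sum>l\<in>UNIV. B k l)" by (intro member_le_sum less_imp_le[OF B(1)]) auto
    also have "\<dots> \<le> M" unfolding M_def
      by (intro member_le_sum[where f = "\<lambda>k. \<Sum>l\<in>UNIV. B k l"] sum_nonneg less_imp_le[OF B(1)]) auto
    finally show ?thesis .
  qed
  then have "\<bar>coeff_matrix A x k l\<bar> \<le> M" for x k l using B(2)[of x k l] by (rule order_trans[rotated])
  moreover have "M \<ge> 0" unfolding M_def by (intro sum_nonneg less_imp_le[OF B(1)])
  ultimately show thesis by (rule that[rotated])
qed

text \<open>\<open>K\<close> is obtained from the bounds on the almost-periodic entries, not from
  the upper ellipticity bound, which sees only the quadratic form.\<close>

lemma elliptic_system_coeff_matrix: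
  fixes A :: "('d::finite, 'm::finite) coeff"
  assumes ell: "elliptic \<mu> A" and ap: "\<forall>i j \<alpha> \<beta>. unif_ap (\<lambda>y. A y i j \<alpha> \<beta>)"
  obtains K where "elliptic_system (coeff_matrix A) \<mu> K"
proof -
  obtain M where M: "M \<ge> 0" "\<And>x k l. \<bar>coeff_matrix A x k l\<bar> \<le> M" using coeff_bounded[OF ap] by blast
  define n where "n = real CARD('d \<times> 'm)"
  define K where "K = max 1 (n * M)"
  have "elliptic_system (coeff_matrix A) \<mu> K"
  proof
    show "unif_ap (\<lambda>x. coeff_matrix A x k l)" for k l unfolding coeff_matrix_def using ap by blast
    show "0 < \<mu>" using ell by (simp add: elliptic_def)
    show "1 \<le> K" by (simp add: K_def)
    have form: "(\<Sum>k\<in>UNIV. \<xi> k * (\<Sum>l\<in>UNIV. coeff_matrix A x k l * \<xi> l))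
        = (\<Sum>i\<in>UNIV. \<Sum>j\<in>UNIV. \<Sum>\<alpha>\<in>UNIV. \<Sum>\<beta>\<in>UNIV. A x i j \<alpha> \<beta> * \<xi> (i, \<alpha>) * \<xi> (j, \<beta>))" for x \<xi>
      using coeff_matrix_form[of A x \<xi> \<xi>] by (simp add: mult_ac)
    have both: "\<mu> * (\<Sum>k\<in>UNIV. (\<xi> k)\<^sup>2) \<le> (\<Sum>k\<in>UNIV. \<xi> k * (\<Sum>l\<in>UNIV. coeff_matrix A x k l * \<xi> l))"
      "(\<Sum>k\<in>UNIV. \<xi> k * (\<Sum>l\<in>UNIV. coeff_matrix A x k l * \<xi> l)) \<le> 1 / \<mu> * (\<Sum>k\<in>UNIV. (\<xi> k)\<^sup>2)" for x \<xi>
    proof -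
      have *: "\<mu> * (\<Sum>i\<in>UNIV. \<Sum>\<alpha>\<in>UNIV. (\<zeta> i \<alpha>)\<^sup>2)
          \<le> (\<Sum>i\<in>UNIV. \<Sum>j\<in>UNIV. \<Sum>\<alpha>\<in>UNIV. \<Sum>\<beta>\<in>UNIV. A x i j \<alpha> \<beta> * \<zeta> i \<alpha> * \<zeta> j \<beta>)"
        "(\<Sum>i\<in>UNIV. \<Sum>j\<in>UNIV. \<Sum>\<alpha>\<in>UNIV. \<Sum>\<beta>\<in>UNIV. A x i j \<alpha> \<beta> * \<zeta> i \<alpha> * \<zeta> j \<beta>)
          \<le> (1 / \<mu>) * (\<Sum>i\<in>UNIV. \<Sum>\<alpha>\<in>UNIV. (\<zeta> i \<alpha>)\<^sup>2)" for \<zeta> :: "'d \<Rightarrow> 'm \<Rightarrow> real"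
        using ell unfolding elliptic_def by blast+
      show "\<mu> * (\<Sum>k\<in>UNIV. (\<xi> k)\<^sup>2) \<le> (\<Sum>k\<in>UNIV. \<xi> k * (\<Sum>l\<in>UNIV. coeff_matrix A x k l * \<xi> l))"
        "(\<Sum>k\<in>UNIV. \<xi> k * (\<Sum>l\<in>UNIV. coeff_matrix A x k l * \<xi> l)) \<le> 1 / \<mu> * (\<Sum>k\<in>UNIV. (\<xi> k)\<^sup>2)"
        unfolding form sum_UNIV_prod[of "\<lambda>k. (\<xi> k)\<^sup>2"]
        using *(1)[of "\<lambda>i \<alpha>. \<xi> (i, \<alpha>)"] *(2)[of "\<lambda>i \<alpha>. \<xi> (i, \<alpha>)"] by simp_all
    qed
    show "\<mu> * (\<Sum>k\<in>UNIV. (\<xi> k)\<^sup>2) \<le> (\<Sum>k\<in>UNIV. \<xi> k * (\<Sum>l\<in>UNIV. coeff_matrix A x k l * \<xi> l))" for x \<xi>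
      by (rule both)
    \<comment> \<open>Testing both ellipticity bounds with the vector of ones gives \<mu> <=
      1/\<mu>, that is, \<mu> <= 1.\<close>
    have "\<mu> * n \<le> 1 / \<mu> * n" using order_trans[OF both(1)[where \<xi> = "\<lambda>_. 1" and x = 0] both(2)[where \<xi> = "\<lambda>_. 1" and x = 0]] by (simp add: n_def)
    moreover have "n > 0" by (simp add: n_def)
    ultimately have "\<mu> * \<mu> \<le> 1" using \<open>0 < \<mu>\<close> by (simp add: field_simps)
    then show "\<mu> \<le> 1" using \<open>0 < \<mu>\<close> by (smt (verit) mult_less_cancel_left2)
    show "(\<Sum>k\<in>UNIV. (\<Sum>l\<in>UNIV. coeff_matrix A x k l * \<xi> l)\<^sup>2) \<le> K\<^sup>2 * (\<Sum>k\<in>UNIV. (\<xi> k)\<^sup>2)" for x \<xi>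
    proof (rule order_trans[OF sum_mult_sq_le])
      have "(\<Sum>k\<in>UNIV. \<Sum>l\<in>UNIV. (coeff_matrix A x k l)\<^sup>2) \<le> (\<Sum>k\<in>(UNIV :: ('d \<times> 'm) set). \<Sum>l\<in>(UNIV :: ('d \<times> 'm) set). M\<^sup>2)"
        using power_mono[OF M(2) abs_ge_zero, where n = 2] by (intro sum_mono) auto
      also have "\<dots> = (n * M)\<^sup>2" by (simp add: n_def power2_eq_square)
      also have "\<dots> \<le> K\<^sup>2" using M(1) by (intro power_mono) (auto simp: K_def n_def)
      finally show "(\<Sum>k\<in>UNIV. \<Sum>l\<in>UNIV. (coeff_matrix A x k l)\<^sup>2) * (\<Sum>l\<in>UNIV. (\<xi> l)\<^sup>2) \<le> K\<^sup>2 * (\<Sum>k\<in>UNIV. (\<xi> k)\<^sup>2)"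
        by (intro mult_right_mono sum_nonneg) auto
    qed
  qed
  then show thesis by (rule that)
qed

text \<open>The suprema in \<open>rho\<close> are taken in the reals, where they are meaningful only
  for bounded families; this bound makes them genuine.\<close>

lemma tensor_dist_bounded:
  fixes A :: "('d::finite, 'm::finite) coeff"
  assumes ap: "\<forall>i j \<alpha> \<beta>. unif_ap (\<lambda>y. A y i j \<alpha> \<beta>)"
  obtains B where "\<And>x y. tensor_dist (A x) (A y) \<le> B"
proof -
  obtain M where M: "M \<ge> 0" "\<And>x k l. \<bar>coeff_matrix A x k l\<bar> \<le> M" using coeff_bounded[OF ap] by blast
  define B where "B = sqrt (\<Sum>k\<in>(UNIV :: ('d \<times> 'm) set). \<Sum>l\<in>(UNIV :: ('d \<times> 'm) set). (2 * M)\<^sup>2)"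
  have "tensor_dist (A x) (A y) \<le> B" for x y
  proof -
    have "(coeff_matrix A x k l - coeff_matrix A y k l)\<^sup>2 \<le> (2 * M)\<^sup>2" for k l
    proof -
      have "\<bar>coeff_matrix A x k l - coeff_matrix A y k l\<bar> \<le> 2 * M" using M(2)[of x k l] M(2)[of y k l] by linarith
      from power_mono[OF this, of 2] show ?thesis by simp
    qed
    then have "(tensor_dist (A x) (A y))\<^sup>2 \<le> (\<Sum>k\<in>(UNIV :: ('d \<times> 'm) set). \<Sum>l\<in>(UNIV :: ('d \<times> 'm) set). (2 * M)\<^sup>2)"
      unfolding tensor_dist_sq by (intro sum_mono)
    from real_sqrt_le_mono[OF this] show ?thesis using tensor_dist_nonneg[of "A x" "A y"] by (simp add: B_def)
  qed
  then show thesis by (rule that)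
qed

context
  fixes A :: "('d::finite, 'm::finite) coeff" and B :: real
  assumes B: "\<And>x y. tensor_dist (A x) (A y) \<le> B"
begin

lemma osc_bounds:
  "bdd_above (range (\<lambda>x. tensor_dist (A (x + y)) (A (x + z))))"
  "0 \<le> (SUP x. tensor_dist (A (x + y)) (A (x + z)))" "(SUP x. tensor_dist (A (x + y)) (A (x + z))) \<le> B"
proof -
  show bdd: "bdd_above (range (\<lambda>x. tensor_dist (A (x + y)) (A (x + z))))" by (intro bdd_aboveI2[of UNIV _ B] B)
  have "0 \<le> tensor_dist (A (0 + y)) (A (0 + z))" by (rule tensor_dist_nonneg)
  also have "\<dots> \<le> (SUP x. tensor_dist (A (x + y)) (A (x + z)))" by (rule cSUP_upper[OF _ bdd]) simp
  finally show "0 \<le> (SUP x. tensor_dist (A (x + y)) (A (x + z)))" .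
  show "(SUP x. tensor_dist (A (x + y)) (A (x + z))) \<le> B" by (rule cSUP_least) (use B in auto)
qed

lemma inf_osc:
  assumes "R \<ge> 0"
  shows "bdd_below ((\<lambda>z. SUP x. tensor_dist (A (x + y)) (A (x + z))) ` cball 0 R)"
    "0 \<le> (INF z\<in>cball 0 R. SUP x. tensor_dist (A (x + y)) (A (x + z)))"
    "(INF z\<in>cball 0 R. SUP x. tensor_dist (A (x + y)) (A (x + z))) \<le> B"
proof -
  show bdd: "bdd_below ((\<lambda>z. SUP x. tensor_dist (A (x + y)) (A (x + z))) ` cball 0 R)"
    using osc_bounds(2) by (intro bdd_belowI[of _ 0]) auto
  show "0 \<le> (INF z\<in>cball 0 R. SUP x. tensor_dist (A (x + y)) (A (x + z)))"
    by (rule cINF_greatest) (use assms osc_bounds(2) in auto)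
  have "(INF z\<in>cball 0 R. SUP x. tensor_dist (A (x + y)) (A (x + z))) \<le> (SUP x. tensor_dist (A (x + y)) (A (x + 0)))"
    by (rule cINF_lower[OF bdd]) (use assms in simp)
  also have "\<dots> \<le> B" by (rule osc_bounds)
  finally show "(INF z\<in>cball 0 R. SUP x. tensor_dist (A (x + y)) (A (x + z))) \<le> B" .
qed

lemma rho_upper:
  assumes "R \<ge> 0"
  shows "(INF z\<in>cball 0 R. SUP x. tensor_dist (A (x + y)) (A (x + z))) \<le> rho A R"
  unfolding rho_def by (rule cSUP_upper[OF UNIV_I bdd_aboveI2[OF inf_osc(3)[OF assms]]])

lemma rho_nonneg: "R \<ge> 0 \<Longrightarrow> 0 \<le> rho A R"
  using inf_osc(2)[of R 0] rho_upper[of R 0] by linarith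

text \<open>The infimum over z yields an actual z at the cost of \<epsilon>, and the Frobenius bound
  turns the tensor distance into the oscillation estimate of \<open>osc_le\<close>.\<close>

lemma rho_near:
  assumes R: "R \<ge> 0" and \<epsilon>: "\<epsilon> > 0"
  obtains z where "norm z \<le> R"
    "\<And>x \<xi>. (\<Sum>k\<in>UNIV. (\<Sum>l\<in>UNIV. (coeff_matrix A (x + y) k l - coeff_matrix A (x + z) k l) * \<xi> l)\<^sup>2) \<le> (rho A R + \<epsilon>)\<^sup>2 * (\<Sum>k\<in>UNIV. (\<xi> k)\<^sup>2)"
proof -
  have less: "(INF z\<in>cball 0 R. SUP x. tensor_dist (A (x + y)) (A (x + z))) < rho A R + \<epsilon>"
    using rho_upper[OF R, of y] \<epsilon> by linarith
  have "cball (0 :: real^'d) R \<noteq> {}" using R by simp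
  from iffD1[OF cINF_less_iff[OF this inf_osc(1)[OF R]] less]
  obtain z where z: "z \<in> cball 0 R" "(SUP x. tensor_dist (A (x + y)) (A (x + z))) < rho A R + \<epsilon>" ..
  show thesis
  proof (rule that[of z])
    show "norm z \<le> R" using z by simp
    fix x and \<xi> :: "'d \<times> 'm \<Rightarrow> real"
    have "tensor_dist (A (x + y)) (A (x + z)) \<le> (SUP x. tensor_dist (A (x + y)) (A (x + z)))"
      by (rule cSUP_upper[OF _ osc_bounds(1)]) simp
    then have "(tensor_dist (A (x + y)) (A (x + z)))\<^sup>2 \<le> (rho A R + \<epsilon>)\<^sup>2"
      using z(2) by (intro power_mono tensor_dist_nonneg) auto
    then have "(tensor_dist (A (x + y)) (A (x + z)))\<^sup>2 * (\<Sum>k\<in>UNIV. (\<xi> k)\<^sup>2) \<le> (rho A R + \<epsilon>)\<^sup>2 * (\<Sum>k\<in>UNIV. (\<xi> k)\<^sup>2)"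
      by (intro mult_right_mono sum_nonneg) auto
    then show "(\<Sum>k\<in>UNIV. (\<Sum>l\<in>UNIV. (coeff_matrix A (x + y) k l - coeff_matrix A (x + z) k l) * \<xi> l)\<^sup>2) \<le> (rho A R + \<epsilon>)\<^sup>2 * (\<Sum>k\<in>UNIV. (\<xi> k)\<^sup>2)"
      unfolding tensor_dist_sq by (rule order_trans[OF sum_mult_sq_le])
  qed
qed

lemma Theta_term_nonneg: "R \<in> {0<..T} \<Longrightarrow> 0 \<le> rho A R + (R / T) powr \<sigma>"
  by (intro add_nonneg_nonneg rho_nonneg powr_ge_zero) simp

lemma Theta_bdd: "bdd_below ((\<lambda>R. rho A R + (R / T) powr \<sigma>) ` {0<..T})"
  by (rule bdd_belowI2[OF Theta_term_nonneg])

lemma Theta_nonneg: "T > 0 \<Longrightarrow> 0 \<le> Theta A \<sigma> T"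
  unfolding Theta_def by (rule cINF_greatest[OF _ Theta_term_nonneg]) simp_all

text \<open>Every R admissible for T is admissible for T' and has a smaller quotient there.\<close>

lemma Theta_antimono:
  assumes "0 < T" "T \<le> T'" "\<sigma> > 0" shows "Theta A \<sigma> T' \<le> Theta A \<sigma> T"
  unfolding Theta_def
proof (rule cINF_mono)
  show "bdd_below ((\<lambda>R. rho A R + (R / T') powr \<sigma>) ` {0<..T'})" by (rule Theta_bdd)
  fix R assume R: "R \<in> {0<..T}"
  show "\<exists>S\<in>{0<..T'}. rho A S + (S / T') powr \<sigma> \<le> rho A R + (R / T) powr \<sigma>"
    using R assms by (intro bexI[of _ R] add_left_mono powr_mono2 divide_left_mono) auto
qed (use assms in auto)

lemma controlled_osc_Theta:
  assumes "elliptic_system (coeff_matrix A) \<mu> K" and \<sigma>: "0 < \<sigma>" "\<sigma> < 1"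
  shows "elliptic_system.controlled_osc (coeff_matrix A) (Theta A \<sigma>)"
proof -
  interpret elliptic_system "coeff_matrix A" \<mu> K by fact
  show ?thesis unfolding controlled_osc_def
  proof (intro allI impI conjI)
    fix T :: real assume T: "0 < T"
    then show "0 \<le> Theta A \<sigma> T" by (rule Theta_nonneg)
    fix \<epsilon> :: real assume \<epsilon>: "0 < \<epsilon>"
    have less: "(INF R\<in>{0<..T}. rho A R + (R / T) powr \<sigma>) < Theta A \<sigma> T + \<epsilon>"
      using \<epsilon> by (simp add: Theta_def)
    have "{0<..T} \<noteq> {}" using T by simp
    from iffD1[OF cINF_less_iff[OF this Theta_bdd] less]
    obtain R where R: "R \<in> {0<..T}" "rho A R + (R / T) powr \<sigma> < Theta A \<sigma> T + \<epsilon>" ..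
    have R0: "R \<ge> 0" using R by simp
    \<comment> \<open>Here R/T <= 1 and \<sigma> < 1 are used: a power with smaller exponent is
      larger.\<close>
    have "R / T \<le> (R / T) powr \<sigma>"
      using powr_mono'[of \<sigma> 1 "R / T"] R T \<sigma> by simp
    moreover have "osc_le R (rho A R + \<epsilon>)"
      unfolding osc_le_def by (rule allI, rule rho_near[OF R0 \<epsilon>]) blast
    ultimately have "0 \<le> rho A R + \<epsilon> \<and> rho A R + \<epsilon> \<le> Theta A \<sigma> T + 2 * \<epsilon> \<and>
        R / T \<le> Theta A \<sigma> T + \<epsilon> \<and> osc_le R (rho A R + \<epsilon>)"
      using R(2) rho_nonneg[OF R0] \<epsilon> powr_ge_zero[of "R / T" \<sigma>] by linarith
    then show "\<exists>R \<eta>. 0 \<le> \<eta> \<and> \<eta> \<le> Theta A \<sigma> T + 2 * \<epsilon> \<and> R / T \<le> Theta A \<sigma> T + \<epsilon> \<and> osc_le R \<eta>"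
      by blast
  qed
qed

text \<open>On the interval from 2^j T to 2^{j+1} T both \<open>Theta\<close> and 1/r are
  decreasing, so the integrand is at least its value \<open>c j\<close> at the right end. The length
  2^j T is half of that end point, which gives half the j-th summand and hence the factor 2.\<close>

lemma Theta_sum_le_integral:
  assumes T: "T > 0" and \<sigma>: "\<sigma> > 0"
  shows "ennreal (\<Sum>j<n. Theta A \<sigma> (2 ^ Suc j * T)) \<le> 2 * (\<integral>\<^sup>+ r\<in>{T/2..}. ennreal (Theta A \<sigma> r / r) \<partial>lborel)"
proof -
  define c where "c = (\<lambda>j. Theta A \<sigma> (2 ^ Suc j * T) / (2 ^ Suc j * T))"
  define I where "I = (\<lambda>j. {2 ^ j * T..<2 ^ Suc j * T})"
  have c: "c j \<ge> 0" for j unfolding c_def using T by (intro divide_nonneg_nonneg Theta_nonneg) auto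
  have disj: "r \<notin> I i" if "r \<in> I j" "i \<noteq> j" for r i j
  proof -
    have *: "2 ^ Suc i * T \<le> 2 ^ j * T" if "i < j" for i j :: nat
      using T that by (intro mult_right_mono power_increasing) auto
    show ?thesis using that *[of i j] *[of j i] by (cases i j rule: linorder_cases) (auto simp: I_def)
  qed
  have "(\<integral>\<^sup>+r. (\<Sum>j<n. ennreal (c j) * indicator (I j) r) \<partial>lborel) \<le> (\<integral>\<^sup>+ r\<in>{T/2..}. ennreal (Theta A \<sigma> r / r) \<partial>lborel)"
  proof (rule nn_integral_mono)
    fix r :: real
    show "(\<Sum>j<n. ennreal (c j) * indicator (I j) r) \<le> ennreal (Theta A \<sigma> r / r) * indicator {T/2..} r"
    proof (cases "\<exists>j<n. r \<in> I j")
      case True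
      then obtain j where j: "j < n" "r \<in> I j" by blast
      have "(\<Sum>i<n. ennreal (c i) * indicator (I i) r) = (\<Sum>i\<in>{j}. ennreal (c i) * indicator (I i) r)"
        using j disj by (intro sum.mono_neutral_right) auto
      then have sum: "(\<Sum>i<n. ennreal (c i) * indicator (I i) r) = ennreal (c j)" using j by simp
      have "1 * T \<le> 2 ^ j * T" using T by (intro mult_right_mono) auto
      then have r: "T \<le> r" "r \<le> 2 ^ Suc j * T" using j by (auto simp: I_def)
      have "c j \<le> Theta A \<sigma> r / r"
        unfolding c_def using r T \<sigma> Theta_nonneg[of r] by (intro frac_le Theta_antimono) auto
      then show ?thesis unfolding sum using r T by (simp add: ennreal_leI)
    next
      case False
      then have "(\<Sum>j<n. ennreal (c j) * indicator (I j) r) = 0" by (intro sum.neutral) auto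
      then show ?thesis by simp
    qed
  qed
  moreover have "(\<integral>\<^sup>+r. (\<Sum>j<n. ennreal (c j) * indicator (I j) r) \<partial>lborel) = (\<Sum>j<n. ennreal (Theta A \<sigma> (2 ^ Suc j * T) / 2))"
  proof -
    have "(\<integral>\<^sup>+r. (\<Sum>j<n. ennreal (c j) * indicator (I j) r) \<partial>lborel) = (\<Sum>j<n. ennreal (c j) * emeasure lborel (I j))"
      unfolding I_def by (subst nn_integral_sum) (auto simp: nn_integral_cmult)
    also have "\<dots> = (\<Sum>j<n. ennreal (Theta A \<sigma> (2 ^ Suc j * T) / 2))"
    proof (rule sum.cong)
      fix j
      have "emeasure lborel (I j) = ennreal (2 ^ j * T)" using T by (simp add: I_def)
      then have "ennreal (c j) * emeasure lborel (I j) = ennreal (c j * (2 ^ j * T))"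
        using c T by (simp add: ennreal_mult)
      also have "c j * (2 ^ j * T) = Theta A \<sigma> (2 ^ Suc j * T) / 2" using T by (simp add: c_def)
      finally show "ennreal (c j) * emeasure lborel (I j) = ennreal (Theta A \<sigma> (2 ^ Suc j * T) / 2)" .
    qed simp
    finally show ?thesis .
  qed
  moreover have "ennreal (\<Sum>j<n. Theta A \<sigma> (2 ^ Suc j * T)) = 2 * (\<Sum>j<n. ennreal (Theta A \<sigma> (2 ^ Suc j * T) / 2))"
  proof -
    have nn: "Theta A \<sigma> (2 ^ Suc j * T) \<ge> 0" for j using T by (intro Theta_nonneg) simp
    have "(\<Sum>j<n. ennreal (Theta A \<sigma> (2 ^ Suc j * T) / 2)) = ennreal (\<Sum>j<n. Theta A \<sigma> (2 ^ Suc j * T) / 2)"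
      using nn by (intro sum_ennreal) simp
    then have "2 * (\<Sum>j<n. ennreal (Theta A \<sigma> (2 ^ Suc j * T) / 2)) = ennreal 2 * ennreal (\<Sum>j<n. Theta A \<sigma> (2 ^ Suc j * T) / 2)"
      by simp
    also have "\<dots> = ennreal (2 * (\<Sum>j<n. Theta A \<sigma> (2 ^ Suc j * T) / 2))"
      using nn by (intro ennreal_mult[symmetric] sum_nonneg) auto
    also have "2 * (\<Sum>j<n. Theta A \<sigma> (2 ^ Suc j * T) / 2) = (\<Sum>j<n. Theta A \<sigma> (2 ^ Suc j * T))"
      by (simp add: sum_distrib_left)
    finally show ?thesis by simp
  qed
  ultimately show ?thesis by (simp add: mult_left_mono)
qed

end

section \<open>From the two corrector definitions to the abstract system\<close>

lemma V2pot_grad: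
  fixes h :: "real^'d::finite \<Rightarrow> 'm::finite \<Rightarrow> real"
  assumes h: "tv h" shows "V2pot (grad h)"
  unfolding V2pot_def
proof (intro conjI allI impI)
  have "trig_poly (\<lambda>x. jet 0 h x (Inl k))" for k by (rule trig_jet[OF h])
  then show "loc_L2 (\<lambda>x. grad h x k)" for k by (simp add: unif_ap_loc_L2 unif_ap_trig)
  fix \<epsilon> :: real assume "\<epsilon> > 0"
  have "B2_norm (\<lambda>x k. grad h x k - grad h x k) = 0"
    by (simp add: B2_norm_def ball_avg_def Limsup_const zero_ereal_def)
  with \<open>\<epsilon> > 0\<close> h show "\<exists>g :: real^'d \<Rightarrow> 'm \<Rightarrow> real. (\<forall>\<alpha>. trig_poly (\<lambda>x. g x \<alpha>)) \<and> B2_norm (\<lambda>x k. grad h x k - grad g x k) < ereal \<epsilon>"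
    by (intro exI[of _ h]) (auto simp: tv_def)
qed

text \<open>A scalar test function is placed in the single component \<alpha> of a vector field. The
  right-hand side of the corrector equation is absorbed as the unit vector \<open>e\<close>, the
  gradient of P_j^\<beta>.\<close>

lemma approx_corrector_scalar_test:
  fixes A :: "('d::finite, 'm::finite) coeff"
  assumes ap: "\<forall>i j \<alpha> \<beta>. unif_ap (\<lambda>y. A y i j \<alpha> \<beta>)" and corr: "approx_corrector A T j \<beta> u Du" and \<phi>: "test_fun \<phi>"
  defines "e \<equiv> \<lambda>l. if l = (j, \<beta>) then 1 else 0"
  shows "(\<integral>x. (\<Sum>i\<in>UNIV. (\<Sum>l\<in>UNIV. coeff_matrix A x (i, \<alpha>) l * (Du x l + e l)) * partial i \<phi> x) + (1 / T)\<^sup>2 * u x \<alpha> * \<phi> x \<partial>lborel) = 0"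
proof -
  have u: "\<And>\<alpha>. loc_L2 (\<lambda>x. u x \<alpha>)" and Du: "\<And>k. loc_L2 (\<lambda>x. Du x k)"
    using corr by (auto simp: approx_corrector_def)
  let ?\<phi> = "\<lambda>x \<alpha>'. if \<alpha>' = \<alpha> then \<phi> x else 0"
  have test: "test_fun (\<lambda>x. ?\<phi> x \<alpha>')" for \<alpha>' using \<phi> test_fun_zero by (cases "\<alpha>' = \<alpha>") simp_all
  have part: "partial i (\<lambda>y. ?\<phi> y \<alpha>') x = (if \<alpha>' = \<alpha> then partial i \<phi> x else 0)" for i \<alpha>' x
    by (cases "\<alpha>' = \<alpha>") (simp_all add: partial_const)
  let ?b = "\<lambda>i x. \<Sum>l\<in>UNIV. coeff_matrix A x (i, \<alpha>) l * Du x l"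
  let ?c = "\<lambda>i x. coeff_matrix A x (i, \<alpha>) (j, \<beta>)"
  have cap: "unif_ap (\<lambda>x. coeff_matrix A x k l)" for k l using ap by (simp add: coeff_matrix_def)
  have "loc_L2 (\<lambda>x. coeff_matrix A x k l * Du x l)" for k l
    by (rule unif_ap_bounded[OF cap[of k l]]) (rule loc_L2_mult_bounded[OF Du unif_ap_borel[OF cap]])
  then have lb: "loc_int (?b i)" for i by (intro loc_int_of_L2 loc_L2_sum)
  note int_b = integrable_mult_test(2)[OF lb \<phi>] and int_c = integrable_mult_test(2)[OF unif_ap_loc_int[OF cap] \<phi>]
    and int_u = integrable_mult_test(1)[OF loc_int_of_L2[OF u] \<phi>]
  have "(\<integral>x. (\<Sum>i\<in>UNIV. \<Sum>k\<in>UNIV. \<Sum>\<alpha>'\<in>UNIV. \<Sum>\<gamma>\<in>UNIV. A x i k \<alpha>' \<gamma> * Du x (k, \<gamma>) * partial i (\<lambda>y. ?\<phi> y \<alpha>') x) \<partial>lborel)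
        + (1 / T\<^sup>2) * (\<integral>x. (\<Sum>\<alpha>'\<in>UNIV. u x \<alpha>' * ?\<phi> x \<alpha>') \<partial>lborel)
        = - (\<integral>x. (\<Sum>i\<in>UNIV. \<Sum>\<alpha>'\<in>UNIV. A x i j \<alpha>' \<beta> * partial i (\<lambda>y. ?\<phi> y \<alpha>') x) \<partial>lborel)"
    by (rule corr[unfolded approx_corrector_def, THEN conjunct2, THEN conjunct2, THEN conjunct2, THEN conjunct2,
          THEN spec[of _ ?\<phi>], THEN mp, OF allI, OF test])
  moreover have "(\<Sum>i\<in>UNIV. \<Sum>k\<in>UNIV. \<Sum>\<alpha>'\<in>UNIV. \<Sum>\<gamma>\<in>UNIV. A x i k \<alpha>' \<gamma> * Du x (k, \<gamma>) * partial i (\<lambda>y. ?\<phi> y \<alpha>') x)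
      = (\<Sum>i\<in>UNIV. ?b i x * partial i \<phi> x)" for x
  proof -
    have "(\<Sum>i\<in>UNIV. \<Sum>k\<in>UNIV. \<Sum>\<alpha>'\<in>UNIV. \<Sum>\<gamma>\<in>UNIV. A x i k \<alpha>' \<gamma> * Du x (k, \<gamma>) * partial i (\<lambda>y. ?\<phi> y \<alpha>') x)
        = (\<Sum>p\<in>UNIV. (\<Sum>l\<in>UNIV. coeff_matrix A x p l * Du x l) * (if snd p = \<alpha> then partial (fst p) \<phi> x else 0))"
      unfolding part coeff_matrix_form fst_conv snd_conv ..
    also have "\<dots> = (\<Sum>i\<in>UNIV. ?b i x * partial i \<phi> x)"
      by (subst sum_UNIV_prod) (simp add: if_distrib[of "\<lambda>t. _ * t"] cong: if_cong)
    finally show ?thesis .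
  qed
  moreover have "(\<Sum>i\<in>UNIV. \<Sum>\<alpha>'\<in>UNIV. A x i j \<alpha>' \<beta> * partial i (\<lambda>y. ?\<phi> y \<alpha>') x) = (\<Sum>i\<in>UNIV. ?c i x * partial i \<phi> x)" for x
    unfolding part by (simp add: coeff_matrix_def if_distrib[of "\<lambda>t. _ * t"] cong: if_cong)
  moreover have "(\<Sum>\<alpha>'\<in>UNIV. u x \<alpha>' * ?\<phi> x \<alpha>') = u x \<alpha> * \<phi> x" for x
    by (simp add: if_distrib[of "\<lambda>t. _ * t"] cong: if_cong)
  ultimately have weak: "(\<integral>x. (\<Sum>i\<in>UNIV. ?b i x * partial i \<phi> x) \<partial>lborel) + (1 / T\<^sup>2) * (\<integral>x. u x \<alpha> * \<phi> x \<partial>lborel)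
        = - (\<integral>x. (\<Sum>i\<in>UNIV. ?c i x * partial i \<phi> x) \<partial>lborel)"
    by (simp only:)
  have be: "(\<Sum>l\<in>UNIV. coeff_matrix A x (i, \<alpha>) l * (Du x l + e l)) = ?b i x + ?c i x" for i x
    by (simp add: e_def distrib_left sum.distrib if_distrib[of "\<lambda>t. _ * t"] cong: if_cong)
  have ib: "integrable lborel (\<lambda>x. \<Sum>i\<in>UNIV. ?b i x * partial i \<phi> x)" and ic: "integrable lborel (\<lambda>x. \<Sum>i\<in>UNIV. ?c i x * partial i \<phi> x)"
    by (intro Bochner_Integration.integrable_sum int_b int_c)+
  have iu: "integrable lborel (\<lambda>x. (1 / T\<^sup>2) * (u x \<alpha> * \<phi> x))" by (intro integrable_mult_right int_u)
  have "(\<integral>x. (\<Sum>i\<in>UNIV. (\<Sum>l\<in>UNIV. coeff_matrix A x (i, \<alpha>) l * (Du x l + e l)) * partial i \<phi> x) + (1 / T)\<^sup>2 * u x \<alpha> * \<phi> x \<partial>lborel)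
      = (\<integral>x. ((\<Sum>i\<in>UNIV. ?b i x * partial i \<phi> x) + (\<Sum>i\<in>UNIV. ?c i x * partial i \<phi> x)) + (1 / T\<^sup>2) * (u x \<alpha> * \<phi> x) \<partial>lborel)"
    unfolding be by (intro Bochner_Integration.integral_cong refl) (simp add: distrib_right sum.distrib power_one_over)
  also have "\<dots> = ((\<integral>x. (\<Sum>i\<in>UNIV. ?b i x * partial i \<phi> x) \<partial>lborel) + (\<integral>x. (\<Sum>i\<in>UNIV. ?c i x * partial i \<phi> x) \<partial>lborel))
      + (1 / T\<^sup>2) * (\<integral>x. u x \<alpha> * \<phi> x \<partial>lborel)"
    by (simp only: Bochner_Integration.integral_add[OF Bochner_Integration.integrable_add[OF ib ic] iu]
        Bochner_Integration.integral_add[OF ib ic] integral_mult_right_zero)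
  also have "\<dots> = 0" using weak by linarith
  finally show ?thesis .
qed

text \<open>The order of the quantifiers is the content: the constant may depend on (j, \<beta>)
  through \<open>e\<close>, but is fixed before T, the corrector and the bound \<open>S\<close> on
  the dyadic sums.\<close>

lemma single_corrector:
  fixes A :: "('d::finite, 'm::finite) coeff" and \<psi> :: "'d \<Rightarrow> 'm \<Rightarrow> real^'d \<Rightarrow> 'd \<times> 'm \<Rightarrow> real"
  assumes sys: "elliptic_system (coeff_matrix A) \<mu> K" and ctrl: "elliptic_system.controlled_osc (coeff_matrix A) \<theta>"
    and ap: "\<forall>i j \<alpha> \<beta>. unif_ap (\<lambda>y. A y i j \<alpha> \<beta>)" and psi: "is_psi A \<psi>"
  shows "\<exists>C\<ge>0. \<forall>T>0. \<forall>u Du S. approx_corrector A T j \<beta> u Du \<longrightarrow> (\<forall>n. (\<Sum>i<n. \<theta> (2 ^ Suc i * T)) \<le> S) \<longrightarrow>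
    (\<exists>L. ((\<lambda>R. bal.nrm R (\<lambda>x k. \<psi> j \<beta> x k - Du x k)) \<longlongrightarrow> L) at_top \<and> 0 \<le> L \<and> L \<le> C * S)"
proof -
  define e where "e = (\<lambda>l. if l = (j, \<beta>) then 1 else (0::real))"
  interpret elliptic_system "coeff_matrix A" \<mu> K e by (rule sys)
  have V: "V2pot (\<psi> j \<beta>)" using psi by (simp add: is_psi_def)
  have psi_eq: "mean (\<lambda>x. \<Sum>k\<in>UNIV. (\<Sum>l\<in>UNIV. coeff_matrix A x k l * \<psi> j \<beta> x l) * grad h x k)
      = - mean (\<lambda>x. \<Sum>k\<in>UNIV. (\<Sum>l\<in>UNIV. coeff_matrix A x k l * e l) * grad h x k)" if h: "tv h" for h
  proof -
    have "(\<Sum>k\<in>UNIV. (\<Sum>l\<in>UNIV. coeff_matrix A x k l * e l) * grad h x k) = (\<Sum>i\<in>UNIV. \<Sum>\<alpha>\<in>UNIV. A x i j \<alpha> \<beta> * grad h x (i, \<alpha>))" for x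
    proof -
      have "(\<Sum>k\<in>UNIV. (\<Sum>l\<in>UNIV. coeff_matrix A x k l * e l) * grad h x k) = (\<Sum>k\<in>UNIV. coeff_matrix A x k (j, \<beta>) * grad h x k)"
        by (simp add: e_def if_distrib[of "\<lambda>t. _ * t"] cong: if_cong)
      then show ?thesis by (simp only: sum_UNIV_prod coeff_matrix_def fst_conv snd_conv)
    qed
    moreover have "mean (\<lambda>y. \<Sum>i\<in>UNIV. \<Sum>k\<in>UNIV. \<Sum>\<alpha>\<in>UNIV. \<Sum>\<gamma>\<in>UNIV. A y i k \<alpha> \<gamma> * \<psi> j \<beta> y (k, \<gamma>) * grad h y (i, \<alpha>))
        = - mean (\<lambda>y. \<Sum>i\<in>UNIV. \<Sum>\<alpha>\<in>UNIV. A y i j \<alpha> \<beta> * grad h y (i, \<alpha>))"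
      using psi V2pot_grad[OF h] unfolding is_psi_def by blast
    ultimately show ?thesis by (simp only: coeff_matrix_form)
  qed
  show ?thesis
  proof (rule exI[of _ "2 / \<mu> * C0"], intro conjI allI impI)
    show "0 \<le> 2 / \<mu> * C0" using \<mu> C0_nonneg by simp
    fix T u Du S assume T: "T > 0" and corr: "approx_corrector A T j \<beta> u Du" and S: "\<forall>n. (\<Sum>i<n. \<theta> (2 ^ Suc i * T)) \<le> S"
    have u: "lL2 u" "lL2 Du" using corr by (auto simp: approx_corrector_def lL2_def)
    have wg: "(\<integral>x. u x \<alpha> * partial i \<phi> x \<partial>lborel) = - (\<integral>x. Du x (i, \<alpha>) * \<phi> x \<partial>lborel)" if "test_fun \<phi>" for \<phi> i \<alpha>
      using corr that unfolding approx_corrector_def by blast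
    obtain M where M: "\<And>x. set_lebesgue_integral lborel (ball x 1) (\<lambda>y. (\<Sum>k\<in>UNIV. (Du y k)\<^sup>2) + (\<Sum>\<alpha>\<in>UNIV. (u y \<alpha>)\<^sup>2)) \<le> M"
      using corr unfolding approx_corrector_def by blast
    have eq: "(\<integral>x. (\<Sum>i\<in>UNIV. (\<Sum>l\<in>UNIV. coeff_matrix A x (i, \<alpha>) l * (Du x l + e l)) * partial i \<phi> x) + (1 / T)\<^sup>2 * u x \<alpha> * \<phi> x \<partial>lborel) = 0"
      if "test_fun \<phi>" for \<phi> \<alpha>
      unfolding e_def by (rule approx_corrector_scalar_test[OF ap corr that])
    obtain L where "((\<lambda>R. bal.nrm R (\<lambda>x k. \<psi> j \<beta> x k - Du x k)) \<longlongrightarrow> L) at_top" "0 \<le> L" "L \<le> 2 / \<mu> * C0 * S"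
      using psi_corrector_dist[OF ctrl T V psi_eq u wg M eq S[rule_format]] by blast
    then show "\<exists>L. ((\<lambda>R. bal.nrm R (\<lambda>x k. \<psi> j \<beta> x k - Du x k)) \<longlongrightarrow> L) at_top \<and> 0 \<le> L \<and> L \<le> 2 / \<mu> * C0 * S" by blast
  qed
qed

theorem theorem6p5:
  fixes A :: "('d::finite, 'm::finite) coeff" and \<mu> :: real
    and \<psi> :: "'d \<Rightarrow> 'm \<Rightarrow> real^'d \<Rightarrow> 'd \<times> 'm \<Rightarrow> real"
    and \<sigma> :: real
  assumes ell: "elliptic \<mu> A"
    and ap: "\<forall>i j \<alpha> \<beta>. unif_ap (\<lambda>y. A y i j \<alpha> \<beta>)"
    and psi: "is_psi A \<psi>"
    and sigma: "0 < \<sigma>" "\<sigma> < 1"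
  shows "\<exists>C>0. \<forall>T\<ge>1. \<forall>(chi :: 'd \<Rightarrow> 'm \<Rightarrow> real^'d \<Rightarrow> 'm \<Rightarrow> real) Dchi.
           (\<forall>j \<beta>. approx_corrector A T j \<beta> (chi j \<beta>) (Dchi j \<beta>)) \<longrightarrow>
           ennreal (sqrt (mean (\<lambda>y. \<Sum>i\<in>UNIV. \<Sum>j\<in>UNIV. \<Sum>\<alpha>\<in>UNIV. \<Sum>\<beta>\<in>UNIV.
                 (\<psi> j \<beta> y (i, \<alpha>) - Dchi j \<beta> y (i, \<alpha>))\<^sup>2)))
           \<le> ennreal C * (\<integral>\<^sup>+ r\<in>{T/2..}. ennreal (Theta A \<sigma> r / r) \<partial>lborel)"
proof -
  obtain K where sys: "elliptic_system (coeff_matrix A) \<mu> K" by (rule elliptic_system_coeff_matrix[OF ell ap])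
  obtain B where B: "\<And>x y. tensor_dist (A x) (A y) \<le> B" by (rule tensor_dist_bounded[OF ap]) blast
  have ctrl: "elliptic_system.controlled_osc (coeff_matrix A) (Theta A \<sigma>)"
    by (rule controlled_osc_Theta[OF B sys sigma])
  define good where "good = (\<lambda>p C. C \<ge> (0::real) \<and> (\<forall>T>0. \<forall>u Du S. approx_corrector A T (fst p) (snd p) u Du \<longrightarrow>
    (\<forall>n. (\<Sum>i<n. Theta A \<sigma> (2 ^ Suc i * T)) \<le> S) \<longrightarrow>
    (\<exists>L. ((\<lambda>R. bal.nrm R (\<lambda>x k. \<psi> (fst p) (snd p) x k - Du x k)) \<longlongrightarrow> L) at_top \<and> 0 \<le> L \<and> L \<le> C * S)))"
  have "\<exists>C. good p C" for p
    unfolding good_def by (rule single_corrector[OF sys ctrl ap psi])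
  then have "\<forall>p. \<exists>C. good p C" ..
  from choice[OF this] obtain c where "\<forall>p. good p (c p)" ..
  then have c: "good p (c p)" for p ..
  \<comment> \<open>The 2 comes from \<open>Theta_sum_le_integral\<close>; the 1 makes C
    positive.\<close>
  define C where "C = 1 + 2 * (\<Sum>p\<in>UNIV. c p)"
  have c0: "(\<Sum>p\<in>UNIV. c p) \<ge> 0" using c by (intro sum_nonneg) (simp add: good_def)
  show ?thesis
  proof (intro exI conjI allI impI)
    show "C > 0" using c0 by (simp add: C_def)
    fix T :: real and chi :: "'d \<Rightarrow> 'm \<Rightarrow> real^'d \<Rightarrow> 'm \<Rightarrow> real" and Dchi
    assume T: "T \<ge> 1" and corr: "\<forall>j \<beta>. approx_corrector A T j \<beta> (chi j \<beta>) (Dchi j \<beta>)"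
    define F where "F = (\<lambda>p x k. \<psi> (fst p) (snd p) x k - Dchi (fst p) (snd p) x k)"
    let ?I = "\<integral>\<^sup>+ r\<in>{T/2..}. ennreal (Theta A \<sigma> r / r) \<partial>lborel"
    let ?m = "mean (\<lambda>y. \<Sum>i\<in>UNIV. \<Sum>j\<in>UNIV. \<Sum>\<alpha>\<in>UNIV. \<Sum>\<beta>\<in>UNIV. (\<psi> j \<beta> y (i, \<alpha>) - Dchi j \<beta> y (i, \<alpha>))\<^sup>2)"
    show "ennreal (sqrt ?m) \<le> ennreal C * ?I"
    \<comment> \<open>An infinite integral makes the claim trivial. Otherwise it bounds the dyadic
      sums by a real \<open>S\<close>.\<close>
    proof (cases "?I = top")
      case True
      then show ?thesis using \<open>C > 0\<close> by (simp add: ennreal_mult_top)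
    next
      case False
      define S where "S = 2 * enn2real ?I"
      have I: "?I = ennreal (enn2real ?I)" using False by (simp add: less_top)
      have S: "(\<Sum>i<n. Theta A \<sigma> (2 ^ Suc i * T)) \<le> S" for n
      proof -
        have "ennreal (\<Sum>i<n. Theta A \<sigma> (2 ^ Suc i * T)) \<le> 2 * ?I"
          using T sigma by (intro Theta_sum_le_integral[OF B]) auto
        also have "\<dots> = ennreal S" unfolding S_def by (subst I) (simp add: ennreal_mult)
        finally show ?thesis by (simp add: S_def ennreal_le_iff)
      qed
      have T0: "T > 0" using T by simp
      have "\<exists>L. ((\<lambda>R. bal.nrm R (F p)) \<longlongrightarrow> L) at_top \<and> 0 \<le> L \<and> L \<le> c p * S" for p
        unfolding F_def
        by (rule c[of p, unfolded good_def, THEN conjunct2, rule_format, OF T0 corr[THEN spec, THEN spec] S])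
      then have "\<forall>p. \<exists>L. ((\<lambda>R. bal.nrm R (F p)) \<longlongrightarrow> L) at_top \<and> 0 \<le> L \<and> L \<le> c p * S" ..
      from choice[OF this] obtain L where "\<forall>p. ((\<lambda>R. bal.nrm R (F p)) \<longlongrightarrow> L p) at_top \<and> 0 \<le> L p \<and> L p \<le> c p * S" ..
      then have L: "\<And>p. ((\<lambda>R. bal.nrm R (F p)) \<longlongrightarrow> L p) at_top" "\<And>p. 0 \<le> L p" "\<And>p. L p \<le> c p * S" by (blast dest: spec)+
      have lF: "lL2 (F p)" for p
      proof -
        have "lL2 (\<psi> (fst p) (snd p))" using psi by (simp add: is_psi_def V2pot_def lL2_def)
        moreover have "lL2 (Dchi (fst p) (snd p))" using corr by (simp add: approx_corrector_def lL2_def)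
        ultimately show ?thesis unfolding F_def by (rule bal.ok_diff)
      qed
      have lsq: "loc_int (\<lambda>x. \<Sum>k\<in>UNIV. (F p x k)\<^sup>2)" for p
        by (intro loc_int_sum loc_int_sq) (rule lF[of p, unfolded lL2_def, THEN spec])
      have sq: "has_mean (\<lambda>x. \<Sum>k\<in>UNIV. (F p x k)\<^sup>2) ((L p)\<^sup>2)" for p
      proof -
        have "((\<lambda>R. (bal.nrm R (F p))\<^sup>2) \<longlongrightarrow> (L p)\<^sup>2) at_top" by (intro tendsto_power L)
        moreover have "(\<lambda>R. (bal.nrm R (F p))\<^sup>2) = ball_avg (\<lambda>x. \<Sum>k\<in>UNIV. (F p x k)\<^sup>2)"
          by (rule ext) (subst bal.nrm_sq[OF lF], simp add: bip_def power2_eq_square)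
        ultimately show ?thesis using lsq by (simp add: has_mean_def)
      qed
      \<comment> \<open>The mean of the full sum is shown to exist, so that \<open>mean\<close> in
        the claim is the sum of the squared limits and not an arbitrary value.\<close>
      have "has_mean (\<lambda>x. \<Sum>p\<in>UNIV. \<Sum>k\<in>UNIV. (F p x k)\<^sup>2) (\<Sum>p\<in>UNIV. (L p)\<^sup>2)"
      proof -
        have "has_mean (\<lambda>x. \<Sum>p\<in>X. \<Sum>k\<in>UNIV. (F p x k)\<^sup>2) (\<Sum>p\<in>X. (L p)\<^sup>2)" if "finite X" for X
          using that by (induction X rule: finite_induct) (auto intro: has_mean_const has_mean_add sq)
        then show ?thesis by simp
      qed
      moreover have "(\<Sum>p\<in>UNIV. \<Sum>k\<in>UNIV. (F p x k)\<^sup>2)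
          = (\<Sum>i\<in>UNIV. \<Sum>j\<in>UNIV. \<Sum>\<alpha>\<in>UNIV. \<Sum>\<beta>\<in>UNIV. (\<psi> j \<beta> x (i, \<alpha>) - Dchi j \<beta> x (i, \<alpha>))\<^sup>2)" for x
      proof -
        have "(\<Sum>p\<in>UNIV. \<Sum>k\<in>UNIV. (F p x k)\<^sup>2) = (\<Sum>k\<in>UNIV. \<Sum>p\<in>UNIV. (F p x k)\<^sup>2)" by (rule sum.swap)
        also have "\<dots> = (\<Sum>i\<in>UNIV. \<Sum>\<alpha>\<in>UNIV. \<Sum>j\<in>UNIV. \<Sum>\<beta>\<in>UNIV. (\<psi> j \<beta> x (i, \<alpha>) - Dchi j \<beta> x (i, \<alpha>))\<^sup>2)"
          by (simp add: sum_UNIV_prod F_def)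
        also have "\<dots> = (\<Sum>i\<in>UNIV. \<Sum>j\<in>UNIV. \<Sum>\<alpha>\<in>UNIV. \<Sum>\<beta>\<in>UNIV. (\<psi> j \<beta> x (i, \<alpha>) - Dchi j \<beta> x (i, \<alpha>))\<^sup>2)"
          by (intro sum.cong refl sum.swap)
        finally show ?thesis .
      qed
      ultimately have m: "?m = (\<Sum>p\<in>UNIV. (L p)\<^sup>2)" using has_mean_eq by (simp only:) blast
      \<comment> \<open>The Euclidean norm of the limits is at most their sum, so the bounds for the
        pairs (j, \<beta>) add up.\<close>
      have "sqrt ?m \<le> (\<Sum>p\<in>UNIV. L p)"
        unfolding m L2_set_def[symmetric] by (rule L2_set_le_sum) (rule L(2))
      also have "\<dots> \<le> (\<Sum>p\<in>UNIV. c p * S)" by (intro sum_mono L)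
      also have "\<dots> = 2 * (\<Sum>p\<in>UNIV. c p) * enn2real ?I" by (simp add: S_def sum_distrib_right mult_ac)
      also have "\<dots> \<le> C * enn2real ?I" unfolding C_def by (intro mult_right_mono) auto
      finally have "ennreal (sqrt ?m) \<le> ennreal (C * enn2real ?I)" by (rule ennreal_leI)
      also have "\<dots> = ennreal C * ?I" using \<open>C > 0\<close> I by (simp add: ennreal_mult)
      finally show ?thesis .
    qed
  qed
qed

end
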